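(* Let $0<p,q<\infty$, $\omega\in\mathcal{D}$, and let $\mu$ be a positive Borel measure on $\mathbb{D}$. For $r\in(0,1)$ and $z\in\mathbb{D}$, write $$G_{\mu,r}(z):=\frac{\mu(\Delta(z,r))^{1/q}}{\widehat{\omega}(z)^{1/p}(1-|z|)^{1/q}}.$$ (1) If $p\leq q$, then the following conditions are equivalent: (a) $I_d:AT^{\infty}_p(\omega)\to T^{\infty}_q(\mu)$ is bounded; (b) $I_d:AT^0_p(\omega)\to T^0_q(\mu)$ is bounded; (c) for some (equivalently, for every) $r\in(0,1/4)$, $G_{\mu,r}\in L^{\infty}(\mathbb{D})$. Moreover, in these cases, for each $r\in(0,1/4)$, $\|I_d\|\asymp\|G_{\mu,r}\|_{L^{\infty}(\mathbb{D})}$. (2) If $p>q$, then the following conditions are equivalent: (a) $I_d:AT^{\infty}_p(\omega)\to T^{\infty}_q(\mu)$ is bounded; (b) $I_d:AT^0_p(\omega)\to T^0_q(\mu)$ is bounded; (c) for some (equivalently, for every) $r\in(0,1/4)$, $G_{\mu,r}\in T^{\infty}_{\frac{pq}{p-q},-1}$. Moreover, in these cases, for each $r\in(0,1/4)$, $\|I_d\|\asymp\|G_{\mu,r}\|_{T^{\infty}_{\frac{pq}{p-q},-1}}$. Here $\|I_d\|$ is the operator norm of $I_d:AT^{\infty}_p(\omega)\to T^{\infty}_q(\mu)$, and the constants implied by $\asymp$ do not depend on $\mu$.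
   Context: $\mathbb{D}$ is the open unit disk of $\mathbb{C}$, $dA$ is Lebesgue area measure on $\mathbb{D}$, and $\mathcal{H}(\mathbb{D})$ is the space of analytic functions on $\mathbb{D}$. Weights: a weight is a function $\omega:\mathbb{D}\to[0,\infty)$ integrable over $\mathbb{D}$ and not a.e. zero; it is radial if $\omega(z)=\omega(|z|)$ for all $z$. For a radial weight put $\widehat{\omega}(z)=\int_{|z|}^1\omega(s)\,ds$. A radial weight $\omega$ is in $\widehat{\mathcal{D}}$ if there is $C\ge1$ with $\widehat{\omega}(r)\le C\widehat{\omega}\left(\frac{1+r}{2}\right)$ for all $0\le r<1$; it is in $\check{\mathcal{D}}$ if there are $K>1$ and $C>1$ with $\widehat{\omega}(r)\ge C\widehat{\omega}\left(1-\frac{1-r}{K}\right)$ for all $0\le r<1$. $\mathcal{D}:=\widehat{\mathcal{D}}\cap\check{\mathcal{D}}$. Tent spaces: the Carleson squares are $S(0):=\mathbb{D}$ and $S(re^{i\theta}):=\{\rho e^{it}:r\le\rho<1,\ |t-\theta|\le\frac{1-r}{2}\}$ for $0<r<1$. For $0<q<\infty$ and a positive Borel measure $\mu$ on $\mathbb{D}$, $T^{\infty}_q(\mu)$ consists of the $\mu$-measurable functions $f$ on $\mathbb{D}$ with $$\|f\|_{T^{\infty}_q(\mu)}:=\sup_{a\in\mathbb{D}}\left(\frac{1}{1-|a|}\int_{S(a)}|f|^q\,d\mu\right)^{1/q}<\infty,$$ and $T^0_q(\mu)$ is the subspace of those $f\in T^{\infty}_q(\mu)$ with $\lim_{|a|\to1^-}\frac{1}{1-|a|}\int_{S(a)}|f|^q\,d\mu=0$.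 When $d\mu=\omega\,dA$ these are written $T^{\infty}_q(\omega)$, $T^0_q(\omega)$; when $d\mu=(1-|z|)^{\alpha}dA(z)$, $\alpha\in\mathbb{R}$, they are written $T^{\infty}_{q,\alpha}$, $T^0_{q,\alpha}$. Set $AT^{\infty}_q(\omega):=T^{\infty}_q(\omega)\cap\mathcal{H}(\mathbb{D})$ and $AT^0_q(\omega):=T^0_q(\omega)\cap\mathcal{H}(\mathbb{D})$, with the inherited (quasi-)norm. Other notation: the pseudo-hyperbolic metric is $d(z,u)=\left|\frac{z-u}{1-z\overline{u}}\right|$ and $\Delta(z,r)=\{u\in\mathbb{D}:d(z,u)<r\}$. $I_d$ is the identity (embedding) $f\mapsto f$; "$I_d:X\to Y$ is bounded" means $X\subset Y$ and $\|f\|_Y\le C\|f\|_X$ for all $f\in X$. $A\asymp B$ means $C^{-1}A\le B\le CA$ for a constant $C>0$ (here depending only on $p,q,\omega,r$). *)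

theory Defs
  imports "HOL-Analysis.Analysis" "HOL-Probability.Essential_Supremum"
begin

abbreviation unit_disc :: "complex set"
  where "unit_disc \<equiv> ball 0 1"

abbreviation dA :: "complex measure"
  where "dA \<equiv> lebesgue_on unit_disc"

definition borel_measure_on_disc :: "complex measure \<Rightarrow> bool"
  where "borel_measure_on_disc \<mu> \<longleftrightarrow> sets \<mu> = sets (restrict_space borel unit_disc)"

text \<open>Powers of extended nonnegative reals, meant for exponents \<open>a > 0\<close> only.
  A Borel measure \<open>\<mu>\<close> need not be locally finite, so \<open>\<mu>(\<Delta>(z,r))\<close> may be infinite.\<close>

definition epowr :: "ennreal \<Rightarrow> real \<Rightarrow> ennreal"
  where "epowr x a = (if x = \<infinity> then \<infinity> else ennreal (enn2real x powr a))"


subsection \<open>Weights\<close>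

text \<open>Functions on the disc are total functions on \<^typ>\<open>complex\<close> whose values outside
  \<^const>\<open>unit_disc\<close> are never used.\<close>

definition radial_weight :: "(complex \<Rightarrow> real) \<Rightarrow> bool"
  where "radial_weight \<omega> \<longleftrightarrow>
    (\<forall>z\<in>unit_disc. 0 \<le> \<omega> z) \<and> integrable dA \<omega> \<and> \<not> (AE z in dA. \<omega> z = 0) \<and>
    (\<forall>z\<in>unit_disc. \<omega> z = \<omega> (complex_of_real (cmod z)))"

text \<open>The value is extended real: \<open>\<integral>\<^sub>0\<^sup>1 \<omega>(s) ds\<close> can be infinite for a radial weight (area
  measure carries a factor \<open>s\<close>), but then \<open>\<omega>\<close> is not in \<open>D_hat\<close>.\<close>

definition omega_hat :: "(complex \<Rightarrow> real) \<Rightarrow> complex \<Rightarrow> ennreal"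
  where "omega_hat \<omega> z = (\<integral>\<^sup>+ s\<in>{cmod z..<1}. ennreal (\<omega> (complex_of_real s)) \<partial>lebesgue)"

definition D_hat :: "(complex \<Rightarrow> real) set"
  where "D_hat = {\<omega>. radial_weight \<omega> \<and>
    (\<exists>C::real. C \<ge> 1 \<and> (\<forall>r::real. 0 \<le> r \<and> r < 1 \<longrightarrow>
      omega_hat \<omega> (complex_of_real r) \<le> ennreal C * omega_hat \<omega> (complex_of_real ((1 + r) / 2))))}"

definition D_check :: "(complex \<Rightarrow> real) set"
  where "D_check = {\<omega>. radial_weight \<omega> \<and>
    (\<exists>K C::real. K > 1 \<and> C > 1 \<and> (\<forall>r::real. 0 \<le> r \<and> r < 1 \<longrightarrow>
      omega_hat \<omega> (complex_of_real r) \<ge> ennreal C * omega_hat \<omega> (complex_of_real (1 - (1 - r) / K))))}"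

definition D_class :: "(complex \<Rightarrow> real) set"
  where "D_class = D_hat \<inter> D_check"


subsection \<open>Tent spaces\<close>

definition carleson_square :: "complex \<Rightarrow> complex set"
  where "carleson_square a = (if a = 0 then unit_disc else
    {complex_of_real \<rho> * cis t | \<rho> t.
       cmod a \<le> \<rho> \<and> \<rho> < 1 \<and> \<bar>t - Arg a\<bar> \<le> (1 - cmod a) / 2})"

text \<open>The tent functionals take the modulus \<open>g = |f|\<close>, so that they also apply
  to functions with values in \<open>[0,\<infinity>]\<close>.\<close>

definition tent_average :: "real \<Rightarrow> complex measure \<Rightarrow> (complex \<Rightarrow> ennreal) \<Rightarrow> complex \<Rightarrow> ennreal"
  where "tent_average q \<mu> g a =
    ennreal (1 / (1 - cmod a)) * (\<integral>\<^sup>+ z\<in>carleson_square a. epowr (g z) q \<partial>\<mu>)"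

definition tent_norm :: "real \<Rightarrow> complex measure \<Rightarrow> (complex \<Rightarrow> ennreal) \<Rightarrow> ennreal"
  where "tent_norm q \<mu> g = (SUP a\<in>unit_disc. epowr (tent_average q \<mu> g a) (1 / q))"

definition modulus :: "(complex \<Rightarrow> complex) \<Rightarrow> complex \<Rightarrow> ennreal"
  where "modulus f z = ennreal (cmod (f z))"

definition T_inf :: "real \<Rightarrow> complex measure \<Rightarrow> (complex \<Rightarrow> complex) set"
  where "T_inf q \<mu> = {f \<in> borel_measurable (completion \<mu>). tent_norm q \<mu> (modulus f) < \<infinity>}"

text \<open>The same space for functions with values in \<open>[0,\<infinity>]\<close>.\<close>

definition T_inf_ext :: "real \<Rightarrow> complex measure \<Rightarrow> (complex \<Rightarrow> ennreal) set"
  where "T_inf_ext q \<mu> = {g \<in> borel_measurable (completion \<mu>). tent_norm q \<mu> g < \<infinity>}"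

definition T_zero :: "real \<Rightarrow> complex measure \<Rightarrow> (complex \<Rightarrow> complex) set"
  where "T_zero q \<mu> = {f \<in> T_inf q \<mu>.
    (tent_average q \<mu> (modulus f) \<longlongrightarrow> 0) (filtercomap cmod (at_left 1))}"

definition weight_measure :: "(complex \<Rightarrow> real) \<Rightarrow> complex measure"
  where "weight_measure \<omega> = density dA (\<lambda>z. ennreal (\<omega> z))"

definition power_measure :: "real \<Rightarrow> complex measure"
  where "power_measure \<alpha> = weight_measure (\<lambda>z. (1 - cmod z) powr \<alpha>)"

definition AT_inf :: "real \<Rightarrow> (complex \<Rightarrow> real) \<Rightarrow> (complex \<Rightarrow> complex) set"
  where "AT_inf q \<omega> = T_inf q (weight_measure \<omega>) \<inter> {f. f holomorphic_on unit_disc}"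

definition AT_zero :: "real \<Rightarrow> (complex \<Rightarrow> real) \<Rightarrow> (complex \<Rightarrow> complex) set"
  where "AT_zero q \<omega> = T_zero q (weight_measure \<omega>) \<inter> {f. f holomorphic_on unit_disc}"


subsection \<open>Embeddings\<close>

definition bounded_embedding ::
    "'f set \<Rightarrow> ('f \<Rightarrow> ennreal) \<Rightarrow> 'f set \<Rightarrow> ('f \<Rightarrow> ennreal) \<Rightarrow> bool"
  where "bounded_embedding X nX Y nY \<longleftrightarrow>
    X \<subseteq> Y \<and> (\<exists>C::real. C \<ge> 0 \<and> (\<forall>f\<in>X. nY f \<le> ennreal C * nX f))"

definition embedding_norm :: "'f set \<Rightarrow> ('f \<Rightarrow> ennreal) \<Rightarrow> ('f \<Rightarrow> ennreal) \<Rightarrow> ennreal"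
  where "embedding_norm X nX nY = (SUP f\<in>{f \<in> X. nX f \<le> 1}. nY f)"

definition Id_bounded_inf :: "real \<Rightarrow> real \<Rightarrow> (complex \<Rightarrow> real) \<Rightarrow> complex measure \<Rightarrow> bool"
  where "Id_bounded_inf p q \<omega> \<mu> \<longleftrightarrow>
    bounded_embedding (AT_inf p \<omega>) (\<lambda>f. tent_norm p (weight_measure \<omega>) (modulus f))
                      (T_inf q \<mu>) (\<lambda>f. tent_norm q \<mu> (modulus f))"

definition Id_bounded_zero :: "real \<Rightarrow> real \<Rightarrow> (complex \<Rightarrow> real) \<Rightarrow> complex measure \<Rightarrow> bool"
  where "Id_bounded_zero p q \<omega> \<mu> \<longleftrightarrow>
    bounded_embedding (AT_zero p \<omega>) (\<lambda>f. tent_norm p (weight_measure \<omega>) (modulus f))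
                      (T_zero q \<mu>) (\<lambda>f. tent_norm q \<mu> (modulus f))"

definition Id_norm :: "real \<Rightarrow> real \<Rightarrow> (complex \<Rightarrow> real) \<Rightarrow> complex measure \<Rightarrow> ennreal"
  where "Id_norm p q \<omega> \<mu> =
    embedding_norm (AT_inf p \<omega>) (\<lambda>f. tent_norm p (weight_measure \<omega>) (modulus f))
                   (\<lambda>f. tent_norm q \<mu> (modulus f))"


subsection \<open>The averaging function\<close>

definition pseudo_hyp_dist :: "complex \<Rightarrow> complex \<Rightarrow> real"
  where "pseudo_hyp_dist z u = cmod ((z - u) / (1 - z * cnj u))"

definition pseudo_hyp_disc :: "complex \<Rightarrow> real \<Rightarrow> complex set"
  where "pseudo_hyp_disc z r = {u \<in> unit_disc. pseudo_hyp_dist z u < r}"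

definition G_fun ::
    "real \<Rightarrow> real \<Rightarrow> (complex \<Rightarrow> real) \<Rightarrow> complex measure \<Rightarrow> real \<Rightarrow> complex \<Rightarrow> ennreal"
  where "G_fun p q \<omega> \<mu> r z =
    epowr (emeasure \<mu> (pseudo_hyp_disc z r)) (1 / q) /
    (epowr (omega_hat \<omega> z) (1 / p) * ennreal ((1 - cmod z) powr (1 / q)))"

text \<open>\<^const>\<open>esssup\<close> is \<open>\<infinity>\<close> on non-measurable functions, so finiteness includes measurability.\<close>

definition L_inf_ext :: "(complex \<Rightarrow> ennreal) set"
  where "L_inf_ext = {g. esssup dA g < \<infinity>}"

definition comparable :: "real \<Rightarrow> ennreal \<Rightarrow> ennreal \<Rightarrow> bool"
  where "comparable C A B \<longleftrightarrow> ennreal (1 / C) * A \<le> B \<and> B \<le> ennreal C * A"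

end

theory Submission
  imports Defs "HOL-Complex_Analysis.Complex_Analysis"
begin

text \<open>The kernel \<open>D(z,u) = |1 - z\<^sup>*u|\<close> satisfies the triangle inequality on the disc, Carleson squares
  are comparable with its balls, and so a Carleson condition for a measure is the same as a bound for its
  integrals against \<open>((1-|z|) / D(z,\<cdot>))\<^sup>\<gamma>\<close>, \<open>\<gamma> > 1\<close>. Everything is discretised over points \<open>z\<^sub>k\<close>
  whose discs of radius comparable with \<open>h\<^sub>k = 1-|z\<^sub>k|\<close> cover the unit disc with bounded overlap.

  Sufficiency: subharmonicity of \<open>|f|\<^sup>p\<close>, weighted by a high power of \<open>h\<^sub>k / D(z\<^sub>k,\<cdot>)\<close>, bounds the
  values of \<open>|f|\<^sup>p\<close> near \<open>z\<^sub>k\<close> by a mean over an annulus that carries a fixed proportion of the weight.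
  The sum over \<open>k\<close> is then estimated by a supremum if \<open>p \<le> q\<close> and by Young's inequality if \<open>p > q\<close>.

  Necessity: finite sums of the functions \<open>c\<^sub>k W(h\<^sub>k)\<^sup>-\<^sup>1\<^sup>/\<^sup>p (h\<^sub>k / (1 - z\<^sub>k\<^sup>*u))\<^sup>n\<close>, with
  \<open>W(1-|z|)\<close> the integral of the weight over \<open>[|z|,1]\<close>, lie in the little tent space, with norm controlled
  by the Carleson sums of \<open>|c\<^sub>k|\<^sup>p h\<^sub>k\<close>. A single summand settles \<open>p \<le> q\<close>. For \<open>p > q\<close> take
  \<open>c\<^sub>k = G(z\<^sub>k)\<^sup>q\<^sup>/\<^sup>(\<^sup>p\<^sup>-\<^sup>q\<^sup>)\<close> and average over all choices of signs; the resulting Carleson constant \<open>X\<close> of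
  a finite sum satisfies \<open>X \<le> C N\<^sup>q X\<^sup>q\<^sup>/\<^sup>p\<close>, where \<open>N\<close> is the norm of the embedding, and this bounds \<open>X\<close>.\<close>

section \<open>Polar coordinates\<close>

text \<open>The weight may vanish on whole discs about z, so |f|^p cannot be averaged against it
  there. What every scale does carry is radial mass, and circle means of |f|^p increase with the
  radius; so a local value is passed to all circles near the boundary, and the kernel power restores
  the localisation that full circles lose. Both halves of \<open>D_class\<close> enter at this
  point: the decay of \<open>W\<close> gives an annulus its share of the mass, doubling brings it
  back to the scale h_k. The large and the little spaces are treated together. Each sufficiency
  bound is in terms of the mass of f seen from the same point a, so smallness near the boundary is
  inherited; the test functions are bounded, so an embedding of either space reaches them. The
  measure mu need not be sigma-finite or finite on discs: its integrals are exchanged with countable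
  sums only, and finiteness on lattice balls is derived from either side. The inequality X <= C N^q
  X^(q/p) can be solved because q/p < 1 and X, belonging to a finite sum, is finite beforehand. All
  constants are fixed before mu.\<close>

lemma measurable_Complex [measurable]:
  "case_prod Complex \<in> borel_measurable (borel \<Otimes>\<^sub>M borel)"
  unfolding borel_prod
  by (intro borel_measurable_continuous_onI) (auto simp: case_prod_beta Complex_eq intro!: continuous_intros)

lemma lborel_complex_eq_distr:
  "(lborel :: complex measure) = distr (lborel \<Otimes>\<^sub>M lborel) borel (\<lambda>(x, y). Complex x y)"
proof (rule lborel_eqI)
  fix l u :: complex assume le: "\<And>b. b \<in> Basis \<Longrightarrow> l \<bullet> b \<le> u \<bullet> b"
  have [measurable]: "case_prod Complex \<in> lborel \<Otimes>\<^sub>M lborel \<rightarrow>\<^sub>M borel"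
    using measurable_Complex by (simp add: borel_prod lborel_prod)
  have "(\<lambda>(x, y). Complex x y) -` box l u = {Re l<..<Re u} \<times> {Im l<..<Im u}"
    by (auto simp: box_def Basis_complex_def)
  then show "emeasure (distr (lborel \<Otimes>\<^sub>M lborel) borel (\<lambda>(x, y). Complex x y)) (box l u) =
      ennreal (\<Prod>b\<in>Basis. (u - l) \<bullet> b)"
    using le[of 1] le[of \<i>]
    by (simp add: emeasure_distr space_pair_measure lborel.emeasure_pair_measure_Times
        Basis_complex_def ennreal_mult)
qed simp

lemma nn_integral_lborel_complex:
  assumes [measurable]: "F \<in> borel_measurable borel"
  shows "(\<integral>\<^sup>+z. F z \<partial>lborel) = (\<integral>\<^sup>+x. \<integral>\<^sup>+y. F (Complex x y) \<partial>lborel \<partial>lborel)"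
proof -
  have "(\<integral>\<^sup>+z. F z \<partial>lborel) = (\<integral>\<^sup>+w. F (case_prod Complex w) \<partial>(lborel \<Otimes>\<^sub>M lborel))"
    by (subst lborel_complex_eq_distr, subst nn_integral_distr) simp_all
  also have "\<dots> = (\<integral>\<^sup>+x. \<integral>\<^sup>+y. F (Complex x y) \<partial>lborel \<partial>lborel)"
    by (subst lborel.nn_integral_fst[symmetric]) simp_all
  finally show ?thesis .
qed

text \<open>The derivative of tan is unbounded at the ends of (-pi/2, pi/2), so the substitution
  rule is used on the compact intervals [arctan (-n), arctan n] and both sides pass to the limit by
  monotone convergence.\<close>

lemma nn_integral_tan_substitution:
  fixes f :: "real \<Rightarrow> ennreal"
  assumes [measurable]: "f \<in> borel_measurable borel"
  shows "(\<integral>\<^sup>+x. f x \<partial>lborel) =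
    (\<integral>\<^sup>+t. f (tan t) * ennreal (inverse ((cos t)\<^sup>2)) * indicator {-(pi/2)<..<pi/2} t \<partial>lborel)"
proof -
  let ?I = "\<lambda>n::nat. {arctan (- real n)..arctan (real n)}"
  let ?g = "\<lambda>t. f (tan t) * ennreal (inverse ((cos t)\<^sup>2))"
  have sub: "?I n \<subseteq> {-(pi/2)<..<pi/2}" for n
    using arctan_bounded[of "real n"] arctan_bounded[of "- real n"] by auto
  have *: "(\<integral>\<^sup>+x. f x * indicator {- real n..real n} x \<partial>lborel) =
      (\<integral>\<^sup>+t. ?g t * indicator (?I n) t \<partial>lborel)" for n
  proof (cases "n = 0")
    \<comment> \<open>The interval degenerates to a point, which the substitution rule does not
      admit; both sides are 0.\<close>
    case True
    have "(\<integral>\<^sup>+x. g x * indicator {0} x \<partial>lborel) = 0" for g :: "real \<Rightarrow> ennreal"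
      by (rule nn_integral_null_set) (simp add: finite_imp_null_set_lborel)
    then show ?thesis using True by simp
  next
    case False
    have cos: "cos t \<noteq> 0" if "t \<in> ?I n" for t
      using sub that cos_gt_zero_pi[of t] by (metis greaterThanLessThan_iff less_irrefl subsetD)
    have "(\<integral>\<^sup>+x. f x * indicator {tan (arctan (- real n))..tan (arctan (real n))} x \<partial>lborel) =
      (\<integral>\<^sup>+t. f (tan t) * ennreal (inverse ((cos t)\<^sup>2)) * indicator (?I n) t \<partial>lborel)"
    proof (rule nn_integral_substitution_aux)
      show "(tan has_real_derivative inverse ((cos x)\<^sup>2)) (at x)" if "x \<in> ?I n" for x
        using DERIV_tan[OF cos[OF that]] .
      show "continuous_on (?I n) (\<lambda>x. inverse ((cos x)\<^sup>2))"
        using cos by (intro continuous_intros) auto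
    qed (use False in \<open>auto simp: arctan_less_iff\<close>)
    then show ?thesis by (simp only: tan_arctan)
  qed
  have "(\<integral>\<^sup>+x. f x \<partial>lborel) = (\<integral>\<^sup>+x. (SUP n::nat. f x * indicator {- real n..real n} x) \<partial>lborel)"
  proof (rule nn_integral_cong)
    fix x :: real
    obtain n :: nat where "\<bar>x\<bar> \<le> real n" using real_arch_simple by blast
    then show "f x = (SUP n::nat. f x * indicator {- real n..real n} x)"
      by (intro antisym SUP_upper2[of n] SUP_least) (auto split: split_indicator)
  qed
  also have "\<dots> = (SUP n::nat. \<integral>\<^sup>+x. f x * indicator {- real n..real n} x \<partial>lborel)"
    by (rule nn_integral_monotone_convergence_SUP)
       (auto simp: incseq_def le_fun_def split: split_indicator)
  also have "\<dots> = (SUP n::nat. \<integral>\<^sup>+t. ?g t * indicator (?I n) t \<partial>lborel)"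
    by (simp add: *)
  also have "\<dots> = (\<integral>\<^sup>+t. (SUP n::nat. ?g t * indicator (?I n) t) \<partial>lborel)"
  proof (rule nn_integral_monotone_convergence_SUP[symmetric])
    have "?I m \<subseteq> ?I n" if "m \<le> n" for m n
      using that by (auto simp: arctan_le_iff intro: order_trans[where y="arctan (real m)"]
         order_trans[where y="arctan (- real m)"])
    then have "indicator (?I m) t \<le> (indicator (?I n) t :: ennreal)" if "m \<le> n" for m n t
      using that by (intro indicator_leI) blast
    then show "incseq (\<lambda>n t. ?g t * indicator (?I n) t)"
      unfolding incseq_def le_fun_def by (intro allI impI mult_left_mono) auto
    show "(\<lambda>t. ?g t * indicator (?I n) t) \<in> borel_measurable lborel" for n
    proof -
      have [measurable]: "(tan :: real \<Rightarrow> real) \<in> borel_measurable borel"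
        unfolding tan_def by measurable
      show ?thesis by measurable
    qed
  qed
  also have "\<dots> = (\<integral>\<^sup>+t. ?g t * indicator {-(pi/2)<..<pi/2} t \<partial>lborel)"
  proof (rule nn_integral_cong)
    fix t :: real
    show "(SUP n::nat. ?g t * indicator (?I n) t) = ?g t * indicator {-(pi/2)<..<pi/2} t"
    proof (cases "t \<in> {-(pi/2)<..<pi/2}")
      case True
      obtain n :: nat where n: "\<bar>tan t\<bar> \<le> real n" using real_arch_simple by blast
      have "t = arctan (tan t)" using True arctan_tan by force
      then have "t \<in> ?I n" using n by (metis abs_le_iff arctan_le_iff atLeastAtMost_iff minus_le_iff)
      then show ?thesis
        using True by (intro antisym SUP_upper2[of n] SUP_least) (auto split: split_indicator)
    next
      case False
      then have "t \<notin> ?I n" for n using sub by blast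
      then show ?thesis using False by simp
    qed
  qed
  finally show ?thesis .
qed

text \<open>Slope coordinates reduce the change of variables to one dimension: for fixed x > 0 put y
  = x * \<tau>, exchange the integrals, put \<tau> = tan t and then x = s * cos t. The factors x, 1
  / (cos t)^2 and cos t multiply to the Jacobian s.\<close>

lemma nn_integral_right_half_plane:
  assumes [measurable]: "F \<in> borel_measurable borel"
  shows "(\<integral>\<^sup>+x. \<integral>\<^sup>+y. F (Complex x y) * indicator {0<..} x \<partial>lborel \<partial>lborel) =
    (\<integral>\<^sup>+t. \<integral>\<^sup>+s. F (of_real s * cis t) * ennreal s * indicator {0<..} s * indicator {-(pi/2)<..<pi/2} t \<partial>lborel \<partial>lborel)"
proof -
  have "(\<integral>\<^sup>+x. \<integral>\<^sup>+y. F (Complex x y) * indicator {0<..} x \<partial>lborel \<partial>lborel)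
      = (\<integral>\<^sup>+x. \<integral>\<^sup>+\<tau>. ennreal x * F (Complex x (x * \<tau>)) * indicator {0<..} x \<partial>lborel \<partial>lborel)"
  proof (rule nn_integral_cong)
    fix x :: real
    show "(\<integral>\<^sup>+y. F (Complex x y) * indicator {0<..} x \<partial>lborel)
      = (\<integral>\<^sup>+\<tau>. ennreal x * F (Complex x (x * \<tau>)) * indicator {0<..} x \<partial>lborel)"
      by (cases "x > 0")
         (simp_all add: nn_integral_real_affine[of "\<lambda>y. F (Complex x y)" x 0] nn_integral_cmult)
  qed
  also have "\<dots> = (\<integral>\<^sup>+\<tau>. \<integral>\<^sup>+x. ennreal x * F (Complex x (x * \<tau>)) * indicator {0<..} x \<partial>lborel \<partial>lborel)"
    by (rule lborel_pair.Fubini') measurable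
  also have "\<dots> = (\<integral>\<^sup>+t. (\<integral>\<^sup>+x. ennreal x * F (Complex x (x * tan t)) * indicator {0<..} x \<partial>lborel) *
      ennreal (inverse ((cos t)\<^sup>2)) * indicator {-(pi/2)<..<pi/2} t \<partial>lborel)"
    by (rule nn_integral_tan_substitution) measurable
  also have "\<dots> = (\<integral>\<^sup>+t. \<integral>\<^sup>+s. F (of_real s * cis t) * ennreal s * indicator {0<..} s * indicator {-(pi/2)<..<pi/2} t \<partial>lborel \<partial>lborel)"
  proof (rule nn_integral_cong)
    fix t :: real
    show "(\<integral>\<^sup>+x. ennreal x * F (Complex x (x * tan t)) * indicator {0<..} x \<partial>lborel) *
      ennreal (inverse ((cos t)\<^sup>2)) * indicator {-(pi/2)<..<pi/2} t =
      (\<integral>\<^sup>+s. F (of_real s * cis t) * ennreal s * indicator {0<..} s * indicator {-(pi/2)<..<pi/2} t \<partial>lborel)"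
    proof (cases "t \<in> {-(pi/2)<..<pi/2}")
      case True
      then have c: "cos t > 0" using cos_gt_zero_pi by simp
      have eq: "Complex (cos t * s) (cos t * s * tan t) = of_real s * cis t" for s
        using c by (simp add: complex_eq_iff tan_def)
      have ind: "indicator {0<..} (cos t * s) = (indicator {0<..} s :: ennreal)" for s
        using c by (auto simp: indicator_def zero_less_mult_iff)
      have "(\<integral>\<^sup>+x. ennreal x * F (Complex x (x * tan t)) * indicator {0<..} x \<partial>lborel) =
        ennreal (cos t) * (\<integral>\<^sup>+s. ennreal (cos t * s) * F (of_real s * cis t) * indicator {0<..} s \<partial>lborel)"
        using c by (subst nn_integral_real_affine[of _ "cos t" 0]) (simp_all add: eq ind)
      also have "(\<integral>\<^sup>+s. ennreal (cos t * s) * F (of_real s * cis t) * indicator {0<..} s \<partial>lborel) =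
         (\<integral>\<^sup>+s. ennreal (cos t) * (F (of_real s * cis t) * ennreal s * indicator {0<..} s) \<partial>lborel)"
        using c by (intro nn_integral_cong) (auto simp: ennreal_mult mult_ac split: split_indicator)
      also have "\<dots> = ennreal (cos t) * (\<integral>\<^sup>+s. F (of_real s * cis t) * ennreal s * indicator {0<..} s \<partial>lborel)"
        by (rule nn_integral_cmult) (simp add: cis_conv_exp)
      finally have A: "(\<integral>\<^sup>+x. ennreal x * F (Complex x (x * tan t)) * indicator {0<..} x \<partial>lborel) =
        ennreal (cos t) * (ennreal (cos t) * (\<integral>\<^sup>+s. F (of_real s * cis t) * ennreal s * indicator {0<..} s \<partial>lborel))" .
      have "ennreal (cos t) * ennreal (cos t) * ennreal (inverse ((cos t)\<^sup>2)) = 1"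
        using c by (simp add: ennreal_mult[symmetric] power2_eq_square ennreal_eq_1 field_simps del: ennreal_mult)
      then have "ennreal (cos t) * (ennreal (cos t) * X) * ennreal (inverse ((cos t)\<^sup>2)) = X" for X
        by (metis mult.assoc mult.commute mult_1)
      then show ?thesis using True unfolding A by simp
    qed simp
  qed
  finally show ?thesis .
qed

text \<open>Arguments of the right half-plane followed by those of the left one, so that each half
  comes from one tangent substitution.\<close>

abbreviation angles :: "real set"
  where "angles \<equiv> {-(pi/2)..3*pi/2}"

text \<open>The left half-plane is the image of the right one under z -> -z, which shifts the angle
  by pi; the imaginary axis and the end angles are null sets.\<close>

lemma nn_integral_polar:
  assumes [measurable]: "F \<in> borel_measurable borel"
  shows "(\<integral>\<^sup>+z. F z \<partial>lborel) =
    (\<integral>\<^sup>+t. \<integral>\<^sup>+s. F (of_real s * cis t) * ennreal s * indicator {0<..} s *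
       indicator angles t \<partial>lborel \<partial>lborel)"
proof -
  let ?G = "\<lambda>t. \<integral>\<^sup>+s. F (of_real s * cis t) * ennreal s * indicator {0<..} s \<partial>lborel"
  have [measurable]: "cis \<in> borel_measurable borel"
    by (intro borel_measurable_continuous_onI continuous_intros)
  have AE_ne: "AE x in lborel. x \<noteq> (a::real)" for a
    by (rule AE_I'[of "{a}"]) (auto simp: finite_imp_null_set_lborel)
  have "(\<integral>\<^sup>+z. F z \<partial>lborel) = (\<integral>\<^sup>+x. \<integral>\<^sup>+y. F (Complex x y) \<partial>lborel \<partial>lborel)"
    by (rule nn_integral_lborel_complex) fact
  also have "\<dots> = (\<integral>\<^sup>+x. (\<integral>\<^sup>+y. F (Complex x y) * indicator {0<..} x \<partial>lborel) +
      (\<integral>\<^sup>+y. F (Complex x y) * indicator {..<0} x \<partial>lborel) \<partial>lborel)"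
  proof (rule nn_integral_cong_AE, use AE_ne[of 0] in eventually_elim)
    fix x :: real assume "x \<noteq> 0"
    then show "(\<integral>\<^sup>+y. F (Complex x y) \<partial>lborel) = (\<integral>\<^sup>+y. F (Complex x y) * indicator {0<..} x \<partial>lborel) +
      (\<integral>\<^sup>+y. F (Complex x y) * indicator {..<0} x \<partial>lborel)"
      by (cases "x > 0") auto
  qed
  also have "\<dots> = (\<integral>\<^sup>+x. \<integral>\<^sup>+y. F (Complex x y) * indicator {0<..} x \<partial>lborel \<partial>lborel) +
      (\<integral>\<^sup>+x. \<integral>\<^sup>+y. F (Complex x y) * indicator {..<0} x \<partial>lborel \<partial>lborel)"
    by (rule nn_integral_add) measurable
  also have "(\<integral>\<^sup>+x. \<integral>\<^sup>+y. F (Complex x y) * indicator {..<0} x \<partial>lborel \<partial>lborel) =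
     (\<integral>\<^sup>+x. \<integral>\<^sup>+y. F (Complex (- x) y) * indicator {..<0} (- x) \<partial>lborel \<partial>lborel)"
    using nn_integral_real_affine[of "\<lambda>x. \<integral>\<^sup>+y. F (Complex x y) * indicator {..<0} x \<partial>lborel" "-1" 0]
    by simp
  also have "\<dots> = (\<integral>\<^sup>+x. \<integral>\<^sup>+y. F (- Complex x y) * indicator {0<..} x \<partial>lborel \<partial>lborel)"
  proof (rule nn_integral_cong)
    fix x :: real
    have "indicator {..<0} (- x) = (indicator {0<..} x :: ennreal)"
      by (auto simp: indicator_def)
    moreover have "Complex (- x) (- y) = - Complex x y" for y
      by (simp add: complex_eq_iff)
    ultimately show "(\<integral>\<^sup>+y. F (Complex (- x) y) * indicator {..<0} (- x) \<partial>lborel) =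
       (\<integral>\<^sup>+y. F (- Complex x y) * indicator {0<..} x \<partial>lborel)"
      by (subst nn_integral_real_affine[of _ "-1" 0]) simp_all
  qed
  also have "\<dots> = (\<integral>\<^sup>+t. \<integral>\<^sup>+s. F (- (of_real s * cis t)) * ennreal s * indicator {0<..} s * indicator {-(pi/2)<..<pi/2} t \<partial>lborel \<partial>lborel)"
    by (rule nn_integral_right_half_plane) simp
  also have "\<dots> = (\<integral>\<^sup>+t. \<integral>\<^sup>+s. F (- (of_real s * cis (t - pi))) * ennreal s * indicator {0<..} s * indicator {-(pi/2)<..<pi/2} (t - pi) \<partial>lborel \<partial>lborel)"
    by (subst nn_integral_real_affine[of _ 1 "-pi"]) simp_all
  also have "\<dots> = (\<integral>\<^sup>+t. ?G t * indicator {pi/2<..<3*pi/2} t \<partial>lborel)"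
  proof (rule nn_integral_cong)
    fix t :: real
    have "indicator {-(pi/2)<..<pi/2} (t - pi) = (indicator {pi/2<..<3*pi/2} t :: ennreal)"
      by (auto simp: indicator_def)
    moreover have "- (of_real s * cis (t - pi)) = of_real s * cis t" for s
      by (simp add: complex_eq_iff)
    ultimately show "(\<integral>\<^sup>+s. F (- (of_real s * cis (t - pi))) * ennreal s * indicator {0<..} s * indicator {-(pi/2)<..<pi/2} (t - pi) \<partial>lborel)
       = ?G t * indicator {pi/2<..<3*pi/2} t"
      by (simp add: nn_integral_multc)
  qed
  also have "(\<integral>\<^sup>+x. \<integral>\<^sup>+y. F (Complex x y) * indicator {0<..} x \<partial>lborel \<partial>lborel) =
      (\<integral>\<^sup>+t. ?G t * indicator {-(pi/2)<..<pi/2} t \<partial>lborel)"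
    by (subst nn_integral_right_half_plane) (simp_all add: nn_integral_multc)
  also have "(\<integral>\<^sup>+t. ?G t * indicator {-(pi/2)<..<pi/2} t \<partial>lborel) + (\<integral>\<^sup>+t. ?G t * indicator {pi/2<..<3*pi/2} t \<partial>lborel)
     = (\<integral>\<^sup>+t. ?G t * indicator {-(pi/2)<..<pi/2} t + ?G t * indicator {pi/2<..<3*pi/2} t \<partial>lborel)"
    by (rule nn_integral_add[symmetric]) measurable
  also have "\<dots> = (\<integral>\<^sup>+t. ?G t * indicator angles t \<partial>lborel)"
  proof (rule nn_integral_cong_AE, use AE_ne[of "-(pi/2)"] AE_ne[of "pi/2"] AE_ne[of "3*pi/2"] in eventually_elim)
    fix t :: real assume "t \<noteq> - (pi/2)" "t \<noteq> pi/2" "t \<noteq> 3*pi/2"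
    then show "?G t * indicator {-(pi/2)<..<pi/2} t + ?G t * indicator {pi/2<..<3*pi/2} t
      = ?G t * indicator angles t"
      using pi_gt_zero by (auto simp: indicator_def simp del: pi_gt_zero)
  qed
  also have "\<dots> = (\<integral>\<^sup>+t. \<integral>\<^sup>+s. F (of_real s * cis t) * ennreal s * indicator {0<..} s *
       indicator angles t \<partial>lborel \<partial>lborel)"
    by (simp add: nn_integral_multc)
  finally show ?thesis .
qed

lemma nn_integral_polar':
  assumes [measurable]: "F \<in> borel_measurable borel"
  shows "(\<integral>\<^sup>+z. F z \<partial>lborel) =
    (\<integral>\<^sup>+s. (\<integral>\<^sup>+t. F (of_real s * cis t) * indicator angles t \<partial>lborel) *
       ennreal s * indicator {0<..} s \<partial>lborel)"
proof -
  have [measurable]: "cis \<in> borel_measurable borel"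
    by (intro borel_measurable_continuous_onI continuous_intros)
  have "(\<integral>\<^sup>+z. F z \<partial>lborel) =
    (\<integral>\<^sup>+s. \<integral>\<^sup>+t. F (of_real s * cis t) * ennreal s * indicator {0<..} s *
       indicator angles t \<partial>lborel \<partial>lborel)"
    by (subst nn_integral_polar[OF assms], rule lborel_pair.Fubini') measurable
  also have "\<dots> = (\<integral>\<^sup>+s. (\<integral>\<^sup>+t. F (of_real s * cis t) * indicator angles t \<partial>lborel) *
       ennreal s * indicator {0<..} s \<partial>lborel)"
  proof (rule nn_integral_cong)
    fix s :: real
    have "(\<integral>\<^sup>+t. F (of_real s * cis t) * ennreal s * indicator {0<..} s * indicator angles t \<partial>lborel) =
      (\<integral>\<^sup>+t. F (of_real s * cis t) * indicator angles t * (ennreal s * indicator {0<..} s) \<partial>lborel)"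
      by (simp only: mult_ac)
    also have "\<dots> = (\<integral>\<^sup>+t. F (of_real s * cis t) * indicator angles t \<partial>lborel) * (ennreal s * indicator {0<..} s)"
      by (rule nn_integral_multc) measurable
    finally show "(\<integral>\<^sup>+t. F (of_real s * cis t) * ennreal s * indicator {0<..} s * indicator angles t \<partial>lborel)
      = (\<integral>\<^sup>+t. F (of_real s * cis t) * indicator angles t \<partial>lborel) * ennreal s * indicator {0<..} s"
      by (simp add: mult.assoc)
  qed
  finally show ?thesis .
qed

section \<open>Circle means of powers of moduli\<close>

lemma cis_lipschitz: "cmod (cis x - cis y) \<le> \<bar>x - y\<bar>"
proof -
  have "cis x - cis y = cis y * (cis (x - y) - 1)" by (simp add: cis_mult algebra_simps)
  then have "cmod (cis x - cis y) = cmod (cis (x - y) - 1)" by (simp add: norm_mult)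
  also have "\<dots> \<le> \<bar>x - y\<bar>"
    using dist_exp_i_1[of "x - y"] abs_sin_x_le_abs_x[of "(x - y)/2"]
    by (simp add: cis_conv_exp)
  finally show ?thesis .
qed

definition circle_mean :: "(complex \<Rightarrow> real) \<Rightarrow> complex \<Rightarrow> real \<Rightarrow> real"
  where "circle_mean v w R = integral angles (\<lambda>t. v (w + of_real R * cis t)) / (2 * pi)"

lemma continuous_on_circle:
  assumes "continuous_on (sphere w R) v" "R \<ge> 0"
  shows "continuous_on A (\<lambda>t. v (w + of_real R * cis t))"
  using assms(2)
  by (intro continuous_on_compose2[OF assms(1)] continuous_intros)
     (auto simp: dist_norm norm_mult)

lemma circle_mean_nonneg:
  assumes "\<And>z. v z \<ge> 0"
  shows "circle_mean v w R \<ge> 0"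
proof (cases "(\<lambda>t. v (w + of_real R * cis t)) integrable_on angles")
  case True
  then show ?thesis using assms
    unfolding circle_mean_def by (intro divide_nonneg_nonneg integral_nonneg) auto
next
  \<comment> \<open>A function that is not integrable has integral 0 by convention.\<close>
  case False
  then show ?thesis by (simp add: circle_mean_def not_integrable_integral)
qed

lemma circle_point:
  assumes "z \<in> sphere w R" "R > 0"
  obtains t where "t \<in> angles" "z = w + of_real R * cis t"
proof -
  have n: "cmod (z - w) = R" using assms by (simp add: dist_norm norm_minus_commute)
  have z: "z = w + of_real R * cis (Arg (z - w))"
    using rcis_cmod_Arg[of "z - w"] n by (simp add: rcis_def algebra_simps)
  have A: "- pi < Arg (z - w)" "Arg (z - w) \<le> pi"
    using Arg_bounded[of "z - w"] by auto
  show ?thesis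
  proof (cases "Arg (z - w) \<ge> - (pi/2)")
    case True
    then show ?thesis using A z by (intro that[of "Arg (z - w)"]) auto
  next
    case False
    have "cis (Arg (z - w) + 2 * pi) = cis (Arg (z - w))" by (simp add: complex_eq_iff)
    then show ?thesis using A z False by (intro that[of "Arg (z - w) + 2 * pi"]) auto
  qed
qed

text \<open>On each of the n arcs the mean value theorem for an antiderivative turns the integral
  into one value of v, and uniform continuity compares it with the sample point. N must not depend
  on the starting angle t: the sums are used as functions of a point that runs over the whole
  circle.\<close>

lemma circle_mean_Riemann_sum:
  assumes v: "continuous_on (sphere w R) v" and R: "R > 0" and e: "e > 0"
  obtains N :: nat where "N > 0"
    "\<And>n t. n \<ge> N \<Longrightarrow> t \<in> angles \<Longrightarrow>
       \<bar>(\<Sum>j<n. v (w + of_real R * cis (t + 2 * pi * real j / real n))) / n - circle_mean v w R\<bar> \<le> e"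
proof -
  define \<phi> where "\<phi> t = v (w + of_real R * cis t)" for t
  have cont: "continuous_on A \<phi>" for A
    unfolding \<phi>_def using continuous_on_circle[OF v] R by simp
  have per: "\<phi> (t + 2 * pi) = \<phi> t" for t
    by (simp add: \<phi>_def cis_mult[symmetric])
  \<comment> \<open>The interval [-10, 20] is ample: it contains \<open>angles\<close> together with
    its translate by 2 pi.\<close>
  obtain \<Phi> where \<Phi>: "\<And>x. x \<in> {-10..20} \<Longrightarrow> (\<Phi> has_vector_derivative \<phi> x) (at x within {-10..20})"
    using antiderivative_continuous[OF cont] by blast
  have D: "(\<Phi> has_real_derivative \<phi> x) (at x)" if "x \<in> {-10<..<20}" for x
  proof -
    have "(\<Phi> has_vector_derivative \<phi> x) (at x within {-10<..<20})"
      using that by (intro has_vector_derivative_within_subset[OF \<Phi>]) auto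
    then show ?thesis
      unfolding has_real_derivative_iff_has_vector_derivative
      using that at_within_open[of x "{-10<..<20::real}"] by (metis open_greaterThanLessThan)
  qed
  have pi: "3 < pi" "pi < 4" using pi_gt3 pi_less_4 by auto
  \<comment> \<open>The integral over a full period does not depend on where it starts: the
    derivative of the difference is \<phi>(x + 2 pi) - \<phi>(x) = 0.\<close>
  have const: "\<Phi> (x + 2 * pi) - \<Phi> x = \<Phi> (3 * pi / 2) - \<Phi> (-(pi/2))" if "x \<in> angles" for x
  proof -
    have "\<Phi> (x + 2 * pi) - \<Phi> x = \<Phi> (-(pi/2) + 2 * pi) - \<Phi> (-(pi/2))"
    proof (rule DERIV_isconst3[where a = "-9" and b = 10 and f = "\<lambda>x. \<Phi> (x + 2 * pi) - \<Phi> x"])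
      fix y :: real assume y: "y \<in> {-9<..<10}"
      have "((\<lambda>x. \<Phi> (x + 2 * pi)) has_real_derivative \<phi> (y + 2 * pi)) (at y)"
        using D[of "y + 2 * pi"] pi y by (simp add: DERIV_at_within_shift DERIV_shift)
      then have "((\<lambda>x. \<Phi> (x + 2 * pi) - \<Phi> x) has_real_derivative \<phi> (y + 2 * pi) - \<phi> y) (at y)"
        using D[of y] y by (intro derivative_intros) auto
      then show "((\<lambda>x. \<Phi> (x + 2 * pi) - \<Phi> x) has_real_derivative 0) (at y)"
        by (simp add: per)
    qed (use that pi in auto)
    moreover have "-(pi/2) + 2 * pi = 3 * pi / 2" by simp
    ultimately show ?thesis by simp
  qed
  have I: "integral angles \<phi> = \<Phi> (3 * pi / 2) - \<Phi> (-(pi/2))"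
  proof (rule integral_unique, rule fundamental_theorem_of_calculus)
    fix x assume "x \<in> angles"
    then show "(\<Phi> has_vector_derivative \<phi> x) (at x within angles)"
      using pi by (intro has_vector_derivative_within_subset[OF \<Phi>]) auto
  qed simp
  have "uniformly_continuous_on (sphere w R) v"
    using v by (rule compact_uniformly_continuous) simp
  then obtain d where d: "d > 0" and
    d': "\<And>x y. x \<in> sphere w R \<Longrightarrow> y \<in> sphere w R \<Longrightarrow> dist x y < d \<Longrightarrow> dist (v x) (v y) < e"
    using e unfolding uniformly_continuous_on_def by metis
  have uc: "\<bar>\<phi> x - \<phi> y\<bar> \<le> e" if "R * \<bar>x - y\<bar> < d" for x y
  proof -
    have "dist (w + of_real R * cis x) (w + of_real R * cis y) = R * cmod (cis x - cis y)"
      using R by (simp add: dist_norm norm_mult right_diff_distrib[symmetric] del: right_diff_distrib)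
    also have "\<dots> \<le> R * \<bar>x - y\<bar>" using cis_lipschitz R by (simp add: mult_left_mono)
    finally have "dist (w + of_real R * cis x) (w + of_real R * cis y) < d" using that by simp
    moreover have "w + of_real R * cis x \<in> sphere w R" for x
      using R by (simp add: dist_norm norm_mult)
    ultimately have "dist (\<phi> x) (\<phi> y) < e" unfolding \<phi>_def by (intro d')
    then show ?thesis by (simp add: dist_real_def)
  qed
  obtain N :: nat where N: "R * 2 * pi / d < real N" using reals_Archimedean2 by blast
  have "N > 0" using N d R pi by (cases N) (auto simp: divide_simps mult_less_0_iff)
  have "\<bar>(\<Sum>j<n. \<phi> (t + 2 * pi * real j / real n)) / n - circle_mean v w R\<bar> \<le> e"
    if n: "n \<ge> N" and t: "t \<in> angles" for n t
  proof -
    have n0: "n > 0" using n \<open>N > 0\<close> by simp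
    define h where "h = 2 * pi / n"
    have h0: "h > 0" using n0 pi by (simp add: h_def)
    have "R * 2 * pi / d < real n" using N n by linarith
    then have Rh: "R * h < d" using d n0 by (simp add: h_def field_simps)
    have "\<exists>\<xi>. \<Phi> (t + h * Suc j) - \<Phi> (t + h * j) = h * \<phi> \<xi> \<and> \<bar>\<xi> - (t + h * j)\<bar> \<le> h" if "j < n" for j
    proof -
      have le: "h * Suc j \<le> h * n" using that h0 by (intro mult_left_mono) auto
      have hn: "h * n = 2 * pi" using n0 by (simp add: h_def)
      have h0j: "0 \<le> h * j" using h0 by simp
      have lt: "t + h * j < t + h * Suc j" using h0 by (simp add: algebra_simps)
      have "\<exists>z>t + h * j. z < t + h * Suc j \<and>
          \<Phi> (t + h * Suc j) - \<Phi> (t + h * j) = (t + h * Suc j - (t + h * j)) * \<phi> z"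
      proof (rule MVT2[OF lt])
        fix x assume "t + h * j \<le> x" "x \<le> t + h * Suc j"
        then have "- (pi/2) \<le> x" "x \<le> 3 * pi / 2 + 2 * pi" using le hn t h0j by auto
        then show "(\<Phi> has_real_derivative \<phi> x) (at x)" using pi by (intro D) auto
      qed
      then obtain \<xi> where "\<xi> > t + h * j" "\<xi> < t + h * Suc j"
        "\<Phi> (t + h * Suc j) - \<Phi> (t + h * j) = (t + h * Suc j - (t + h * j)) * \<phi> \<xi>"
        by blast
      then show ?thesis by (intro exI[of _ \<xi>]) (simp add: algebra_simps)
    qed
    then obtain \<xi> where \<xi>: "\<And>j. j < n \<Longrightarrow> \<Phi> (t + h * Suc j) - \<Phi> (t + h * j) = h * \<phi> (\<xi> j)"
      "\<And>j. j < n \<Longrightarrow> \<bar>\<xi> j - (t + h * j)\<bar> \<le> h" by metis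
    have "(\<Sum>j<n. h * \<phi> (\<xi> j)) = (\<Sum>j<n. \<Phi> (t + h * Suc j) - \<Phi> (t + h * j))"
      using \<xi> by simp
    also have "\<dots> = \<Phi> (t + h * n) - \<Phi> (t + h * real 0)"
      by (subst sum_lessThan_telescope[symmetric]) simp
    also have "\<dots> = \<Phi> (t + 2 * pi) - \<Phi> t" using n0 by (simp add: h_def)
    also have "\<dots> = 2 * pi * circle_mean v w R"
      using const[OF t] I unfolding circle_mean_def \<phi>_def[symmetric] by simp
    finally have "2 * pi * circle_mean v w R = h * (\<Sum>j<n. \<phi> (\<xi> j))"
      by (simp add: sum_distrib_left)
    then have M: "circle_mean v w R = (\<Sum>j<n. \<phi> (\<xi> j)) / n"
      using pi n0 by (simp add: h_def field_simps)
    have "\<bar>(\<Sum>j<n. \<phi> (t + h * j)) - (\<Sum>j<n. \<phi> (\<xi> j))\<bar> \<le> (\<Sum>j<n. e)"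
      unfolding sum_subtractf[symmetric]
    proof (rule order_trans[OF sum_abs sum_mono])
      fix j assume "j \<in> {..<n}"
      then have "R * \<bar>\<xi> j - (t + h * j)\<bar> \<le> R * h" using \<xi>(2) R by (intro mult_left_mono) auto
      then have "R * \<bar>(t + h * j) - \<xi> j\<bar> < d" using Rh by (simp add: abs_minus_commute)
      then show "\<bar>\<phi> (t + h * j) - \<phi> (\<xi> j)\<bar> \<le> e" by (rule uc)
    qed
    then have "\<bar>(\<Sum>j<n. \<phi> (t + h * j)) - (\<Sum>j<n. \<phi> (\<xi> j))\<bar> / n \<le> e"
      using n0 by (simp add: field_simps)
    moreover have "(\<Sum>j<n. \<phi> (t + h * j)) / n - (\<Sum>j<n. \<phi> (\<xi> j)) / n =
        ((\<Sum>j<n. \<phi> (t + h * j)) - (\<Sum>j<n. \<phi> (\<xi> j))) / n" by (simp add: diff_divide_distrib)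
    ultimately have "\<bar>(\<Sum>j<n. \<phi> (t + h * j)) / n - circle_mean v w R\<bar> \<le> e"
      unfolding M by (simp add: abs_divide)
    moreover have "h * real j = 2 * pi * real j / real n" for j by (simp add: h_def)
    ultimately show ?thesis by simp
  qed
  then show ?thesis using that \<open>N > 0\<close> unfolding \<phi>_def by blast
qed

text \<open>For the submean property of \<open>|F|\<^sup>p\<close>, apply the maximum principle to the product of \<open>n\<close>
  rotated copies of \<open>F\<close>: by the arithmetic-geometric mean inequality it is bounded on the circle
  by a Riemann sum of \<open>|F|\<^sup>p\<close>. This avoids factoring out zeros.\<close>

lemma submean_norm_powr:
  assumes F: "F holomorphic_on S" and S: "cball w R \<subseteq> S" "open S" and R: "R > 0" and p: "p > 0"
  shows "cmod (F w) powr p \<le> circle_mean (\<lambda>z. cmod (F z) powr p) w R"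
proof (rule field_le_epsilon)
  fix e :: real assume e: "e > 0"
  let ?v = "\<lambda>z. cmod (F z) powr p"
  have contF: "continuous_on S F" using F by (rule holomorphic_on_imp_continuous_on)
  have v: "continuous_on S ?v"
    using contF p by (intro continuous_on_powr' continuous_intros) auto
  have sph: "sphere w R \<subseteq> S" using S by (auto simp: subset_eq)
  obtain N :: nat where N: "N > 0" and
    NR: "\<And>n t. n \<ge> N \<Longrightarrow> t \<in> angles \<Longrightarrow>
       \<bar>(\<Sum>j<n. ?v (w + of_real R * cis (t + 2 * pi * real j / real n))) / n - circle_mean ?v w R\<bar> \<le> e"
    using circle_mean_Riemann_sum[OF continuous_on_subset[OF v sph] R e] by blast
  let ?M = "circle_mean ?v w R + e"
  let ?r = "\<lambda>j z. w + cis (2 * pi * real j / N) * (z - w)"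
  define G where "G z = (\<Prod>j<N. F (?r j z))" for z
  have rS: "?r j ` cball w R \<subseteq> S" for j
    using S by (auto simp: subset_eq dist_norm norm_mult norm_minus_commute)
  have holG: "G holomorphic_on ball w R"
    unfolding G_def
  proof (rule holomorphic_on_prod)
    fix j
    have "(F \<circ> ?r j) holomorphic_on ball w R"
      by (rule holomorphic_on_compose_gen[OF _ F])
         (use rS[of j] in \<open>auto intro!: holomorphic_intros\<close>)
    then show "(\<lambda>z. F (?r j z)) holomorphic_on ball w R" by (simp add: o_def)
  qed
  have contG: "continuous_on (cball w R) G"
    unfolding G_def using rS
    by (intro continuous_intros continuous_on_compose2[OF contF]) auto
  have "cmod (G w) \<le> ?M powr (N / p)"
  proof (rule maximum_modulus_frontier[of G "cball w R"])
    fix z assume "z \<in> frontier (cball w R)"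
    then have "z \<in> sphere w R" using R by (simp add: frontier_cball)
    then obtain t where t: "t \<in> angles" and z: "z = w + of_real R * cis t"
      using circle_point R by blast
    have rz: "?r j z = w + of_real R * cis (t + 2 * pi * real j / real N)" for j
      by (simp add: z cis_mult[symmetric] mult_ac)
    have "(\<Prod>j<N. ?v (?r j z)) powr (1 / card {..<N}) \<le> (\<Sum>j<N. ?v (?r j z) / card {..<N})"
      using N by (intro arith_geom_mean) auto
    also have "\<dots> = (\<Sum>j<N. ?v (?r j z)) / N" by (simp add: sum_divide_distrib)
    also have "\<dots> \<le> ?M" using NR[OF order_refl t] unfolding rz by linarith
    finally have "(cmod (G z) powr p) powr (1 / N) \<le> ?M"
      by (simp add: G_def prod_norm[symmetric] prod_powr_distrib)
    then have "((cmod (G z) powr p) powr (1 / N)) powr (N / p) \<le> ?M powr (N / p)"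
      using p by (intro powr_mono2) auto
    then show "cmod (G z) \<le> ?M powr (N / p)"
      using p N by (simp add: powr_powr)
  qed (use holG contG R in auto)
  \<comment> \<open>The rotations are about w and fix it.\<close>
  moreover have "G w = F w ^ N" by (simp add: G_def)
  ultimately have *: "cmod (F w) ^ N \<le> ?M powr (N / p)" by (simp add: norm_power)
  have M0: "0 \<le> ?M"
  proof -
    have "0 \<le> (\<Sum>j<N. ?v (w + of_real R * cis (0 + 2 * pi * real j / real N))) / N"
      by (intro divide_nonneg_nonneg sum_nonneg) auto
    also have "\<dots> \<le> ?M" using NR[OF order_refl, of 0] by auto
    finally show ?thesis .
  qed
  have "(cmod (F w) ^ N) powr (p / N) \<le> (?M powr (N / p)) powr (p / N)"
    using * p by (intro powr_mono2) auto
  moreover have "(cmod (F w) ^ N) powr (p / N) = cmod (F w) powr p"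
    using N p by (cases "F w = 0") (simp_all add: powr_realpow[symmetric] powr_powr)
  ultimately show "cmod (F w) powr p \<le> ?M"
    using M0 N p by (simp add: powr_powr)
qed

text \<open>Among the points where the maximum is attained take one of largest modulus. A circle
  about it inside the disc has mean at least the maximum, so v equals the maximum on all of it, yet
  this circle contains a point of larger modulus.\<close>

lemma submean_max_principle:
  fixes v :: "complex \<Rightarrow> real"
  assumes cont: "continuous_on (cball 0 \<rho>) v"
    and sub: "\<And>w s. s > 0 \<Longrightarrow> cball w s \<subseteq> ball 0 \<rho> \<Longrightarrow> v w \<le> circle_mean v w s"
    and B: "\<And>z. z \<in> sphere 0 \<rho> \<Longrightarrow> v z \<le> B"
    and w: "w \<in> cball 0 \<rho>"
  shows "v w \<le> B"
proof (rule ccontr)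
  assume nB: "\<not> v w \<le> B"
  obtain x0 where x0: "x0 \<in> cball 0 \<rho>" "\<And>y. y \<in> cball 0 \<rho> \<Longrightarrow> v y \<le> v x0"
    using continuous_attains_sup[OF compact_cball _ cont] w by blast
  define m where "m = v x0"
  have m: "m > B" using x0(2)[OF w] nB by (simp add: m_def)
  define K where "K = {x \<in> cball 0 \<rho>. v x = m}"
  have "closed K" unfolding K_def
    using continuous_closed_preimage[OF cont closed_cball, of "{m}"] by (simp add: vimage_def Int_def)
  moreover have "bounded K" by (rule bounded_subset[OF bounded_cball[of 0 \<rho>]]) (auto simp: K_def)
  ultimately have "compact K" by (simp add: compact_eq_bounded_closed)
  moreover have "K \<noteq> {}" using x0 by (auto simp: K_def m_def)
  ultimately obtain x where x: "x \<in> K" "\<And>y. y \<in> K \<Longrightarrow> cmod y \<le> cmod x"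
    using continuous_attains_sup[of K cmod] continuous_on_norm_id by blast
  have xr: "cmod x < \<rho>"
    using x(1) B[of x] m by (fastforce simp: K_def)
  define s where "s = (\<rho> - cmod x) / 2"
  have s: "s > 0" using xr by (simp add: s_def)
  have cb: "cball x s \<subseteq> ball 0 \<rho>"
  proof
    fix y assume "y \<in> cball x s"
    then have "cmod y \<le> cmod x + s"
      using norm_triangle_ineq2[of y x] by (simp add: dist_norm norm_minus_commute)
    then show "y \<in> ball 0 \<rho>" using xr by (simp add: s_def field_simps)
  qed
  \<comment> \<open>The outward direction; at the origin any direction will do.\<close>
  define d where "d = (if x = 0 then 1 else sgn x)"
  have nd: "cmod d = 1" by (simp add: d_def norm_sgn)
  have "x = of_real (cmod x) * d" by (simp add: d_def sgn_eq)
  then have y: "cmod (x + of_real s * d) = cmod x + s"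
  proof -
    have "cmod (x + of_real s * d) = cmod (of_real (cmod x + s) * d)"
      using \<open>x = of_real (cmod x) * d\<close> by (metis distrib_right of_real_add)
    also have "\<dots> = cmod x + s" using nd s by (simp add: norm_mult del: of_real_add)
    finally show ?thesis .
  qed
  have "x + of_real s * d \<in> sphere x s" using nd s by (simp add: dist_norm norm_mult)
  then obtain t where t: "t \<in> angles" and yt: "x + of_real s * d = x + of_real s * cis t"
    using circle_point s by blast
  have scb: "sphere x s \<subseteq> cball 0 \<rho>"
    using cb sphere_cball[of x s] ball_subset_cball[of 0 \<rho>] by blast
  have phi: "continuous_on A (\<lambda>t. v (x + of_real s * cis t))" for A
    using continuous_on_circle[OF continuous_on_subset[OF cont scb]] s by simp
  have int: "(\<lambda>t. v (x + of_real s * cis t)) integrable_on angles"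
    by (rule integrable_continuous_interval[OF phi])
  have sph: "x + of_real s * cis t \<in> cball 0 \<rho>" for t
    by (rule subsetD[OF scb]) (use s in \<open>simp add: dist_norm norm_mult\<close>)
  have le: "v (x + of_real s * cis t) \<le> m" for t
    using x0(2)[OF sph] by (simp add: m_def)
  let ?f = "\<lambda>t. m - v (x + of_real s * cis t)"
  have fJ: "(?f has_integral (m * (2 * pi) - integral angles (\<lambda>t. v (x + of_real s * cis t)))) angles"
    using has_integral_diff[OF has_integral_const_real[of m "-(pi/2)" "3*pi/2"] integrable_integral[OF int]]
    by (simp add: algebra_simps)
  have "m \<le> circle_mean v x s" using sub[OF s cb] x(1) by (simp add: K_def)
  then have "m * (2 * pi) \<le> integral angles (\<lambda>t. v (x + of_real s * cis t))"
    by (simp add: circle_mean_def field_simps)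
  then have "m * (2 * pi) - integral angles (\<lambda>t. v (x + of_real s * cis t)) = 0"
    using has_integral_nonneg[OF fJ] le by fastforce
  then have "(?f has_integral 0) (cbox (-(pi/2)) (3*pi/2))" using fJ by simp
  then have "?f t = 0"
  proof (rule has_integral_0_cbox_imp_0[rotated 2])
    show "continuous_on (cbox (-(pi/2)) (3*pi/2)) ?f" by (intro continuous_intros phi)
  qed (use le t in \<open>auto simp: not_le\<close>)
  then have "x + of_real s * d \<in> K" using sph[of t] by (simp add: K_def yt)
  then show False using x(2)[of "x + of_real s * d"] y s by simp
qed

lemma continuous_on_norm_powr:
  assumes "F holomorphic_on S" "p > 0"
  shows "continuous_on S (\<lambda>z. cmod (F z) powr p)"
  using holomorphic_on_imp_continuous_on[OF assms(1)] assms(2)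
  by (intro continuous_on_powr' continuous_intros) auto

text \<open>The average V of n rotated copies of |F|^p is again submean. On the circle of radius R
  and at the point r it is a Riemann sum of the respective circle mean, up to e / 2, so the maximum
  principle for V compares the two means.\<close>

lemma circle_mean_mono:
  assumes F: "F holomorphic_on S" and S: "cball 0 R \<subseteq> S" "open S" and r: "0 < r" "r \<le> R" and p: "p > 0"
  shows "circle_mean (\<lambda>z. cmod (F z) powr p) 0 r \<le> circle_mean (\<lambda>z. cmod (F z) powr p) 0 R"
proof (rule field_le_epsilon)
  fix e :: real assume e: "e > 0"
  let ?v = "\<lambda>z. cmod (F z) powr p"
  have R: "R > 0" using r by simp
  have v: "continuous_on S ?v" by (rule continuous_on_norm_powr[OF F p])
  have sR: "sphere 0 R \<subseteq> S" and sr: "sphere 0 r \<subseteq> S" using S r by auto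
  have e2: "e / 2 > 0" using e by simp
  obtain N1 :: nat where N1: "N1 > 0"
    "\<And>n t. n \<ge> N1 \<Longrightarrow> t \<in> angles \<Longrightarrow>
       \<bar>(\<Sum>j<n. ?v (0 + of_real R * cis (t + 2 * pi * real j / real n))) / n - circle_mean ?v 0 R\<bar> \<le> e / 2"
    using circle_mean_Riemann_sum[OF continuous_on_subset[OF v sR] R e2] by blast
  obtain N2 :: nat where N2: "N2 > 0"
    "\<And>n t. n \<ge> N2 \<Longrightarrow> t \<in> angles \<Longrightarrow>
       \<bar>(\<Sum>j<n. ?v (0 + of_real r * cis (t + 2 * pi * real j / real n))) / n - circle_mean ?v 0 r\<bar> \<le> e / 2"
    using circle_mean_Riemann_sum[OF continuous_on_subset[OF v sr] r(1) e2] by blast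
  define n where "n = max N1 N2"
  have n: "n > 0" "n \<ge> N1" "n \<ge> N2" using N1 by (auto simp: n_def)
  define rot where "rot j = cis (2 * pi * real j / real n)" for j :: nat
  define V where "V z = (\<Sum>j<n. ?v (rot j * z)) / n" for z
  have rS: "(\<lambda>z. rot j * z) ` cball 0 R \<subseteq> S" for j
    using S by (auto simp: subset_eq norm_mult rot_def)
  have Vrot: "V (of_real \<rho> * cis t) = (\<Sum>j<n. ?v (0 + of_real \<rho> * cis (t + 2 * pi * real j / real n))) / n" for \<rho> t
    by (simp add: V_def rot_def cis_mult[symmetric] mult_ac)
  have contj: "continuous_on (cball 0 R) (\<lambda>z. ?v (rot j * z))" for j
    using rS[of j] by (intro continuous_on_compose2[OF v] continuous_intros) auto
  have "V (of_real r) \<le> circle_mean ?v 0 R + e / 2"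
  proof (rule submean_max_principle[of R])
    show "continuous_on (cball 0 R) V"
      unfolding V_def using n by (intro continuous_intros contj) auto
    show "V z \<le> circle_mean ?v 0 R + e / 2" if z: "z \<in> sphere 0 R" for z
    proof -
      obtain t where t: "t \<in> angles" "z = 0 + of_real R * cis t"
        using circle_point[OF z R] by blast
      then have "V z = (\<Sum>j<n. ?v (0 + of_real R * cis (t + 2 * pi * real j / real n))) / n"
        using Vrot[of R t] by simp
      then show ?thesis using N1(2)[OF n(2) t(1)] by linarith
    qed
    show "complex_of_real r \<in> cball 0 R" using r by simp
    fix w :: complex and s :: real assume s: "s > 0" and cb: "cball w s \<subseteq> ball 0 R"
    have sub: "?v (rot j * w) \<le> circle_mean (\<lambda>z. ?v (rot j * z)) w s" for j
    proof -
      have "(F \<circ> (\<lambda>z. rot j * z)) holomorphic_on ball 0 R"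
      proof (rule holomorphic_on_compose_gen[OF _ F])
        show "(\<lambda>z. rot j * z) ` ball 0 R \<subseteq> S"
          by (rule order_trans[OF image_mono[OF ball_subset_cball] rS])
      qed (intro holomorphic_intros)
      then have "(\<lambda>z. F (rot j * z)) holomorphic_on ball 0 R" by (simp add: o_def)
      from submean_norm_powr[OF this cb _ s p] show ?thesis by simp
    qed
    have sw: "sphere w s \<subseteq> cball 0 R" using cb sphere_cball[of w s] ball_subset_cball[of 0 R] by blast
    have int: "(\<lambda>t. ?v (rot j * (w + of_real s * cis t))) integrable_on angles" for j
      using continuous_on_circle[OF continuous_on_subset[OF contj[of j] sw]] s
      by (intro integrable_continuous_interval) simp
    have "circle_mean V w s = (\<Sum>j<n. circle_mean (\<lambda>z. ?v (rot j * z)) w s) / n"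
      unfolding circle_mean_def V_def using int
      by (subst integral_divide, subst integral_sum) (simp_all add: sum_divide_distrib[symmetric])
    moreover have "(\<Sum>j<n. ?v (rot j * w)) \<le> (\<Sum>j<n. circle_mean (\<lambda>z. ?v (rot j * z)) w s)"
      by (intro sum_mono sub)
    ultimately show "V w \<le> circle_mean V w s"
      using n by (simp add: V_def divide_right_mono)
  qed
  moreover have "circle_mean ?v 0 r - e / 2 \<le> V (of_real r)"
  proof -
    have "V (of_real r) = (\<Sum>j<n. ?v (0 + of_real r * cis (0 + 2 * pi * real j / real n))) / n"
      using Vrot[of r 0] by simp
    moreover have "(0::real) \<in> angles" using pi_gt_zero by simp
    ultimately show ?thesis using N2(2)[OF n(3), of 0] by linarith
  qed
  ultimately show "circle_mean ?v 0 r \<le> circle_mean ?v 0 R + e" by linarith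
qed

lemma nn_integral_circle:
  assumes v: "continuous_on (sphere w R) v" and R: "R \<ge> 0" and nn: "\<And>z. v z \<ge> 0"
  shows "(\<integral>\<^sup>+t. ennreal (v (w + of_real R * cis t)) * indicator angles t \<partial>lborel)
     = ennreal (2 * pi * circle_mean v w R)"
proof -
  have "((\<lambda>t. v (w + of_real R * cis t)) has_integral
      integral angles (\<lambda>t. v (w + of_real R * cis t))) angles"
    using continuous_on_circle[OF v R] by (intro integrable_integral integrable_continuous_interval)
  from nn_integral_has_integral_lebesgue'[OF _ this] show ?thesis
    using nn by (simp add: circle_mean_def)
qed

lemma borel_measurable_norm_powr_indicator:
  assumes F: "F holomorphic_on S" "open S" and p: "p > 0" and A: "A \<subseteq> S" "A \<in> sets borel"
  shows "(\<lambda>z. ennreal (cmod (F z) powr p) * indicator A z) \<in> borel_measurable borel"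
proof -
  have "(\<lambda>z. indicator A z *\<^sub>R (cmod (F z) powr p)) \<in> borel_measurable borel"
    using continuous_on_subset[OF continuous_on_norm_powr[OF F(1) p] A(1)] A(2)
    by (intro borel_measurable_continuous_on_indicator)
  then have "(\<lambda>z. ennreal (indicator A z *\<^sub>R (cmod (F z) powr p))) \<in> borel_measurable borel"
    by measurable
  moreover have "ennreal (indicator A z *\<^sub>R (cmod (F z) powr p)) = ennreal (cmod (F z) powr p) * indicator A z" for z
    by (simp split: split_indicator)
  ultimately show ?thesis by (simp only:)
qed

lemma area_submean_norm_powr:
  assumes F: "F holomorphic_on S" "open S" and S: "ball w R \<subseteq> S" and R: "R > 0" and p: "p > 0"
  shows "ennreal (pi * R\<^sup>2 * cmod (F w) powr p) \<le> (\<integral>\<^sup>+z. ennreal (cmod (F z) powr p) * indicator (ball w R) z \<partial>lborel)"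
proof -
  let ?v = "\<lambda>z. cmod (F z) powr p"
  let ?g = "\<lambda>z. ennreal (?v z) * indicator (ball w R) z"
  have [measurable]: "?g \<in> borel_measurable borel"
    by (rule borel_measurable_norm_powr_indicator[OF F p S]) simp
  have "(\<integral>\<^sup>+z. ?g z \<partial>lborel) = (\<integral>\<^sup>+z. ?g (w + z) \<partial>lborel)"
    by (subst lborel_distr_plus[of w, symmetric], subst nn_integral_distr) simp_all
  also have "\<dots> = (\<integral>\<^sup>+s. (\<integral>\<^sup>+t. ?g (w + of_real s * cis t) * indicator angles t \<partial>lborel) *
       ennreal s * indicator {0<..} s \<partial>lborel)"
    by (rule nn_integral_polar') measurable
  also have "\<dots> \<ge> (\<integral>\<^sup>+s. ennreal (2 * pi * ?v w * s) * indicator {0..R} s \<partial>lborel)"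
  proof (rule nn_integral_mono_AE)
    \<comment> \<open>Only the open ball lies in S, so the circle of radius R is left out; the
      submean property asks for a positive radius.\<close>
    have "AE s in lborel. s \<noteq> (0::real)" "AE s in lborel. s \<noteq> R"
      by (rule AE_I'[of "{0}"], auto simp: finite_imp_null_set_lborel)
         (rule AE_I'[of "{R}"], auto simp: finite_imp_null_set_lborel)
    then show "AE s in lborel. ennreal (2 * pi * ?v w * s) * indicator {0..R} s \<le>
      (\<integral>\<^sup>+t. ?g (w + of_real s * cis t) * indicator angles t \<partial>lborel) *
       ennreal s * indicator {0<..} s"
    proof eventually_elim
      fix s :: real assume ne: "s \<noteq> 0" "s \<noteq> R"
      show "ennreal (2 * pi * ?v w * s) * indicator {0..R} s \<le>
      (\<integral>\<^sup>+t. ?g (w + of_real s * cis t) * indicator angles t \<partial>lborel) *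
       ennreal s * indicator {0<..} s"
      proof (cases "s \<in> {0..R}")
        case True
        then have s: "0 < s" "s < R" using ne by auto
        have cb: "cball w s \<subseteq> S" using S s by (auto simp: subset_eq)
        then have sph: "sphere w s \<subseteq> S" by auto
        have "(\<integral>\<^sup>+t. ?g (w + of_real s * cis t) * indicator angles t \<partial>lborel)
           = (\<integral>\<^sup>+t. ennreal (?v (w + of_real s * cis t)) * indicator angles t \<partial>lborel)"
          using s by (intro nn_integral_cong) (simp add: dist_norm norm_mult)
        also have "\<dots> = ennreal (2 * pi * circle_mean ?v w s)"
          using s continuous_on_subset[OF continuous_on_norm_powr[OF F(1) p] sph]
          by (intro nn_integral_circle) auto
        finally have eq: "(\<integral>\<^sup>+t. ?g (w + of_real s * cis t) * indicator angles t \<partial>lborel) =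
            ennreal (2 * pi * circle_mean ?v w s)" .
        have "?v w \<le> circle_mean ?v w s"
          by (rule submean_norm_powr[OF F(1) cb F(2) s(1) p])
        then have "ennreal (2 * pi * ?v w) \<le> ennreal (2 * pi * circle_mean ?v w s)"
          by (intro ennreal_leI mult_left_mono) auto
        then have "ennreal (2 * pi * ?v w) * ennreal s \<le> ennreal (2 * pi * circle_mean ?v w s) * ennreal s"
          by (rule mult_right_mono) simp
        then show ?thesis
          unfolding eq using True s by (simp add: ennreal_mult)
      qed simp
    qed
  qed
  also have "(\<integral>\<^sup>+s. ennreal (2 * pi * ?v w * s) * indicator {0..R} s \<partial>lborel) = ennreal (pi * R\<^sup>2 * ?v w)"
  proof -
    have "((\<lambda>s. 2 * pi * ?v w * s) has_integral (pi * ?v w * R\<^sup>2 - pi * ?v w * 0\<^sup>2)) {0..R}"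
      using R by (intro fundamental_theorem_of_calculus)
        (auto intro!: derivative_eq_intros simp: has_real_derivative_iff_has_vector_derivative[symmetric] power2_eq_square)
    from nn_integral_has_integral_lebesgue'[OF _ this] show ?thesis by (simp add: mult_ac)
  qed
  finally show ?thesis .
qed

text \<open>The mean over a disc about w of radius (1 - |z|) / 4 is bounded by an integral over
  radii in an interval of length 1 - |z|, all of them at most \<rho>, and circle means increase with
  the radius. Since \<rho> is free, the estimate can be integrated against a radial weight that may
  vanish near z.\<close>

lemma norm_powr_le_circle_integral:
  assumes F: "F holomorphic_on unit_disc" and p: "p > 0" and z: "z \<in> unit_disc"
    and w: "w \<in> ball z ((1 - cmod z) / 4)" and \<rho>: "1 - (1 - cmod z) / 2 \<le> \<rho>" "\<rho> < 1"
  shows "ennreal (cmod (F w) powr p) \<le> ennreal (16 / (pi * (1 - cmod z))) *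
    (\<integral>\<^sup>+t. ennreal (cmod (F (of_real \<rho> * cis t)) powr p) * indicator angles t \<partial>lborel)"
proof -
  let ?v = "\<lambda>z. cmod (F z) powr p"
  define h where "h = 1 - cmod z"
  have h: "h > 0" "h \<le> 1" using z by (auto simp: h_def)
  have czh: "cmod z = 1 - h" by (simp add: h_def)
  have \<rho>h: "1 - h / 2 \<le> \<rho>" using \<rho> by (simp add: h_def)
  have "1 + cmod z \<le> 2 * \<rho>" using \<rho>(1) by (simp add: field_simps)
  then have \<rho>0: "\<rho> > 0" using norm_ge_zero[of z] by linarith
  let ?B = "ball z (h / 2)"
  have normB: "cmod z - h / 2 < cmod u" "cmod u < 1 - h / 2" if "u \<in> ?B" for u
  proof -
    have 1: "cmod (u - z) < h / 2" using that by (simp add: dist_norm norm_minus_commute)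
    have 2: "cmod z - cmod u \<le> cmod (u - z)" "cmod u - cmod z \<le> cmod (u - z)"
      using norm_triangle_ineq2[of z u] norm_triangle_ineq2[of u z] by (simp_all add: norm_minus_commute)
    show "cmod z - h / 2 < cmod u" using 1 2 by linarith
    have "cmod z = 1 - h" by (simp add: h_def)
    then show "cmod u < 1 - h / 2" using 1 2 by linarith
  qed
  have BD: "?B \<subseteq> unit_disc"
  proof
    fix u assume "u \<in> ?B"
    then have "cmod u < 1" using normB(2)[of u] h by linarith
    then show "u \<in> unit_disc" by simp
  qed
  have wB: "ball w (h / 4) \<subseteq> ?B"
  proof
    fix u assume "u \<in> ball w (h / 4)"
    then have "dist z u < h / 4 + h / 4"
      using w dist_triangle[of z u w] by (simp add: h_def)
    then show "u \<in> ?B" by simp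
  qed
  let ?I = "circle_mean ?v 0 \<rho>"
  have I0: "?I \<ge> 0" by (rule circle_mean_nonneg) simp
  have mean: "?v w * (h / 16) \<le> 2 * ?I"
  proof -
    have "ennreal (pi * (h/4)\<^sup>2 * ?v w) \<le> (\<integral>\<^sup>+u. ennreal (?v u) * indicator (ball w (h/4)) u \<partial>lborel)"
      using wB BD h by (intro area_submean_norm_powr[OF F _ _ _ p]) auto
    also have "\<dots> \<le> (\<integral>\<^sup>+u. ennreal (?v u) * indicator ?B u \<partial>lborel)"
      using wB by (intro nn_integral_mono) (auto split: split_indicator)
    also have "\<dots> = (\<integral>\<^sup>+s. (\<integral>\<^sup>+t. ennreal (?v (of_real s * cis t)) * indicator ?B (of_real s * cis t) * indicator angles t \<partial>lborel) *
       ennreal s * indicator {0<..} s \<partial>lborel)"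
      by (intro nn_integral_polar' borel_measurable_norm_powr_indicator[OF F _ p BD]) auto
    also have "\<dots> \<le> (\<integral>\<^sup>+s. ennreal (2 * pi * ?I) * indicator {cmod z - h/2..cmod z + h/2} s \<partial>lborel)"
    proof (rule nn_integral_mono)
      fix s :: real
      show "(\<integral>\<^sup>+t. ennreal (?v (of_real s * cis t)) * indicator ?B (of_real s * cis t) * indicator angles t \<partial>lborel) *
       ennreal s * indicator {0<..} s \<le> ennreal (2 * pi * ?I) * indicator {cmod z - h/2..cmod z + h/2} s"
      proof (cases "s > 0 \<and> s \<in> {cmod z - h/2..cmod z + h/2}")
        case True
        then have s: "0 < s" "s \<le> \<rho>" "s \<le> 1" using \<rho>(2) \<rho>h h czh by auto
        have sph: "sphere 0 s \<subseteq> unit_disc" using s \<rho> by auto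
        have "(\<integral>\<^sup>+t. ennreal (?v (of_real s * cis t)) * indicator ?B (of_real s * cis t) * indicator angles t \<partial>lborel)
          \<le> (\<integral>\<^sup>+t. ennreal (?v (0 + of_real s * cis t)) * indicator angles t \<partial>lborel)"
          by (intro nn_integral_mono) (auto split: split_indicator)
        also have "\<dots> = ennreal (2 * pi * circle_mean ?v 0 s)"
          using s continuous_on_subset[OF continuous_on_norm_powr[OF F p] sph]
          by (intro nn_integral_circle) auto
        also have "\<dots> \<le> ennreal (2 * pi * ?I)"
          using s \<rho> by (intro ennreal_leI mult_left_mono circle_mean_mono[OF F _ _ _ _ p]) auto
        finally have "(\<integral>\<^sup>+t. ennreal (?v (of_real s * cis t)) * indicator ?B (of_real s * cis t) * indicator angles t \<partial>lborel) * ennreal s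
            \<le> ennreal (2 * pi * ?I) * 1"
          using s by (intro mult_mono) auto
        then show ?thesis using True by simp
      next
        case False
        have "(\<integral>\<^sup>+t. ennreal (?v (of_real s * cis t)) * indicator ?B (of_real s * cis t) * indicator angles t \<partial>lborel) = 0"
          if s: "s > 0"
        proof -
          have "indicator ?B (of_real s * cis t) = (0::ennreal)" for t
          proof -
            have "of_real s * cis t \<notin> ?B"
            proof
              assume "of_real s * cis t \<in> ?B"
              then have "cmod z - h / 2 < s" "s < 1 - h / 2"
                using normB[of "of_real s * cis t"] s by (auto simp: norm_mult)
              then show False using False s czh by auto
            qed
            then show ?thesis by simp
          qed
          then show ?thesis by simp
        qed
        then show ?thesis by (cases "s > 0") auto
      qed
    qed
    also have "\<dots> = ennreal (2 * pi * ?I * h)"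
      using h I0 by (simp add: nn_integral_cmult ennreal_mult)
    finally have "pi * (h/4)\<^sup>2 * ?v w \<le> 2 * pi * ?I * h"
      using I0 h by (subst (asm) ennreal_le_iff) auto
    then have "(pi * h) * (?v w * (h / 16)) \<le> (pi * h) * (2 * ?I)"
      by (simp add: power2_eq_square field_simps)
    then show ?thesis using h by (simp add: mult_le_cancel_left_pos)
  qed
  have sph: "sphere 0 \<rho> \<subseteq> unit_disc" using \<rho> by auto
  have II: "(\<integral>\<^sup>+t. ennreal (?v (of_real \<rho> * cis t)) * indicator angles t \<partial>lborel) = ennreal (2 * pi * ?I)"
    using \<rho>0 continuous_on_subset[OF continuous_on_norm_powr[OF F p] sph]
      nn_integral_circle[of 0 \<rho> ?v] by simp
  have "ennreal (16 / (pi * h)) * (\<integral>\<^sup>+t. ennreal (?v (of_real \<rho> * cis t)) * indicator angles t \<partial>lborel) =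
     ennreal (16 / (pi * h) * (2 * pi * ?I))"
    unfolding II using I0 h by (intro ennreal_mult[symmetric]) auto
  moreover have "?v w \<le> 16 / (pi * h) * (2 * pi * ?I)"
    using mean h by (simp add: field_simps)
  ultimately show ?thesis by (simp add: h_def ennreal_leI)
qed

section \<open>The kernel quasi-metric and Carleson squares\<close>

definition bdist :: "complex \<Rightarrow> real"
  where "bdist z = 1 - cmod z"

text \<open>On the disc \<open>kdist\<close> satisfies the triangle inequality, although \<open>kdist z z\<close> is of the
  order of \<open>bdist z\<close>.\<close>

definition kdist :: "complex \<Rightarrow> complex \<Rightarrow> real"
  where "kdist z u = cmod (1 - cnj z * u)"

text \<open>The modulus of the normalised kernel (1 - |z|) / (1 - conj z * u): at most 1, bounded
  below near z, and decaying away from z.\<close>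

definition kratio :: "complex \<Rightarrow> complex \<Rightarrow> real"
  where "kratio z u = bdist z / kdist z u"

lemma kdist_nonneg [simp]: "0 \<le> kdist z u"
  by (simp add: kdist_def)

lemma bdist_pos: "z \<in> unit_disc \<Longrightarrow> 0 < bdist z"
  and bdist_le_1: "bdist z \<le> 1"
  by (auto simp: bdist_def)

lemma kdist_commute: "kdist z u = kdist u z"
proof -
  have "kdist z u = cmod (cnj (1 - cnj z * u))" by (simp only: kdist_def complex_mod_cnj)
  then show ?thesis by (simp add: kdist_def mult.commute)
qed

lemma bdist_le_kdist:
  assumes "z \<in> unit_disc" "u \<in> unit_disc"
  shows "bdist z \<le> kdist z u"
proof -
  have "cmod (cnj z * u) \<le> cmod z * 1"
    using assms by (simp add: norm_mult mult_left_le)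
  moreover have "1 - cmod (cnj z * u) \<le> kdist z u"
    using norm_triangle_ineq2[of 1 "cnj z * u"] by (simp add: kdist_def)
  ultimately show ?thesis by (simp add: bdist_def)
qed

lemma bdist_le_kdist':
  "z \<in> unit_disc \<Longrightarrow> u \<in> unit_disc \<Longrightarrow> bdist u \<le> kdist z u"
  using bdist_le_kdist[of u z] by (simp add: kdist_commute)

lemma kdist_pos: "z \<in> unit_disc \<Longrightarrow> u \<in> unit_disc \<Longrightarrow> 0 < kdist z u"
  using bdist_le_kdist bdist_pos by fastforce

text \<open>From the identity |1 - conj z * u|^2 - |z - u|^2 = (1 - |z|^2) * (1 - |u|^2).\<close>

lemma norm_diff_le_kdist:
  assumes "z \<in> unit_disc" "u \<in> unit_disc"
  shows "cmod (z - u) \<le> kdist z u"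
proof -
  have "(kdist z u)\<^sup>2 - (cmod (z - u))\<^sup>2 = (1 - (cmod z)\<^sup>2) * (1 - (cmod u)\<^sup>2)"
    unfolding kdist_def cmod_power2 by (simp add: power2_eq_square algebra_simps)
  moreover have "(1 - (cmod z)\<^sup>2) * (1 - (cmod u)\<^sup>2) \<ge> 0"
    using assms by (intro mult_nonneg_nonneg) (simp_all add: abs_square_le_1)
  ultimately have "(cmod (z - u))\<^sup>2 \<le> (kdist z u)\<^sup>2" by linarith
  then show ?thesis by (rule power2_le_imp_le) (simp add: kdist_def)
qed

text \<open>Split 1 - conj a * u = (1 - conj a * z) + conj a * (z - u) and use |z - u| <=
  \<open>kdist z u\<close>.\<close>

lemma kdist_triangle:
  assumes "a \<in> unit_disc" "z \<in> unit_disc" "u \<in> unit_disc"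
  shows "kdist a u \<le> kdist a z + kdist z u"
proof -
  have "kdist a u = cmod ((1 - cnj a * z) + cnj a * (z - u))"
    by (simp add: kdist_def algebra_simps)
  also have "\<dots> \<le> kdist a z + cmod a * cmod (z - u)"
    unfolding kdist_def by (rule order_trans[OF norm_triangle_ineq]) (simp add: norm_mult)
  also have "cmod a * cmod (z - u) \<le> 1 * cmod (z - u)"
    using assms by (intro mult_right_mono) auto
  also have "1 * cmod (z - u) \<le> kdist z u" using norm_diff_le_kdist[OF assms(2,3)] by simp
  finally show ?thesis by simp
qed

lemma kdist_le_dist:
  assumes "z \<in> unit_disc"
  shows "kdist z u \<le> 2 * bdist z + cmod (z - u)"
proof -
  have "kdist z u = cmod ((1 - cnj z * z) + cnj z * (z - u))"
    by (simp add: kdist_def algebra_simps)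
  also have "\<dots> \<le> cmod (1 - cnj z * z) + cmod z * cmod (z - u)"
    by (rule order_trans[OF norm_triangle_ineq]) (simp add: norm_mult)
  also have "1 - cnj z * z = of_real (1 - (cmod z)\<^sup>2)"
    by (simp add: complex_norm_square[symmetric] mult.commute)
  also have "cmod (of_real (1 - (cmod z)\<^sup>2)) = 1 - (cmod z)\<^sup>2"
    using assms by (simp only: norm_of_real) (simp add: abs_square_le_1)
  also have "1 - (cmod z)\<^sup>2 = bdist z * (1 + cmod z)"
    by (simp add: bdist_def power2_eq_square algebra_simps)
  also have "bdist z * (1 + cmod z) \<le> bdist z * 2"
    using assms bdist_pos[of z] by (intro mult_left_mono) auto
  also have "cmod z * cmod (z - u) \<le> 1 * cmod (z - u)"
    using assms by (intro mult_right_mono) auto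
  finally show ?thesis by simp
qed

lemma kratio_pos: "z \<in> unit_disc \<Longrightarrow> u \<in> unit_disc \<Longrightarrow> 0 < kratio z u"
  by (simp add: kratio_def bdist_pos kdist_pos)

lemma kratio_le_1: "z \<in> unit_disc \<Longrightarrow> u \<in> unit_disc \<Longrightarrow> kratio z u \<le> 1"
  using kdist_pos[of z u] bdist_le_kdist[of z u] by (simp add: kratio_def)

lemma kratio_le_bdist: "z \<in> unit_disc \<Longrightarrow> u \<in> unit_disc \<Longrightarrow> kratio z u \<le> bdist z / bdist u"
  using kdist_pos[of z u] bdist_le_kdist'[of z u] bdist_pos[of u] bdist_pos[of z]
  by (simp add: kratio_def frac_le)

text \<open>Multiply the triangle inequality by \<open>bdist z\<close>, which is at most either
  distance on the right. This moves a kernel centred at a from the point z to the point u, at the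
  cost of a kernel centred at z.\<close>

lemma kratio_mult_le:
  assumes "a \<in> unit_disc" "z \<in> unit_disc" "u \<in> unit_disc"
  shows "kratio a z * kratio z u \<le> 2 * kratio a u"
proof -
  note p = kdist_pos[OF assms(1,2)] kdist_pos[OF assms(2,3)] kdist_pos[OF assms(1,3)] bdist_pos[OF assms(1)] bdist_pos[OF assms(2)]
  have "bdist z * kdist a u \<le> bdist z * kdist a z + bdist z * kdist z u"
    using kdist_triangle[OF assms] p by (simp add: distrib_left[symmetric] del: distrib_left)
  also have "\<dots> \<le> kdist z u * kdist a z + kdist a z * kdist z u"
    using bdist_le_kdist[OF assms(2,3)] bdist_le_kdist'[OF assms(1,2)] p
    by (intro add_mono mult_right_mono) auto
  finally have "bdist z * kdist a u \<le> 2 * (kdist a z * kdist z u)" by simp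
  then have "bdist a * (bdist z * kdist a u) \<le> bdist a * (2 * (kdist a z * kdist z u))"
    using p by (intro mult_left_mono) auto
  then show ?thesis using p by (simp add: kratio_def divide_simps mult_ac)
qed

text \<open>Here u is the middle point of the triangle inequality, so \<open>bdist z\<close> must
  also be bounded by \<open>kdist b u\<close>; the assumption on b provides this.\<close>

lemma kratio_mult_le':
  assumes "b \<in> unit_disc" "z \<in> unit_disc" "u \<in> unit_disc" "bdist z \<le> bdist b"
  shows "kratio b u * kratio z u \<le> 2 * kratio b z"
proof -
  note p = kdist_pos[OF assms(1,2)] kdist_pos[OF assms(2,3)] kdist_pos[OF assms(1,3)] bdist_pos[OF assms(1)] bdist_pos[OF assms(2)]
  have "kdist b z \<le> kdist b u + kdist z u"
    using kdist_triangle[OF assms(1,3,2)] by (simp add: kdist_commute)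
  then have "bdist z * kdist b z \<le> bdist z * kdist b u + bdist z * kdist z u"
    using p by (simp add: distrib_left[symmetric] del: distrib_left)
  also have "\<dots> \<le> kdist z u * kdist b u + kdist b u * kdist z u"
    using bdist_le_kdist[OF assms(2,3)] bdist_le_kdist[OF assms(1,3)] assms(4) p
    by (intro add_mono mult_right_mono) auto
  finally have "bdist z * kdist b z \<le> 2 * (kdist b u * kdist z u)" by simp
  then have "bdist b * (bdist z * kdist b z) \<le> bdist b * (2 * (kdist b u * kdist z u))"
    using p by (intro mult_left_mono) auto
  then show ?thesis using p by (simp add: kratio_def divide_simps mult_ac)
qed

lemma borel_measurable_kdist [measurable]: "kdist z \<in> borel_measurable borel"
  and borel_measurable_bdist [measurable]: "bdist \<in> borel_measurable borel"
  unfolding kdist_def[abs_def] bdist_def[abs_def]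
  by (intro borel_measurable_continuous_onI continuous_intros)+

lemma borel_measurable_kratio [measurable]: "kratio z \<in> borel_measurable borel"
  unfolding kratio_def[abs_def] by measurable

text \<open>Jordan's inequality sin y >= 2 y / pi on [0, pi/2], from concavity, applied to the chord
  |cis t - 1| = 2 |sin (t / 2)|.\<close>

lemma abs_le_norm_cis:
  assumes "\<bar>t\<bar> \<le> pi"
  shows "\<bar>t\<bar> \<le> pi / 2 * cmod (cis t - 1)"
proof -
  define y where "y = \<bar>t\<bar> / 2"
  have y: "0 \<le> y" "y \<le> pi / 2" using assms by (auto simp: y_def)
  have cvx: "convex_on {0..pi/2} (\<lambda>x. - sin x)"
    by (rule f''_ge0_imp_convex[where f' = "\<lambda>x. - cos x" and f'' = sin])
       (auto intro!: derivative_eq_intros sin_ge_zero)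
  have "2 / pi * y \<le> sin y"
  proof -
    define l where "l = 2 * y / pi"
    have l: "0 \<le> l" "l \<le> 1" using y pi_gt_zero by (auto simp: l_def field_simps)
    have "- sin ((1 - l) *\<^sub>R 0 + l *\<^sub>R (pi/2)) \<le> (1 - l) * (- sin 0) + l * (- sin (pi/2))"
      using convex_onD[OF cvx l(1,2), of 0 "pi/2"] by simp
    moreover have "l * (pi / 2) = y" by (simp add: l_def)
    ultimately show ?thesis by (simp add: l_def)
  qed
  moreover have "cmod (cis t - 1) = 2 * \<bar>sin (t / 2)\<bar>"
    using dist_exp_i_1[of t] by (simp add: cis_conv_exp)
  moreover have "sin y \<le> \<bar>sin (t / 2)\<bar>"
    by (cases "t \<ge> 0") (auto simp: y_def)
  ultimately have "pi * (2 / pi * y) \<le> pi * (cmod (cis t - 1) / 2)"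
    by (intro mult_left_mono) auto
  then show ?thesis by (simp add: y_def)
qed

text \<open>With h = 1 - |b|, the radial part is 1 - |b| * \<rho> <= 2 h and the angle adds at most
  h / 2; hence 5 / 2.\<close>

lemma carleson_square_subset:
  assumes b: "b \<in> unit_disc" and u: "u \<in> carleson_square b"
  shows "u \<in> unit_disc" "kdist b u \<le> 5 / 2 * bdist b"
proof -
  have "u \<in> unit_disc \<and> kdist b u \<le> 5 / 2 * bdist b"
  proof (cases "b = 0")
    case True
    then show ?thesis using u by (simp add: carleson_square_def kdist_def bdist_def)
  next
    case False
    then obtain \<rho> t where ut: "u = of_real \<rho> * cis t" "cmod b \<le> \<rho>" "\<rho> < 1" "\<bar>t - Arg b\<bar> \<le> (1 - cmod b) / 2"
      using u by (auto simp: carleson_square_def)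
    have \<rho>: "0 \<le> \<rho>" using ut norm_ge_zero[of b] by linarith
    have nu: "cmod u = \<rho>" using \<rho> by (simp add: ut norm_mult)
    have bb: "b = of_real (cmod b) * cis (Arg b)" using rcis_cmod_Arg[of b] by (simp add: rcis_def)
    define v where "v = of_real \<rho> * cis (Arg b)"
    have "cmod (b - v) = \<rho> - cmod b"
    proof -
      have "b - v = of_real (cmod b - \<rho>) * cis (Arg b)"
        using bb by (simp add: v_def algebra_simps)
      then have "cmod (b - v) = \<bar>cmod b - \<rho>\<bar>" by (simp only: norm_mult norm_of_real norm_cis mult_1_right)
      then show ?thesis using ut by simp
    qed
    moreover have "cmod (v - u) \<le> (1 - cmod b) / 2"
    proof -
      have "v - u = of_real \<rho> * (cis (Arg b) - cis t)" by (simp add: v_def ut algebra_simps)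
      then have "cmod (v - u) = \<rho> * cmod (cis (Arg b) - cis t)" using \<rho> by (simp add: norm_mult)
      also have "\<dots> \<le> 1 * \<bar>Arg b - t\<bar>" using cis_lipschitz \<rho> ut by (intro mult_mono) auto
      finally show ?thesis using ut(4) by (simp add: abs_minus_commute)
    qed
    moreover have "kdist b u \<le> (1 - cmod b * \<rho>) + cmod (v - u)"
    proof -
      have "cnj b * v = of_real (cmod b * \<rho>)"
        by (subst bb) (simp add: v_def cis_cnj cis_mult)
      then have "1 - cnj b * u = of_real (1 - cmod b * \<rho>) + cnj b * (v - u)" by (simp add: algebra_simps)
      then have "kdist b u \<le> cmod (of_real (1 - cmod b * \<rho>)) + cmod (cnj b * (v - u))"
        unfolding kdist_def by (metis norm_triangle_ineq)
      also have "cmod (of_real (1 - cmod b * \<rho>)) = 1 - cmod b * \<rho>"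
      proof -
        have "cmod b * \<rho> \<le> 1 * 1" using b ut \<rho> by (intro mult_mono) auto
        then show ?thesis by (simp only: norm_of_real; simp)
      qed
      also have "cmod (cnj b * (v - u)) \<le> 1 * cmod (v - u)"
        unfolding norm_mult using b by (intro mult_right_mono) auto
      finally show ?thesis by simp
    qed
    moreover have "1 - cmod b * \<rho> \<le> 2 * (1 - cmod b)"
    proof -
      have "cmod b * cmod b \<le> cmod b * \<rho>" using ut by (intro mult_left_mono) auto
      moreover have "1 - cmod b * cmod b = (1 - cmod b) * (1 + cmod b)" by (simp add: algebra_simps)
      moreover have "(1 - cmod b) * (1 + cmod b) \<le> (1 - cmod b) * 2" using b by (intro mult_left_mono) auto
      ultimately show ?thesis by linarith
    qed
    ultimately show ?thesis using nu ut(3) by (simp add: bdist_def)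
  qed
  then show "u \<in> unit_disc" "kdist b u \<le> 5 / 2 * bdist b" by auto
qed

text \<open>Both 1 - |u| and the angle between u and b are controlled by \<open>kdist b u\<close>:
  the angle is at most 7 x, and 14 is twice 7 because the half-width of a Carleson square is (1 -
  |b'|) / 2. For 14 x >= 1 the square of 0 is the whole disc.\<close>

lemma kdist_ball_subset_carleson_square:
  assumes b: "b \<in> unit_disc" and x: "x > 0"
  obtains b' where "b' \<in> unit_disc" "bdist b' = min 1 (14 * x)"
    "\<And>u. u \<in> unit_disc \<Longrightarrow> kdist b u \<le> x \<Longrightarrow> u \<in> carleson_square b'"
proof (cases "14 * x \<ge> 1")
  case True
  then show ?thesis by (intro that[of 0]) (auto simp: bdist_def carleson_square_def)
next
  case False
  show ?thesis
  proof (cases "b = 0")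
    case True
    \<comment> \<open>Here \<open>kdist 0 u\<close> is 1 > x, so no u satisfies the condition and
      any point at the right height serves.\<close>
    have "cmod (of_real (1 - 14 * x)) = 1 - 14 * x" using False by (simp del: of_real_diff)
    then show ?thesis
      by (intro that[of "of_real (1 - 14 * x)"])
         (use False x True in \<open>auto simp: bdist_def kdist_def norm_mult simp del: of_real_diff\<close>)
  next
    case b0: False
    define b' where "b' = of_real (1 - 14 * x) * cis (Arg b)"
    have nb': "cmod b' = 1 - 14 * x" using False by (simp add: b'_def norm_mult del: of_real_diff)
    have Arg': "Arg b' = Arg b"
      unfolding b'_def using False x by (simp add: Arg_times_of_real2 Arg_cis Arg_bounded del: of_real_diff)
    have "b' \<noteq> 0" using nb' False by auto
    have bb: "b = of_real (cmod b) * cis (Arg b)" using rcis_cmod_Arg[of b] by (simp add: rcis_def)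
    show ?thesis
    proof (rule that[of b'])
      show "b' \<in> unit_disc" using nb' x by simp
      show "bdist b' = min 1 (14 * x)" using nb' False by (simp add: bdist_def)
      fix u assume u: "u \<in> unit_disc" and le: "kdist b u \<le> x"
      have hu: "1 - cmod u \<le> x" "1 - cmod b \<le> x"
        using bdist_le_kdist'[OF b u] bdist_le_kdist[OF b u] le by (auto simp: bdist_def)
      define \<phi> where "\<phi> = Arg (u * cnj b)"
      have ub: "u * cnj b = of_real (cmod u * cmod b) * cis \<phi>"
        using rcis_cmod_Arg[of "u * cnj b"] by (simp add: rcis_def \<phi>_def norm_mult)
      have pb: "cmod u * cmod b \<ge> 1 / 2"
      proof -
        have "(1 - x) * (1 - x) \<le> cmod u * cmod b" using hu False x by (intro mult_mono) auto
        moreover have "(1 - x) * (1 - x) \<ge> 1 - 2 * x" by (simp add: algebra_simps)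
        ultimately show ?thesis using False by simp
      qed
      have u': "u = of_real (cmod u) * cis (Arg b + \<phi>)"
      proof -
        have "u * cnj b * b = of_real (cmod u) * cis (Arg b + \<phi>) * (cnj b * b)"
        proof -
          have "u * cnj b * b = of_real (cmod u * cmod b) * cis \<phi> * (of_real (cmod b) * cis (Arg b))"
            using ub bb by simp
          also have "\<dots> = of_real (cmod u) * cis (Arg b + \<phi>) * of_real ((cmod b)\<^sup>2)"
            by (simp add: cis_mult[symmetric] power2_eq_square mult_ac)
          also have "of_real ((cmod b)\<^sup>2) = cnj b * b"
            by (simp only: complex_norm_square mult.commute)
          finally show ?thesis .
        qed
        then show ?thesis using b0 by simp
      qed
      have "\<bar>\<phi>\<bar> \<le> pi / 2 * cmod (cis \<phi> - 1)"
        using Arg_bounded[of "u * cnj b"] by (intro abs_le_norm_cis) (auto simp: \<phi>_def)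
      moreover have "cmod (cis \<phi> - 1) \<le> 4 * x"
      proof -
        have "1 / 2 * cmod (cis \<phi> - 1) \<le> (cmod u * cmod b) * cmod (cis \<phi> - 1)"
          using pb by (intro mult_right_mono) auto
        also have "\<dots> = cmod (u * cnj b - of_real (cmod u * cmod b))"
        proof -
          have "u * cnj b - of_real (cmod u * cmod b) = of_real (cmod u * cmod b) * (cis \<phi> - 1)"
            unfolding ub by (simp add: algebra_simps)
          then show ?thesis by (simp only: norm_mult norm_of_real; simp)
        qed
        also have "\<dots> \<le> cmod (u * cnj b - 1) + cmod (1 - of_real (cmod u * cmod b))"
          using norm_triangle_ineq[of "u * cnj b - 1" "1 - of_real (cmod u * cmod b)"] by simp
        also have "cmod (u * cnj b - 1) = kdist b u"
          unfolding kdist_def by (simp add: norm_minus_commute mult.commute)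
        also have "cmod (1 - of_real (cmod u * cmod b)) = 1 - cmod u * cmod b"
        proof -
          have "cmod u * cmod b \<le> 1 * 1" using u b by (intro mult_mono) auto
          moreover have "(1::complex) - of_real (cmod u * cmod b) = of_real (1 - cmod u * cmod b)" by simp
          ultimately show ?thesis by (simp only: norm_of_real; simp)
        qed
        also have "1 - cmod u * cmod b \<le> kdist b u"
          using norm_triangle_ineq2[of 1 "cnj b * u"] by (simp add: kdist_def norm_mult mult.commute)
        finally show ?thesis using le by linarith
      qed
      \<comment> \<open>7 / 4 is a rational upper bound for pi / 2.\<close>
      moreover have "pi / 2 * cmod (cis \<phi> - 1) \<le> 7 / 4 * (4 * x)"
        using calculation(2) pi_less_4 by (intro mult_mono) (use pi_approx in auto)
      ultimately have "\<bar>\<phi>\<bar> \<le> 7 * x" by linarith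
      then have "u = of_real (cmod u) * cis (Arg b + \<phi>) \<and> cmod b' \<le> cmod u \<and> cmod u < 1 \<and>
          \<bar>Arg b + \<phi> - Arg b'\<bar> \<le> (1 - cmod b') / 2"
        using u' hu u x by (simp add: nb' Arg')
      then show "u \<in> carleson_square b'"
        unfolding carleson_square_def using \<open>b' \<noteq> 0\<close> by auto
    qed
  qed
qed

section \<open>Dyadic layers and Carleson measures\<close>

lemma suminf_ennreal_geometric:
  assumes "0 \<le> A" "0 \<le> r" "r < 1"
  shows "(\<Sum>j. ennreal (A * r ^ j)) = ennreal (A / (1 - r))"
proof -
  have "(\<lambda>j. A * r ^ j) sums (A * (1 / (1 - r)))"
    using assms by (intro sums_mult geometric_sums) auto
  then show ?thesis
    using assms by (intro suminf_ennreal_eq) (auto simp: mult_nonneg_nonneg)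
qed

lemma ennreal_le_suminf: "f j \<le> (\<Sum>i. f i)" for f :: "nat \<Rightarrow> ennreal"
  using sum_le_suminf[of f "{j}"] by simp

lemma geometric_layer:
  fixes x x0 b :: real
  assumes "0 < x0" "x0 \<le> x" "b > 1"
  obtains j :: nat where "b ^ j * x0 \<le> x" "x \<le> b ^ Suc j * x0"
proof -
  obtain n :: nat where n: "x / x0 < b ^ n" using real_arch_pow[OF assms(3), of "x / x0"] by auto
  define P where "P k \<longleftrightarrow> x < b ^ k * x0" for k :: nat
  have "P n" using n assms by (simp add: P_def divide_less_eq)
  then have L: "P (LEAST k. P k)" by (rule LeastI)
  have "\<not> P 0" using assms by (simp add: P_def)
  then have "(LEAST k. P k) \<noteq> 0" using L by metis
  then obtain j where j: "(LEAST k. P k) = Suc j" by (cases "LEAST k. P k") auto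
  then have "\<not> P j" using not_less_Least[of j P] by simp
  then show ?thesis using L j by (intro that[of j]) (auto simp: P_def)
qed

lemma geometric_lower_layer:
  fixes x x0 b :: real
  assumes "0 < x" "x \<le> x0" "b > 1"
  obtains j :: nat where "x0 / b ^ Suc j \<le> x" "x \<le> x0 / b ^ j"
proof -
  obtain j :: nat where "b ^ j * x \<le> x0" "x0 \<le> b ^ Suc j * x"
    using geometric_layer[OF assms] by auto
  then show ?thesis using assms by (intro that[of j]) (auto simp: field_simps)
qed

text \<open>On the layer where X is about 2^j * x0 the factor is at most 2^(-\<gamma> j). Whole
  sublevel sets stand in for the layers because the mass bounds at hand are for balls.\<close>

lemma nn_integral_upper_layers:
  fixes X :: "'a \<Rightarrow> real"
  assumes [measurable]: "\<phi> \<in> borel_measurable M" "X \<in> borel_measurable M"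
    and X: "\<And>u. u \<in> space M \<Longrightarrow> x0 \<le> X u" and x0: "x0 > 0" and \<gamma>: "\<gamma> > 0"
  shows "(\<integral>\<^sup>+u. \<phi> u * ennreal ((x0 / X u) powr \<gamma>) \<partial>M) \<le>
    (\<Sum>j. ennreal (2 powr (- \<gamma> * real j)) * (\<integral>\<^sup>+u. \<phi> u * indicator {..2 ^ Suc j * x0} (X u) \<partial>M))"
proof -
  have "(\<integral>\<^sup>+u. \<phi> u * ennreal ((x0 / X u) powr \<gamma>) \<partial>M) \<le>
    (\<integral>\<^sup>+u. (\<Sum>j. ennreal (2 powr (- \<gamma> * real j)) * (\<phi> u * indicator {..2 ^ Suc j * x0} (X u))) \<partial>M)"
  proof (rule nn_integral_mono)
    fix u assume u: "u \<in> space M"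
    obtain j :: nat where j: "2 ^ j * x0 \<le> X u" "X u \<le> 2 ^ Suc j * x0"
      using geometric_layer[OF x0 X[OF u], of 2] by auto
    have Xp: "X u > 0" using X[OF u] x0 by linarith
    have "x0 / X u \<le> 2 powr (- real j)"
      using j Xp x0 by (simp add: powr_minus powr_realpow field_simps)
    then have "(x0 / X u) powr \<gamma> \<le> (2 powr (- real j)) powr \<gamma>"
      using \<gamma> Xp x0 by (intro powr_mono2) auto
    then have "(x0 / X u) powr \<gamma> \<le> 2 powr (- \<gamma> * real j)" by (simp add: powr_powr mult.commute)
    then have "\<phi> u * ennreal ((x0 / X u) powr \<gamma>) \<le> \<phi> u * ennreal (2 powr (- \<gamma> * real j))"
      by (intro mult_left_mono ennreal_leI) auto
    also have "\<dots> = ennreal (2 powr (- \<gamma> * real j)) * (\<phi> u * indicator {..2 ^ Suc j * x0} (X u))"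
      using j by (simp add: mult.commute)
    also have "\<dots> \<le> (\<Sum>j. ennreal (2 powr (- \<gamma> * real j)) * (\<phi> u * indicator {..2 ^ Suc j * x0} (X u)))"
      by (rule ennreal_le_suminf[of _ j])
    finally show "\<phi> u * ennreal ((x0 / X u) powr \<gamma>) \<le>
       (\<Sum>j. ennreal (2 powr (- \<gamma> * real j)) * (\<phi> u * indicator {..2 ^ Suc j * x0} (X u)))" .
  qed
  also have "\<dots> = (\<Sum>j. ennreal (2 powr (- \<gamma> * real j)) * (\<integral>\<^sup>+u. \<phi> u * indicator {..2 ^ Suc j * x0} (X u) \<partial>M))"
    by (subst nn_integral_suminf) (simp_all add: nn_integral_cmult)
  finally show ?thesis .
qed

text \<open>The same decomposition towards 0: the factor grows like 2^(\<gamma> j), to be paid for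
  by the decay of the mass of {X <= x0 / 2^j}.\<close>

lemma nn_integral_lower_layers:
  fixes X :: "'a \<Rightarrow> real"
  assumes [measurable]: "\<phi> \<in> borel_measurable M" "X \<in> borel_measurable M"
    and X: "\<And>u. u \<in> space M \<Longrightarrow> 0 < X u" and x0: "x0 > 0" and \<gamma>: "\<gamma> \<ge> 0"
  shows "(\<integral>\<^sup>+u. \<phi> u * ennreal ((x0 / X u) powr \<gamma>) * indicator {..x0} (X u) \<partial>M) \<le>
    (\<Sum>j. ennreal (2 powr (\<gamma> * real (Suc j))) * (\<integral>\<^sup>+u. \<phi> u * indicator {..x0 / 2 ^ j} (X u) \<partial>M))"
proof -
  have "(\<integral>\<^sup>+u. \<phi> u * ennreal ((x0 / X u) powr \<gamma>) * indicator {..x0} (X u) \<partial>M) \<le>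
    (\<integral>\<^sup>+u. (\<Sum>j. ennreal (2 powr (\<gamma> * real (Suc j))) * (\<phi> u * indicator {..x0 / 2 ^ j} (X u))) \<partial>M)"
  proof (rule nn_integral_mono)
    fix u assume u: "u \<in> space M"
    show "\<phi> u * ennreal ((x0 / X u) powr \<gamma>) * indicator {..x0} (X u) \<le>
       (\<Sum>j. ennreal (2 powr (\<gamma> * real (Suc j))) * (\<phi> u * indicator {..x0 / 2 ^ j} (X u)))"
    proof (cases "X u \<le> x0")
      case True
      have Xp: "X u > 0" by (rule X[OF u])
      obtain j :: nat where j: "x0 / 2 ^ Suc j \<le> X u" "X u \<le> x0 / 2 ^ j"
        using geometric_lower_layer[OF Xp True, of 2] by auto
      have "x0 / X u \<le> 2 powr (real (Suc j))"
        using j Xp x0 by (simp add: powr_realpow field_simps del: of_nat_Suc power_Suc)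
      then have "(x0 / X u) powr \<gamma> \<le> (2 powr (real (Suc j))) powr \<gamma>"
        using \<gamma> Xp x0 by (intro powr_mono2) auto
      then have "(x0 / X u) powr \<gamma> \<le> 2 powr (\<gamma> * real (Suc j))" by (simp add: powr_powr mult.commute)
      then have "\<phi> u * ennreal ((x0 / X u) powr \<gamma>) \<le> \<phi> u * ennreal (2 powr (\<gamma> * real (Suc j)))"
        by (intro mult_left_mono ennreal_leI) auto
      also have "\<dots> = ennreal (2 powr (\<gamma> * real (Suc j))) * (\<phi> u * indicator {..x0 / 2 ^ j} (X u))"
        using j by (simp add: mult.commute)
      also have "\<dots> \<le> (\<Sum>j. ennreal (2 powr (\<gamma> * real (Suc j))) * (\<phi> u * indicator {..x0 / 2 ^ j} (X u)))"
        by (rule ennreal_le_suminf[of _ j])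
      finally show ?thesis using True by simp
    qed simp
  qed
  also have "\<dots> = (\<Sum>j. ennreal (2 powr (\<gamma> * real (Suc j))) * (\<integral>\<^sup>+u. \<phi> u * indicator {..x0 / 2 ^ j} (X u) \<partial>M))"
    by (subst nn_integral_suminf) (simp_all add: nn_integral_cmult)
  finally show ?thesis .
qed

lemma suminf_ennreal_le_geometric:
  assumes "\<And>j. f j \<le> ennreal (A * r ^ j)" "0 \<le> A" "0 \<le> r" "r < 1"
  shows "(\<Sum>j. f j) \<le> ennreal (A / (1 - r))"
  using suminf_le[of f "\<lambda>j. ennreal (A * r ^ j)", OF assms(1)] suminf_ennreal_geometric[OF assms(2-4)] by simp

lemma two_powr_lt_1: "\<gamma> > 0 \<Longrightarrow> 2 powr (- \<gamma>) < (1::real)"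
  using powr_less_mono[of "-\<gamma>" 0 2] by simp

lemma powr_mult_nat: "(2::real) powr (a * real j) = (2 powr a) ^ j"
  by (simp add: powr_realpow[symmetric] powr_powr)

lemma powr_minus_mult_nat: "(2::real) powr (- \<gamma> * real j) = (2 powr (- \<gamma>)) ^ j"
  by (simp add: powr_realpow[symmetric] powr_powr)

text \<open>Shared by the bounded and the vanishing case: the \<open>kdist\<close> ball of radius
  2^(j+1) * bdist b lies in one Carleson square, and the bound c j for the mass of that square is
  left open.\<close>

lemma nn_integral_kratio_layers:
  assumes M: "space M \<subseteq> unit_disc" "kdist b \<in> borel_measurable M" "\<phi> \<in> borel_measurable M"
    and b: "b \<in> unit_disc" and \<gamma>: "\<gamma> > 0"
    and X: "\<And>j b'. b' \<in> unit_disc \<Longrightarrow> bdist b' = min 1 (14 * 2 ^ Suc j * bdist b) \<Longrightarrow>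
      (\<integral>\<^sup>+u. \<phi> u * indicator (carleson_square b') u \<partial>M) \<le> ennreal (c j)"
  shows "(\<integral>\<^sup>+u. \<phi> u * ennreal (kratio b u powr \<gamma>) \<partial>M) \<le> (\<Sum>j. ennreal (2 powr (- \<gamma> * real j)) * ennreal (c j))"
proof -
  have "(\<integral>\<^sup>+u. \<phi> u * ennreal ((bdist b / kdist b u) powr \<gamma>) \<partial>M) \<le>
    (\<Sum>j. ennreal (2 powr (- \<gamma> * real j)) * (\<integral>\<^sup>+u. \<phi> u * indicator {..2 ^ Suc j * bdist b} (kdist b u) \<partial>M))"
    using M b \<gamma> by (intro nn_integral_upper_layers) (auto intro!: bdist_le_kdist simp: bdist_pos subset_eq)
  also have "\<dots> \<le> (\<Sum>j. ennreal (2 powr (- \<gamma> * real j)) * ennreal (c j))"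
  proof (intro suminf_le mult_left_mono)
    fix j :: nat
    have "0 < 2 ^ Suc j * bdist b" using bdist_pos[OF b] by simp
    then obtain b' where b': "b' \<in> unit_disc" "bdist b' = min 1 (14 * (2 ^ Suc j * bdist b))"
      "\<And>u. u \<in> unit_disc \<Longrightarrow> kdist b u \<le> 2 ^ Suc j * bdist b \<Longrightarrow> u \<in> carleson_square b'"
      using kdist_ball_subset_carleson_square[OF b] by metis
    have "(\<integral>\<^sup>+u. \<phi> u * indicator {..2 ^ Suc j * bdist b} (kdist b u) \<partial>M) \<le>
        (\<integral>\<^sup>+u. \<phi> u * indicator (carleson_square b') u \<partial>M)"
      using b'(3) M(1) by (intro nn_integral_mono mult_left_mono) (auto split: split_indicator)
    also have "\<dots> \<le> ennreal (c j)" using b' by (intro X) (auto simp: mult_ac)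
    finally show "(\<integral>\<^sup>+u. \<phi> u * indicator {..2 ^ Suc j * bdist b} (kdist b u) \<partial>M) \<le> ennreal (c j)" .
  qed auto
  finally show ?thesis by (simp add: kratio_def)
qed

text \<open>28 = 14 * 2, where 14 enlarges a ball to a square and 2 is the outer radius of a layer;
  the rest sums a geometric series of ratio 2^(1 - \<gamma>).\<close>

definition carleson_const :: "real \<Rightarrow> real"
  where "carleson_const \<gamma> = 28 / (1 - 2 powr (1 - \<gamma>))"

lemma carleson_const_pos: "\<gamma> > 1 \<Longrightarrow> carleson_const \<gamma> > 0"
  using two_powr_lt_1[of "\<gamma> - 1"] by (simp add: carleson_const_def)

text \<open>The square of the j-th layer has mass of order 2^j while the kernel is of order
  2^(-\<gamma> j), so \<gamma> > 1 makes the layers summable.\<close>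

lemma carleson_kratio_integral:
  assumes M: "space M \<subseteq> unit_disc" "kdist b \<in> borel_measurable M" "\<phi> \<in> borel_measurable M"
    and b: "b \<in> unit_disc" and \<gamma>: "\<gamma> > 1" and X0: "X \<ge> 0"
    and X: "\<And>b'. b' \<in> unit_disc \<Longrightarrow> (\<integral>\<^sup>+u. \<phi> u * indicator (carleson_square b') u \<partial>M) \<le> ennreal (X * bdist b')"
  shows "(\<integral>\<^sup>+u. \<phi> u * ennreal (kratio b u powr \<gamma>) \<partial>M) \<le> ennreal (carleson_const \<gamma> * X * bdist b)"
proof -
  have h: "bdist b > 0" using b by (rule bdist_pos)
  have "(\<integral>\<^sup>+u. \<phi> u * ennreal (kratio b u powr \<gamma>) \<partial>M) \<le>
     (\<Sum>j. ennreal (2 powr (- \<gamma> * real j)) * ennreal (X * (14 * 2 ^ Suc j * bdist b)))"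
  proof (rule nn_integral_kratio_layers[OF M b])
    fix j :: nat and b' assume b': "b' \<in> unit_disc" "bdist b' = min 1 (14 * 2 ^ Suc j * bdist b)"
    show "(\<integral>\<^sup>+u. \<phi> u * indicator (carleson_square b') u \<partial>M) \<le> ennreal (X * (14 * 2 ^ Suc j * bdist b))"
      using X0 b'(2) by (intro order_trans[OF X[OF b'(1)]] ennreal_leI mult_left_mono) auto
  qed (use \<gamma> in simp)
  also have "\<dots> \<le> ennreal ((28 * X * bdist b) / (1 - 2 powr (1 - \<gamma>)))"
  proof (rule suminf_ennreal_le_geometric)
    fix j :: nat
    have "2 powr (- \<gamma> * real j) * (X * (14 * 2 ^ Suc j * bdist b)) = 28 * X * bdist b * (2 powr (1 - \<gamma>)) ^ j"
      by (simp add: powr_mult_nat powr_minus_mult_nat powr_diff power_divide powr_minus field_simps)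
    moreover have "ennreal (2 powr (- \<gamma> * real j)) * ennreal (X * (14 * 2 ^ Suc j * bdist b)) =
        ennreal (2 powr (- \<gamma> * real j) * (X * (14 * 2 ^ Suc j * bdist b)))"
      using X0 h by (intro ennreal_mult[symmetric]) auto
    ultimately show "ennreal (2 powr (- \<gamma> * real j)) * ennreal (X * (14 * 2 ^ Suc j * bdist b)) \<le>
        ennreal (28 * X * bdist b * (2 powr (1 - \<gamma>)) ^ j)"
      by (simp only: order_refl)
  qed (use X0 h two_powr_lt_1[of "\<gamma> - 1"] \<gamma> in auto)
  finally show ?thesis by (simp add: carleson_const_def)
qed

text \<open>Close to the boundary the squares of the first layers are small and obey the small
  constant. A square of height at least \<open>d1\<close> belongs to a layer with 28 * 2^j * bdist b
  >= \<open>d2\<close>; there the full constant X may be multiplied by T * 2^(\<tau> j) >= 1, where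
  T tends to 0 as b approaches the circle.\<close>

lemma carleson_kratio_integral_vanishing:
  assumes M: "space M \<subseteq> unit_disc" "\<And>b. kdist b \<in> borel_measurable M" "\<phi> \<in> borel_measurable M"
    and \<gamma>: "\<gamma> > 1" and X0: "X \<ge> 0"
    and X: "\<And>b'. b' \<in> unit_disc \<Longrightarrow> (\<integral>\<^sup>+u. \<phi> u * indicator (carleson_square b') u \<partial>M) \<le> ennreal (X * bdist b')"
    and van: "\<And>e. e > 0 \<Longrightarrow> \<exists>d>0. \<forall>b'\<in>unit_disc. bdist b' < d \<longrightarrow>
       (\<integral>\<^sup>+u. \<phi> u * indicator (carleson_square b') u \<partial>M) \<le> ennreal (e * bdist b')"
    and e: "e > 0"
  shows "\<exists>d>0. \<forall>b\<in>unit_disc. bdist b < d \<longrightarrow>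
       (\<integral>\<^sup>+u. \<phi> u * ennreal (kratio b u powr \<gamma>) \<partial>M) \<le> ennreal (e * bdist b)"
proof -
  \<comment> \<open>Half of the excess of \<gamma> over 1 pays for 2^(\<tau> j); the other half
    keeps the series convergent.\<close>
  define \<tau> where "\<tau> = (\<gamma> - 1) / 2"
  define r1 r2 :: real where "r1 = 2 powr (1 - \<gamma>)" and "r2 = 2 powr (- \<tau>)"
  have \<tau>: "\<tau> > 0" using \<gamma> by (simp add: \<tau>_def)
  have r1: "0 \<le> r1" "r1 < 1" and r2: "0 \<le> r2" "r2 < 1"
    using two_powr_lt_1[of "\<gamma> - 1"] two_powr_lt_1[OF \<tau>] \<gamma> by (auto simp: r1_def r2_def)
  \<comment> \<open>56 = 2 * 28: each of the two series may use half of e.\<close>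
  define e1 where "e1 = e * (1 - r1) / 56"
  have e1: "e1 > 0" using e r1 by (simp add: e1_def)
  obtain d1 where d1: "d1 > 0" and d1': "\<And>b'. b' \<in> unit_disc \<Longrightarrow> bdist b' < d1 \<Longrightarrow>
       (\<integral>\<^sup>+u. \<phi> u * indicator (carleson_square b') u \<partial>M) \<le> ennreal (e1 * bdist b')"
    using van[OF e1] by blast
  define d2 where "d2 = min d1 1"
  have d2: "d2 > 0" "d2 \<le> 1" "d2 \<le> d1" using d1 by (auto simp: d2_def)
  define e2 where "e2 = e * (1 - r2) / (56 * (X + 1))"
  have e2: "e2 > 0" using e r2 X0 by (simp add: e2_def)
  define d where "d = d2 / 28 * e2 powr (1 / \<tau>)"
  have d: "d > 0" using d2 e2 by (simp add: d_def)
  have "(\<integral>\<^sup>+u. \<phi> u * ennreal (kratio b u powr \<gamma>) \<partial>M) \<le> ennreal (e * bdist b)"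
    if b: "b \<in> unit_disc" and bd: "bdist b < d" for b
  proof -
    have h: "bdist b > 0" using b by (rule bdist_pos)
    define T where "T = (28 * bdist b / d2) powr \<tau>"
    have "T \<le> (e2 powr (1 / \<tau>)) powr \<tau>"
      unfolding T_def using bd h d2 \<tau> by (intro powr_mono2) (auto simp: d_def field_simps)
    then have T: "T \<le> e2" using \<tau> e2 by (simp add: powr_powr)
    have T0: "T \<ge> 0" by (simp add: T_def)
    let ?c = "\<lambda>j::nat. (e1 + X * T * (2 powr \<tau>) ^ j) * (28 * 2 ^ j * bdist b)"
    have "(\<integral>\<^sup>+u. \<phi> u * ennreal (kratio b u powr \<gamma>) \<partial>M) \<le>
       (\<Sum>j. ennreal (2 powr (- \<gamma> * real j)) * ennreal (?c j))"
    proof (rule nn_integral_kratio_layers[OF M(1) M(2) M(3) b])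
      fix j :: nat and b' assume b': "b' \<in> unit_disc" "bdist b' = min 1 (14 * 2 ^ Suc j * bdist b)"
      have le: "bdist b' \<le> 28 * 2 ^ j * bdist b" using b'(2) by simp
      show "(\<integral>\<^sup>+u. \<phi> u * indicator (carleson_square b') u \<partial>M) \<le> ennreal (?c j)"
      proof (cases "bdist b' < d1")
        case True
        have "e1 * bdist b' \<le> ?c j"
          using le e1 X0 T0 bdist_pos[OF b'(1)] by (intro mult_mono) auto
        then show ?thesis using d1'[OF b'(1) True] by (meson ennreal_leI order_trans)
      next
        case False
        then have "1 \<le> 28 * 2 ^ j * bdist b / d2" using le d2 by (simp add: divide_simps)
        then have "1 \<le> (28 * 2 ^ j * bdist b / d2) powr \<tau>" using \<tau> by (simp add: ge_one_powr_ge_zero)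
        also have "28 * 2 ^ j * bdist b / d2 = (28 * bdist b / d2) * 2 ^ j" by simp
        also have "\<dots> powr \<tau> = T * (2 powr \<tau>) ^ j"
          unfolding T_def using h d2
          by (subst powr_mult) (auto simp: powr_realpow[symmetric] powr_powr mult.commute)
        finally have "X * 1 \<le> X * (T * (2 powr \<tau>) ^ j)" using X0 by (intro mult_left_mono)
        then have "X * bdist b' \<le> ?c j"
          using le e1 X0 T0 bdist_pos[OF b'(1)] by (intro mult_mono) (auto simp: mult_ac)
        then show ?thesis using X[OF b'(1)] by (meson ennreal_leI order_trans)
      qed
    qed (use \<gamma> in simp)
    also have "\<dots> = (\<Sum>j. ennreal (28 * bdist b * e1 * r1 ^ j) + ennreal (28 * bdist b * X * T * r2 ^ j))"
    proof (rule suminf_cong)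
      fix j :: nat
      have rr: "2 powr (- \<gamma> * real j) * 2 ^ j = r1 ^ j"
        by (simp add: r1_def powr_mult_nat powr_minus_mult_nat powr_diff power_divide powr_minus field_simps)
      have e\<tau>: "1 - \<gamma> + \<tau> = - \<tau>" by (simp add: \<tau>_def field_simps)
      have rr2: "r1 ^ j * (2 powr \<tau>) ^ j = r2 ^ j"
        unfolding r1_def r2_def power_mult_distrib[symmetric] powr_add[symmetric] e\<tau> ..
      have "2 powr (- \<gamma> * real j) * ?c j = 28 * bdist b * (2 powr (- \<gamma> * real j) * 2 ^ j) * (e1 + X * T * (2 powr \<tau>) ^ j)"
        by (simp only: mult_ac)
      also have "\<dots> = 28 * bdist b * e1 * r1 ^ j + 28 * bdist b * X * T * (r1 ^ j * (2 powr \<tau>) ^ j)"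
        unfolding rr by (simp add: algebra_simps)
      finally show "ennreal (2 powr (- \<gamma> * real j)) * ennreal (?c j) =
          ennreal (28 * bdist b * e1 * r1 ^ j) + ennreal (28 * bdist b * X * T * r2 ^ j)"
        unfolding rr2 using h e1 X0 T0 r1 r2
        by (simp add: ennreal_mult'[symmetric] ennreal_plus[symmetric] del: ennreal_plus)
    qed
    also have "\<dots> = ennreal (28 * bdist b * e1 / (1 - r1)) + ennreal (28 * bdist b * X * T / (1 - r2))"
    proof -
      have "(\<Sum>j. ennreal (28 * bdist b * e1 * r1 ^ j)) = ennreal (28 * bdist b * e1 / (1 - r1))"
        "(\<Sum>j. ennreal (28 * bdist b * X * T * r2 ^ j)) = ennreal (28 * bdist b * X * T / (1 - r2))"
        using h e1 X0 T0 r1 r2 by (intro suminf_ennreal_geometric; simp)+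
      then show ?thesis by (subst suminf_add[symmetric]) (simp_all only: summableI)
    qed
    also have "\<dots> = ennreal (28 * bdist b * e1 / (1 - r1) + 28 * bdist b * X * T / (1 - r2))"
      using h e1 X0 T0 r1 r2 by (subst ennreal_plus) auto
    also have "\<dots> \<le> ennreal (e * bdist b)"
    proof (rule ennreal_leI)
      have "28 * bdist b * e1 / (1 - r1) = e * bdist b / 2" using r1 by (simp add: e1_def field_simps)
      moreover have "28 * bdist b * X * T / (1 - r2) \<le> e * bdist b / 2"
      proof -
        have "X * T \<le> (X + 1) * e2" using T X0 T0 by (intro mult_mono) auto
        then have "28 * bdist b * (X * T) / (1 - r2) \<le> 28 * bdist b * ((X + 1) * e2) / (1 - r2)"
          using h r2 by (intro divide_right_mono mult_left_mono) auto
        also have "\<dots> = e * bdist b / 2" 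
        proof -
          have "Y * (c / (56 * Y)) = c / 56" if "Y \<noteq> 0" for Y c :: real using that by simp
          from this[of "X + 1"] have q: "(X + 1) * e2 = e * (1 - r2) / 56" using X0 unfolding e2_def by simp
          show ?thesis unfolding q using r2 by (simp add: field_simps)
        qed
        finally show ?thesis by (simp add: mult_ac)
      qed
      ultimately show "28 * bdist b * e1 / (1 - r1) + 28 * bdist b * X * T / (1 - r2) \<le> e * bdist b" by linarith
    qed
    finally show ?thesis .
  qed
  then show ?thesis using d by blast
qed

section \<open>Lattices\<close>

lemma emeasure_lborel_ball_complex:
  fixes u :: complex
  shows "R \<ge> 0 \<Longrightarrow> emeasure lborel (ball u R) = ennreal (pi * R\<^sup>2)"
  using emeasure_ball[of R u] by (simp add: eval_unit_ball_vol)

text \<open>5 is the factor of Vitali's covering lemma. Radii proportional to \<open>bdist\<close>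
  make the balls comparable with pseudo-hyperbolic discs of a fixed radius.\<close>

definition disc_lattice :: "real \<Rightarrow> complex set \<Rightarrow> bool"
  where "disc_lattice \<epsilon> Z \<longleftrightarrow> countable Z \<and> Z \<subseteq> unit_disc \<and>
    pairwise (\<lambda>z w. disjnt (ball z (\<epsilon> * bdist z)) (ball w (\<epsilon> * bdist w))) Z \<and>
    unit_disc \<subseteq> (\<Union>z\<in>Z. ball z (5 * \<epsilon> * bdist z))"

lemma disc_lattice_exists:
  assumes "\<epsilon> > 0"
  obtains Z where "disc_lattice \<epsilon> Z"
proof -
  have cov: "unit_disc \<subseteq> (\<Union>z\<in>unit_disc. ball z (\<epsilon> * bdist z))"
    using assms bdist_pos by (force intro: mult_pos_pos)
  have rr: "0 < \<epsilon> * bdist z \<and> \<epsilon> * bdist z \<le> \<epsilon>" if "z \<in> unit_disc" for z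
    using that assms bdist_pos[of z] bdist_le_1[of z] by (simp add: mult_left_le)
  from Vitali_covering_lemma_balls[OF cov rr] obtain C where "countable C" "C \<subseteq> unit_disc"
    "pairwise (\<lambda>i j. disjnt (ball i (\<epsilon> * bdist i)) (ball j (\<epsilon> * bdist j))) C"
    "unit_disc \<subseteq> (\<Union>i\<in>C. ball i (5 * (\<epsilon> * bdist i)))" by blast
  then show ?thesis by (intro that[of C]) (simp add: disc_lattice_def mult.assoc)
qed

lemma bdist_diff_le: "\<bar>bdist z - bdist u\<bar> \<le> cmod (z - u)"
  using norm_triangle_ineq3[of z u] by (simp add: bdist_def norm_minus_commute)

text \<open>The area where |z - u| is at most 2^j * h grows like 4^j, so any exponent beyond 2 gives
  a convergent series over the layers.\<close>

lemma nn_integral_max_kernel: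
  fixes u :: complex
  assumes h: "h > 0" and e: "e > 0"
  shows "(\<integral>\<^sup>+z. ennreal (max h (cmod (z - u)) powr (- 2 - e)) \<partial>lborel) \<le> ennreal (16 * pi / (1 - 2 powr (- e)) * h powr (- e))"
proof -
  let ?X = "\<lambda>z. max h (cmod (z - u))"
  have "(\<integral>\<^sup>+z. ennreal (?X z powr (- 2 - e)) \<partial>lborel) =
      (\<integral>\<^sup>+z. ennreal (h powr (- 2 - e)) * ennreal ((h / ?X z) powr (2 + e)) \<partial>lborel)"
  proof (rule nn_integral_cong)
    fix z :: complex
    have "?X z powr (- 2 - e) = h powr (- 2 - e) * (h / ?X z) powr (2 + e)"
    proof -
      have "h powr (- 2 - e) * (h / ?X z) powr (2 + e) = h powr (- 2 - e) * h powr (2 + e) * (?X z) powr (- (2 + e))"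
        using h powr_minus_divide[of "?X z" "2 + e"] by (simp add: powr_divide)
      also have "h powr (- 2 - e) * h powr (2 + e) = 1" using h by (simp add: powr_add[symmetric])
      finally show ?thesis by simp
    qed
    then show "ennreal (?X z powr (- 2 - e)) = ennreal (h powr (- 2 - e)) * ennreal ((h / ?X z) powr (2 + e))"
      by (simp add: ennreal_mult[symmetric] del: ennreal_mult)
  qed
  also have "\<dots> \<le> (\<Sum>j. ennreal (2 powr (- (2 + e) * real j)) * (\<integral>\<^sup>+z. ennreal (h powr (- 2 - e)) * indicator {..2 ^ Suc j * h} (?X z) \<partial>lborel))"
    using h e by (intro nn_integral_upper_layers) auto
  also have "\<dots> \<le> ennreal (16 * pi * h powr (- e) / (1 - 2 powr (- e)))"
  proof (rule suminf_ennreal_le_geometric)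
    fix j :: nat
    \<comment> \<open>Doubling the radius turns the closed disc of the layer into part of an open
      ball.\<close>
    have lt: "2 ^ Suc j * h < 2 * (2 ^ Suc j * h)" using h by simp
    have "z \<in> ball u (2 * (2 ^ Suc j * h))" if "?X z \<le> 2 ^ Suc j * h" for z
    proof -
      have "dist u z \<le> 2 ^ Suc j * h" using that by (simp add: dist_norm norm_minus_commute del: power_Suc)
      then show ?thesis using lt unfolding mem_ball by (rule order_le_less_trans)
    qed
    then have "(\<integral>\<^sup>+z. ennreal (h powr (- 2 - e)) * indicator {..2 ^ Suc j * h} (?X z) \<partial>lborel) \<le>
       (\<integral>\<^sup>+z. ennreal (h powr (- 2 - e)) * indicator (ball u (2 * (2 ^ Suc j * h))) z \<partial>lborel)"
      by (intro nn_integral_mono mult_left_mono) (auto simp: indicator_def)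
    also have "\<dots> = ennreal (h powr (- 2 - e) * (pi * (2 * (2 ^ Suc j * h))\<^sup>2))"
      using h by (simp add: nn_integral_cmult_indicator emeasure_lborel_ball_complex ennreal_mult)
    finally have "ennreal (2 powr (- (2 + e) * real j)) * (\<integral>\<^sup>+z. ennreal (h powr (- 2 - e)) * indicator {..2 ^ Suc j * h} (?X z) \<partial>lborel)
      \<le> ennreal (2 powr (- (2 + e) * real j)) * ennreal (h powr (- 2 - e) * (pi * (2 * (2 ^ Suc j * h))\<^sup>2))"
      by (rule mult_left_mono) simp
    also have "\<dots> = ennreal (16 * pi * h powr (- e) * (2 powr (- e)) ^ j)"
    proof -
      have "h powr (- 2 - e) * h\<^sup>2 = h powr (- e)"
        using h by (simp add: powr_diff powr_minus powr_numeral[symmetric] field_simps del: powr_numeral)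
      moreover have "2 powr (- (2 + e) * real j) * (2 ^ j)\<^sup>2 = (2 powr (- e)) ^ j"
      proof -
        have "(2::real) powr (- (2 + e)) * 2\<^sup>2 = 2 powr (- e)"
        proof -
          have "(2::real) powr (- (2 + e)) * 2\<^sup>2 = 2 powr (- (2 + e)) * 2 powr 2" by simp
          also have "\<dots> = 2 powr (- e)" unfolding powr_add[symmetric] by simp
          finally show ?thesis .
        qed
        then have "((2::real) powr (- (2 + e))) ^ j * (2\<^sup>2) ^ j = (2 powr (- e)) ^ j"
          by (simp only: power_mult_distrib[symmetric])
        moreover have "((2::real)\<^sup>2) ^ j = (2 ^ j)\<^sup>2" by (simp only: power_mult[symmetric] mult.commute)
        ultimately show ?thesis by (simp only: powr_minus_mult_nat)
      qed
      moreover have "2 powr (- (2 + e) * real j) * (h powr (- 2 - e) * (pi * (2 * (2 ^ Suc j * h))\<^sup>2)) =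
         16 * pi * (h powr (- 2 - e) * h\<^sup>2) * (2 powr (- (2 + e) * real j) * (2 ^ j)\<^sup>2)"
        by (simp add: power_mult_distrib)
      ultimately show ?thesis by (simp add: ennreal_mult[symmetric] del: ennreal_mult)
    qed
    finally show "ennreal (2 powr (- (2 + e) * real j)) * (\<integral>\<^sup>+z. ennreal (h powr (- 2 - e)) * indicator {..2 ^ Suc j * h} (?X z) \<partial>lborel)
      \<le> ennreal (16 * pi * h powr (- e) * (2 powr (- e)) ^ j)" .
  qed (use two_powr_lt_1[OF e] in auto)
  finally show ?thesis by simp
qed

lemma lattice_nn_integral_sum_le:
  assumes Z: "disc_lattice \<epsilon> Z" and F: "finite F" "F \<subseteq> Z" and [measurable]: "g \<in> borel_measurable borel"
  shows "(\<Sum>k\<in>F. \<integral>\<^sup>+z. g z * indicator (ball k (\<epsilon> * bdist k)) z \<partial>lborel) \<le> (\<integral>\<^sup>+z. g z \<partial>lborel)"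
proof -
  have singl: "(\<Sum>k'\<in>{k}. h k') = h k" for h :: "complex \<Rightarrow> ennreal" and k by simp
  let ?B = "\<lambda>k. ball k (\<epsilon> * bdist k)"
  have [measurable]: "ball c R \<in> sets borel" for c :: complex and R by simp
  have "(\<Sum>k\<in>F. \<integral>\<^sup>+z. g z * indicator (?B k) z \<partial>lborel) = (\<integral>\<^sup>+z. (\<Sum>k\<in>F. g z * indicator (?B k) z) \<partial>lborel)"
    by (rule nn_integral_sum[symmetric]) measurable
  also have "\<dots> \<le> (\<integral>\<^sup>+z. g z \<partial>lborel)"
  proof (rule nn_integral_mono)
    fix z
    show "(\<Sum>k\<in>F. g z * indicator (?B k) z) \<le> g z"
    proof (cases "\<exists>k\<in>F. z \<in> ?B k")
      case True
      then obtain k where k: "k \<in> F" "z \<in> ?B k" by blast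
      have "z \<notin> ?B k'" if "k' \<in> F" "k' \<noteq> k" for k'
        using that k F Z unfolding disc_lattice_def pairwise_def disjnt_def by blast
      then have "(\<Sum>k'\<in>F. g z * indicator (?B k') z) = (\<Sum>k'\<in>{k}. g z * indicator (?B k') z)"
        using F k by (intro sum.mono_neutral_right) auto
      also have "\<dots> = g z * indicator (?B k) z"
        by (rule singl)
      finally show ?thesis using k(2) by (simp only: indicator_simps) simp
    next
      case False
      then have "(\<Sum>k\<in>F. g z * indicator (?B k) z) = (\<Sum>k\<in>F. 0)" by (intro sum.cong) auto
      then show ?thesis by simp
    qed
  qed
  finally show ?thesis .
qed

text \<open>On the ball about k the function max (bdist u) |z - u| is at most 2 *
  \<open>kdist k u\<close>, and this ball has area of order (bdist k)^2. So each summand is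
  dominated by an integral over its own ball, and the balls are disjoint.\<close>

lemma lattice_kratio_sum:
  assumes Z: "disc_lattice \<epsilon> Z" and \<epsilon>: "0 < \<epsilon>" "\<epsilon> \<le> 1" and e: "e > 0"
  obtains C where "C > 0" "\<And>F u. finite F \<Longrightarrow> F \<subseteq> Z \<Longrightarrow> u \<in> unit_disc \<Longrightarrow>
    (\<Sum>k\<in>F. kratio k u powr (2 + e) * bdist k powr (- e)) \<le> C * bdist u powr (- e)"
proof -
  define A where "A = 16 * pi / (1 - 2 powr (- e))"
  have A: "A > 0" using two_powr_lt_1[OF e] by (simp add: A_def)
  define C where "C = A * (2 powr (2 + e) / (pi * \<epsilon>\<^sup>2))"
  have C: "C > 0" using A \<epsilon> by (simp add: C_def)
  have "(\<Sum>k\<in>F. kratio k u powr (2 + e) * bdist k powr (- e)) \<le> C * bdist u powr (- e)"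
    if F: "finite F" "F \<subseteq> Z" and u: "u \<in> unit_disc" for F u
  proof -
    let ?g = "\<lambda>z. ennreal (max (bdist u) (cmod (z - u)) powr (- 2 - e))"
    let ?B = "\<lambda>k. ball k (\<epsilon> * bdist k)"
    have hu: "bdist u > 0" by (rule bdist_pos[OF u])
    have one: "ennreal (kratio k u powr (2 + e) * bdist k powr (- e)) \<le>
       ennreal (2 powr (2 + e) / (pi * \<epsilon>\<^sup>2)) * (\<integral>\<^sup>+z. ?g z * indicator (?B k) z \<partial>lborel)" if k: "k \<in> F" for k
    proof -
      have kD: "k \<in> unit_disc" using k F Z by (auto simp: disc_lattice_def)
      have hk: "bdist k > 0" by (rule bdist_pos[OF kD])
      have dk: "kdist k u > 0" by (rule kdist_pos[OF kD u])
      have le: "max (bdist u) (cmod (z - u)) \<le> 2 * kdist k u" if "z \<in> ?B k" for z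
      proof -
        have "cmod (z - u) \<le> cmod (z - k) + cmod (k - u)"
          using norm_triangle_ineq[of "z - k" "k - u"] by simp
        moreover have "cmod (z - k) \<le> \<epsilon> * bdist k" using that by (simp add: dist_norm norm_minus_commute)
        moreover have "\<epsilon> * bdist k \<le> 1 * bdist k" using \<epsilon> hk by (intro mult_right_mono) auto
        ultimately show ?thesis
          using norm_diff_le_kdist[OF kD u] bdist_le_kdist[OF kD u] bdist_le_kdist'[OF kD u] dk by auto
      qed
      have "ennreal ((2 * kdist k u) powr (- 2 - e)) * ennreal (pi * (\<epsilon> * bdist k)\<^sup>2) =
         (\<integral>\<^sup>+z. ennreal ((2 * kdist k u) powr (- 2 - e)) * indicator (?B k) z \<partial>lborel)"
        using hk \<epsilon> by (simp add: nn_integral_cmult_indicator emeasure_lborel_ball_complex)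
      also have "\<dots> \<le> (\<integral>\<^sup>+z. ?g z * indicator (?B k) z \<partial>lborel)"
      proof (intro nn_integral_mono)
        fix z
        show "ennreal ((2 * kdist k u) powr (- 2 - e)) * indicator (?B k) z \<le> ?g z * indicator (?B k) z"
          using le[of z] hu e by (cases "z \<in> ?B k") (auto intro!: ennreal_leI powr_mono2')
      qed
      finally have *: "ennreal ((2 * kdist k u) powr (- 2 - e) * (pi * (\<epsilon> * bdist k)\<^sup>2)) \<le> (\<integral>\<^sup>+z. ?g z * indicator (?B k) z \<partial>lborel)"
        by (simp add: ennreal_mult)
      have "kratio k u powr (2 + e) * bdist k powr (- e) =
        2 powr (2 + e) / (pi * \<epsilon>\<^sup>2) * ((2 * kdist k u) powr (- 2 - e) * (pi * (\<epsilon> * bdist k)\<^sup>2))"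
      proof -
        have "kratio k u powr (2 + e) * bdist k powr (- e) = (bdist k)\<^sup>2 * kdist k u powr (- (2 + e))"
        proof -
          have "bdist k powr (2 + e) * bdist k powr (- e) = (bdist k)\<^sup>2"
            using hk by (simp add: powr_add[symmetric])
          then show ?thesis
            using hk dk powr_minus_divide[of "kdist k u" "2 + e"]
            by (simp add: kratio_def powr_divide)
        qed
        moreover have "(2 * kdist k u) powr (- 2 - e) = 2 powr (- (2 + e)) * kdist k u powr (- (2 + e))"
          using dk by (simp add: powr_mult)
        moreover have "2 powr (2 + e) * 2 powr (- (2 + e)) = (1::real)" by (simp add: powr_add[symmetric])
        ultimately show ?thesis using \<epsilon> by (simp add: power_mult_distrib)
      qed
      then show ?thesis
        using mult_left_mono[OF *, of "ennreal (2 powr (2 + e) / (pi * \<epsilon>\<^sup>2))"]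
        by (simp add: ennreal_mult[symmetric] del: ennreal_mult)
    qed
    have "ennreal (\<Sum>k\<in>F. kratio k u powr (2 + e) * bdist k powr (- e)) =
        (\<Sum>k\<in>F. ennreal (kratio k u powr (2 + e) * bdist k powr (- e)))"
      by (rule sum_ennreal[symmetric]) simp
    also have "\<dots> \<le> (\<Sum>k\<in>F. ennreal (2 powr (2 + e) / (pi * \<epsilon>\<^sup>2)) * (\<integral>\<^sup>+z. ?g z * indicator (?B k) z \<partial>lborel))"
      by (intro sum_mono one)
    also have "\<dots> = ennreal (2 powr (2 + e) / (pi * \<epsilon>\<^sup>2)) * (\<Sum>k\<in>F. \<integral>\<^sup>+z. ?g z * indicator (?B k) z \<partial>lborel)"
      by (simp only: sum_distrib_left)
    also have "\<dots> \<le> ennreal (2 powr (2 + e) / (pi * \<epsilon>\<^sup>2)) * (\<integral>\<^sup>+z. ?g z \<partial>lborel)"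
    proof (rule mult_left_mono[OF lattice_nn_integral_sum_le[OF Z F]])
      show "?g \<in> borel_measurable borel" by measurable
    qed simp
    also have "\<dots> \<le> ennreal (2 powr (2 + e) / (pi * \<epsilon>\<^sup>2)) * ennreal (A * bdist u powr (- e))"
      unfolding A_def by (intro mult_left_mono nn_integral_max_kernel hu e) simp
    also have "\<dots> = ennreal (C * bdist u powr (- e))"
      using A \<epsilon> by (simp add: C_def ennreal_mult[symmetric] mult_ac del: ennreal_mult)
    finally show ?thesis using C by (subst (asm) ennreal_le_iff) auto
  qed
  then show ?thesis using that C by blast
qed

lemma nn_integral_count_space_le:
  fixes f :: "'a \<Rightarrow> ennreal"
  assumes Z: "countable Z" and le: "\<And>F. finite F \<Longrightarrow> F \<subseteq> Z \<Longrightarrow> sum f F \<le> x"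
  shows "(\<integral>\<^sup>+k. f k \<partial>count_space Z) \<le> x"
proof (cases "finite Z")
  case True
  then show ?thesis using le[of Z] by (simp add: nn_integral_count_space_finite)
next
  case False
  have bij: "bij_betw (from_nat_into Z) UNIV Z" using Z False by (rule bij_betw_from_nat_into)
  have "(\<integral>\<^sup>+k. f k \<partial>count_space Z) = (\<Sum>i. f (from_nat_into Z i))"
    using nn_integral_bij_count_space[OF bij, of f] by (simp add: nn_integral_count_space_nat)
  also have "\<dots> \<le> x"
  proof (rule suminf_le_const)
    fix n
    have inj: "inj_on (from_nat_into Z) {..<n}" using bij by (auto simp: bij_betw_def inj_on_def)
    have "(\<Sum>i<n. f (from_nat_into Z i)) = sum f (from_nat_into Z ` {..<n})"
      by (simp add: sum.reindex[OF inj])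
    also have "\<dots> \<le> x" using bij by (intro le) (auto simp: bij_betw_def)
    finally show "(\<Sum>i<n. f (from_nat_into Z i)) \<le> x" .
  qed simp
  finally show ?thesis .
qed

section \<open>Weights in the class \<open>D\<close>\<close>

lemma borel_measurable_dA:
  assumes "\<phi> \<in> borel_measurable (restrict_space borel unit_disc)"
  shows "\<phi> \<in> borel_measurable dA"
proof (rule measurableI)
  fix A :: "'a set" assume "A \<in> sets borel"
  then have "\<phi> -` A \<inter> space (restrict_space borel unit_disc) \<in> sets (restrict_space borel unit_disc)"
    using assms by (rule measurable_sets[rotated])
  then have "\<phi> -` A \<inter> unit_disc \<in> sets borel"
    by (subst (asm) sets_restrict_space_iff) (auto simp: space_restrict_space)
  then show "\<phi> -` A \<inter> space dA \<in> sets dA"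
    by (simp add: sets_restrict_space_iff)
qed simp

lemma nn_integral_weight_measure_lborel:
  assumes w: "(\<lambda>z. ennreal (w z)) \<in> borel_measurable dA" and \<phi>: "\<phi> \<in> borel_measurable (restrict_space borel unit_disc)"
  shows "(\<integral>\<^sup>+u. \<phi> u \<partial>weight_measure w) = (\<integral>\<^sup>+u. ennreal (w u) * \<phi> u * indicator unit_disc u \<partial>lborel)"
  unfolding weight_measure_def using w borel_measurable_dA[OF \<phi>]
  by (subst nn_integral_density) (simp_all add: nn_integral_restrict_space nn_integral_completion)

lemma radial_weightD:
  assumes "radial_weight \<omega>"
  shows "z \<in> unit_disc \<Longrightarrow> 0 \<le> \<omega> z" "integrable dA \<omega>" "\<not> (AE z in dA. \<omega> z = 0)"
    "z \<in> unit_disc \<Longrightarrow> \<omega> z = \<omega> (of_real (cmod z))" "(\<lambda>z. ennreal (\<omega> z)) \<in> borel_measurable dA"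
proof -
  show "z \<in> unit_disc \<Longrightarrow> 0 \<le> \<omega> z" "\<not> (AE z in dA. \<omega> z = 0)"
    "z \<in> unit_disc \<Longrightarrow> \<omega> z = \<omega> (of_real (cmod z))" and int: "integrable dA \<omega>"
    using assms unfolding radial_weight_def by blast+
  show "(\<lambda>z. ennreal (\<omega> z)) \<in> borel_measurable dA" using int by simp
qed

text \<open>The real axis is a null set of the plane, so measurability of the weight says nothing
  about it directly. A Borel function agrees with the weight off a null set N; by polar coordinates
  almost every ray meets N in a null set, and radial symmetry carries the values on one such ray to
  the axis.\<close>

lemma radial_weight_profile:
  assumes "radial_weight \<omega>"
  obtains h :: "real \<Rightarrow> ennreal" where "h \<in> borel_measurable borel"
    "AE s in lborel. 0 < s \<and> s < 1 \<longrightarrow> ennreal (\<omega> (of_real s)) = h s"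
proof -
  note rad = radial_weightD(4)[OF assms]
  have "(\<lambda>z. ennreal (\<omega> z) * indicator unit_disc z) \<in> borel_measurable lebesgue"
    using radial_weightD(5)[OF assms] by (subst (asm) borel_measurable_restrict_space_iff_ennreal) auto
  from completion_ex_borel_measurable[OF this]
  obtain g where g: "g \<in> borel_measurable lborel"
    and ae: "AE z in lborel. ennreal (\<omega> z) * indicator unit_disc z = g z" by blast
  have [measurable]: "g \<in> borel_measurable borel" using g by simp
  obtain N where N: "N \<in> null_sets lborel" "{z. ennreal (\<omega> z) * indicator unit_disc z \<noteq> g z} \<subseteq> N"
    using AE_E[OF ae] by (auto simp: null_sets_def)
  have [measurable]: "N \<in> sets borel" using N by auto
  have [measurable]: "cis \<in> borel_measurable borel"
    by (intro borel_measurable_continuous_onI continuous_intros)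
  have "0 = (\<integral>\<^sup>+z. indicator N z \<partial>lborel)" using N by (simp add: null_sets_def)
  also have "\<dots> = (\<integral>\<^sup>+t. \<integral>\<^sup>+s. indicator N (of_real s * cis t) * ennreal s * indicator {0<..} s *
       indicator angles t \<partial>lborel \<partial>lborel)"
    by (rule nn_integral_polar) measurable
  finally have "AE t in lborel. (\<integral>\<^sup>+s. indicator N (of_real s * cis t) * ennreal s * indicator {0<..} s *
       indicator angles t \<partial>lborel) = 0"
    by (subst (asm) eq_commute, subst (asm) nn_integral_0_iff_AE) auto
  moreover have "\<not> (AE t in lborel. t \<notin> angles)"
  proof
    assume "AE t in lborel. t \<notin> angles"
    then have "angles \<in> null_sets lborel" by (subst AE_iff_null_sets) auto
    then have "emeasure lborel angles = 0" by auto
    then show False using pi_gt_zero by simp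
  qed
  ultimately obtain t where t: "t \<in> angles"
    "(\<integral>\<^sup>+s. indicator N (of_real s * cis t) * ennreal s * indicator {0<..} s * indicator angles t \<partial>lborel) = 0"
    by (metis (mono_tags, lifting) eventually_mono)
  then have *: "AE s in lborel. indicator N (of_real s * cis t) * ennreal s * indicator {0<..} s = 0"
    by (subst (asm) nn_integral_0_iff_AE) auto
  have "AE s in lborel. 0 < s \<and> s < 1 \<longrightarrow> ennreal (\<omega> (of_real s)) = g (of_real s * cis t)"
    using *
  proof eventually_elim
    fix s :: real assume s: "indicator N (of_real s * cis t) * ennreal s * indicator {0<..} s = 0"
    show "0 < s \<and> s < 1 \<longrightarrow> ennreal (\<omega> (of_real s)) = g (of_real s * cis t)"
    proof
      assume s01: "0 < s \<and> s < 1"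
      then have "of_real s * cis t \<notin> N" using s by (auto simp: indicator_def split: if_splits)
      then have "ennreal (\<omega> (of_real s * cis t)) * indicator unit_disc (of_real s * cis t) = g (of_real s * cis t)"
        using N(2) by auto
      moreover have "of_real s * cis t \<in> unit_disc" using s01 by (simp add: norm_mult)
      moreover have "\<omega> (of_real s * cis t) = \<omega> (of_real s)"
        using rad[OF calculation(2)] s01 by (simp add: norm_mult)
      ultimately show "ennreal (\<omega> (of_real s)) = g (of_real s * cis t)" by simp
    qed
  qed
  then show ?thesis by (intro that[of "\<lambda>s. g (of_real s * cis t)"]) auto
qed

text \<open>In polar coordinates a null set of radii sweeps out a null set of the plane.\<close>

lemma AE_lborel_cmod:
  assumes "AE s in lborel. P s"
  shows "AE z in lborel. z \<noteq> 0 \<longrightarrow> P (cmod z)"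
proof -
  obtain N where N: "N \<in> null_sets lborel" "{s. \<not> P s} \<subseteq> N"
    using AE_E[OF assms] by (auto simp: null_sets_def)
  have [measurable]: "N \<in> sets borel" using N by auto
  let ?A = "{z. cmod z \<in> N \<and> z \<noteq> (0::complex)}"
  have A[measurable]: "?A \<in> sets borel" by measurable
  have "emeasure lborel ?A = (\<integral>\<^sup>+z. indicator ?A z \<partial>lborel)" by simp
  also have "\<dots> = (\<integral>\<^sup>+s. (\<integral>\<^sup>+t. indicator ?A (of_real s * cis t) * indicator angles t \<partial>lborel) *
       ennreal s * indicator {0<..} s \<partial>lborel)"
    by (rule nn_integral_polar') measurable
  also have "\<dots> = (\<integral>\<^sup>+_. 0 \<partial>(lborel :: real measure))"
  proof (rule nn_integral_cong_AE)
    have "AE s in lborel. s \<notin> N" using N(1) by (rule AE_not_in)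
    then show "AE s in lborel. (\<integral>\<^sup>+t. indicator ?A (of_real s * cis t) * indicator angles t \<partial>lborel) *
       ennreal s * indicator {0<..} s = 0"
    proof eventually_elim
      fix s assume "s \<notin> N"
      then have "indicator ?A (of_real s * cis t) * indicator {0<..} s = (0::ennreal)" for t
        by (auto simp: indicator_def norm_mult)
      then have "s > 0 \<Longrightarrow> indicator ?A (of_real s * cis t) = (0::ennreal)" for t by (simp add: indicator_def split: if_splits)
      then show "(\<integral>\<^sup>+t. indicator ?A (of_real s * cis t) * indicator angles t \<partial>lborel) *
       ennreal s * indicator {0<..} s = 0" by (cases "s > 0") simp_all
    qed
  qed
  finally have "?A \<in> null_sets lborel" using A by (simp add: null_sets_def)
  then show ?thesis by (rule AE_I') (use N(2) in auto)
qed

text \<open>If t0 is one admissible angle, every other one differs from it by at most 2 pi x modulo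
  2 pi; inside \<open>angles\<close> this leaves three intervals of length 4 pi x, hence 12 pi x.
  The chord bound uses |z| * s >= 1/2; otherwise \<open>kdist\<close> exceeds 1/2, and either the
  set is empty or its trivial bound 2 pi suffices.\<close>

lemma emeasure_kdist_angle:
  assumes z: "z \<in> unit_disc" and s: "0 < s" "s < 1" and x: "x > 0"
  shows "emeasure lborel {t \<in> angles. kdist z (of_real s * cis t) \<le> x} \<le> ennreal (12 * pi * x)"
proof (cases "cmod z * s < 1 / 2")
  case True
  show ?thesis
  proof (cases "x < 1 / 2")
    case x: True
    have "\<not> kdist z (of_real s * cis t) \<le> x" for t
    proof -
      have "1 - cmod (cnj z * (of_real s * cis t)) \<le> kdist z (of_real s * cis t)"
        using norm_triangle_ineq2[of 1 "cnj z * (of_real s * cis t)"] by (simp add: kdist_def)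
      moreover have "cmod (cnj z * (of_real s * cis t)) = cmod z * s" using s by (simp add: norm_mult)
      ultimately show ?thesis using True x by simp
    qed
    then show ?thesis by simp
  next
    case False
    have "emeasure lborel {t \<in> angles. kdist z (of_real s * cis t) \<le> x} \<le> emeasure lborel angles"
      by (intro emeasure_mono) auto
    also have "\<dots> = ennreal (2 * pi)" by simp
    also have "\<dots> \<le> ennreal (12 * pi * x)" using False by (intro ennreal_leI) simp
    finally show ?thesis .
  qed
next
  case False
  show ?thesis
  proof (cases "{t \<in> angles. kdist z (of_real s * cis t) \<le> x} = {}")
    case True
    show ?thesis unfolding True by simp
  next
    case ne: False
    then obtain t0 where t0: "t0 \<in> angles" "kdist z (of_real s * cis t0) \<le> x" by blast
    let ?I = "\<lambda>c. {c - 2 * pi * x..c + 2 * pi * x}"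
    have "{t \<in> angles. kdist z (of_real s * cis t) \<le> x} \<subseteq> ?I t0 \<union> (?I (t0 + 2 * pi) \<union> ?I (t0 - 2 * pi))"
    proof
      fix t assume "t \<in> {t \<in> angles. kdist z (of_real s * cis t) \<le> x}"
      then have t: "t \<in> angles" "kdist z (of_real s * cis t) \<le> x" by auto
      have "cmod z * s * cmod (cis (t - t0) - 1) = cmod (cnj z * (of_real s * cis t) - cnj z * (of_real s * cis t0))"
      proof -
        have "cnj z * (of_real s * cis t) - cnj z * (of_real s * cis t0) = cnj z * of_real s * cis t0 * (cis (t - t0) - 1)"
          by (simp add: cis_divide[symmetric] right_diff_distrib)
        then show ?thesis using s by (simp add: norm_mult)
      qed
      also have "\<dots> \<le> kdist z (of_real s * cis t) + kdist z (of_real s * cis t0)"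
        using norm_triangle_ineq4[of "1 - cnj z * (of_real s * cis t0)" "1 - cnj z * (of_real s * cis t)"]
        by (simp add: kdist_def)
      finally have "cmod z * s * cmod (cis (t - t0) - 1) \<le> 2 * x" using t t0 by linarith
      moreover have "1 / 2 * cmod (cis (t - t0) - 1) \<le> cmod z * s * cmod (cis (t - t0) - 1)"
        using False by (intro mult_right_mono) auto
      ultimately have c4: "cmod (cis (t - t0) - 1) \<le> 4 * x" by simp
      have key: "\<bar>\<theta>\<bar> \<le> 2 * pi * x" if "\<bar>\<theta>\<bar> \<le> pi" "cis \<theta> = cis (t - t0)" for \<theta>
      proof -
        have "\<bar>\<theta>\<bar> \<le> pi / 2 * cmod (cis \<theta> - 1)" by (rule abs_le_norm_cis[OF that(1)])
        also have "\<dots> \<le> pi / 2 * (4 * x)" using c4 that(2) by (intro mult_left_mono) auto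
        finally show ?thesis by simp
      qed
      consider "\<bar>t - t0\<bar> \<le> pi" | "t - t0 > pi" | "t - t0 < - pi" by linarith
      then show "t \<in> ?I t0 \<union> (?I (t0 + 2 * pi) \<union> ?I (t0 - 2 * pi))"
      proof cases
        case 1
        then show ?thesis using key[of "t - t0"] by auto
      next
        case 2
        have "cis (t - t0 - 2 * pi) = cis (t - t0)" by (simp add: cis_divide[symmetric])
        then have "\<bar>t - t0 - 2 * pi\<bar> \<le> 2 * pi * x" using 2 t t0 by (intro key) auto
        then show ?thesis by auto
      next
        case 3
        have "cis (t - t0 + 2 * pi) = cis (t - t0)" by (simp add: cis_mult[symmetric])
        then have "\<bar>t - t0 + 2 * pi\<bar> \<le> 2 * pi * x" using 3 t t0 by (intro key) auto
        then show ?thesis by auto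
      qed
    qed
    then have "emeasure lborel {t \<in> angles. kdist z (of_real s * cis t) \<le> x} \<le>
        emeasure lborel (?I t0 \<union> (?I (t0 + 2 * pi) \<union> ?I (t0 - 2 * pi)))"
      by (intro emeasure_mono) auto
    also have "\<dots> \<le> emeasure lborel (?I t0) + (emeasure lborel (?I (t0 + 2 * pi)) + emeasure lborel (?I (t0 - 2 * pi)))"
      by (intro order_trans[OF emeasure_subadditive] add_left_mono emeasure_subadditive) auto
    also have "\<dots> = ennreal (12 * pi * x)"
      using x by (simp add: ennreal_plus[symmetric] del: ennreal_plus)
    finally show ?thesis .
  qed
qed

locale D_weight =
  fixes \<omega> :: "complex \<Rightarrow> real"
  assumes D_class: "\<omega> \<in> D_class"
begin

lemma radial: "radial_weight \<omega>"
  using D_class by (simp add: D_class_def D_hat_def)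

definition profile :: "real \<Rightarrow> ennreal"
  where "profile = (SOME h. h \<in> borel_measurable borel \<and>
    (AE s in lborel. 0 < s \<and> s < 1 \<longrightarrow> ennreal (\<omega> (of_real s)) = h s))"

lemma profile_measurable [measurable]: "profile \<in> borel_measurable borel"
  and profile_AE: "AE s in lborel. 0 < s \<and> s < 1 \<longrightarrow> ennreal (\<omega> (of_real s)) = profile s"
proof -
  have "\<exists>h. h \<in> borel_measurable borel \<and>
    (AE s in lborel. 0 < s \<and> s < 1 \<longrightarrow> ennreal (\<omega> (of_real s)) = h s)"
    using radial_weight_profile[OF radial] by metis
  from someI_ex[OF this] show "profile \<in> borel_measurable borel"
    "AE s in lborel. 0 < s \<and> s < 1 \<longrightarrow> ennreal (\<omega> (of_real s)) = profile s"
    unfolding profile_def by auto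
qed

text \<open>A Borel version of the weight measure: \<open>\<omega>\<close> itself is only Lebesgue measurable.\<close>

definition wA :: "complex measure"
  where "wA = density (restrict_space lborel unit_disc) (\<lambda>u. profile (cmod u))"

lemma space_wA [simp]: "space wA = unit_disc"
  by (simp add: wA_def space_restrict_space)

lemma sets_wA [measurable_cong]: "sets wA = sets (restrict_space borel unit_disc)"
  by (simp add: wA_def) (metis sets_lborel sets_restrict_space_cong)

lemma measurable_wA: "f \<in> borel_measurable (restrict_space borel unit_disc) \<Longrightarrow> f \<in> borel_measurable wA"
  using measurable_cong_sets[OF sets_wA refl] by blast

lemma borel_measurable_wA [measurable (raw)]: "f \<in> borel_measurable borel \<Longrightarrow> f \<in> borel_measurable wA"
  by (intro measurable_wA measurable_restrict_space1)

lemma nn_integral_wA: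
  assumes "\<phi> \<in> borel_measurable (restrict_space borel unit_disc)"
  shows "(\<integral>\<^sup>+u. \<phi> u \<partial>wA) = (\<integral>\<^sup>+u. \<phi> u * profile (cmod u) * indicator unit_disc u \<partial>lborel)"
proof -
  have "\<phi> \<in> borel_measurable (restrict_space lborel unit_disc)"
    using assms by (metis measurable_cong_sets sets_lborel sets_restrict_space_cong)
  moreover have "(\<lambda>u. profile (cmod u)) \<in> borel_measurable (restrict_space lborel unit_disc)"
    by (intro measurable_restrict_space1) measurable
  ultimately show ?thesis
    unfolding wA_def
    by (subst nn_integral_density) (simp_all add: nn_integral_restrict_space mult_ac)
qed

lemma nn_integral_weight_measure:
  assumes "\<phi> \<in> borel_measurable (restrict_space borel unit_disc)"
  shows "(\<integral>\<^sup>+u. \<phi> u \<partial>weight_measure \<omega>) = (\<integral>\<^sup>+u. \<phi> u \<partial>wA)"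
proof -
  note rad = radial_weightD(4)[OF radial] and 1 = radial_weightD(5)[OF radial]
  have "(\<integral>\<^sup>+u. \<phi> u \<partial>weight_measure \<omega>) = (\<integral>\<^sup>+u. ennreal (\<omega> u) * \<phi> u * indicator unit_disc u \<partial>lborel)"
    by (rule nn_integral_weight_measure_lborel[OF 1 assms])
  also have "\<dots> = (\<integral>\<^sup>+u. \<phi> u * profile (cmod u) * indicator unit_disc u \<partial>lborel)"
  proof (rule nn_integral_cong_AE)
    have "AE z in lborel. z \<noteq> (0::complex)"
      by (rule AE_I'[of "{0}"]) (auto simp: finite_imp_null_set_lborel)
    then show "AE u in lborel. ennreal (\<omega> u) * \<phi> u * indicator unit_disc u = \<phi> u * profile (cmod u) * indicator unit_disc u"
      using AE_lborel_cmod[OF profile_AE]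
    proof eventually_elim
      fix u :: complex
      assume u0: "u \<noteq> 0" and "u \<noteq> 0 \<longrightarrow> 0 < cmod u \<and> cmod u < 1 \<longrightarrow> ennreal (\<omega> (of_real (cmod u))) = profile (cmod u)"
      then have "u \<in> unit_disc \<Longrightarrow> ennreal (\<omega> u) = profile (cmod u)" using rad[of u] by simp
      then show "ennreal (\<omega> u) * \<phi> u * indicator unit_disc u = \<phi> u * profile (cmod u) * indicator unit_disc u"
        by (cases "u \<in> unit_disc") (simp_all add: mult_ac)
    qed
  qed
  also have "\<dots> = (\<integral>\<^sup>+u. \<phi> u \<partial>wA)" by (rule nn_integral_wA[OF assms, symmetric])
  finally show ?thesis .
qed

text \<open>\<open>omega_hat\<close> in the variable t = 1 - |z|, the distance to the boundary, and
  written with the Borel \<open>profile\<close>.\<close>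

definition what :: "real \<Rightarrow> ennreal"
  where "what t = (\<integral>\<^sup>+s. profile s * indicator {1 - t..<1} s \<partial>lborel)"

lemma omega_hat_eq_what: "z \<in> unit_disc \<Longrightarrow> omega_hat \<omega> z = what (bdist z)"
proof -
  assume z: "z \<in> unit_disc"
  have AE0: "AE s in lborel. s \<noteq> (0::real)"
    by (rule AE_I'[of "{0}"]) (auto simp: finite_imp_null_set_lborel)
  have "omega_hat \<omega> z = (\<integral>\<^sup>+s. ennreal (\<omega> (of_real s)) * indicator {cmod z..<1} s \<partial>lborel)"
    by (simp add: omega_hat_def nn_integral_completion)
  also have "\<dots> = what (bdist z)"
    unfolding what_def
  proof (rule nn_integral_cong_AE, use AE0 profile_AE in eventually_elim)
    fix s :: real
    assume "s \<noteq> 0" "0 < s \<and> s < 1 \<longrightarrow> ennreal (\<omega> (of_real s)) = profile s"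
    then show "ennreal (\<omega> (of_real s)) * indicator {cmod z..<1} s = profile s * indicator {1 - bdist z..<1} s"
      using norm_ge_zero[of z] by (auto simp: bdist_def indicator_def simp del: norm_ge_zero)
  qed
  finally show ?thesis .
qed

lemma what_mono: "s \<le> t \<Longrightarrow> what s \<le> what t"
  unfolding what_def by (intro nn_integral_mono mult_left_mono) (auto split: split_indicator)

lemma omega_hat_real: "0 \<le> r \<Longrightarrow> r < 1 \<Longrightarrow> omega_hat \<omega> (complex_of_real r) = what (1 - r)"
  using omega_hat_eq_what[of "of_real r"] by (simp add: bdist_def)

lemma what_doubling: "\<exists>C\<ge>1. \<forall>t. 0 < t \<and> t \<le> 1 \<longrightarrow> what t \<le> ennreal C * what (t / 2)"
proof -
  obtain C where C: "C \<ge> 1" and le: "\<And>r::real. 0 \<le> r \<Longrightarrow> r < 1 \<Longrightarrow>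
      omega_hat \<omega> (complex_of_real r) \<le> ennreal C * omega_hat \<omega> (complex_of_real ((1 + r) / 2))"
    using D_class unfolding D_class_def D_hat_def by auto
  have "what t \<le> ennreal C * what (t / 2)" if "0 < t" "t \<le> 1" for t
  proof -
    have eq: "(1 + (1 - t)) / 2 = 1 - t / 2" by (simp add: field_simps)
    have "omega_hat \<omega> (complex_of_real (1 - t)) \<le> ennreal C * omega_hat \<omega> (complex_of_real (1 - t / 2))"
      by (rule le[of "1 - t", unfolded eq]) (use that in auto)
    then show ?thesis using that omega_hat_real[of "1 - t"] omega_hat_real[of "1 - t / 2"] by simp
  qed
  then show ?thesis using C by blast
qed

lemma nn_integral_wA_radial:
  assumes [measurable]: "\<phi> \<in> borel_measurable borel"
  shows "(\<integral>\<^sup>+u. \<phi> u \<partial>wA) = (\<integral>\<^sup>+s. (\<integral>\<^sup>+t. \<phi> (of_real s * cis t) * indicator angles t \<partial>lborel) *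
     (profile s * ennreal s * indicator {0<..<1} s) \<partial>lborel)"
proof -
  have [measurable]: "cis \<in> borel_measurable borel"
    by (intro borel_measurable_continuous_onI continuous_intros)
  have [measurable]: "unit_disc \<in> sets borel" by simp
  have "(\<integral>\<^sup>+u. \<phi> u \<partial>wA) = (\<integral>\<^sup>+u. \<phi> u * profile (cmod u) * indicator unit_disc u \<partial>lborel)"
    by (intro nn_integral_wA measurable_restrict_space1) fact
  also have "\<dots> = (\<integral>\<^sup>+s. (\<integral>\<^sup>+t. \<phi> (of_real s * cis t) * profile (cmod (of_real s * cis t)) *
      indicator unit_disc (of_real s * cis t) * indicator angles t \<partial>lborel) * ennreal s * indicator {0<..} s \<partial>lborel)"
    by (rule nn_integral_polar') measurable
  also have "\<dots> = (\<integral>\<^sup>+s. (\<integral>\<^sup>+t. \<phi> (of_real s * cis t) * indicator angles t \<partial>lborel) *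
     (profile s * ennreal s * indicator {0<..<1} s) \<partial>lborel)"
  proof (rule nn_integral_cong)
    fix s :: real
    show "(\<integral>\<^sup>+t. \<phi> (of_real s * cis t) * profile (cmod (of_real s * cis t)) *
      indicator unit_disc (of_real s * cis t) * indicator angles t \<partial>lborel) * ennreal s * indicator {0<..} s =
      (\<integral>\<^sup>+t. \<phi> (of_real s * cis t) * indicator angles t \<partial>lborel) * (profile s * ennreal s * indicator {0<..<1} s)"
    proof (cases "0 < s")
      case True
      have "(\<integral>\<^sup>+t. \<phi> (of_real s * cis t) * profile (cmod (of_real s * cis t)) *
          indicator unit_disc (of_real s * cis t) * indicator angles t \<partial>lborel) =
        (\<integral>\<^sup>+t. \<phi> (of_real s * cis t) * indicator angles t * (profile s * indicator {0<..<1} s) \<partial>lborel)"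
        using True by (intro nn_integral_cong) (auto simp: norm_mult indicator_def)
      also have "\<dots> = (\<integral>\<^sup>+t. \<phi> (of_real s * cis t) * indicator angles t \<partial>lborel) * (profile s * indicator {0<..<1} s)"
        by (rule nn_integral_multc) measurable
      finally show ?thesis using True by (simp add: mult_ac)
    qed simp
  qed
  finally show ?thesis .
qed

text \<open>The area integral carries the factor s, which is at least 1/2 on [1/2, 1), so
  integrability of the weight bounds the tail from 1/2 on. Doubling extends this to the tail from 0,
  where the factor s gives no control.\<close>

lemma what_finite: 
  assumes "t \<le> 1" shows "what t < \<infinity>"
proof -
  obtain C where C1: "\<forall>t. 0 < t \<and> t \<le> 1 \<longrightarrow> what t \<le> ennreal C * what (t / 2)" using what_doubling by blast
  have C: "what 1 \<le> ennreal C * what (1 / 2)" using C1[rule_format, of 1] by simp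
  have "(\<integral>\<^sup>+u. ennreal (norm (\<omega> u)) \<partial>dA) < \<infinity>"
    using radial_weightD(2)[OF radial] by (simp add: integrable_iff_bounded)
  moreover have "(\<integral>\<^sup>+u. ennreal (norm (\<omega> u)) \<partial>dA) = (\<integral>\<^sup>+u. 1 \<partial>weight_measure \<omega>)"
  proof -
    have "(\<integral>\<^sup>+u. 1 \<partial>weight_measure \<omega>) = (\<integral>\<^sup>+u. ennreal (\<omega> u) \<partial>dA)"
      unfolding weight_measure_def using radial_weightD(5)[OF radial]
      by (subst nn_integral_density) auto
    also have "\<dots> = (\<integral>\<^sup>+u. ennreal (norm (\<omega> u)) \<partial>dA)"
      using radial_weightD(1)[OF radial] by (intro nn_integral_cong) auto
    finally show ?thesis by simp
  qed
  ultimately have fin: "(\<integral>\<^sup>+u. 1 \<partial>wA) < \<infinity>"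
    using nn_integral_weight_measure[of "\<lambda>_. 1"] by simp
  have "what (1 / 2) \<le> (\<integral>\<^sup>+s. ennreal (2 * pi) * (profile s * ennreal s * indicator {0<..<1} s) \<partial>lborel)"
    unfolding what_def
  proof (rule nn_integral_mono)
    fix s :: real
    show "profile s * indicator {1 - 1 / 2..<1} s \<le> ennreal (2 * pi) * (profile s * ennreal s * indicator {0<..<1} s)"
    proof (cases "s \<in> {1 - 1 / 2..<1}")
      case True
      have "1 * 1 \<le> 2 * pi * s" 
        using True pi_ge_two by (intro order_trans[OF _ mult_mono[of 4 "2 * pi" "1/2" s]]) auto
      then have "1 \<le> ennreal (2 * pi * s)" by simp
      then have "profile s * 1 \<le> profile s * ennreal (2 * pi * s)" by (intro mult_left_mono) auto
      then show ?thesis using True by (simp add: ennreal_mult mult_ac)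
    qed auto
  qed
  also have "\<dots> = (\<integral>\<^sup>+u. 1 \<partial>wA)"
    by (subst nn_integral_wA_radial) simp_all
  finally have "what (1 / 2) < \<infinity>" using fin by (rule order_le_less_trans)
  then have "what 1 < \<infinity>" using C by (auto simp: ennreal_mult_less_top intro: order_le_less_trans)
  then show ?thesis using what_mono[OF assms] by (rule order_le_less_trans[rotated])
qed

text \<open>If the tail vanished at t, doubling would carry the zero from a scale 2^(-j) below t up
  to scale 1, and the weight would be 0 almost everywhere.\<close>

lemma what_pos:
  assumes "0 < t" "t \<le> 1" shows "0 < what t"
proof (rule ccontr)
  assume "\<not> 0 < what t"
  then have z: "what t = 0" by (simp add: zero_less_iff_neq_zero)
  obtain C where C: "\<And>t. 0 < t \<Longrightarrow> t \<le> 1 \<Longrightarrow> what t \<le> ennreal C * what (t / 2)" using what_doubling by blast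
  obtain j :: nat where j: "1 / 2 ^ j < t"
    using assms real_arch_pow_inv[of t "1/2"] by (auto simp: power_divide)
  have "what (1 / 2 ^ i) = 0" if "i \<le> j" for i
    using that
  proof (induction i rule: inc_induct)
    case base
    have "what (1 / 2 ^ j) \<le> what t" using j by (intro what_mono) simp
    then show ?case using z by simp
  next
    case (step n)
    have "what (1 / 2 ^ n) \<le> ennreal C * what (1 / 2 ^ n / 2)" by (intro C) (auto simp: divide_simps)
    also have "(1::real) / 2 ^ n / 2 = 1 / 2 ^ Suc n" by simp
    finally show ?case unfolding step.IH by simp
  qed
  from this[of 0] have w1: "what 1 = 0" by simp
  have "(\<integral>\<^sup>+u. ennreal (\<omega> u) \<partial>dA) = (\<integral>\<^sup>+u. 1 \<partial>weight_measure \<omega>)"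
    unfolding weight_measure_def using radial_weightD(5)[OF radial]
    by (subst nn_integral_density) auto
  also have "\<dots> = (\<integral>\<^sup>+u. 1 \<partial>wA)" by (rule nn_integral_weight_measure) simp
  also have "\<dots> = (\<integral>\<^sup>+s. ennreal (2 * pi) * (profile s * ennreal s * indicator {0<..<1} s) \<partial>lborel)"
    by (subst nn_integral_wA_radial) simp_all
  also have "\<dots> \<le> (\<integral>\<^sup>+s. ennreal (2 * pi) * (profile s * indicator {1 - 1..<1} s) \<partial>lborel)"
  proof (intro nn_integral_mono mult_left_mono)
    fix s :: real
    show "profile s * ennreal s * indicator {0<..<1} s \<le> profile s * indicator {1 - 1..<1} s"
      using mult_left_mono[of "ennreal s" 1 "profile s"] by (auto split: split_indicator)
  qed simp
  also have "\<dots> = 0" using w1 by (simp add: what_def nn_integral_cmult)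
  finally have "AE u in dA. ennreal (\<omega> u) = 0"
    using radial_weightD(5)[OF radial] by (subst (asm) le_zero_eq, subst (asm) nn_integral_0_iff_AE) auto
  then have "AE u in dA. \<omega> u = 0"
    by (elim AE_mp, intro AE_I2) (use radial_weightD(1)[OF radial] in \<open>auto simp: ennreal_eq_0_iff intro: antisym\<close>)
  then show False using radial_weightD(3)[OF radial] by blast
qed

definition W :: "real \<Rightarrow> real"
  where "W t = enn2real (what t)"

lemma what_eq_W: "t \<le> 1 \<Longrightarrow> what t = ennreal (W t)"
  using what_finite[of t] by (simp add: W_def less_top)

lemma W_nonneg [simp]: "0 \<le> W t"
  by (simp add: W_def)

lemma W_pos: "0 < t \<Longrightarrow> t \<le> 1 \<Longrightarrow> 0 < W t"
  using what_pos[of t] what_finite[of t] by (simp add: W_def enn2real_positive_iff less_top)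

lemma W_mono: "s \<le> t \<Longrightarrow> t \<le> 1 \<Longrightarrow> W s \<le> W t"
  using what_mono[of s t] what_eq_W[of s] what_eq_W[of t] by simp

lemma W_doubling: "\<exists>C\<ge>1. \<forall>t. 0 < t \<and> t \<le> 1 \<longrightarrow> W t \<le> C * W (t / 2)"
proof -
  obtain C where C: "C \<ge> 1" "\<And>t. 0 < t \<Longrightarrow> t \<le> 1 \<Longrightarrow> what t \<le> ennreal C * what (t / 2)"
    using what_doubling by blast
  have "W t \<le> C * W (t / 2)" if "0 < t" "t \<le> 1" for t
  proof -
    have "ennreal (W t) \<le> ennreal (C * W (t / 2))"
      using C(2)[OF that] C(1) that by (simp add: what_eq_W ennreal_mult)
    then show ?thesis using C(1) by simp
  qed
  then show ?thesis using C(1) by blast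
qed

lemma W_check: "\<exists>K>1. \<exists>C>1. \<forall>t. 0 < t \<and> t \<le> 1 \<longrightarrow> C * W (t / K) \<le> W t"
proof -
  obtain K C where KC: "K > 1" "C > 1" and le: "\<And>r::real. 0 \<le> r \<Longrightarrow> r < 1 \<Longrightarrow>
      ennreal C * omega_hat \<omega> (complex_of_real (1 - (1 - r) / K)) \<le> omega_hat \<omega> (complex_of_real r)"
    using D_class unfolding D_class_def D_check_def by auto
  have "C * W (t / K) \<le> W t" if t: "0 < t" "t \<le> 1" for t
  proof -
    have tK: "0 < t / K" "t / K \<le> 1" using t KC by (auto simp: divide_simps)
    have "ennreal C * omega_hat \<omega> (complex_of_real (1 - t / K)) \<le> omega_hat \<omega> (complex_of_real (1 - t))"
      using le[of "1 - t"] t by simp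
    moreover have "omega_hat \<omega> (complex_of_real (1 - t / K)) = ennreal (W (t / K))"
      using omega_hat_real[of "1 - t / K"] tK what_eq_W[of "t / K"] by simp
    moreover have "omega_hat \<omega> (complex_of_real (1 - t)) = ennreal (W t)"
      using omega_hat_real[of "1 - t"] t what_eq_W[of t] by simp
    ultimately have "ennreal (C * W (t / K)) \<le> ennreal (W t)" using KC by (simp add: ennreal_mult)
    then show ?thesis by simp
  qed
  then show ?thesis using KC by blast
qed

text \<open>Iterated doubling turns the doubling constant C into the power \<beta> = log 2
  C.\<close>

lemma W_upper: "\<exists>C\<ge>1. \<exists>\<beta>\<ge>0. \<forall>s t. 0 < s \<and> s \<le> t \<and> t \<le> 1 \<longrightarrow> W t \<le> C * (t / s) powr \<beta> * W s"
proof -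
  obtain C where C: "C \<ge> 1" and d: "\<And>t. 0 < t \<Longrightarrow> t \<le> 1 \<Longrightarrow> W t \<le> C * W (t / 2)"
    using W_doubling by blast
  define \<beta> where "\<beta> = log 2 C"
  have \<beta>: "\<beta> \<ge> 0" using C by (simp add: \<beta>_def)
  have C\<beta>: "C = 2 powr \<beta>" using C by (simp add: \<beta>_def)
  have it: "W t \<le> C ^ n * W (t / 2 ^ n)" if "0 < t" "t \<le> 1" for t n
  proof (induction n)
    case (Suc n)
    have "t / 2 ^ n \<le> 1" using that by (simp add: divide_simps) (meson one_le_power one_le_numeral order_trans)
    then have "W (t / 2 ^ n) \<le> C * W (t / 2 ^ n / 2)" using that by (intro d) auto
    then have "C ^ n * W (t / 2 ^ n) \<le> C ^ n * (C * W (t / 2 ^ n / 2))" using C by (intro mult_left_mono) auto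
    then show ?case using Suc by (simp add: mult_ac)
  qed simp
  have "W t \<le> C * (t / s) powr \<beta> * W s" if st: "0 < s" "s \<le> t" "t \<le> 1" for s t
  proof -
    obtain j :: nat where j: "t / 2 ^ Suc j \<le> s" "s \<le> t / 2 ^ j"
      using geometric_lower_layer[OF st(1,2), of 2] by auto
    have "W t \<le> C ^ Suc j * W (t / 2 ^ Suc j)" using st by (intro it) auto
    also have "\<dots> \<le> C ^ Suc j * W s" using j st C by (intro mult_left_mono W_mono) auto
    also have "C ^ Suc j = C * (2 ^ j) powr \<beta>"
      by (simp add: C\<beta> powr_realpow[symmetric] powr_powr mult.commute)
    also have "C * (2 ^ j) powr \<beta> * W s \<le> C * (t / s) powr \<beta> * W s"
      using j st C \<beta> by (intro mult_right_mono mult_left_mono powr_mono2) (auto simp: field_simps)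
    finally show ?thesis .
  qed
  then show ?thesis using C \<beta> by blast
qed

text \<open>A decay exponent of \<open>W\<close>, fixed once for the locale because later exponents
  \<eta> have to stay below it. It exists by iterating the condition of \<open>D_check\<close>,
  which gives log K C.\<close>

definition alpha :: real
  where "alpha = (SOME \<alpha>. \<alpha> > 0 \<and> (\<exists>C\<ge>1. \<forall>s t. 0 < s \<and> s \<le> t \<and> t \<le> 1 \<longrightarrow> W s \<le> C * (s / t) powr \<alpha> * W t))"

lemma alpha_pos: "alpha > 0"
  and W_lower: "\<exists>C\<ge>1. \<forall>s t. 0 < s \<and> s \<le> t \<and> t \<le> 1 \<longrightarrow> W s \<le> C * (s / t) powr alpha * W t"
proof -
  have "\<exists>\<alpha>. \<alpha> > 0 \<and> (\<exists>C\<ge>1. \<forall>s t. 0 < s \<and> s \<le> t \<and> t \<le> 1 \<longrightarrow> W s \<le> C * (s / t) powr \<alpha> * W t)"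
  proof -
    obtain K C where KC: "K > 1" "C > 1" and d: "\<And>t. 0 < t \<Longrightarrow> t \<le> 1 \<Longrightarrow> C * W (t / K) \<le> W t"
      using W_check by blast
    define \<alpha> where "\<alpha> = log K C"
    have \<alpha>: "\<alpha> > 0" using KC by (simp add: \<alpha>_def)
    have C\<alpha>: "C = K powr \<alpha>" using KC by (simp add: \<alpha>_def)
    have it: "C ^ n * W (t / K ^ n) \<le> W t" if t: "0 < t" "t \<le> 1" for t n
    proof (induction n)
      case (Suc n)
      have "1 \<le> K ^ n" using KC by simp
      then have "t / K ^ n \<le> 1" "0 < t / K ^ n" using t by (auto simp: divide_simps)
      then have "C * W (t / K ^ n / K) \<le> W (t / K ^ n)" by (intro d)
      then have "C ^ n * (C * W (t / K ^ n / K)) \<le> C ^ n * W (t / K ^ n)" using KC by (intro mult_left_mono) auto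
      then show ?case using Suc by (simp add: mult_ac)
    qed simp
    have "W s \<le> C * (s / t) powr \<alpha> * W t" if st: "0 < s" "s \<le> t" "t \<le> 1" for s t
    proof -
      obtain j :: nat where j: "t / K ^ Suc j \<le> s" "s \<le> t / K ^ j"
        using geometric_lower_layer[OF st(1,2) KC(1)] by auto
      have Kj: "1 \<le> K ^ j" using KC by simp
      have tj: "t / K ^ j \<le> t" "t \<le> K ^ j" using st Kj by (auto simp: divide_simps)
      have "C ^ j * W s \<le> C ^ j * W (t / K ^ j)"
        using j st KC tj by (intro mult_left_mono W_mono) auto
      also have "\<dots> \<le> W t" using st by (intro it) auto
      finally have le: "C ^ j * W s \<le> W t" .
      have "1 / C ^ Suc j = (1 / K ^ Suc j) powr \<alpha>"
        using KC by (simp add: C\<alpha> powr_realpow[symmetric] powr_powr powr_divide powr_mult mult.commute powr_add[symmetric])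
      also have "\<dots> \<le> (s / t) powr \<alpha>"
        using j st KC \<alpha> by (intro powr_mono2) (auto simp: field_simps)
      finally have "1 / C ^ Suc j * (C * W t) \<le> (s / t) powr \<alpha> * (C * W t)"
        using KC by (intro mult_right_mono) auto
      moreover have "W s \<le> 1 / C ^ Suc j * (C * W t)" using le KC by (simp add: field_simps)
      ultimately show ?thesis by (simp add: mult_ac)
    qed
    then show ?thesis using \<alpha> KC(2) less_imp_le by blast
  qed
  from someI_ex[OF this] show "alpha > 0"
    "\<exists>C\<ge>1. \<forall>s t. 0 < s \<and> s \<le> t \<and> t \<le> 1 \<longrightarrow> W s \<le> C * (s / t) powr alpha * W t"
    unfolding alpha_def by auto
qed

section \<open>Kernel integrals against the weight\<close>

lemma wA_mass:
  assumes z: "z \<in> unit_disc" and x: "x > 0" and y: "y \<le> 1"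
  shows "(\<integral>\<^sup>+u. indicator {..x} (kdist z u) * indicator {..y} (bdist u) \<partial>wA) \<le> ennreal (12 * pi * x * W y)"
proof -
  have [measurable]: "cis \<in> borel_measurable borel"
    by (intro borel_measurable_continuous_onI continuous_intros)
  have "(\<integral>\<^sup>+u. indicator {..x} (kdist z u) * indicator {..y} (bdist u) \<partial>wA) =
    (\<integral>\<^sup>+s. (\<integral>\<^sup>+t. indicator {..x} (kdist z (of_real s * cis t)) * indicator {..y} (bdist (of_real s * cis t)) * indicator angles t \<partial>lborel) *
     (profile s * ennreal s * indicator {0<..<1} s) \<partial>lborel)"
    by (rule nn_integral_wA_radial) measurable
  \<comment> \<open>For each radius the angles contribute at most 12 pi x; the radii then contribute
    W y.\<close>
  also have "\<dots> \<le> (\<integral>\<^sup>+s. ennreal (12 * pi * x) * (profile s * indicator {1 - y..<1} s) \<partial>lborel)"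
  proof (rule nn_integral_mono)
    fix s :: real
    show "(\<integral>\<^sup>+t. indicator {..x} (kdist z (of_real s * cis t)) * indicator {..y} (bdist (of_real s * cis t)) * indicator angles t \<partial>lborel) *
     (profile s * ennreal s * indicator {0<..<1} s) \<le> ennreal (12 * pi * x) * (profile s * indicator {1 - y..<1} s)"
    proof (cases "0 < s \<and> s < 1")
      case True
      have bs: "bdist (of_real s * cis t) = 1 - s" for t using True by (simp add: bdist_def norm_mult)
      show ?thesis
      proof (cases "1 - y \<le> s")
        case y: True
        have "(\<integral>\<^sup>+t. indicator {..x} (kdist z (of_real s * cis t)) * indicator {..y} (bdist (of_real s * cis t)) * indicator angles t \<partial>lborel)
          \<le> (\<integral>\<^sup>+t. indicator {t \<in> angles. kdist z (of_real s * cis t) \<le> x} t \<partial>lborel)"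
          by (intro nn_integral_mono) (auto simp: indicator_def)
        also have "\<dots> = emeasure lborel {t \<in> angles. kdist z (of_real s * cis t) \<le> x}"
          by (intro nn_integral_indicator) measurable
        also have "\<dots> \<le> ennreal (12 * pi * x)"
          using True by (intro emeasure_kdist_angle[OF z _ _ x]) auto
        finally have 1: "(\<integral>\<^sup>+t. indicator {..x} (kdist z (of_real s * cis t)) * indicator {..y} (bdist (of_real s * cis t)) * indicator angles t \<partial>lborel) \<le> ennreal (12 * pi * x)" .
        have "profile s * ennreal s \<le> profile s * 1" using True by (intro mult_left_mono) auto
        then show ?thesis using True y by (intro mult_mono[OF 1]) auto
      next
        case False
        then show ?thesis by (simp add: bs)
      qed
    qed simp
  qed
  also have "\<dots> = ennreal (12 * pi * x * W y)"
    using x y by (simp add: nn_integral_cmult what_def[symmetric] what_eq_W ennreal_mult)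
  finally show ?thesis .
qed

text \<open>Near the boundary the mass decays with exponent \<open>alpha\<close>, so a negative
  power of \<open>bdist\<close> of order \<eta> < \<open>alpha\<close> is integrable: the dyadic
  layers of \<open>bdist u\<close> form a geometric series of ratio 2^(\<eta> - alpha).\<close>

lemma wA_kdist_ball:
  assumes \<eta>: "0 \<le> \<eta>" "\<eta> < alpha"
  obtains C where "C > 0" "\<And>z x. z \<in> unit_disc \<Longrightarrow> x > 0 \<Longrightarrow>
    (\<integral>\<^sup>+u. indicator {..x} (kdist z u) * ennreal ((1 / bdist u) powr \<eta>) \<partial>wA) \<le>
      ennreal (C * x * min x 1 powr (- \<eta>) * W (min x 1))"
proof -
  obtain C1 where C1: "C1 \<ge> 1" and Wl: "\<And>s t. 0 < s \<Longrightarrow> s \<le> t \<Longrightarrow> t \<le> 1 \<Longrightarrow> W s \<le> C1 * (s / t) powr alpha * W t"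
    using W_lower by blast
  define r :: real where "r = 2 powr (\<eta> - alpha)"
  have r: "0 \<le> r" "r < 1" using two_powr_lt_1[of "alpha - \<eta>"] \<eta> by (auto simp: r_def)
  define C where "C = 2 powr \<eta> * (12 * pi) * C1 / (1 - r)"
  have C: "C > 0" using C1 r by (simp add: C_def)
  have "(\<integral>\<^sup>+u. indicator {..x} (kdist z u) * ennreal ((1 / bdist u) powr \<eta>) \<partial>wA) \<le>
      ennreal (C * x * min x 1 powr (- \<eta>) * W (min x 1))" if z: "z \<in> unit_disc" and x: "x > 0" for z x
  proof -
    \<comment> \<open>Points of the ball satisfy bdist u <= x, and also bdist u <= 1, which keeps
      the argument of \<open>W\<close> in the range of its estimates.\<close>
    define x0 where "x0 = min x 1"
    have x0: "0 < x0" "x0 \<le> 1" using x by (auto simp: x0_def)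
    let ?\<phi> = "\<lambda>u. indicator {..x} (kdist z u) :: ennreal"
    have "(\<integral>\<^sup>+u. ?\<phi> u * ennreal ((1 / bdist u) powr \<eta>) \<partial>wA) =
       (\<integral>\<^sup>+u. ennreal (x0 powr (- \<eta>)) * (?\<phi> u * ennreal ((x0 / bdist u) powr \<eta>) * indicator {..x0} (bdist u)) \<partial>wA)"
    proof (rule nn_integral_cong)
      fix u assume "u \<in> space wA"
      then have u: "u \<in> unit_disc" by simp
      have "bdist u \<le> x0" if "kdist z u \<le> x"
        using that bdist_le_kdist'[OF z u] bdist_le_1[of u] by (simp add: x0_def)
      moreover have "(1 / bdist u) powr \<eta> = x0 powr (- \<eta>) * (x0 / bdist u) powr \<eta>"
        using x0 bdist_pos[OF u] by (simp add: powr_divide powr_minus field_simps)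
      ultimately show "?\<phi> u * ennreal ((1 / bdist u) powr \<eta>) = ennreal (x0 powr (- \<eta>)) * (?\<phi> u * ennreal ((x0 / bdist u) powr \<eta>) * indicator {..x0} (bdist u))"
        by (auto simp: indicator_def ennreal_mult)
    qed
    also have "\<dots> = ennreal (x0 powr (- \<eta>)) * (\<integral>\<^sup>+u. ?\<phi> u * ennreal ((x0 / bdist u) powr \<eta>) * indicator {..x0} (bdist u) \<partial>wA)"
      by (rule nn_integral_cmult) measurable
    also have "(\<integral>\<^sup>+u. ?\<phi> u * ennreal ((x0 / bdist u) powr \<eta>) * indicator {..x0} (bdist u) \<partial>wA) \<le>
       (\<Sum>j. ennreal (2 powr (\<eta> * real (Suc j))) * (\<integral>\<^sup>+u. ?\<phi> u * indicator {..x0 / 2 ^ j} (bdist u) \<partial>wA))"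
      using x0 \<eta> by (intro nn_integral_lower_layers) (auto simp: bdist_pos)
    also have "\<dots> \<le> ennreal (2 powr \<eta> * (12 * pi) * C1 * x * W x0 / (1 - r))"
    proof (rule suminf_ennreal_le_geometric)
      fix j :: nat
      have "1 \<le> (2::real) ^ j" by simp
      then have le1: "x0 / 2 ^ j \<le> x0" "x0 \<le> 2 ^ j" using x0 by (simp add: divide_simps, linarith)
      have "(\<integral>\<^sup>+u. ?\<phi> u * indicator {..x0 / 2 ^ j} (bdist u) \<partial>wA) \<le> ennreal (12 * pi * x * W (x0 / 2 ^ j))"
        using le1 x0 by (intro wA_mass z x) auto
      also have "\<dots> \<le> ennreal (12 * pi * x * (C1 * (x0 / 2 ^ j / x0) powr alpha * W x0))"
        using x0 x le1 by (intro ennreal_leI mult_left_mono Wl) auto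
      also have "(x0 / 2 ^ j / x0) powr alpha = (2 powr (- alpha)) ^ j"
        using x0 by (simp add: powr_divide powr_minus powr_realpow[symmetric] powr_powr field_simps)
      finally have "ennreal (2 powr (\<eta> * real (Suc j))) * (\<integral>\<^sup>+u. ?\<phi> u * indicator {..x0 / 2 ^ j} (bdist u) \<partial>wA) \<le>
         ennreal (2 powr (\<eta> * real (Suc j))) * ennreal (12 * pi * x * (C1 * (2 powr (- alpha)) ^ j * W x0))"
        by (rule mult_left_mono) simp
      also have "\<dots> = ennreal (2 powr (\<eta> * real (Suc j)) * (12 * pi * x * (C1 * (2 powr (- alpha)) ^ j * W x0)))"
        using x C1 by (intro ennreal_mult[symmetric]) auto
      also have "2 powr (\<eta> * real (Suc j)) * (12 * pi * x * (C1 * (2 powr (- alpha)) ^ j * W x0)) =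
          2 powr \<eta> * (12 * pi) * C1 * x * W x0 * r ^ j"
      proof -
        have "r ^ j = (2 powr \<eta>) ^ j * (2 powr (- alpha)) ^ j"
          by (simp add: r_def power_mult_distrib[symmetric] powr_add[symmetric])
        moreover have "2 powr (\<eta> * real (Suc j)) = 2 powr \<eta> * (2 powr \<eta>) ^ j"
          by (simp only: powr_mult_nat power_Suc)
        ultimately show ?thesis by (simp only: mult_ac)
      qed
      finally show "ennreal (2 powr (\<eta> * real (Suc j))) * (\<integral>\<^sup>+u. ?\<phi> u * indicator {..x0 / 2 ^ j} (bdist u) \<partial>wA) \<le>
        ennreal (2 powr \<eta> * (12 * pi) * C1 * x * W x0 * r ^ j)" .
    qed (use r x C1 in auto)
    also have "2 powr \<eta> * (12 * pi) * C1 * x * W x0 / (1 - r) = C * x * W x0" by (simp add: C_def)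
    finally have "(\<integral>\<^sup>+u. ?\<phi> u * ennreal ((1 / bdist u) powr \<eta>) \<partial>wA) \<le> ennreal (x0 powr (- \<eta>)) * ennreal (C * x * W x0)"
      by (simp add: mult_left_mono)
    also have "\<dots> = ennreal (C * x * x0 powr (- \<eta>) * W x0)"
      using C x by (simp add: ennreal_mult[symmetric] mult_ac del: ennreal_mult)
    finally show ?thesis by (simp add: x0_def)
  qed
  then show ?thesis using that C by blast
qed

text \<open>The mass of a ball of radius x <= 1 about z is at most of order x * W x, and W x exceeds
  W (bdist z) by at most the order (x / bdist z)^\<beta>. A high power of the kernel beats this
  growth.\<close>

lemma wA_kratio_full:
  assumes \<eta>: "0 \<le> \<eta>" "\<eta> < alpha"
  obtains M0 C where "M0 > 0" "C > 0" "\<And>M z. M \<ge> M0 \<Longrightarrow> z \<in> unit_disc \<Longrightarrow>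
    (\<integral>\<^sup>+u. ennreal (kratio z u powr M * (bdist z / bdist u) powr \<eta>) \<partial>wA) \<le> ennreal (C * (bdist z * W (bdist z)))"
proof -
  obtain C1 \<beta> where C1: "C1 \<ge> 1" "\<beta> \<ge> 0" and Wu: "\<And>s t. 0 < s \<Longrightarrow> s \<le> t \<Longrightarrow> t \<le> 1 \<Longrightarrow> W t \<le> C1 * (t / s) powr \<beta> * W s"
    using W_upper by blast
  obtain C2 where C2: "C2 > 0" and ball: "\<And>z x. z \<in> unit_disc \<Longrightarrow> x > 0 \<Longrightarrow>
    (\<integral>\<^sup>+u. indicator {..x} (kdist z u) * ennreal ((1 / bdist u) powr \<eta>) \<partial>wA) \<le>
      ennreal (C2 * x * min x 1 powr (- \<eta>) * W (min x 1))"
    using wA_kdist_ball[OF \<eta>] by blast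
  \<comment> \<open>\<beta> for the growth of \<open>W\<close>, 1 for the radius of the ball, and 1
    more so that the series has ratio 1 / 2.\<close>
  define M0 where "M0 = 2 + \<beta>"
  define C where "C = 2 * (C2 * 2 * C1 * 2 powr \<beta>)"
  have C: "C > 0" using C1 C2 by (simp add: C_def)
  have M0: "M0 > 0" using C1 by (simp add: M0_def)
  have "(\<integral>\<^sup>+u. ennreal (kratio z u powr M * (bdist z / bdist u) powr \<eta>) \<partial>wA) \<le> ennreal (C * (bdist z * W (bdist z)))"
    if M: "M \<ge> M0" and z: "z \<in> unit_disc" for M z
  proof -
    have h: "bdist z > 0" by (rule bdist_pos[OF z])
    have h1: "bdist z \<le> 1" by (rule bdist_le_1)
    let ?\<phi> = "\<lambda>u. ennreal ((bdist z / bdist u) powr \<eta>)"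
    have "(\<integral>\<^sup>+u. ennreal (kratio z u powr M * (bdist z / bdist u) powr \<eta>) \<partial>wA) \<le>
       (\<integral>\<^sup>+u. ?\<phi> u * ennreal ((bdist z / kdist z u) powr M0) \<partial>wA)"
    proof (rule nn_integral_mono)
      fix u assume "u \<in> space wA"
      then have u: "u \<in> unit_disc" by simp
      have "kratio z u powr M \<le> kratio z u powr M0"
        using kratio_pos[OF z u] kratio_le_1[OF z u] M by (intro powr_mono') auto
      then have "(bdist z / bdist u) powr \<eta> * kratio z u powr M \<le> (bdist z / bdist u) powr \<eta> * kratio z u powr M0"
        by (intro mult_left_mono) auto
      then have "kratio z u powr M * (bdist z / bdist u) powr \<eta> \<le> (bdist z / bdist u) powr \<eta> * (bdist z / kdist z u) powr M0"
        by (simp add: kratio_def mult.commute)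
      then show "ennreal (kratio z u powr M * (bdist z / bdist u) powr \<eta>) \<le> ?\<phi> u * ennreal ((bdist z / kdist z u) powr M0)"
        by (simp add: ennreal_mult[symmetric] ennreal_leI del: ennreal_mult)
    qed
    also have "\<dots> \<le> (\<Sum>j. ennreal (2 powr (- M0 * real j)) * (\<integral>\<^sup>+u. ?\<phi> u * indicator {..2 ^ Suc j * bdist z} (kdist z u) \<partial>wA))"
      using M0 h z by (intro nn_integral_upper_layers) (auto simp: bdist_le_kdist)
    also have "\<dots> \<le> ennreal (C2 * 2 * C1 * 2 powr \<beta> * (bdist z * W (bdist z)) / (1 - 1 / 2))"
    proof (rule suminf_ennreal_le_geometric)
      fix j :: nat
      define x where "x = 2 ^ Suc j * bdist z"
      define m where "m = min x 1"
      have "1 * bdist z \<le> x" unfolding x_def using h by (intro mult_right_mono) (auto simp: one_le_power simp del: power_Suc)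
      then have x: "x > 0" "bdist z \<le> m" "m \<le> x" "m \<le> 1" using h h1 by (auto simp: m_def)
      have "(\<integral>\<^sup>+u. ?\<phi> u * indicator {..2 ^ Suc j * bdist z} (kdist z u) \<partial>wA) =
         (\<integral>\<^sup>+u. ennreal (bdist z powr \<eta>) * (indicator {..x} (kdist z u) * ennreal ((1 / bdist u) powr \<eta>)) \<partial>wA)"
      proof (rule nn_integral_cong)
        fix u assume "u \<in> space wA"
        then have u: "u \<in> unit_disc" by simp
        have "(bdist z / bdist u) powr \<eta> = bdist z powr \<eta> * (1 / bdist u) powr \<eta>"
          using h bdist_pos[OF u] by (simp add: powr_divide)
        then show "?\<phi> u * indicator {..2 ^ Suc j * bdist z} (kdist z u) =
          ennreal (bdist z powr \<eta>) * (indicator {..x} (kdist z u) * ennreal ((1 / bdist u) powr \<eta>))"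
          by (simp add: x_def ennreal_mult mult_ac)
      qed
      also have "\<dots> = ennreal (bdist z powr \<eta>) * (\<integral>\<^sup>+u. indicator {..x} (kdist z u) * ennreal ((1 / bdist u) powr \<eta>) \<partial>wA)"
        by (rule nn_integral_cmult) measurable
      also have "\<dots> \<le> ennreal (bdist z powr \<eta>) * ennreal (C2 * x * m powr (- \<eta>) * W m)"
        unfolding m_def by (intro mult_left_mono ball z x) simp
      also have "\<dots> = ennreal (bdist z powr \<eta> * (C2 * x * m powr (- \<eta>) * W m))"
        using C2 x by (intro ennreal_mult[symmetric]) auto
      also have "\<dots> \<le> ennreal (bdist z powr \<eta> * (C2 * x * bdist z powr (- \<eta>) * (C1 * (x / bdist z) powr \<beta> * W (bdist z))))"
      proof (intro ennreal_leI mult_left_mono mult_mono)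
        show "m powr (- \<eta>) \<le> bdist z powr (- \<eta>)" using x h \<eta> by (intro powr_mono2') auto
        have "W m \<le> C1 * (m / bdist z) powr \<beta> * W (bdist z)" using h x by (intro Wu) auto
        also have "\<dots> \<le> C1 * (x / bdist z) powr \<beta> * W (bdist z)"
          using h x C1 by (intro mult_right_mono mult_left_mono powr_mono2 divide_right_mono) auto
        finally show "W m \<le> C1 * (x / bdist z) powr \<beta> * W (bdist z)" .
      qed (use C1 C2 x h in auto)
      also have "bdist z powr \<eta> * (C2 * x * bdist z powr (- \<eta>) * (C1 * (x / bdist z) powr \<beta> * W (bdist z))) =
         C2 * C1 * W (bdist z) * x * (x / bdist z) powr \<beta>"
        using h by (simp add: powr_minus field_simps)
      also have "x / bdist z = 2 ^ Suc j" using h by (simp add: x_def)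
      finally have "ennreal (2 powr (- M0 * real j)) * (\<integral>\<^sup>+u. ?\<phi> u * indicator {..2 ^ Suc j * bdist z} (kdist z u) \<partial>wA) \<le>
         ennreal (2 powr (- M0 * real j)) * ennreal (C2 * C1 * W (bdist z) * x * (2 ^ Suc j) powr \<beta>)"
        by (rule mult_left_mono) simp
      also have "\<dots> = ennreal (2 powr (- M0 * real j) * (C2 * C1 * W (bdist z) * x * (2 ^ Suc j) powr \<beta>))"
        using C1 C2 x by (intro ennreal_mult[symmetric]) auto
      also have "2 powr (- M0 * real j) * (C2 * C1 * W (bdist z) * x * (2 ^ Suc j) powr \<beta>) =
         C2 * 2 * C1 * 2 powr \<beta> * (bdist z * W (bdist z)) * (1 / 2) ^ j"
      proof -
        have "(2 ^ Suc j) powr \<beta> = 2 powr \<beta> * (2 powr \<beta>) ^ j"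
          by (simp add: powr_mult powr_realpow[symmetric] powr_powr mult.commute)
        moreover have "2 powr (- M0 * real j) * 2 ^ j * (2 powr \<beta>) ^ j = (1 / 2) ^ j"
        proof -
          have q: "2 powr (- M0) * 2 * 2 powr \<beta> = (1 / 2 :: real)"
          proof -
            have "2 powr (- M0) * 2 * 2 powr \<beta> = 2 powr (- M0) * 2 powr 1 * (2 powr \<beta> :: real)" by simp
            also have "\<dots> = 2 powr (- 1)" unfolding powr_add[symmetric] by (simp add: M0_def)
            finally show ?thesis by (simp add: powr_minus_divide)
          qed
          show ?thesis unfolding powr_minus_mult_nat power_mult_distrib[symmetric] q ..
        qed
        ultimately show ?thesis by (simp add: x_def mult_ac)
      qed
      finally show "ennreal (2 powr (- M0 * real j)) * (\<integral>\<^sup>+u. ?\<phi> u * indicator {..2 ^ Suc j * bdist z} (kdist z u) \<partial>wA) \<le>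
         ennreal (C2 * 2 * C1 * 2 powr \<beta> * (bdist z * W (bdist z)) * (1 / 2) ^ j)" .
    qed (use C1 C2 h in auto)
    also have "C2 * 2 * C1 * 2 powr \<beta> * (bdist z * W (bdist z)) / (1 - 1 / 2) = C * (bdist z * W (bdist z))"
      by (simp add: C_def)
    finally show ?thesis .
  qed
  then show ?thesis using that M0 C by blast
qed

text \<open>The exponent 1 + alpha - \<eta> exceeds 1, which is what the Carleson sums over the
  lattice require. If bdist z <= bdist b, part of the kernel power is turned into
  \<open>kratio b z\<close> and the rest is integrated over the disc. If bdist b < bdist z, the
  kernel on the small ball is bounded by a multiple of (bdist z / kdist b z)^\<gamma>, and
  \<open>W\<close> at scale bdist b is smaller than at scale bdist z by (bdist b / bdist
  z)^alpha.\<close>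

lemma wA_kratio_local:
  assumes \<eta>: "0 \<le> \<eta>" "\<eta> < alpha"
  obtains M0 C where "M0 > 0" "C > 0" "\<And>M z b. M \<ge> M0 \<Longrightarrow> z \<in> unit_disc \<Longrightarrow> b \<in> unit_disc \<Longrightarrow>
    (\<integral>\<^sup>+u. indicator {..5 / 2 * bdist b} (kdist b u) * ennreal (kratio z u powr M * (bdist z / bdist u) powr \<eta>) \<partial>wA)
      \<le> ennreal (C * (bdist z * W (bdist z)) * kratio b z powr (1 + alpha - \<eta>))"
proof -
  obtain C1 \<beta> where C1: "C1 \<ge> 1" "\<beta> \<ge> 0" and Wu: "\<And>s t. 0 < s \<Longrightarrow> s \<le> t \<Longrightarrow> t \<le> 1 \<Longrightarrow> W t \<le> C1 * (t / s) powr \<beta> * W s"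
    using W_upper by blast
  obtain C4 where C4: "C4 \<ge> 1" and Wl: "\<And>s t. 0 < s \<Longrightarrow> s \<le> t \<Longrightarrow> t \<le> 1 \<Longrightarrow> W s \<le> C4 * (s / t) powr alpha * W t"
    using W_lower by blast
  obtain C2 where C2: "C2 > 0" and ball: "\<And>z x. z \<in> unit_disc \<Longrightarrow> x > 0 \<Longrightarrow>
    (\<integral>\<^sup>+u. indicator {..x} (kdist z u) * ennreal ((1 / bdist u) powr \<eta>) \<partial>wA) \<le>
      ennreal (C2 * x * min x 1 powr (- \<eta>) * W (min x 1))"
    using wA_kdist_ball[OF \<eta>] by blast
  obtain M1 C3 where M1: "M1 > 0" and C3: "C3 > 0" and full: "\<And>M z. M \<ge> M1 \<Longrightarrow> z \<in> unit_disc \<Longrightarrow>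
    (\<integral>\<^sup>+u. ennreal (kratio z u powr M * (bdist z / bdist u) powr \<eta>) \<partial>wA) \<le> ennreal (C3 * (bdist z * W (bdist z)))"
    using wA_kratio_full[OF \<eta>] by blast
  define \<gamma> where "\<gamma> = 1 + alpha - \<eta>"
  have \<gamma>: "\<gamma> > 1" using \<eta> by (simp add: \<gamma>_def)
  define M0 where "M0 = M1 + \<gamma>"
  define C5 where "C5 = (7 / 2) powr \<gamma> * (C2 * (5 / 2) * (C1 * (5 / 2) powr \<beta>) * C4)"
  define C where "C = C3 * 5 powr \<gamma> + C5"
  have C5: "C5 > 0" using C1 C2 C4 by (simp add: C5_def)
  have C: "C > 0" using C3 C5 by (simp add: C_def add_pos_pos)
  have M0: "M0 > 0" using M1 \<gamma> by (simp add: M0_def)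
  have "(\<integral>\<^sup>+u. indicator {..5 / 2 * bdist b} (kdist b u) * ennreal (kratio z u powr M * (bdist z / bdist u) powr \<eta>) \<partial>wA)
      \<le> ennreal (C * (bdist z * W (bdist z)) * kratio b z powr \<gamma>)"
    if M: "M \<ge> M0" and z: "z \<in> unit_disc" and b: "b \<in> unit_disc" for M z b
  proof -
    have hz: "bdist z > 0" and hb: "bdist b > 0" by (auto intro: bdist_pos z b)
    have kp: "kratio b z > 0" by (rule kratio_pos[OF b z])
    let ?R = "bdist z * W (bdist z)"
    have R: "?R \<ge> 0" using hz by simp
    show ?thesis
    proof (cases "bdist z \<le> bdist b")
      case True
      have "(\<integral>\<^sup>+u. indicator {..5 / 2 * bdist b} (kdist b u) * ennreal (kratio z u powr M * (bdist z / bdist u) powr \<eta>) \<partial>wA)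
        \<le> (\<integral>\<^sup>+u. ennreal ((5 * kratio b z) powr \<gamma>) * ennreal (kratio z u powr (M - \<gamma>) * (bdist z / bdist u) powr \<eta>) \<partial>wA)"
      proof (rule nn_integral_mono)
        fix u assume "u \<in> space wA"
        then have u: "u \<in> unit_disc" by simp
        show "indicator {..5 / 2 * bdist b} (kdist b u) * ennreal (kratio z u powr M * (bdist z / bdist u) powr \<eta>)
          \<le> ennreal ((5 * kratio b z) powr \<gamma>) * ennreal (kratio z u powr (M - \<gamma>) * (bdist z / bdist u) powr \<eta>)"
        proof (cases "kdist b u \<le> 5 / 2 * bdist b")
          case le: True
          have kz: "kratio z u > 0" by (rule kratio_pos[OF z u])
          have "2 / 5 \<le> kratio b u" using le kdist_pos[OF b u] by (simp add: kratio_def field_simps)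
          then have "2 / 5 * kratio z u \<le> kratio b u * kratio z u" using kz by (intro mult_right_mono) auto
          also have "\<dots> \<le> 2 * kratio b z" by (rule kratio_mult_le'[OF b z u True])
          finally have "kratio z u \<le> 5 * kratio b z" by simp
          then have "kratio z u powr \<gamma> * kratio z u powr (M - \<gamma>) \<le> (5 * kratio b z) powr \<gamma> * kratio z u powr (M - \<gamma>)"
            using kz \<gamma> by (intro mult_right_mono powr_mono2) auto
          then have "kratio z u powr M * (bdist z / bdist u) powr \<eta> \<le> (5 * kratio b z) powr \<gamma> * kratio z u powr (M - \<gamma>) * (bdist z / bdist u) powr \<eta>"
            by (intro mult_right_mono) (auto simp: powr_add[symmetric])
          then show ?thesis using le by (simp add: ennreal_mult[symmetric] mult.assoc ennreal_leI del: ennreal_mult)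
        qed simp
      qed
      also have "\<dots> = ennreal ((5 * kratio b z) powr \<gamma>) * (\<integral>\<^sup>+u. ennreal (kratio z u powr (M - \<gamma>) * (bdist z / bdist u) powr \<eta>) \<partial>wA)"
        by (rule nn_integral_cmult) measurable
      also have "\<dots> \<le> ennreal ((5 * kratio b z) powr \<gamma>) * ennreal (C3 * ?R)"
        using M by (intro mult_left_mono full z) (auto simp: M0_def)
      also have "\<dots> = ennreal ((5 * kratio b z) powr \<gamma> * (C3 * ?R))" using C3 R by (intro ennreal_mult[symmetric]) auto
      also have "\<dots> \<le> ennreal (C * ?R * kratio b z powr \<gamma>)"
      proof (rule ennreal_leI)
        have "(5 * kratio b z) powr \<gamma> * (C3 * ?R) = (C3 * 5 powr \<gamma>) * ?R * kratio b z powr \<gamma>"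
          using kp by (simp add: powr_mult)
        also have "\<dots> \<le> C * ?R * kratio b z powr \<gamma>"
          using C5 R by (intro mult_right_mono) (auto simp: C_def)
        finally show "(5 * kratio b z) powr \<gamma> * (C3 * ?R) \<le> C * ?R * kratio b z powr \<gamma>" .
      qed
      finally show ?thesis .
    next
      case False
      then have bz: "bdist b < bdist z" by simp
      define \<kappa> where "\<kappa> = bdist z / kdist b z"
      have dp: "kdist b z > 0" by (rule kdist_pos[OF b z])
      have \<kappa>: "\<kappa> > 0" using hz dp by (simp add: \<kappa>_def)
      define x where "x = 5 / 2 * bdist b"
      define m where "m = min x 1"
      have x: "x > 0" "bdist b \<le> m" "m \<le> x" "m \<le> 1" using hb bdist_le_1[of b] by (auto simp: m_def x_def)
      have "(\<integral>\<^sup>+u. indicator {..5 / 2 * bdist b} (kdist b u) * ennreal (kratio z u powr M * (bdist z / bdist u) powr \<eta>) \<partial>wA)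
        \<le> (\<integral>\<^sup>+u. ennreal ((7 / 2 * \<kappa>) powr \<gamma> * bdist z powr \<eta>) * (indicator {..x} (kdist b u) * ennreal ((1 / bdist u) powr \<eta>)) \<partial>wA)"
      proof (rule nn_integral_mono)
        fix u assume "u \<in> space wA"
        then have u: "u \<in> unit_disc" by simp
        show "indicator {..5 / 2 * bdist b} (kdist b u) * ennreal (kratio z u powr M * (bdist z / bdist u) powr \<eta>)
          \<le> ennreal ((7 / 2 * \<kappa>) powr \<gamma> * bdist z powr \<eta>) * (indicator {..x} (kdist b u) * ennreal ((1 / bdist u) powr \<eta>))"
        proof (cases "kdist b u \<le> x")
          case le: True
          have kz: "kratio z u > 0" by (rule kratio_pos[OF z u])
          have du: "kdist z u > 0" by (rule kdist_pos[OF z u])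
          have "kdist b z \<le> kdist b u + kdist u z" by (rule kdist_triangle[OF b u z])
          \<comment> \<open>7 / 2 = 5 / 2 + 1: on the ball kdist b u <= 5 / 2 * bdist b, and bdist b
            < bdist z <= kdist z u.\<close>
          also have "\<dots> \<le> 7 / 2 * kdist z u"
            using le bz bdist_le_kdist[OF z u] by (simp add: x_def kdist_commute)
          finally have "kratio z u \<le> 7 / 2 * \<kappa>" using hz du dp by (simp add: kratio_def \<kappa>_def field_simps)
          then have "kratio z u powr \<gamma> \<le> (7 / 2 * \<kappa>) powr \<gamma>" using kz \<gamma> by (intro powr_mono2) auto
          moreover have "kratio z u powr M \<le> kratio z u powr \<gamma>"
            using kz kratio_le_1[OF z u] M M1 by (intro powr_mono') (auto simp: M0_def)
          ultimately have "kratio z u powr M * (bdist z / bdist u) powr \<eta> \<le> (7 / 2 * \<kappa>) powr \<gamma> * (bdist z / bdist u) powr \<eta>"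
            by (intro mult_right_mono) auto
          moreover have "(bdist z / bdist u) powr \<eta> = bdist z powr \<eta> * (1 / bdist u) powr \<eta>"
            using hz bdist_pos[OF u] by (simp add: powr_divide)
          ultimately show ?thesis using le
            by (simp add: x_def ennreal_mult[symmetric] mult.assoc ennreal_leI del: ennreal_mult)
        qed (simp add: x_def)
      qed
      also have "\<dots> = ennreal ((7 / 2 * \<kappa>) powr \<gamma> * bdist z powr \<eta>) * (\<integral>\<^sup>+u. indicator {..x} (kdist b u) * ennreal ((1 / bdist u) powr \<eta>) \<partial>wA)"
        by (rule nn_integral_cmult) measurable
      also have "\<dots> \<le> ennreal ((7 / 2 * \<kappa>) powr \<gamma> * bdist z powr \<eta>) * ennreal (C2 * x * m powr (- \<eta>) * W m)"
        unfolding m_def by (intro mult_left_mono ball b x) simp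
      also have "\<dots> = ennreal ((7 / 2 * \<kappa>) powr \<gamma> * bdist z powr \<eta> * (C2 * x * m powr (- \<eta>) * W m))"
        using C2 x by (intro ennreal_mult[symmetric]) auto
      also have "\<dots> \<le> ennreal ((7 / 2 * \<kappa>) powr \<gamma> * bdist z powr \<eta> * (C2 * x * bdist b powr (- \<eta>) *
           (C1 * (5 / 2) powr \<beta> * (C4 * (bdist b / bdist z) powr alpha * W (bdist z)))))"
      proof (intro ennreal_leI mult_left_mono mult_mono)
        show "m powr (- \<eta>) \<le> bdist b powr (- \<eta>)" using x hb \<eta> by (intro powr_mono2') auto
        have "W m \<le> C1 * (m / bdist b) powr \<beta> * W (bdist b)" using hb x by (intro Wu) auto
        also have "\<dots> \<le> C1 * (5 / 2) powr \<beta> * W (bdist b)"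
          using hb x C1 by (intro mult_right_mono mult_left_mono powr_mono2) (auto simp: x_def field_simps)
        also have "\<dots> \<le> C1 * (5 / 2) powr \<beta> * (C4 * (bdist b / bdist z) powr alpha * W (bdist z))"
          using hb bz C1 bdist_le_1[of z] by (intro mult_left_mono Wl) auto
        finally show "W m \<le> C1 * (5 / 2) powr \<beta> * (C4 * (bdist b / bdist z) powr alpha * W (bdist z))" .
      qed (use C1 C2 C4 x hb \<kappa> in auto)
      also have "(7 / 2 * \<kappa>) powr \<gamma> * bdist z powr \<eta> * (C2 * x * bdist b powr (- \<eta>) *
           (C1 * (5 / 2) powr \<beta> * (C4 * (bdist b / bdist z) powr alpha * W (bdist z)))) = C5 * ?R * kratio b z powr \<gamma>"
      proof -
        have "kratio b z = \<kappa> * (bdist b / bdist z)" using hz by (simp add: kratio_def \<kappa>_def)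
        then have e1: "kratio b z powr \<gamma> = \<kappa> powr \<gamma> * (bdist b / bdist z) powr \<gamma>"
          by (simp only: powr_mult)
        have e2: "bdist z * (bdist b / bdist z) powr \<gamma> = bdist z powr \<eta> * bdist b * bdist b powr (- \<eta>) * (bdist b / bdist z) powr alpha"
        proof -
          have "(bdist b / bdist z) powr \<gamma> = (bdist b / bdist z) * (bdist b / bdist z) powr (- \<eta>) * (bdist b / bdist z) powr alpha"
            using hb hz by (simp add: \<gamma>_def powr_add powr_diff powr_minus field_simps)
          moreover have "(bdist b / bdist z) powr (- \<eta>) = bdist b powr (- \<eta>) * bdist z powr \<eta>"
            using hb hz by (simp add: powr_divide powr_minus field_simps)
          ultimately show ?thesis using hz by simp
        qed
        have e3: "(7 / 2 * \<kappa>) powr \<gamma> = (7 / 2) powr \<gamma> * \<kappa> powr \<gamma>" by (simp only: powr_mult)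
        have "C5 * ?R * kratio b z powr \<gamma> = C5 * W (bdist z) * \<kappa> powr \<gamma> * (bdist z * (bdist b / bdist z) powr \<gamma>)"
          unfolding e1 by (simp only: mult_ac)
        then show ?thesis unfolding e2 e3 C5_def x_def by (simp only: mult_ac)
      qed
      also have "ennreal (C5 * ?R * kratio b z powr \<gamma>) \<le> ennreal (C * ?R * kratio b z powr \<gamma>)"
        using C3 R by (intro ennreal_leI mult_right_mono) (auto simp: C_def)
      finally show ?thesis .
    qed
  qed
  then show ?thesis using that M0 C unfolding \<gamma>_def by blast
qed

end

section \<open>Pointwise estimates and test functions\<close>

lemma borel_measurable_restrict_norm_powr:
  assumes "f holomorphic_on unit_disc" "p > 0"
  shows "(\<lambda>u. cmod (f u) powr p) \<in> borel_measurable (restrict_space borel unit_disc)"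
  by (intro borel_measurable_continuous_on_restrict continuous_on_norm_powr assms)

text \<open>An integer exponent makes holomorphy immediate; real exponents reappear as n * p after
  taking moduli to the power p.\<close>

definition ker :: "nat \<Rightarrow> complex \<Rightarrow> complex \<Rightarrow> complex"
  where "ker n z u = (of_real (bdist z) / (1 - cnj z * u)) ^ n"

lemma norm_ker: "z \<in> unit_disc \<Longrightarrow> cmod (ker n z u) = kratio z u ^ n"
  using bdist_pos[of z] by (simp add: ker_def norm_power norm_divide kratio_def kdist_def)

lemma holomorphic_ker: "z \<in> unit_disc \<Longrightarrow> ker n z holomorphic_on unit_disc"
  unfolding ker_def[abs_def]
  by (intro holomorphic_intros) (use kdist_pos[of z] in \<open>force simp: kdist_def\<close>)

text \<open>Divide by a + b: on [0, 1] one has x <= x^p.\<close>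

lemma powr_add_le_add_powr:
  fixes a b p :: real
  assumes "0 \<le> a" "0 \<le> b" "0 < p" "p \<le> 1"
  shows "(a + b) powr p \<le> a powr p + b powr p"
proof (cases "a + b = 0")
  case True
  then show ?thesis by simp
next
  case False
  then have s: "a + b > 0" using assms by simp
  have le: "x / (a + b) \<le> (x / (a + b)) powr p" if "0 \<le> x" "x \<le> a + b" for x
  proof (cases "x = 0")
    case False
    have "(x / (a + b)) powr 1 \<le> (x / (a + b)) powr p"
      using that s assms by (intro powr_mono') auto
    then show ?thesis using that s False by simp
  qed simp
  have "1 = a / (a + b) + b / (a + b)" using s by (simp add: add_divide_distrib[symmetric])
  also have "\<dots> \<le> (a / (a + b)) powr p + (b / (a + b)) powr p"
    using assms by (intro add_mono le) auto
  also have "\<dots> = (a powr p + b powr p) / (a + b) powr p"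
    using assms s by (simp add: powr_divide add_divide_distrib)
  finally show ?thesis using s by (simp add: field_simps)
qed

lemma sum_powr_le_powr_sum:
  fixes x :: "'a \<Rightarrow> real"
  assumes "\<And>k. k \<in> F \<Longrightarrow> 0 \<le> x k" "0 < p" "p \<le> 1" "finite F"
  shows "(\<Sum>k\<in>F. x k) powr p \<le> (\<Sum>k\<in>F. x k powr p)"
  using assms(4,1)
proof (induction F rule: finite_induct)
  case (insert k F)
  have "(\<Sum>k\<in>insert k F. x k) powr p \<le> x k powr p + (\<Sum>k\<in>F. x k) powr p"
    using insert assms by (simp add: powr_add_le_add_powr sum_nonneg)
  then show ?case using insert by fastforce
qed simp

text \<open>A form of Hoelder's inequality. Young's inequality is applied to v k and m^(p-1), where
  m is the weighted mean of v; this is the tangent line bound at m for the convex function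
  x^p.\<close>

lemma weighted_power_mean:
  fixes l v :: "'a \<Rightarrow> real"
  assumes F: "finite F" and l: "\<And>k. k \<in> F \<Longrightarrow> 0 < l k" and v: "\<And>k. k \<in> F \<Longrightarrow> 0 \<le> v k" and p: "p > 1"
  shows "(\<Sum>k\<in>F. l k * v k) powr p \<le> (\<Sum>k\<in>F. l k) powr (p - 1) * (\<Sum>k\<in>F. l k * v k powr p)"
proof (cases "F = {}")
  case True
  then show ?thesis by simp
next
  case False
  define L where "L = (\<Sum>k\<in>F. l k)"
  define m where "m = (\<Sum>k\<in>F. l k * v k) / L"
  define q where "q = p / (p - 1)"
  have L: "L > 0" unfolding L_def using False F l by (intro sum_pos) auto
  have m: "m \<ge> 0" unfolding m_def using L l v by (intro divide_nonneg_pos sum_nonneg mult_nonneg_nonneg) (auto intro: less_imp_le)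
  have q: "q > 1" "1 / p + 1 / q = 1" "1 / q = (p - 1) / p" using p by (auto simp: q_def field_simps)
  have young: "v k * m powr (p - 1) \<le> v k powr p / p + m powr p * ((p - 1) / p)" if k: "k \<in> F" for k
  proof -
    have "v k * m powr (p - 1) \<le> v k powr p / p + (m powr (p - 1)) powr q / q"
      using p q v[OF k] by (intro Youngs_inequality) auto
    also have "(m powr (p - 1)) powr q / q = m powr p * ((p - 1) / p)"
      using p by (simp add: powr_powr q_def)
    finally show ?thesis .
  qed
  have "(\<Sum>k\<in>F. l k * (v k * m powr (p - 1))) \<le> (\<Sum>k\<in>F. l k * (v k powr p / p + m powr p * ((p - 1) / p)))"
    using young l by (intro sum_mono mult_left_mono) (auto intro: less_imp_le)
  also have "\<dots> = (\<Sum>k\<in>F. l k * v k powr p) / p + L * (m powr p * ((p - 1) / p))"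
    by (simp add: distrib_left sum.distrib sum_divide_distrib L_def sum_distrib_right)
  also have "(\<Sum>k\<in>F. l k * (v k * m powr (p - 1))) = L * m * m powr (p - 1)"
    using L by (simp add: m_def sum_distrib_right mult.assoc)
  also have "L * m * m powr (p - 1) = L * m powr p"
    using m by (cases "m = 0") (auto simp: powr_diff)
  finally have "L * m powr p \<le> (\<Sum>k\<in>F. l k * v k powr p)"
    using p by (simp add: field_simps)
  then have "L powr (p - 1) * (L * m powr p) \<le> L powr (p - 1) * (\<Sum>k\<in>F. l k * v k powr p)"
    by (intro mult_left_mono) auto
  moreover have "L powr (p - 1) * (L * m powr p) = (L * m) powr p"
    using L m by (simp add: powr_mult powr_diff)
  moreover have "L * m = (\<Sum>k\<in>F. l k * v k)" using L by (simp add: m_def)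
  ultimately show ?thesis by (simp add: L_def)
qed

text \<open>The square is the trace on the disc of the image of a compact rectangle, closed up by
  the side \<rho> = 1.\<close>

lemma carleson_square_measurable: "carleson_square a \<in> sets (restrict_space borel unit_disc)"
proof (cases "a = 0")
  case True
  then show ?thesis
    using sets.top[of "restrict_space borel unit_disc"] by (simp add: carleson_square_def space_restrict_space)
next
  case False
  let ?K = "(\<lambda>x. of_real (fst x) * cis (snd x)) ` ({cmod a..1} \<times> {Arg a - (1 - cmod a) / 2..Arg a + (1 - cmod a) / 2})"
  have "compact ?K"
    by (intro compact_continuous_image continuous_intros compact_Times) auto
  then have K: "?K \<in> sets borel" by (intro borel_closed compact_imp_closed)
  have "carleson_square a = ?K \<inter> unit_disc"
  proof (intro set_eqI iffI)
    fix u assume "u \<in> carleson_square a"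
    then obtain \<rho> t where ut: "u = of_real \<rho> * cis t" "cmod a \<le> \<rho>" "\<rho> < 1" "\<bar>t - Arg a\<bar> \<le> (1 - cmod a) / 2"
      using False by (auto simp: carleson_square_def)
    have "0 \<le> \<rho>" using ut(2) norm_ge_zero[of a] by linarith
    then have "cmod u < 1" using ut by (simp add: norm_mult)
    moreover have "u \<in> ?K"
    proof (rule image_eqI[of _ _ "(\<rho>, t)"])
      have "Arg a - (1 - cmod a) / 2 \<le> t" "t \<le> Arg a + (1 - cmod a) / 2"
        using abs_le_D1[OF ut(4)] abs_le_D2[OF ut(4)] by linarith+
      then show "(\<rho>, t) \<in> {cmod a..1} \<times> {Arg a - (1 - cmod a) / 2..Arg a + (1 - cmod a) / 2}"
        using ut by simp
    qed (simp add: ut)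
    ultimately show "u \<in> ?K \<inter> unit_disc" by simp
  next
    fix u assume "u \<in> ?K \<inter> unit_disc"
    then obtain \<rho> t where ut: "u = of_real \<rho> * cis t" "cmod a \<le> \<rho>" "t \<in> {Arg a - (1 - cmod a) / 2..Arg a + (1 - cmod a) / 2}"
      "cmod u < 1" by auto
    have "0 \<le> \<rho>" using ut(2) norm_ge_zero[of a] by linarith
    then have "\<rho> < 1" using ut by (simp add: norm_mult)
    moreover have "\<bar>t - Arg a\<bar> \<le> (1 - cmod a) / 2"
    proof (rule abs_leI)
      show "t - Arg a \<le> (1 - cmod a) / 2" "- (t - Arg a) \<le> (1 - cmod a) / 2" using ut(3) unfolding atLeastAtMost_iff by linarith+
    qed
    ultimately show "u \<in> carleson_square a"
      using ut False unfolding carleson_square_def by auto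
  qed
  then show ?thesis using K by (auto simp: sets_restrict_space)
qed

context D_weight
begin

text \<open>The circle estimate is applied to f * \<open>ker n z\<close> and integrated against the
  weight over the radii with h / (2 K) <= 1 - s <= h / 2, h = bdist z. By the condition of
  \<open>D_check\<close> these carry at least the share 1 - 1 / c of W (h / 2), and doubling
  replaces W (h / 2) by W h.\<close>

lemma weighted_pointwise_estimate:
  assumes p: "p > 0" and m: "m \<ge> 0"
  obtains K C where "K > 1" "C > 0"
    "\<And>f z w. f holomorphic_on unit_disc \<Longrightarrow> z \<in> unit_disc \<Longrightarrow> w \<in> ball z (bdist z / 4) \<Longrightarrow>
      ennreal (cmod (f w) powr p * (bdist z * W (bdist z))) \<le>
      ennreal C * (\<integral>\<^sup>+u. ennreal (cmod (f u) powr p * kratio z u powr m) * indicator {bdist z / K..bdist z} (bdist u) \<partial>wA)"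
proof -
  obtain K c where K: "K > 1" and c: "c > 1" and chk: "\<And>t. 0 < t \<Longrightarrow> t \<le> 1 \<Longrightarrow> c * W (t / K) \<le> W t"
    using W_check by blast
  obtain Cd where Cd: "Cd \<ge> 1" and dbl: "\<And>t. 0 < t \<Longrightarrow> t \<le> 1 \<Longrightarrow> W t \<le> Cd * W (t / 2)"
    using W_doubling by blast
  \<comment> \<open>\<open>ker\<close> has integer powers only; exceeding m is harmless because
    \<open>kratio\<close> is at most 1.\<close>
  obtain n :: nat where n: "m / p \<le> real n" using real_arch_simple by blast
  have nm: "m \<le> real n * p" using n p by (simp add: field_simps)
  define D where "D = 1 - 1 / c"
  have D: "D > 0" using c by (simp add: D_def)
  define C where "C = 3 powr (real n * p) * Cd * (32 / (pi * D))"
  have C: "C > 0" using Cd D by (simp add: C_def)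
  have "ennreal (cmod (f w) powr p * (bdist z * W (bdist z))) \<le>
      ennreal C * (\<integral>\<^sup>+u. ennreal (cmod (f u) powr p * kratio z u powr m) * indicator {bdist z / (2 * K)..bdist z} (bdist u) \<partial>wA)"
    if f: "f holomorphic_on unit_disc" and z: "z \<in> unit_disc" and w: "w \<in> ball z (bdist z / 4)" for f z w
  proof -
    define h where "h = bdist z"
    have h: "0 < h" "h \<le> 1" using bdist_pos[OF z] bdist_le_1[of z] by (auto simp: h_def)
    have w': "cmod (w - z) < h / 4" using w by (simp add: h_def dist_norm norm_minus_commute)
    have wD: "w \<in> unit_disc"
      using bdist_diff_le[of w z] w' h by (simp add: h_def[symmetric]) (simp add: bdist_def)
    define F where "F u = f u * ker n z u" for u
    have F: "F holomorphic_on unit_disc"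
      unfolding F_def[abs_def] by (intro holomorphic_intros f holomorphic_ker z)
    have Fp: "cmod (F u) powr p = cmod (f u) powr p * kratio z u powr (real n * p)" if u: "u \<in> unit_disc" for u
      using kratio_pos[OF z u] by (simp add: F_def norm_mult norm_ker[OF z] powr_mult powr_realpow[symmetric] powr_powr)
    let ?A = "unit_disc \<inter> {u. bdist u \<in> {h / (2 * K)..h / 2}}"
    let ?\<phi> = "\<lambda>u. ennreal (cmod (F u) powr p) * indicator ?A u"
    have A: "?A \<in> sets borel"
    proof -
      have "{u. bdist u \<in> {h / (2 * K)..h / 2}} \<in> sets borel" by measurable
      then show ?thesis by auto
    qed
    have meas: "?\<phi> \<in> borel_measurable borel"
      by (intro borel_measurable_norm_powr_indicator[OF F _ p _ A]) auto
    define Q where "Q = pi * h / 16 * cmod (F w) powr p"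
    have circ: "ennreal Q \<le> (\<integral>\<^sup>+t. ennreal (cmod (F (of_real s * cis t)) powr p) * indicator angles t \<partial>lborel)"
      if s: "1 - h / 2 \<le> s" "s < 1" for s
    proof -
      have "ennreal (cmod (F w) powr p) \<le> ennreal (16 / (pi * h)) *
        (\<integral>\<^sup>+t. ennreal (cmod (F (of_real s * cis t)) powr p) * indicator angles t \<partial>lborel)"
        unfolding h_def bdist_def using s w by (intro norm_powr_le_circle_integral[OF F p z]) (auto simp: h_def bdist_def)
      then have "ennreal (pi * h / 16) * ennreal (cmod (F w) powr p) \<le> ennreal (pi * h / 16) * (ennreal (16 / (pi * h)) *
        (\<integral>\<^sup>+t. ennreal (cmod (F (of_real s * cis t)) powr p) * indicator angles t \<partial>lborel))"
        by (rule mult_left_mono) simp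
      moreover have "ennreal (pi * h / 16) * ennreal (16 / (pi * h)) = 1"
        using h by (subst ennreal_mult[symmetric]) auto
      moreover have "ennreal Q = ennreal (pi * h / 16) * ennreal (cmod (F w) powr p)"
        unfolding Q_def using h by (intro ennreal_mult) auto
      ultimately show ?thesis by (simp add: mult.assoc[symmetric])
    qed
    define a where "a = W (h / 2) - W (h / 2 / K)"
    have a: "D * W (h / 2) \<le> a"
      using chk[of "h / 2"] h c by (simp add: a_def D_def field_simps)
    have a0: "a \<ge> 0" using a D by (meson W_nonneg less_imp_le mult_nonneg_nonneg order_trans)
    have hK: "h / 2 / K \<le> h / 2" using h K by (simp add: divide_simps)
    have Aint: "(\<integral>\<^sup>+s. profile s * indicator {1 - h / 2..<1 - h / 2 / K} s \<partial>lborel) = ennreal a"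
    proof -
      let ?I = "\<integral>\<^sup>+s. profile s * indicator {1 - h / 2..<1 - h / 2 / K} s \<partial>lborel"
      have "what (h / 2) = (\<integral>\<^sup>+s. profile s * indicator {1 - h / 2..<1 - h / 2 / K} s + profile s * indicator {1 - h / 2 / K..<1} s \<partial>lborel)"
      proof -
        have split: "indicator {1 - x..<1} s = indicator {1 - x..<1 - r} s + (indicator {1 - r..<1} s :: ennreal)"
          if "0 < r" "r \<le> x" for x r s :: real using that by (auto simp: indicator_def)
        have "0 < h / 2 / K" using h K by simp
        from split[OF this hK] show ?thesis unfolding what_def by (simp add: distrib_left)
      qed
      also have "\<dots> = ?I + what (h / 2 / K)" unfolding what_def by (rule nn_integral_add) measurable
      finally have eq: "ennreal (W (h / 2)) = ?I + ennreal (W (h / 2 / K))"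
        using h hK by (simp add: what_eq_W del: divide_divide_eq_left)
      then have "?I = ennreal (W (h / 2)) - ennreal (W (h / 2 / K))" by simp
      then show ?thesis by (simp add: a_def ennreal_minus)
    qed
    have "ennreal (Q / 2) * ennreal a = (\<integral>\<^sup>+s. ennreal (Q / 2) * (profile s * indicator {1 - h / 2..<1 - h / 2 / K} s) \<partial>lborel)"
      unfolding Aint[symmetric] by (rule nn_integral_cmult[symmetric]) measurable
    also have "\<dots> \<le> (\<integral>\<^sup>+s. (\<integral>\<^sup>+t. ?\<phi> (of_real s * cis t) * indicator angles t \<partial>lborel) *
         (profile s * ennreal s * indicator {0<..<1} s) \<partial>lborel)"
    proof (rule nn_integral_mono)
      fix s :: real
      show "ennreal (Q / 2) * (profile s * indicator {1 - h / 2..<1 - h / 2 / K} s) \<le>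
        (\<integral>\<^sup>+t. ?\<phi> (of_real s * cis t) * indicator angles t \<partial>lborel) * (profile s * ennreal s * indicator {0<..<1} s)"
      proof (cases "s \<in> {1 - h / 2..<1 - h / 2 / K}")
        case True
        have "0 < h / 2 / K" using h K by simp
        then have s: "1 - h / 2 \<le> s" "s < 1" "1 / 2 \<le> s" using True h by auto
        have "of_real s * cis t \<in> ?A" for t
        proof -
          have "cmod (of_real s * cis t) = s" using s by (simp add: norm_mult)
          then show ?thesis using True s by (auto simp: bdist_def field_simps)
        qed
        then have "(\<integral>\<^sup>+t. ?\<phi> (of_real s * cis t) * indicator angles t \<partial>lborel) =
          (\<integral>\<^sup>+t. ennreal (cmod (F (of_real s * cis t)) powr p) * indicator angles t \<partial>lborel)"
          by (intro nn_integral_cong) (simp add: indicator_def)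
        then have 1: "ennreal Q \<le> (\<integral>\<^sup>+t. ?\<phi> (of_real s * cis t) * indicator angles t \<partial>lborel)"
          using circ[OF s(1,2)] by simp
        \<comment> \<open>The area factor s is at least 1 / 2, which accounts for Q / 2 in place of
          Q.\<close>
        have 2: "ennreal (1 / 2) * profile s \<le> ennreal s * profile s" using s by (intro mult_right_mono ennreal_leI) auto
        have "ennreal Q * (ennreal (1 / 2) * profile s) \<le>
          (\<integral>\<^sup>+t. ?\<phi> (of_real s * cis t) * indicator angles t \<partial>lborel) * (ennreal s * profile s)"
          by (rule mult_mono[OF 1 2]) simp_all
        moreover have "ennreal (Q / 2) = ennreal Q * ennreal (1 / 2)"
          using h by (subst ennreal_mult[symmetric]) (auto simp: Q_def)
        ultimately show ?thesis using True s by (simp add: mult_ac)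
      qed simp
    qed
    also have "\<dots> = (\<integral>\<^sup>+u. ?\<phi> u \<partial>wA)" by (rule nn_integral_wA_radial[OF meas, symmetric])
    also have "\<dots> \<le> (\<integral>\<^sup>+u. ennreal (cmod (f u) powr p * kratio z u powr m) * indicator {h / (2 * K)..h} (bdist u) \<partial>wA)"
    proof (rule nn_integral_mono)
      fix u assume "u \<in> space wA"
      then have u: "u \<in> unit_disc" by simp
      have "kratio z u powr (real n * p) \<le> kratio z u powr m"
        using kratio_pos[OF z u] kratio_le_1[OF z u] nm by (intro powr_mono') auto
      then have "cmod (F u) powr p \<le> cmod (f u) powr p * kratio z u powr m"
        unfolding Fp[OF u] by (intro mult_left_mono) auto
      then show "?\<phi> u \<le> ennreal (cmod (f u) powr p * kratio z u powr m) * indicator {h / (2 * K)..h} (bdist u)"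
        using h by (auto simp: indicator_def ennreal_leI)
    qed
    finally have m0: "ennreal (Q / 2) * ennreal a \<le> (\<integral>\<^sup>+u. ennreal (cmod (f u) powr p * kratio z u powr m) * indicator {h / (2 * K)..h} (bdist u) \<partial>wA)"
      (is "_ \<le> ?J") .
    have "ennreal (Q / 2 * a) = ennreal (Q / 2) * ennreal a"
      using a0 h by (intro ennreal_mult) (auto simp: Q_def)
    then have main: "ennreal (Q / 2 * a) \<le> ?J" using m0 by (simp only:)
    have "cmod (f w) powr p * (h * W h) \<le> C * (Q / 2 * a)"
    proof -
      \<comment> \<open>At w itself the kernel is at least 1 / 3, so it can be removed on the left
        at the price 3^(n p).\<close>
      have "kdist z w \<le> 2 * h + cmod (z - w)" unfolding h_def by (rule kdist_le_dist[OF z])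
      then have "kdist z w \<le> 3 * h" using w' h by (simp add: norm_minus_commute)
      then have "1 / 3 \<le> kratio z w" using kdist_pos[OF z wD] by (simp add: kratio_def h_def field_simps)
      then have "(1 / 3) powr (real n * p) \<le> kratio z w powr (real n * p)" using p by (intro powr_mono2) auto
      then have "cmod (f w) powr p * (1 / 3) powr (real n * p) \<le> cmod (F w) powr p"
        unfolding Fp[OF wD] by (intro mult_left_mono) auto
      then have 1: "cmod (f w) powr p \<le> 3 powr (real n * p) * cmod (F w) powr p"
        by (simp add: powr_divide field_simps)
      have "W h \<le> Cd * W (h / 2)" using h by (intro dbl) auto
      also have "\<dots> \<le> Cd * (a / D)" using a D Cd by (intro mult_left_mono) (auto simp: field_simps)
      finally have 2: "h * W h \<le> h * (Cd * (a / D))" using h by (intro mult_left_mono) auto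
      have "cmod (f w) powr p * (h * W h) \<le> 3 powr (real n * p) * cmod (F w) powr p * (h * (Cd * (a / D)))"
        using h by (intro mult_mono 1 2) auto
      also have "\<dots> = C * (Q / 2 * a)" by (simp add: C_def Q_def)
      finally show ?thesis .
    qed
    then have "ennreal (cmod (f w) powr p * (h * W h)) \<le> ennreal (C * (Q / 2 * a))" by (rule ennreal_leI)
    also have "\<dots> = ennreal C * ennreal (Q / 2 * a)"
      using C a0 h by (intro ennreal_mult) (auto simp: Q_def)
    also have "\<dots> \<le> ennreal C * ?J" by (intro mult_left_mono main) simp
    finally show ?thesis by (simp add: h_def)
  qed
  moreover have "2 * K > 1" using K by simp
  ultimately show ?thesis using that C by blast
qed

section \<open>Test functions and their weighted Carleson bounds\<close>

lemma W_tendsto_0: assumes "e > 0" shows "\<exists>d>0. \<forall>t. 0 < t \<and> t < d \<longrightarrow> W (min 1 t) < e"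
proof -
  obtain C where C: "C \<ge> 1" and Wl: "\<And>s t. 0 < s \<Longrightarrow> s \<le> t \<Longrightarrow> t \<le> 1 \<Longrightarrow> W s \<le> C * (s / t) powr alpha * W t"
    using W_lower by blast
  define B where "B = C * (W 1 + 1)"
  have B: "B > 0" using C by (simp add: B_def add_nonneg_pos)
  define d where "d = min 1 ((e / B) powr (1 / alpha))"
  have d: "d > 0" using assms B by (simp add: d_def)
  have "W (min 1 t) < e" if t: "0 < t" "t < d" for t
  proof -
    have "t powr alpha < ((e / B) powr (1 / alpha)) powr alpha"
      using t alpha_pos by (intro powr_less_mono2) (auto simp: d_def)
    then have "t powr alpha < e / B" using alpha_pos assms B by (simp add: powr_powr)
    then have *: "B * t powr alpha < e" using B by (simp add: field_simps)
    have "W t \<le> C * (t / 1) powr alpha * W 1" using t by (intro Wl) (auto simp: d_def)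
    also have "\<dots> \<le> B * t powr alpha" using C by (simp add: B_def field_simps)
    finally have "W t < e" using * by linarith
    moreover have "min 1 t = t" using t by (simp add: d_def)
    ultimately show ?thesis by simp
  qed
  then show ?thesis using d by blast
qed

text \<open>The factor W^(-1/p) normalises the summands: for large n the p-th power of
  \<open>ker n k\<close> has weighted integral at most of order bdist k * W (bdist k), so that k
  accounts for |c k|^p * bdist k.\<close>

definition test :: "real \<Rightarrow> nat \<Rightarrow> complex set \<Rightarrow> (complex \<Rightarrow> real) \<Rightarrow> complex \<Rightarrow> complex"
  where "test p n F c u = (\<Sum>k\<in>F. of_real (c k * W (bdist k) powr (- 1 / p)) * ker n k u)"

lemma holomorphic_test: "F \<subseteq> unit_disc \<Longrightarrow> test p n F c holomorphic_on unit_disc"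
  unfolding test_def[abs_def] using holomorphic_ker by (intro holomorphic_intros) auto

lemma norm_test_le:
  assumes "F \<subseteq> unit_disc"
  shows "cmod (test p n F c u) \<le> (\<Sum>k\<in>F. \<bar>c k\<bar> * W (bdist k) powr (- 1 / p) * kratio k u ^ n)"
  unfolding test_def
proof (rule order_trans[OF norm_sum sum_mono])
  fix k assume "k \<in> F"
  then have "k \<in> unit_disc" using assms by blast
  then show "cmod (of_real (c k * W (bdist k) powr (- 1 / p)) * ker n k u) \<le> \<bar>c k\<bar> * W (bdist k) powr (- 1 / p) * kratio k u ^ n"
    by (simp add: norm_mult norm_ker abs_mult del: of_real_mult)
qed

text \<open>For p <= 1 the p-th power is subadditive. For p > 1 Hoelder's inequality is used with
  weights kratio^(2 + e) * bdist^(-e), whose sum over the lattice is at most of order (bdist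
  u)^(-e). The resulting loss (bdist k / bdist u)^\<eta> is kept with \<eta> arbitrarily small, so
  that it stays integrable against the weight.\<close>

lemma test_pointwise:
  assumes p: "p > 0" and Z: "disc_lattice \<epsilon> Z" "0 < \<epsilon>" "\<epsilon> \<le> 1" and \<eta>: "\<eta> > 0" and M: "M \<ge> 0"
  obtains n0 C where "C > 0" "\<And>n F c u. n \<ge> n0 \<Longrightarrow> finite F \<Longrightarrow> F \<subseteq> Z \<Longrightarrow> u \<in> unit_disc \<Longrightarrow>
     cmod (test p n F c u) powr p \<le>
     C * (\<Sum>k\<in>F. \<bar>c k\<bar> powr p / W (bdist k) * (kratio k u powr M * (bdist k / bdist u) powr \<eta>))"
proof -
  have ZD: "Z \<subseteq> unit_disc" using Z by (simp add: disc_lattice_def)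
  have Wp: "(W (bdist k) powr (- 1 / p)) powr p = 1 / W (bdist k)" if "k \<in> unit_disc" for k
    unfolding powr_powr using W_pos[OF bdist_pos[OF that] bdist_le_1] p by (simp add: powr_minus_divide)
  show ?thesis
  proof (cases "p \<le> 1")
    case True
    \<comment> \<open>M powers of \<open>kratio\<close> remain as decay; the other \<eta> are
      bounded by (bdist k / bdist u)^\<eta>.\<close>
    obtain n0 :: nat where n0: "(M + \<eta>) / p \<le> real n0" using real_arch_simple by blast
    show ?thesis
    proof (rule that[of 1 n0])
      fix n :: nat and F c u
      assume n: "n \<ge> n0" and F: "finite F" "F \<subseteq> Z" and u: "u \<in> unit_disc"
      have FD: "F \<subseteq> unit_disc" using F ZD by blast
      have np: "M + \<eta> \<le> real n * p"
      proof -
        have "M + \<eta> \<le> real n0 * p" using n0 p by (simp add: field_simps)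
        also have "\<dots> \<le> real n * p" using n p by (intro mult_right_mono) auto
        finally show ?thesis .
      qed
      have kp: "0 \<le> \<bar>c k\<bar> * W (bdist k) powr (- 1 / p) * kratio k u ^ n" if "k \<in> F" for k
        using kratio_pos[of k u] u that FD by (intro mult_nonneg_nonneg) auto
      have "cmod (test p n F c u) powr p \<le> (\<Sum>k\<in>F. \<bar>c k\<bar> * W (bdist k) powr (- 1 / p) * kratio k u ^ n) powr p"
        using norm_test_le[OF FD] p by (intro powr_mono2) auto
      also have "\<dots> \<le> (\<Sum>k\<in>F. (\<bar>c k\<bar> * W (bdist k) powr (- 1 / p) * kratio k u ^ n) powr p)"
        using kp p True F by (intro sum_powr_le_powr_sum) auto
      also have "\<dots> \<le> (\<Sum>k\<in>F. \<bar>c k\<bar> powr p / W (bdist k) * (kratio k u powr M * (bdist k / bdist u) powr \<eta>))"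
      proof (rule sum_mono)
        fix k assume k: "k \<in> F"
        then have kD: "k \<in> unit_disc" using FD by blast
        have kr: "0 < kratio k u" "kratio k u \<le> 1" by (rule kratio_pos[OF kD u], rule kratio_le_1[OF kD u])
        have "kratio k u powr (real n * p) \<le> kratio k u powr (M + \<eta>)" using kr np by (intro powr_mono') auto
        also have "\<dots> = kratio k u powr M * kratio k u powr \<eta>" by (simp add: powr_add)
        also have "\<dots> \<le> kratio k u powr M * (bdist k / bdist u) powr \<eta>"
          using kr \<eta> kratio_le_bdist[OF kD u] by (intro mult_left_mono powr_mono2) auto
        finally have 1: "kratio k u powr (real n * p) \<le> kratio k u powr M * (bdist k / bdist u) powr \<eta>" .
        have "(\<bar>c k\<bar> * W (bdist k) powr (- 1 / p) * kratio k u ^ n) powr p = \<bar>c k\<bar> powr p / W (bdist k) * kratio k u powr (real n * p)"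
          using kr by (simp only: powr_mult Wp[OF kD]) (simp add: powr_realpow[symmetric] powr_powr)
        also have "\<dots> \<le> \<bar>c k\<bar> powr p / W (bdist k) * (kratio k u powr M * (bdist k / bdist u) powr \<eta>)"
          by (intro mult_left_mono 1) auto
        finally show "(\<bar>c k\<bar> * W (bdist k) powr (- 1 / p) * kratio k u ^ n) powr p \<le> \<bar>c k\<bar> powr p / W (bdist k) * (kratio k u powr M * (bdist k / bdist u) powr \<eta>)" .
      qed
      finally show "cmod (test p n F c u) powr p \<le> 1 * (\<Sum>k\<in>F. \<bar>c k\<bar> powr p / W (bdist k) * (kratio k u powr M * (bdist k / bdist u) powr \<eta>))"
        by simp
    qed simp
  next
    case False
    then have p1: "p > 1" by simp
    \<comment> \<open>Chosen so that (bdist u)^(-e), raised to the power p - 1, becomes (bdist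
      u)^(-\<eta>).\<close>
    define e where "e = \<eta> / (p - 1)"
    have e: "e > 0" using \<eta> p1 by (simp add: e_def)
    have ep: "e * (p - 1) = \<eta>" using p1 by (simp add: e_def)
    obtain C where C: "C > 0" and S: "\<And>F u. finite F \<Longrightarrow> F \<subseteq> Z \<Longrightarrow> u \<in> unit_disc \<Longrightarrow>
      (\<Sum>k\<in>F. kratio k u powr (2 + e) * bdist k powr (- e)) \<le> C * bdist u powr (- e)"
      using lattice_kratio_sum[OF Z e] by blast
    obtain n0 :: nat where n0: "M + 2 + e \<le> real n0" using real_arch_simple by blast
    show ?thesis
    proof (rule that[of "C powr (p - 1)" n0])
      show "C powr (p - 1) > 0" using C by simp
      fix n :: nat and F c u
      assume n: "n \<ge> n0" and F: "finite F" "F \<subseteq> Z" and u: "u \<in> unit_disc"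
      have FD: "F \<subseteq> unit_disc" using F ZD by blast
      have hu: "bdist u > 0" by (rule bdist_pos[OF u])
      define l where "l k = kratio k u powr (2 + e) * bdist k powr (- e)" for k
      define v where "v k = \<bar>c k\<bar> * W (bdist k) powr (- 1 / p) * kratio k u powr (real n - 2 - e) * bdist k powr e" for k
      have nM: "M \<le> real n - 2 - e" using n0 n by linarith
      have FkD: "k \<in> unit_disc" if "k \<in> F" for k using that FD by blast
      have kr: "0 < kratio k u" "kratio k u \<le> 1" "bdist k > 0" if "k \<in> F" for k
        using FkD[OF that] u by (auto intro: kratio_pos kratio_le_1 bdist_pos)
      have lp: "0 < l k" if "k \<in> F" for k using kr[OF that] by (simp add: l_def)
      have vp: "0 \<le> v k" if "k \<in> F" for k using kr[OF that] by (simp add: v_def)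
      have lv: "\<bar>c k\<bar> * W (bdist k) powr (- 1 / p) * kratio k u ^ n = l k * v k" if "k \<in> F" for k
      proof -
        have "kratio k u ^ n = kratio k u powr (2 + e) * kratio k u powr (real n - 2 - e)"
          using kr[OF that] by (simp add: powr_realpow[symmetric] powr_add[symmetric])
        moreover have "bdist k powr (- e) * bdist k powr e = 1" using kr[OF that] by (simp add: powr_add[symmetric])
        ultimately show ?thesis by (simp add: l_def v_def)
      qed
      have "cmod (test p n F c u) powr p \<le> (\<Sum>k\<in>F. l k * v k) powr p"
        using norm_test_le[OF FD, of p n c u] p lv by (intro powr_mono2) auto
      also have "\<dots> \<le> (\<Sum>k\<in>F. l k) powr (p - 1) * (\<Sum>k\<in>F. l k * v k powr p)"
        by (rule weighted_power_mean[OF F(1) lp vp p1])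
      also have "\<dots> \<le> (C powr (p - 1) * bdist u powr (- \<eta>)) *
          (\<Sum>k\<in>F. \<bar>c k\<bar> powr p / W (bdist k) * (kratio k u powr M * bdist k powr \<eta>))"
      proof (rule mult_mono)
        have "(\<Sum>k\<in>F. l k) powr (p - 1) \<le> (C * bdist u powr (- e)) powr (p - 1)"
          using S[OF F u] p1 lp by (intro powr_mono2 sum_nonneg) (auto simp: l_def)
        also have "\<dots> = C powr (p - 1) * bdist u powr (- \<eta>)"
          unfolding powr_mult powr_powr using ep by simp
        finally show "(\<Sum>k\<in>F. l k) powr (p - 1) \<le> C powr (p - 1) * bdist u powr (- \<eta>)" .
        show "(\<Sum>k\<in>F. l k * v k powr p) \<le> (\<Sum>k\<in>F. \<bar>c k\<bar> powr p / W (bdist k) * (kratio k u powr M * bdist k powr \<eta>))"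
        proof (rule sum_mono)
        fix k assume k: "k \<in> F"
        have "l k * v k powr p = \<bar>c k\<bar> powr p / W (bdist k) *
           (kratio k u powr (2 + e + (real n - 2 - e) * p) * (bdist k powr (- e) * bdist k powr (e * p)))"
          unfolding l_def v_def powr_mult Wp[OF FkD[OF k]] powr_powr powr_add using p by (simp add: mult_ac)
        also have "bdist k powr (- e) * bdist k powr (e * p) = bdist k powr \<eta>"
        proof -
          have "- e + e * p = \<eta>" using ep by (simp add: algebra_simps)
          then show ?thesis by (simp add: powr_add[symmetric])
        qed
        also have "kratio k u powr (2 + e + (real n - 2 - e) * p) \<le> kratio k u powr M"
        proof (rule powr_mono')
          have "(real n - 2 - e) * 1 \<le> (real n - 2 - e) * p" using nM M p1 by (intro mult_left_mono) auto
          then show "M \<le> 2 + e + (real n - 2 - e) * p" using nM e by simp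
        qed (use kr[OF k] in auto)
        then have "\<bar>c k\<bar> powr p / W (bdist k) * (kratio k u powr (2 + e + (real n - 2 - e) * p) * bdist k powr \<eta>) \<le>
           \<bar>c k\<bar> powr p / W (bdist k) * (kratio k u powr M * bdist k powr \<eta>)"
          by (intro mult_left_mono mult_right_mono) auto
        finally show "l k * v k powr p \<le> \<bar>c k\<bar> powr p / W (bdist k) * (kratio k u powr M * bdist k powr \<eta>)" .
        qed
      qed (use lp in \<open>auto intro!: sum_nonneg mult_nonneg_nonneg simp: less_imp_le\<close>)
      also have "\<dots> = C powr (p - 1) * (\<Sum>k\<in>F. \<bar>c k\<bar> powr p / W (bdist k) * (kratio k u powr M * (bdist k / bdist u) powr \<eta>))"
      proof -
        have q: "bdist u powr (- \<eta>) * (\<bar>c k\<bar> powr p / W (bdist k) * (kratio k u powr M * bdist k powr \<eta>)) =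
          \<bar>c k\<bar> powr p / W (bdist k) * (kratio k u powr M * (bdist k / bdist u) powr \<eta>)" if "k \<in> F" for k
          using kr[OF that] hu by (simp add: powr_divide powr_minus_divide)
        have "bdist u powr (- \<eta>) * (\<Sum>k\<in>F. \<bar>c k\<bar> powr p / W (bdist k) * (kratio k u powr M * bdist k powr \<eta>)) =
          (\<Sum>k\<in>F. \<bar>c k\<bar> powr p / W (bdist k) * (kratio k u powr M * (bdist k / bdist u) powr \<eta>))"
          by (subst sum_distrib_left) (intro sum.cong refl q)
        then show ?thesis by (simp only: mult.assoc)
      qed
      finally show "cmod (test p n F c u) powr p \<le> C powr (p - 1) * (\<Sum>k\<in>F. \<bar>c k\<bar> powr p / W (bdist k) * (kratio k u powr M * (bdist k / bdist u) powr \<eta>))" .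
    qed
  qed
qed

text \<open>Termwise, \<open>wA_kratio_local\<close> bounds the integral over the ball by a multiple
  of |c k|^p * bdist k * (kratio b k)^\<gamma>. As \<gamma> > 1, the Carleson condition for the
  point masses |c k|^p * bdist k sums these terms.\<close>

lemma test_carleson:
  assumes p: "p > 0" and Z: "disc_lattice \<epsilon> Z" "0 < \<epsilon>" "\<epsilon> \<le> 1"
  obtains n0 C where "C > 0" "\<And>n F c X b. n \<ge> n0 \<Longrightarrow> finite F \<Longrightarrow> F \<subseteq> Z \<Longrightarrow> X \<ge> 0 \<Longrightarrow>
     (\<And>b'. b' \<in> unit_disc \<Longrightarrow> (\<Sum>k\<in>{k\<in>F. k \<in> carleson_square b'}. \<bar>c k\<bar> powr p * bdist k) \<le> X * bdist b') \<Longrightarrow>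
     b \<in> unit_disc \<Longrightarrow>
     (\<integral>\<^sup>+u. ennreal (cmod (test p n F c u) powr p) * indicator {..5 / 2 * bdist b} (kdist b u) \<partial>wA) \<le> ennreal (C * X * bdist b)"
proof -
  \<comment> \<open>A value strictly between 0 and \<open>alpha\<close>: positive for the pointwise
    bound, below \<open>alpha\<close> for integrability.\<close>
  define \<eta> where "\<eta> = alpha / 2"
  have \<eta>: "0 < \<eta>" "\<eta> < alpha" using alpha_pos by (auto simp: \<eta>_def)
  define \<gamma> where "\<gamma> = 1 + alpha - \<eta>"
  have \<gamma>: "\<gamma> > 1" using \<eta> by (simp add: \<gamma>_def)
  have ZD: "Z \<subseteq> unit_disc" using Z by (simp add: disc_lattice_def)
  from wA_kratio_local[OF less_imp_le[OF \<eta>(1)] \<eta>(2)]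
  obtain M C1 where M: "M > 0" and C1: "C1 > 0" and loc': "\<And>M' z b. M' \<ge> M \<Longrightarrow> z \<in> unit_disc \<Longrightarrow> b \<in> unit_disc \<Longrightarrow>
    (\<integral>\<^sup>+u. indicator {..5 / 2 * bdist b} (kdist b u) * ennreal (kratio z u powr M' * (bdist z / bdist u) powr \<eta>) \<partial>wA)
      \<le> ennreal (C1 * (bdist z * W (bdist z)) * kratio b z powr \<gamma>)"
    unfolding \<gamma>_def by blast
  have loc: "\<And>z b. z \<in> unit_disc \<Longrightarrow> b \<in> unit_disc \<Longrightarrow>
    (\<integral>\<^sup>+u. indicator {..5 / 2 * bdist b} (kdist b u) * ennreal (kratio z u powr M * (bdist z / bdist u) powr \<eta>) \<partial>wA)
      \<le> ennreal (C1 * (bdist z * W (bdist z)) * kratio b z powr \<gamma>)"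
    by (rule loc'[OF order_refl])
  obtain n0 C2 where C2: "C2 > 0" and pw: "\<And>n F c u. n \<ge> n0 \<Longrightarrow> finite F \<Longrightarrow> F \<subseteq> Z \<Longrightarrow> u \<in> unit_disc \<Longrightarrow>
     cmod (test p n F c u) powr p \<le>
     C2 * (\<Sum>k\<in>F. \<bar>c k\<bar> powr p / W (bdist k) * (kratio k u powr M * (bdist k / bdist u) powr \<eta>))"
    by (rule test_pointwise[OF p Z \<eta>(1) less_imp_le[OF M]]) (rule that)
  define C where "C = C2 * C1 * carleson_const \<gamma>"
  have C: "C > 0" using C1 C2 carleson_const_pos[OF \<gamma>] by (simp add: C_def)
  have "(\<integral>\<^sup>+u. ennreal (cmod (test p n F c u) powr p) * indicator {..5 / 2 * bdist b} (kdist b u) \<partial>wA) \<le> ennreal (C * X * bdist b)"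
    if n: "n \<ge> n0" and F: "finite F" "F \<subseteq> Z" and X: "X \<ge> 0" and car: "\<And>b'. b' \<in> unit_disc \<Longrightarrow>
      (\<Sum>k\<in>{k\<in>F. k \<in> carleson_square b'}. \<bar>c k\<bar> powr p * bdist k) \<le> X * bdist b'" and b: "b \<in> unit_disc"
    for n F c X b
  proof -
    have FD: "k \<in> unit_disc" if "k \<in> F" for k using that F ZD by blast
    let ?a = "\<lambda>k. C2 * (\<bar>c k\<bar> powr p / W (bdist k))"
    have a0: "0 \<le> ?a k" for k using C2 by simp
    let ?g = "\<lambda>k u. ennreal (kratio k u powr M * (bdist k / bdist u) powr \<eta>)"
    have "(\<integral>\<^sup>+u. ennreal (cmod (test p n F c u) powr p) * indicator {..5 / 2 * bdist b} (kdist b u) \<partial>wA) \<le>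
      (\<integral>\<^sup>+u. (\<Sum>k\<in>F. ennreal (?a k) * (indicator {..5 / 2 * bdist b} (kdist b u) * ?g k u)) \<partial>wA)"
    proof (rule nn_integral_mono)
      fix u assume "u \<in> space wA"
      then have u: "u \<in> unit_disc" by simp
      have "cmod (test p n F c u) powr p \<le> (\<Sum>k\<in>F. ?a k * (kratio k u powr M * (bdist k / bdist u) powr \<eta>))"
        using pw[OF n F u, of c] by (simp add: sum_distrib_left mult.assoc)
      then have "ennreal (cmod (test p n F c u) powr p) \<le> ennreal (\<Sum>k\<in>F. ?a k * (kratio k u powr M * (bdist k / bdist u) powr \<eta>))"
        by (rule ennreal_leI)
      also have "\<dots> = (\<Sum>k\<in>F. ennreal (?a k * (kratio k u powr M * (bdist k / bdist u) powr \<eta>)))"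
        by (rule sum_ennreal[symmetric]) (intro mult_nonneg_nonneg a0 powr_ge_zero)
      also have "\<dots> = (\<Sum>k\<in>F. ennreal (?a k) * ?g k u)"
        using a0 by (intro sum.cong refl ennreal_mult) auto
      finally show "ennreal (cmod (test p n F c u) powr p) * indicator {..5 / 2 * bdist b} (kdist b u) \<le>
         (\<Sum>k\<in>F. ennreal (?a k) * (indicator {..5 / 2 * bdist b} (kdist b u) * ?g k u))"
        by (auto simp: indicator_def)
    qed
    also have "\<dots> = (\<Sum>k\<in>F. \<integral>\<^sup>+u. ennreal (?a k) * (indicator {..5 / 2 * bdist b} (kdist b u) * ?g k u) \<partial>wA)"
      by (rule nn_integral_sum) measurable
    also have "\<dots> = (\<Sum>k\<in>F. ennreal (?a k) * (\<integral>\<^sup>+u. indicator {..5 / 2 * bdist b} (kdist b u) * ?g k u \<partial>wA))"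
      by (intro sum.cong refl nn_integral_cmult) measurable
    also have "\<dots> \<le> (\<Sum>k\<in>F. ennreal (?a k) * ennreal (C1 * (bdist k * W (bdist k)) * kratio b k powr \<gamma>))"
      using FD by (intro sum_mono mult_left_mono loc b) auto
    also have "\<dots> = (\<Sum>k\<in>F. ennreal (C2 * C1) * (ennreal (\<bar>c k\<bar> powr p * bdist k) * ennreal (kratio b k powr \<gamma>)))"
    proof (rule sum.cong[OF refl])
      fix k assume "k \<in> F"
      then have k: "k \<in> unit_disc" by (rule FD)
      have h: "bdist k > 0" "W (bdist k) > 0" using bdist_pos[OF k] W_pos[OF bdist_pos[OF k] bdist_le_1] by auto
      have "ennreal (?a k) * ennreal (C1 * (bdist k * W (bdist k)) * kratio b k powr \<gamma>) =
        ennreal (?a k * (C1 * (bdist k * W (bdist k)) * kratio b k powr \<gamma>))"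
        using C1 C2 h by (intro ennreal_mult[symmetric]) auto
      also have "?a k * (C1 * (bdist k * W (bdist k)) * kratio b k powr \<gamma>) = C2 * C1 * ((\<bar>c k\<bar> powr p * bdist k) * kratio b k powr \<gamma>)"
        using h by simp
      also have "ennreal \<dots> = ennreal (C2 * C1) * (ennreal (\<bar>c k\<bar> powr p * bdist k) * ennreal (kratio b k powr \<gamma>))"
        using C1 C2 h by (subst ennreal_mult[symmetric], simp, simp, subst ennreal_mult[symmetric]) auto
      finally show "ennreal (?a k) * ennreal (C1 * (bdist k * W (bdist k)) * kratio b k powr \<gamma>) =
        ennreal (C2 * C1) * (ennreal (\<bar>c k\<bar> powr p * bdist k) * ennreal (kratio b k powr \<gamma>))" .
    qed
    \<comment> \<open>As an integral over counting measure the sum falls under the Carleson lemma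
      for measures.\<close>
    also have "\<dots> = ennreal (C2 * C1) * (\<integral>\<^sup>+k. ennreal (\<bar>c k\<bar> powr p * bdist k) * ennreal (kratio b k powr \<gamma>) \<partial>count_space F)"
      using F by (simp add: nn_integral_count_space_finite sum_distrib_left)
    also have "\<dots> \<le> ennreal (C2 * C1) * ennreal (carleson_const \<gamma> * X * bdist b)"
    proof (intro mult_left_mono carleson_kratio_integral b \<gamma> X)
      fix b' assume b': "b' \<in> unit_disc"
      have "(\<integral>\<^sup>+k. ennreal (\<bar>c k\<bar> powr p * bdist k) * indicator (carleson_square b') k \<partial>count_space F) =
         (\<Sum>k\<in>F. ennreal (\<bar>c k\<bar> powr p * bdist k) * indicator (carleson_square b') k)"
        using F by (simp add: nn_integral_count_space_finite)
      also have "\<dots> = (\<Sum>k\<in>{k\<in>F. k \<in> carleson_square b'}. ennreal (\<bar>c k\<bar> powr p * bdist k))"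
        using F by (intro sum.mono_neutral_cong_right) auto
      also have "\<dots> = ennreal (\<Sum>k\<in>{k\<in>F. k \<in> carleson_square b'}. \<bar>c k\<bar> powr p * bdist k)"
        using bdist_pos FD by (intro sum_ennreal) (auto intro!: mult_nonneg_nonneg simp: less_imp_le)
      also have "\<dots> \<le> ennreal (X * bdist b')" by (intro ennreal_leI car b')
      finally show "(\<integral>\<^sup>+k. ennreal (\<bar>c k\<bar> powr p * bdist k) * indicator (carleson_square b') k \<partial>count_space F) \<le> ennreal (X * bdist b')" .
    qed (use FD in auto)
    also have "\<dots> = ennreal (C * X * bdist b)"
      using C1 C2 X carleson_const_pos[OF \<gamma>] bdist_pos[OF b] by (subst ennreal_mult[symmetric]) (auto simp: C_def mult_ac)
    finally show ?thesis .
  qed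
  then show ?thesis by (rule that[OF C])
qed

text \<open>The ball about b has mass at most a multiple of bdist b times \<open>W\<close> at a
  scale of order bdist b, and \<open>W\<close> tends to 0.\<close>

lemma bounded_vanishing:
  assumes p: "p > 0" and B: "\<And>u. u \<in> unit_disc \<Longrightarrow> cmod (f u) \<le> B" and e: "e > 0"
  shows "\<exists>d>0. \<forall>b\<in>unit_disc. bdist b < d \<longrightarrow>
    (\<integral>\<^sup>+u. ennreal (cmod (f u) powr p) * indicator {..5 / 2 * bdist b} (kdist b u) \<partial>wA) \<le> ennreal (e * bdist b)"
proof -
  \<comment> \<open>30 = 12 * 5 / 2, from the mass bound and the radius of the ball; adding 1 keeps
    the denominator positive when B is 0.\<close>
  define e' where "e' = e / (30 * pi * (B powr p + 1))"
  have e': "e' > 0" using e by (simp add: e'_def add_nonneg_pos)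
  obtain d where d: "d > 0" and W0: "\<And>t. 0 < t \<Longrightarrow> t < d \<Longrightarrow> W (min 1 t) < e'"
    using W_tendsto_0[OF e'] by blast
  have "(\<integral>\<^sup>+u. ennreal (cmod (f u) powr p) * indicator {..5 / 2 * bdist b} (kdist b u) \<partial>wA) \<le> ennreal (e * bdist b)"
    if b: "b \<in> unit_disc" and bd: "bdist b < d * 2 / 5" for b
  proof -
    define x where "x = 5 / 2 * bdist b"
    have x: "x > 0" "x < d" using bdist_pos[OF b] bd by (auto simp: x_def)
    have "(\<integral>\<^sup>+u. ennreal (cmod (f u) powr p) * indicator {..5 / 2 * bdist b} (kdist b u) \<partial>wA) \<le>
      (\<integral>\<^sup>+u. ennreal (B powr p) * (indicator {..x} (kdist b u) * indicator {..min 1 x} (bdist u)) \<partial>wA)"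
    proof (rule nn_integral_mono)
      fix u assume "u \<in> space wA"
      then have u: "u \<in> unit_disc" by simp
      have "ennreal (cmod (f u) powr p) \<le> ennreal (B powr p)" using B[OF u] p by (intro ennreal_leI powr_mono2) auto
      then show "ennreal (cmod (f u) powr p) * indicator {..5 / 2 * bdist b} (kdist b u) \<le>
         ennreal (B powr p) * (indicator {..x} (kdist b u) * indicator {..min 1 x} (bdist u))"
        using bdist_le_kdist'[OF b u] bdist_le_1[of u] by (auto simp: x_def indicator_def)
    qed
    also have "\<dots> = ennreal (B powr p) * (\<integral>\<^sup>+u. indicator {..x} (kdist b u) * indicator {..min 1 x} (bdist u) \<partial>wA)"
      by (rule nn_integral_cmult) measurable
    also have "\<dots> \<le> ennreal (B powr p) * ennreal (12 * pi * x * W (min 1 x))"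
      by (intro mult_left_mono wA_mass b x) auto
    also have "\<dots> = ennreal (B powr p * (12 * pi * x * W (min 1 x)))" using x by (intro ennreal_mult[symmetric]) auto
    also have "\<dots> \<le> ennreal (e * bdist b)"
    proof (rule ennreal_leI)
      have "B powr p * (12 * pi * x * W (min 1 x)) \<le> (B powr p + 1) * (12 * pi * x * e')"
        using W0[OF x] x by (intro mult_mono mult_left_mono) auto
      also have "\<dots> = (30 * pi * (B powr p + 1)) * e' * bdist b" by (simp add: x_def)
      also have "(30 * pi * (B powr p + 1)) * e' = e"
      proof -
        have "0 < B powr p + 1" by (simp add: add_nonneg_pos)
        then show ?thesis unfolding e'_def by (metis (no_types, lifting) less_irrefl mult_pos_pos nonzero_mult_div_cancel_left pi_gt_zero times_divide_eq_right zero_less_numeral)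
      qed
      finally show "B powr p * (12 * pi * x * W (min 1 x)) \<le> e * bdist b" .
    qed
    finally show ?thesis .
  qed
  then show ?thesis using d by (intro exI[of _ "d * 2 / 5"]) auto
qed

lemma test_bounded:
  assumes "finite F" "F \<subseteq> unit_disc" "u \<in> unit_disc"
  shows "cmod (test p n F c u) \<le> (\<Sum>k\<in>F. \<bar>c k\<bar> * W (bdist k) powr (- 1 / p))"
proof (rule order_trans[OF norm_test_le[OF assms(2)] sum_mono])
  fix k assume "k \<in> F"
  then have k: "k \<in> unit_disc" using assms by blast
  have "kratio k u ^ n \<le> 1" using kratio_le_1[OF k assms(3)] kratio_pos[OF k assms(3)] by (simp add: power_le_one)
  then show "\<bar>c k\<bar> * W (bdist k) powr (- 1 / p) * kratio k u ^ n \<le> \<bar>c k\<bar> * W (bdist k) powr (- 1 / p)"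
    by (simp add: mult_left_le)
qed

end

section \<open>Pseudo-hyperbolic discs\<close>

lemma pseudo_hyp_dist_eq: "pseudo_hyp_dist z u = cmod (z - u) / kdist z u"
proof -
  have "1 - z * cnj u = cnj (1 - cnj z * u)" by simp
  then have "cmod (1 - z * cnj u) = kdist z u" unfolding kdist_def by (metis complex_mod_cnj)
  then show ?thesis by (simp add: pseudo_hyp_dist_def norm_divide)
qed

lemma ball_bdist_subset: "z \<in> unit_disc \<Longrightarrow> c \<le> 1 \<Longrightarrow> u \<in> ball z (c * bdist z) \<Longrightarrow> u \<in> unit_disc"
proof -
  assume z: "z \<in> unit_disc" and c: "c \<le> 1" and u: "u \<in> ball z (c * bdist z)"
  have "c * bdist z \<le> 1 * bdist z" using c bdist_pos[OF z] by (intro mult_right_mono) auto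
  then have "cmod (u - z) < bdist z" using u by (simp add: dist_norm norm_minus_commute)
  then show ?thesis using norm_triangle_ineq2[of u z] by (simp add: bdist_def)
qed

text \<open>With D = \<open>kdist z u\<close>, combine |z - u| < D / 4 and D <= 2 * bdist z + |z -
  u| to get 3 / 4 * |z - u| < bdist z / 2.\<close>

lemma pseudo_hyp_disc_subset_ball:
  assumes z: "z \<in> unit_disc" and r: "r \<le> 1 / 4"
  shows "pseudo_hyp_disc z r \<subseteq> ball z (2 / 3 * bdist z)"
proof
  fix u assume "u \<in> pseudo_hyp_disc z r"
  then have u: "u \<in> unit_disc" and d: "cmod (z - u) / kdist z u < r"
    by (auto simp: pseudo_hyp_disc_def pseudo_hyp_dist_eq)
  have "cmod (z - u) < r * kdist z u"
    using d kdist_pos[OF z u] by (simp add: divide_less_eq)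
  also have "r * kdist z u \<le> 1 / 4 * kdist z u" using r by (intro mult_right_mono) auto
  finally show "u \<in> ball z (2 / 3 * bdist z)"
    using kdist_le_dist[OF z, of u] by (simp add: dist_norm)
qed

text \<open>Two points of the small ball are less than r / 2 * bdist k apart, and bdist k <= 2 *
  bdist w. This lets \<open>G_fun\<close> at any point of a lattice ball control the measure of that
  ball.\<close>

lemma ball_subset_pseudo_hyp_disc:
  assumes k: "k \<in> unit_disc" and r: "0 < r" "r \<le> 1 / 4" and w: "w \<in> ball k (r / 4 * bdist k)"
  shows "ball k (r / 4 * bdist k) \<subseteq> pseudo_hyp_disc w r"
proof
  fix u assume u: "u \<in> ball k (r / 4 * bdist k)"
  have h: "bdist k > 0" by (rule bdist_pos[OF k])
  have wD: "w \<in> unit_disc" and uD: "u \<in> unit_disc"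
    using ball_bdist_subset[OF k _ w] ball_bdist_subset[OF k _ u] r by auto
  have wk: "cmod (w - k) < r / 4 * bdist k" and uk: "cmod (k - u) < r / 4 * bdist k"
    using w u by (auto simp: dist_norm norm_minus_commute)
  have "cmod (w - u) < r / 2 * bdist k"
    using norm_triangle_ineq[of "w - k" "k - u"] wk uk by simp
  also have "bdist k \<le> 2 * bdist w"
  proof -
    have "r / 4 * bdist k \<le> 1 / 2 * bdist k" using r h by (intro mult_right_mono) auto
    then show ?thesis using wk bdist_diff_le[of w k] by linarith
  qed
  then have "r / 2 * bdist k \<le> r * bdist w" using r by simp
  also have "r * bdist w \<le> r * kdist w u" using bdist_le_kdist[OF wD uD] r by simp
  finally have "cmod (w - u) < r * kdist w u" .
  then show "u \<in> pseudo_hyp_disc w r"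
    using uD kdist_pos[OF wD uD] by (simp add: pseudo_hyp_disc_def pseudo_hyp_dist_eq divide_less_eq)
qed

lemma pseudo_hyp_disc_measurable: "pseudo_hyp_disc z r \<in> sets (restrict_space borel unit_disc)"
proof -
  have "{u. cmod (z - u) / kdist z u < r} \<in> sets borel" by measurable
  moreover have "pseudo_hyp_disc z r = {u. cmod (z - u) / kdist z u < r} \<inter> unit_disc"
    by (auto simp: pseudo_hyp_disc_def pseudo_hyp_dist_eq)
  ultimately have "pseudo_hyp_disc z r \<in> sets borel" by simp
  then show ?thesis by (subst sets_restrict_space_iff) (auto simp: pseudo_hyp_disc_def)
qed

text \<open>Replacing z0 by z changes numerator and denominator by at most |z - z0| each. The error
  does not involve u, so a whole smaller disc about z0 can be moved into the disc about z.\<close>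

lemma pseudo_hyp_dist_lipschitz:
  assumes "z \<in> unit_disc" "z0 \<in> unit_disc" "u \<in> unit_disc"
  shows "pseudo_hyp_dist z u \<le> pseudo_hyp_dist z0 u + 2 * cmod (z - z0) / bdist z"
proof -
  let ?d = "cmod (z - z0)"
  note p = kdist_pos[OF assms(1,3)] kdist_pos[OF assms(2,3)] bdist_pos[OF assms(1)]
  have a: "cmod (z - u) \<le> ?d + cmod (z0 - u)" using norm_triangle_ineq[of "z - z0" "z0 - u"] by simp
  have b: "kdist z0 u \<le> kdist z u + ?d"
  proof -
    have "1 - cnj z0 * u = (1 - cnj z * u) + cnj (z - z0) * u" by (simp add: algebra_simps)
    then have "kdist z0 u \<le> kdist z u + cmod (cnj (z - z0) * u)"
      unfolding kdist_def by (metis norm_triangle_ineq)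
    also have "cmod (cnj (z - z0) * u) \<le> ?d * 1"
      unfolding norm_mult complex_mod_cnj using assms by (intro mult_left_mono) auto
    finally show ?thesis by simp
  qed
  have c: "cmod (z0 - u) \<le> kdist z0 u" by (rule norm_diff_le_kdist[OF assms(2,3)])
  have "cmod (z - u) * kdist z0 u \<le> (?d + cmod (z0 - u)) * kdist z0 u" using a p by (intro mult_right_mono) auto
  also have "\<dots> \<le> ?d * kdist z0 u + cmod (z0 - u) * (kdist z u + ?d)"
    using b by (simp add: distrib_right mult_left_mono)
  also have "\<dots> \<le> cmod (z0 - u) * kdist z u + 2 * ?d * kdist z0 u"
    using mult_left_mono[OF c, of ?d] by (simp add: algebra_simps)
  finally have "cmod (z - u) / kdist z u \<le> (cmod (z0 - u) * kdist z u + 2 * ?d * kdist z0 u) / (kdist z u * kdist z0 u)"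
    using p by (simp add: field_simps)
  also have "\<dots> = cmod (z0 - u) / kdist z0 u + 2 * ?d / kdist z u" using p by (simp add: field_simps)
  also have "2 * ?d / kdist z u \<le> 2 * ?d / bdist z"
    using p bdist_le_kdist[OF assms(1,3)] by (intro divide_left_mono) auto
  finally show ?thesis by (simp add: pseudo_hyp_dist_eq)
qed

text \<open>Lower semicontinuity makes \<open>\<mu>(\<Delta>(z,r))\<close> measurable in \<open>z\<close> for an arbitrary,
  possibly not \<open>\<sigma>\<close>-finite, measure.\<close>

lemma emeasure_pseudo_hyp_disc_measurable:
  assumes \<mu>: "borel_measure_on_disc \<mu>"
  shows "(\<lambda>z. emeasure \<mu> (pseudo_hyp_disc z r)) \<in> borel_measurable (restrict_space borel unit_disc)"
proof (rule borel_measurableI_greater)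
  fix y :: ennreal
  let ?S = "{z \<in> space (restrict_space borel unit_disc). y < emeasure \<mu> (pseudo_hyp_disc z r)}"
  have sets: "pseudo_hyp_disc z s \<in> sets \<mu>" for z s
    using pseudo_hyp_disc_measurable \<mu> by (simp add: borel_measure_on_disc_def)
  have "open ?S"
    unfolding open_contains_ball
  proof (intro ballI)
    fix z0 assume z0': "z0 \<in> ?S"
    then have z0: "z0 \<in> unit_disc" "y < emeasure \<mu> (pseudo_hyp_disc z0 r)" by (auto simp: space_restrict_space)
    \<comment> \<open>Smaller discs about z0 exhaust the disc, so by continuity from below one of
      them already has measure above y; the Lipschitz bound puts it inside
      \<open>pseudo_hyp_disc z r\<close> for all z near z0.\<close>
    let ?A = "\<lambda>n::nat. pseudo_hyp_disc z0 (r - 1 / Suc n)"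
    have "pseudo_hyp_disc z0 r = (\<Union>n. ?A n)"
    proof (intro set_eqI iffI)
      fix u assume u: "u \<in> pseudo_hyp_disc z0 r"
      then obtain n where "1 / Suc n < r - pseudo_hyp_dist z0 u"
        using nat_approx_posE[of "r - pseudo_hyp_dist z0 u"] by (auto simp: pseudo_hyp_disc_def)
      then show "u \<in> (\<Union>n. ?A n)" using u by (auto simp: pseudo_hyp_disc_def intro!: exI[of _ n])
    next
      fix u assume "u \<in> (\<Union>n. ?A n)"
      then obtain n where n: "u \<in> unit_disc" "pseudo_hyp_dist z0 u < r - 1 / Suc n" by (auto simp: pseudo_hyp_disc_def)
      have "0 < 1 / real (Suc n)" by simp
      then have "pseudo_hyp_dist z0 u < r" using n(2) by linarith
      then show "u \<in> pseudo_hyp_disc z0 r" using n(1) by (simp add: pseudo_hyp_disc_def)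
    qed
    moreover have "incseq ?A"
    proof (rule incseq_SucI)
      fix n
      have "1 / real (Suc (Suc n)) \<le> 1 / real (Suc n)" by (simp add: frac_le)
      then show "?A n \<subseteq> ?A (Suc n)" unfolding pseudo_hyp_disc_def by auto
    qed
    ultimately have "emeasure \<mu> (pseudo_hyp_disc z0 r) = (SUP n. emeasure \<mu> (?A n))"
      using sets by (subst SUP_emeasure_incseq) auto
    then obtain n where n: "y < emeasure \<mu> (?A n)" using z0 by (auto simp: less_SUP_iff)
    \<comment> \<open>The first term keeps bdist z above bdist z0 / 2; with the second, 2 * |z - z0|
      / bdist z is then at most 1 / (n + 1).\<close>
    define d where "d = min (bdist z0 / 2) (bdist z0 / (4 * Suc n))"
    have h: "bdist z0 > 0" by (rule bdist_pos[OF z0(1)])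
    have d: "d > 0" using h by (simp add: d_def)
    have "ball z0 d \<subseteq> ?S"
    proof
      fix z assume "z \<in> ball z0 d"
      then have zd: "cmod (z - z0) < d" by (simp add: dist_norm norm_minus_commute)
      have zh: "cmod (z - z0) < bdist z0 / 2" "cmod (z - z0) < bdist z0 / (4 * Suc n)" using zd by (auto simp: d_def)
      have bz: "bdist z0 / 2 < bdist z" using bdist_diff_le[of z z0] zh by linarith
      have zD: "z \<in> unit_disc" using bz h by (simp add: bdist_def)
      have "2 * cmod (z - z0) / bdist z \<le> 2 * cmod (z - z0) / (bdist z0 / 2)"
        using bz h by (intro divide_left_mono) auto
      also have "\<dots> \<le> 1 / Suc n" using zh(2) h by (simp add: field_simps)
      finally have le: "2 * cmod (z - z0) / bdist z \<le> 1 / Suc n" .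
      have "?A n \<subseteq> pseudo_hyp_disc z r"
      proof
        fix u assume u: "u \<in> ?A n"
        then have "u \<in> unit_disc" by (simp add: pseudo_hyp_disc_def)
        then show "u \<in> pseudo_hyp_disc z r"
          using u pseudo_hyp_dist_lipschitz[OF zD z0(1), of u] le unfolding pseudo_hyp_disc_def by auto
      qed
      then have "emeasure \<mu> (?A n) \<le> emeasure \<mu> (pseudo_hyp_disc z r)" by (intro emeasure_mono sets)
      then show "z \<in> ?S" using n zD by (auto simp: space_restrict_space)
    qed
    then show "\<exists>e>0. ball z0 e \<subseteq> ?S" using d by blast
  qed
  then have "?S \<in> sets borel" by simp
  moreover have "?S \<subseteq> unit_disc" by (auto simp: space_restrict_space)
  ultimately show "?S \<in> sets (restrict_space borel unit_disc)"
    by (subst sets_restrict_space_iff) auto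
qed

section \<open>Powers of extended reals and bounds for the averaging function\<close>

lemma epowr_ennreal: "0 \<le> x \<Longrightarrow> epowr (ennreal x) a = ennreal (x powr a)"
  by (simp add: epowr_def)

lemma epowr_le_iff:
  assumes "a > 0" "N \<ge> 0"
  shows "epowr x (1 / a) \<le> ennreal N \<longleftrightarrow> x \<le> ennreal (N powr a)"
proof (cases x)
  case (real y)
  have "y powr (1 / a) \<le> N \<longleftrightarrow> y \<le> N powr a"
  proof
    assume "y powr (1 / a) \<le> N"
    then have "(y powr (1 / a)) powr a \<le> N powr a" using assms by (intro powr_mono2) auto
    then show "y \<le> N powr a" using assms real by (simp add: powr_powr)
  next
    assume "y \<le> N powr a"
    then have "y powr (1 / a) \<le> (N powr a) powr (1 / a)" using assms real by (intro powr_mono2) auto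
    then show "y powr (1 / a) \<le> N" using assms by (simp add: powr_powr)
  qed
  then show ?thesis using real assms by (simp add: epowr_ennreal)
next
  case top
  have "\<not> top \<le> ennreal y" for y using ennreal_less_top[of y] by (simp only: not_le)
  then show ?thesis using top by (simp add: epowr_def)
qed

lemma ennreal_divide_le_iff:
  assumes "d > 0" "N \<ge> 0"
  shows "x / ennreal d \<le> ennreal N \<longleftrightarrow> x \<le> ennreal (N * d)"
proof (cases x)
  case (real y)
  then show ?thesis using assms by (simp add: divide_ennreal divide_le_eq)
next
  case top
  have "\<not> top \<le> ennreal y" for y using ennreal_less_top[of y] by (simp only: not_le)
  then show ?thesis using top by (simp add: ennreal_top_divide)
qed

lemma epowr_mono: "x \<le> y \<Longrightarrow> 0 \<le> a \<Longrightarrow> epowr x a \<le> epowr y a"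
proof (cases y)
  case (real b)
  assume "x \<le> y" "0 \<le> a"
  moreover from this real obtain c where "x = ennreal c" "0 \<le> c" by (cases x) (auto simp: top_unique)
  ultimately show ?thesis using real by (simp add: epowr_ennreal powr_mono2)
next
  case top
  then show ?thesis by (simp add: epowr_def)
qed

lemma epowr_measurable [measurable]: "(\<lambda>x. epowr x a) \<in> borel_measurable borel"
  unfolding epowr_def by measurable

context D_weight
begin

lemma G_fun_eq:
  assumes "z \<in> unit_disc"
  shows "G_fun p q \<omega> \<mu> r z = epowr (emeasure \<mu> (pseudo_hyp_disc z r)) (1 / q) /
    ennreal (W (bdist z) powr (1 / p) * bdist z powr (1 / q))"
  using assms by (simp add: G_fun_def omega_hat_eq_what what_eq_W bdist_le_1 epowr_ennreal ennreal_mult bdist_def[symmetric])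

text \<open>Trades a bound on the extended quotient for a real bound on the measure of a disc, the
  form in which the estimates use it.\<close>

lemma G_fun_le_iff:
  assumes z: "z \<in> unit_disc" and q: "q > 0" and N: "N \<ge> 0"
  shows "G_fun p q \<omega> \<mu> r z \<le> ennreal N \<longleftrightarrow>
    emeasure \<mu> (pseudo_hyp_disc z r) \<le> ennreal (N powr q * (W (bdist z) powr (q / p) * bdist z))"
proof -
  define d where "d = W (bdist z) powr (1 / p) * bdist z powr (1 / q)"
  have h: "bdist z > 0" "W (bdist z) > 0" using bdist_pos[OF z] W_pos[OF bdist_pos[OF z] bdist_le_1] by auto
  have d: "d > 0" using h by (simp add: d_def)
  have "G_fun p q \<omega> \<mu> r z \<le> ennreal N \<longleftrightarrow> epowr (emeasure \<mu> (pseudo_hyp_disc z r)) (1 / q) / ennreal d \<le> ennreal N"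
    by (simp add: G_fun_eq[OF z] d_def)
  also have "\<dots> \<longleftrightarrow> epowr (emeasure \<mu> (pseudo_hyp_disc z r)) (1 / q) \<le> ennreal (N * d)"
    using d N by (rule ennreal_divide_le_iff)
  also have "\<dots> \<longleftrightarrow> emeasure \<mu> (pseudo_hyp_disc z r) \<le> ennreal ((N * d) powr q)"
    using q N d by (intro epowr_le_iff) auto
  also have "(N * d) powr q = N powr q * (W (bdist z) powr (q / p) * bdist z)"
    using h q by (simp add: d_def powr_mult powr_powr)
  finally show ?thesis .
qed

lemma G_fun_measurable:
  assumes "borel_measure_on_disc \<mu>"
  shows "G_fun p q \<omega> \<mu> r \<in> borel_measurable (restrict_space borel unit_disc)"
proof -
  have [measurable]: "(\<lambda>z. emeasure \<mu> (pseudo_hyp_disc z r)) \<in> borel_measurable (restrict_space borel unit_disc)"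
    by (rule emeasure_pseudo_hyp_disc_measurable[OF assms])
  \<comment> \<open>\<open>W\<close> is monotone on {..1}, which contains the range of
    \<open>bdist\<close>, hence Borel there.\<close>
  have W1: "W \<in> borel_measurable (restrict_space borel {..1})"
    by (rule borel_measurable_mono_on_fnc) (auto simp: mono_on_def intro: W_mono)
  have "(\<lambda>z. W (bdist z)) \<in> borel_measurable (restrict_space borel unit_disc)"
    by (rule measurable_compose[OF _ W1]) (auto simp: measurable_restrict_space2_iff bdist_le_1 intro!: measurable_restrict_space1)
  then have "(\<lambda>z. epowr (emeasure \<mu> (pseudo_hyp_disc z r)) (1 / q) / ennreal (W (bdist z) powr (1 / p) * bdist z powr (1 / q)))
      \<in> borel_measurable (restrict_space borel unit_disc)"
  proof -
    assume [measurable]: "(\<lambda>z. W (bdist z)) \<in> borel_measurable (restrict_space borel unit_disc)"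
    have [measurable]: "bdist \<in> borel_measurable (restrict_space borel unit_disc)"
      by (intro measurable_restrict_space1) measurable
    show ?thesis by measurable
  qed
  then show ?thesis
    by (subst measurable_cong[OF G_fun_eq]) (auto simp: space_restrict_space)
qed

end

section \<open>Sufficiency\<close>

abbreviation carleson_mass :: "complex measure \<Rightarrow> real \<Rightarrow> (complex \<Rightarrow> complex) \<Rightarrow> complex \<Rightarrow> ennreal"
  where "carleson_mass M q f b \<equiv> (\<integral>\<^sup>+u. ennreal (cmod (f u) powr q) * indicator (carleson_square b) u \<partial>M)"

context D_weight
begin

text \<open>The version of \<open>carleson_mass\<close> with a kernel in place of the indicator of
  the square; 2 is a fixed choice of an exponent beyond 1.\<close>

abbreviation kratio_mass :: "real \<Rightarrow> (complex \<Rightarrow> complex) \<Rightarrow> complex \<Rightarrow> ennreal"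
  where "kratio_mass p f a \<equiv> (\<integral>\<^sup>+u. ennreal (cmod (f u) powr p) * ennreal (kratio a u powr 2) \<partial>wA)"

text \<open>X stands for a bound on the p-th power of the tent norm; being real, it keeps extended
  norms out of the estimates.\<close>

definition carleson_bound :: "real \<Rightarrow> (complex \<Rightarrow> complex) \<Rightarrow> real \<Rightarrow> bool"
  where "carleson_bound p f X \<longleftrightarrow> 0 \<le> X \<and> f holomorphic_on unit_disc \<and>
    (\<forall>b\<in>unit_disc. carleson_mass wA p f b \<le> ennreal (X * bdist b))"

lemma carleson_bound_kratio:
  assumes "carleson_bound p f X" "p > 0" "a \<in> unit_disc"
  shows "kratio_mass p f a \<le> ennreal (carleson_const 2 * X * bdist a)"
proof (rule carleson_kratio_integral)
  have "(\<lambda>u. cmod (f u) powr p) \<in> borel_measurable wA"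
    using assms by (intro measurable_wA borel_measurable_restrict_norm_powr) (auto simp: carleson_bound_def)
  then show "(\<lambda>u. ennreal (cmod (f u) powr p)) \<in> borel_measurable wA" by measurable
qed (use assms in \<open>auto simp: carleson_bound_def\<close>)

lemma W_le_mult:
  assumes L: "L \<ge> 1"
  shows "\<exists>C\<ge>1. \<forall>s t. 0 < s \<and> 0 < t \<and> s \<le> 1 \<and> t \<le> 1 \<and> t \<le> L * s \<longrightarrow> W t \<le> C * W s"
proof -
  obtain C \<beta> where C: "C \<ge> 1" "\<beta> \<ge> 0" and Wu: "\<And>s t. 0 < s \<Longrightarrow> s \<le> t \<Longrightarrow> t \<le> 1 \<Longrightarrow> W t \<le> C * (t / s) powr \<beta> * W s"
    using W_upper by blast
  have L1: "1 \<le> L powr \<beta>" using L C by (simp add: ge_one_powr_ge_zero)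
  have CL: "1 \<le> C * L powr \<beta>" using mult_mono[of 1 C 1 "L powr \<beta>"] C L1 by simp
  have "W t \<le> C * L powr \<beta> * W s" if "0 < s" "0 < t" "s \<le> 1" "t \<le> 1" "t \<le> L * s" for s t
  proof (cases "s \<le> t")
    case True
    have "W t \<le> C * (t / s) powr \<beta> * W s" using that True by (intro Wu)
    also have "\<dots> \<le> C * L powr \<beta> * W s"
      using that C by (intro mult_right_mono mult_left_mono powr_mono2) (auto simp: field_simps)
    finally show ?thesis .
  next
    case False
    then have "W t \<le> 1 * W s" using that by (simp add: W_mono)
    also have "\<dots> \<le> C * L powr \<beta> * W s" using CL by (intro mult_right_mono) auto
    finally show ?thesis .
  qed
  then show ?thesis using CL by blast
qed

text \<open>\<open>I k\<close> is the integral of |f|^p over the annulus at height bdist k, damped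
  by the fifth power of \<open>kratio k\<close>. It dominates |f|^p on the ball of k, yet its
  Carleson sums are controlled by f. Of the 5 kernel powers, 2 move \<open>kratio a k\<close> to
  \<open>kratio a u\<close> and 3 = 2 + 1 make the sum over k converge.\<close>

lemma lattice_integrals:
  assumes p: "p > 0" and Z: "disc_lattice \<epsilon> Z" and \<epsilon>: "0 < \<epsilon>" "\<epsilon> \<le> 1 / 20"
  shows "\<exists>C>0. \<forall>f X. carleson_bound p f X \<longrightarrow> (\<exists>I.
    (\<forall>k\<in>Z. 0 \<le> I k \<and> I k \<le> C * X * bdist k \<and>
       (\<forall>w\<in>ball k (5 * \<epsilon> * bdist k). cmod (f w) powr p * (bdist k * W (bdist k)) \<le> C * I k)) \<and>
    (\<forall>a\<in>unit_disc. (\<integral>\<^sup>+k. ennreal (I k * kratio a k powr 2) \<partial>count_space Z) \<le>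
       ennreal C * kratio_mass p f a))"
proof -
  have ZD: "k \<in> unit_disc" if "k \<in> Z" for k using Z that by (auto simp: disc_lattice_def)
  have Zc: "countable Z" using Z by (simp add: disc_lattice_def)
  have five: "(0::real) \<le> 5" by simp
  obtain K C1 where K: "K > 1" and C1: "C1 > 0" and pw: "\<And>f z w. f holomorphic_on unit_disc \<Longrightarrow> z \<in> unit_disc \<Longrightarrow> w \<in> ball z (bdist z / 4) \<Longrightarrow>
      ennreal (cmod (f w) powr p * (bdist z * W (bdist z))) \<le>
      ennreal C1 * (\<integral>\<^sup>+u. ennreal (cmod (f u) powr p * kratio z u powr 5) * indicator {bdist z / K..bdist z} (bdist u) \<partial>wA)"
    by (rule weighted_pointwise_estimate[OF p five]) (rule that)
  have e1: "\<epsilon> \<le> 1" using \<epsilon> by simp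
  obtain C2 where C2: "C2 > 0" and S: "\<And>F u. finite F \<Longrightarrow> F \<subseteq> Z \<Longrightarrow> u \<in> unit_disc \<Longrightarrow>
      (\<Sum>k\<in>F. kratio k u powr (2 + 1) * bdist k powr (- 1)) \<le> C2 * bdist u powr (- 1)"
    by (rule lattice_kratio_sum[OF Z \<epsilon>(1) e1 zero_less_one]) (rule that)
  define Cc where "Cc = carleson_const 2"
  have Cc: "Cc > 0" by (simp add: Cc_def carleson_const_pos)
  define C where "C = C1 + Cc + 4 * K * C2"
  have C: "C > 0" "C1 \<le> C" "Cc \<le> C" "4 * K * C2 \<le> C" using C1 C2 Cc K by (auto simp: C_def add_pos_pos)
  show ?thesis
  proof (intro exI[of _ C] conjI allI impI C(1))
    fix f X assume car: "carleson_bound p f X"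
    then have f: "f holomorphic_on unit_disc" and X: "X \<ge> 0" by (auto simp: carleson_bound_def)
    have fm: "(\<lambda>u. cmod (f u) powr p) \<in> borel_measurable wA"
      by (intro measurable_wA borel_measurable_restrict_norm_powr f p)
    note [measurable] = fm
    define g where "g k u = ennreal (cmod (f u) powr p * kratio k u powr 5) * indicator {bdist k / K..bdist k} (bdist u)" for k u
    have gm [measurable]: "g k \<in> borel_measurable wA" for k unfolding g_def by measurable
    define I where "I k = enn2real (\<integral>\<^sup>+u. g k u \<partial>wA)" for k
    have Ile: "(\<integral>\<^sup>+u. g k u \<partial>wA) \<le> ennreal (Cc * X * bdist k)" if k: "k \<in> Z" for k
    proof -
      have "(\<integral>\<^sup>+u. g k u \<partial>wA) \<le> (\<integral>\<^sup>+u. ennreal (cmod (f u) powr p) * ennreal (kratio k u powr 2) \<partial>wA)"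
      proof (rule nn_integral_mono)
        fix u assume "u \<in> space wA"
        then have u: "u \<in> unit_disc" by simp
        have "kratio k u powr 5 \<le> kratio k u powr 2"
          using kratio_pos[OF ZD[OF k] u] kratio_le_1[OF ZD[OF k] u] by (intro powr_mono') auto
        then have "ennreal (cmod (f u) powr p * kratio k u powr 5) \<le> ennreal (cmod (f u) powr p) * ennreal (kratio k u powr 2)"
          by (simp add: ennreal_mult[symmetric] ennreal_leI mult_left_mono del: ennreal_mult)
        then show "g k u \<le> ennreal (cmod (f u) powr p) * ennreal (kratio k u powr 2)"
          by (auto simp: g_def indicator_def)
      qed
      also have "\<dots> \<le> ennreal (Cc * X * bdist k)" unfolding Cc_def by (rule carleson_bound_kratio[OF car p ZD[OF k]])
      finally show ?thesis .
    qed
    have Ieq: "ennreal (I k) = (\<integral>\<^sup>+u. g k u \<partial>wA)" if k: "k \<in> Z" for k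
      using order_le_less_trans[OF Ile[OF k] ennreal_less_top] by (simp add: I_def)
    show "\<exists>I. (\<forall>k\<in>Z. 0 \<le> I k \<and> I k \<le> C * X * bdist k \<and>
       (\<forall>w\<in>ball k (5 * \<epsilon> * bdist k). cmod (f w) powr p * (bdist k * W (bdist k)) \<le> C * I k)) \<and>
      (\<forall>a\<in>unit_disc. (\<integral>\<^sup>+k. ennreal (I k * kratio a k powr 2) \<partial>count_space Z) \<le>
       ennreal C * kratio_mass p f a)"
    proof (rule exI[of _ I], intro conjI ballI)
      fix k assume k: "k \<in> Z"
      have h: "bdist k > 0" by (rule bdist_pos[OF ZD[OF k]])
      show I0: "0 \<le> I k" by (simp add: I_def)
      have "ennreal (I k) \<le> ennreal (Cc * X * bdist k)" using Ieq[OF k] Ile[OF k] by simp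
      then have "I k \<le> Cc * X * bdist k" using Cc X h by (subst (asm) ennreal_le_iff) auto
      also have "\<dots> \<le> C * X * bdist k" using C X h by (intro mult_right_mono) auto
      finally show "I k \<le> C * X * bdist k" .
      fix w assume "w \<in> ball k (5 * \<epsilon> * bdist k)"
      moreover have "5 * \<epsilon> * bdist k \<le> bdist k / 4"
      proof -
        have "5 * \<epsilon> * bdist k \<le> 1 / 4 * bdist k" using \<epsilon> h by (intro mult_right_mono) auto
        then show ?thesis by simp
      qed
      ultimately have w: "w \<in> ball k (bdist k / 4)" by simp
      have "ennreal (cmod (f w) powr p * (bdist k * W (bdist k))) \<le> ennreal C1 * ennreal (I k)"
        using pw[OF f ZD[OF k] w] unfolding Ieq[OF k] g_def .
      also have "\<dots> = ennreal (C1 * I k)" using C1 I0 by (intro ennreal_mult[symmetric]) auto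
      finally have "cmod (f w) powr p * (bdist k * W (bdist k)) \<le> C1 * I k"
        using C1 I0 by (subst (asm) ennreal_le_iff) auto
      also have "\<dots> \<le> C * I k" using C I0 by (intro mult_right_mono) auto
      finally show "cmod (f w) powr p * (bdist k * W (bdist k)) \<le> C * I k" .
    next
      fix a :: complex assume a: "a \<in> unit_disc"
      have "(\<integral>\<^sup>+k. ennreal (I k * kratio a k powr 2) \<partial>count_space Z) = (\<integral>\<^sup>+k. \<integral>\<^sup>+u. g k u * ennreal (kratio a k powr 2) \<partial>wA \<partial>count_space Z)"
      proof (rule nn_integral_cong)
        fix k assume "k \<in> space (count_space Z)"
        then have k: "k \<in> Z" by simp
        have "ennreal (I k * kratio a k powr 2) = ennreal (I k) * ennreal (kratio a k powr 2)"
          by (intro ennreal_mult) (auto simp: I_def)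
        then show "ennreal (I k * kratio a k powr 2) = (\<integral>\<^sup>+u. g k u * ennreal (kratio a k powr 2) \<partial>wA)"
          unfolding Ieq[OF k] by (subst nn_integral_multc) simp_all
      qed
      also have "\<dots> = (\<integral>\<^sup>+u. \<integral>\<^sup>+k. g k u * ennreal (kratio a k powr 2) \<partial>count_space Z \<partial>wA)"
        by (rule nn_integral_count_space_nn_integral[symmetric, OF Zc]) measurable
      also have "\<dots> \<le> (\<integral>\<^sup>+u. ennreal C * (ennreal (cmod (f u) powr p) * ennreal (kratio a u powr 2)) \<partial>wA)"
      proof (rule nn_integral_mono)
        fix u assume "u \<in> space wA"
        then have u: "u \<in> unit_disc" by simp
        have hu: "bdist u > 0" by (rule bdist_pos[OF u])
        let ?A = "cmod (f u) powr p * kratio a u powr 2"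
        have "(\<integral>\<^sup>+k. g k u * ennreal (kratio a k powr 2) \<partial>count_space Z) \<le> ennreal (C * ?A)"
        proof (rule nn_integral_count_space_le[OF Zc])
          fix F assume F: "finite F" "F \<subseteq> Z"
          have one: "g k u * ennreal (kratio a k powr 2) \<le> ennreal (4 * K * bdist u * ?A * (kratio k u powr (2 + 1) * bdist k powr (- 1)))"
            if k: "k \<in> F" for k
          proof (cases "bdist u \<in> {bdist k / K..bdist k}")
            case True
            have kD: "k \<in> unit_disc" using ZD F k by blast
            have h: "bdist k > 0" by (rule bdist_pos[OF kD])
            have kr: "kratio k u > 0" "kratio a k > 0" "kratio a u > 0" by (intro kratio_pos kD u a)+
            have "(kratio a k * kratio k u) powr 2 \<le> (2 * kratio a u) powr 2"
              using kratio_mult_le[OF a kD u] kr by (intro powr_mono2) auto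
            then have "kratio a k powr 2 * kratio k u powr 2 \<le> 4 * kratio a u powr 2"
              using kr by (simp add: powr_mult)
            then have i1: "kratio k u powr 5 * kratio a k powr 2 \<le> 4 * kratio a u powr 2 * kratio k u powr 3"
            proof -
              assume *: "kratio a k powr 2 * kratio k u powr 2 \<le> 4 * kratio a u powr 2"
              have "kratio k u powr 5 = kratio k u powr 2 * kratio k u powr 3" using kr by (simp add: powr_add[symmetric])
              then show ?thesis using mult_right_mono[OF *, of "kratio k u powr 3"] by (simp add: mult_ac)
            qed
            \<comment> \<open>The cut-off in the annulus gives bdist k <= K * bdist u; this supplies
              the factor (bdist k)^(-1) of the lattice sum.\<close>
            have i2: "1 \<le> K * bdist u * bdist k powr (- 1)"
              using True h K by (simp add: powr_minus_divide field_simps)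
            have "kratio k u powr 5 * kratio a k powr 2 * 1 \<le> 4 * kratio a u powr 2 * kratio k u powr 3 * (K * bdist u * bdist k powr (- 1))"
              by (rule mult_mono[OF i1 i2]) auto
            then have "cmod (f u) powr p * (kratio k u powr 5 * kratio a k powr 2 * 1) \<le>
              cmod (f u) powr p * (4 * kratio a u powr 2 * kratio k u powr 3 * (K * bdist u * bdist k powr (- 1)))"
              by (intro mult_left_mono) auto
            then have "ennreal (cmod (f u) powr p * kratio k u powr 5 * kratio a k powr 2) \<le> ennreal (4 * K * bdist u * ?A * (kratio k u powr (2 + 1) * bdist k powr (- 1)))"
              by (intro ennreal_leI) (simp add: mult_ac)
            moreover have "g k u * ennreal (kratio a k powr 2) = ennreal (cmod (f u) powr p * kratio k u powr 5 * kratio a k powr 2)"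
              using True by (simp add: g_def ennreal_mult)
            ultimately show ?thesis by (simp only:)
          qed (simp add: g_def)
          have "(\<Sum>k\<in>F. g k u * ennreal (kratio a k powr 2)) \<le> (\<Sum>k\<in>F. ennreal (4 * K * bdist u * ?A * (kratio k u powr (2 + 1) * bdist k powr (- 1))))"
            by (intro sum_mono one)
          also have "\<dots> = ennreal (\<Sum>k\<in>F. 4 * K * bdist u * ?A * (kratio k u powr (2 + 1) * bdist k powr (- 1)))"
            using K hu by (intro sum_ennreal mult_nonneg_nonneg) auto
          also have "\<dots> = ennreal (4 * K * bdist u * ?A * (\<Sum>k\<in>F. kratio k u powr (2 + 1) * bdist k powr (- 1)))"
            by (simp only: sum_distrib_left)
          also have "\<dots> \<le> ennreal (4 * K * bdist u * ?A * (C2 * bdist u powr (- 1)))"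
            using K hu by (intro ennreal_leI mult_left_mono S F u mult_nonneg_nonneg) auto
          also have "4 * K * bdist u * ?A * (C2 * bdist u powr (- 1)) = 4 * K * C2 * ?A"
            using hu by (simp add: powr_minus_divide)
          also have "ennreal (4 * K * C2 * ?A) \<le> ennreal (C * ?A)"
            using C by (intro ennreal_leI mult_right_mono) auto
          finally show "(\<Sum>k\<in>F. g k u * ennreal (kratio a k powr 2)) \<le> ennreal (C * ?A)" .
        qed
        also have "ennreal (C * ?A) = ennreal C * (ennreal (cmod (f u) powr p) * ennreal (kratio a u powr 2))"
          using C by (simp add: ennreal_mult)
        finally show "(\<integral>\<^sup>+k. g k u * ennreal (kratio a k powr 2) \<partial>count_space Z) \<le> ennreal C * (ennreal (cmod (f u) powr p) * ennreal (kratio a u powr 2))" .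
      qed
      also have "\<dots> = ennreal C * kratio_mass p f a"
        by (rule nn_integral_cmult) measurable
      finally show "(\<integral>\<^sup>+k. ennreal (I k * kratio a k powr 2) \<partial>count_space Z) \<le> ennreal C * kratio_mass p f a" .
    qed
  qed
qed

end

text \<open>A point u of S(a) in the ball of k has kratio a u >= 2 / 5 and kratio u k >= 1 / 3,
  hence kratio a k >= 1 / 15; and 225 = 15^2. The covering turns the integral into a countable sum,
  which can be exchanged with the integral for every \<mu>.\<close>

lemma lattice_embedding:
  assumes \<mu>: "borel_measure_on_disc \<mu>" and Z: "disc_lattice \<epsilon> Z" and \<epsilon>: "0 < \<epsilon>" "\<epsilon> \<le> 1 / 20"
    and m: "\<And>k w. k \<in> Z \<Longrightarrow> w \<in> ball k (5 * \<epsilon> * bdist k) \<Longrightarrow> cmod (f w) powr q \<le> m k"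
    and m0: "\<And>k. k \<in> Z \<Longrightarrow> 0 \<le> m k" and a: "a \<in> unit_disc"
  shows "carleson_mass \<mu> q f a \<le>
    (\<integral>\<^sup>+k. ennreal (225 * (m k * kratio a k powr 2)) * emeasure \<mu> (ball k (5 * \<epsilon> * bdist k)) \<partial>count_space Z)"
proof -
  have ZD: "k \<in> unit_disc" if "k \<in> Z" for k using Z that by (auto simp: disc_lattice_def)
  have Zc: "countable Z" using Z by (simp add: disc_lattice_def)
  let ?B = "\<lambda>k. ball k (5 * \<epsilon> * bdist k)"
  have B: "?B k \<in> sets \<mu>" if "k \<in> Z" for k
  proof -
    have "?B k \<subseteq> unit_disc" using ball_bdist_subset[OF ZD[OF that], of "5 * \<epsilon>"] \<epsilon> by auto
    then have "?B k \<in> sets (restrict_space borel unit_disc)" by (subst sets_restrict_space_iff) auto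
    then show ?thesis using \<mu> by (simp add: borel_measure_on_disc_def)
  qed
  have sp: "space \<mu> = unit_disc"
    using \<mu> sets_eq_imp_space_eq[of \<mu> "restrict_space borel unit_disc"] by (simp add: borel_measure_on_disc_def space_restrict_space)
  have "carleson_mass \<mu> q f a \<le>
    (\<integral>\<^sup>+u. \<integral>\<^sup>+k. ennreal (225 * (m k * kratio a k powr 2)) * indicator (?B k) u \<partial>count_space Z \<partial>\<mu>)"
  proof (rule nn_integral_mono)
    fix u assume "u \<in> space \<mu>"
    then have u: "u \<in> unit_disc" by (simp add: sp)
    show "ennreal (cmod (f u) powr q) * indicator (carleson_square a) u \<le> (\<integral>\<^sup>+k. ennreal (225 * (m k * kratio a k powr 2)) * indicator (?B k) u \<partial>count_space Z)"
    proof (cases "u \<in> carleson_square a")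
      case True
      have "u \<in> (\<Union>k\<in>Z. ?B k)" using Z u unfolding disc_lattice_def by blast
      then obtain k where k: "k \<in> Z" "u \<in> ?B k" by blast
      have kD: "k \<in> unit_disc" by (rule ZD[OF k(1)])
      have h: "bdist k > 0" by (rule bdist_pos[OF kD])
      have d: "cmod (u - k) < bdist k / 4"
      proof -
        have "5 * \<epsilon> * bdist k \<le> 1 / 4 * bdist k" using \<epsilon> h by (intro mult_right_mono) auto
        then show ?thesis using k(2) by (simp add: dist_norm norm_minus_commute)
      qed
      have hu: "3 / 4 * bdist k \<le> bdist u" using bdist_diff_le[of u k] d by linarith
      have hu0: "bdist u > 0" by (rule bdist_pos[OF u])
      have "kdist u k \<le> 3 * bdist u" using kdist_le_dist[OF u, of k] d hu hu0 by linarith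
      then have 1: "1 / 3 \<le> kratio u k" using kdist_pos[OF u kD] by (simp add: kratio_def field_simps)
      have 2: "2 / 5 \<le> kratio a u"
        using carleson_square_subset(2)[OF a True] kdist_pos[OF a u] by (simp add: kratio_def field_simps)
      have "2 / 5 * (1 / 3) \<le> kratio a u * kratio u k" using 1 2 by (intro mult_mono) auto
      also have "\<dots> \<le> 2 * kratio a k" by (rule kratio_mult_le[OF a u kD])
      finally have "1 / 15 \<le> kratio a k" by simp
      then have "(1 / 15) powr 2 \<le> kratio a k powr 2" by (intro powr_mono2) auto
      then have "1 \<le> 225 * kratio a k powr 2" by (simp add: power2_eq_square)
      then have "m k * 1 \<le> m k * (225 * kratio a k powr 2)" using m0[OF k(1)] by (intro mult_left_mono) auto
      then have "cmod (f u) powr q \<le> 225 * (m k * kratio a k powr 2)" using m[OF k] by (simp add: mult_ac)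
      then have "ennreal (cmod (f u) powr q) * indicator (carleson_square a) u \<le> ennreal (225 * (m k * kratio a k powr 2)) * indicator (?B k) u"
        using True k(2) by (simp add: ennreal_leI del: ennreal_mult')
      also have "\<dots> \<le> (\<integral>\<^sup>+k. ennreal (225 * (m k * kratio a k powr 2)) * indicator (?B k) u \<partial>count_space Z)"
        by (rule nn_integral_ge_point[OF k(1)])
      finally show ?thesis .
    qed simp
  qed
  also have "\<dots> = (\<integral>\<^sup>+k. \<integral>\<^sup>+u. ennreal (225 * (m k * kratio a k powr 2)) * indicator (?B k) u \<partial>\<mu> \<partial>count_space Z)"
  proof (rule nn_integral_count_space_nn_integral[OF Zc])
    fix k assume "k \<in> Z"
    note [measurable] = B[OF this]
    show "(\<lambda>u. ennreal (225 * (m k * kratio a k powr 2)) * indicator (?B k) u) \<in> borel_measurable \<mu>" by measurable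
  qed
  also have "\<dots> = (\<integral>\<^sup>+k. ennreal (225 * (m k * kratio a k powr 2)) * emeasure \<mu> (?B k) \<partial>count_space Z)"
    using B by (intro nn_integral_cong) (simp add: nn_integral_cmult_indicator)
  finally show ?thesis .
qed

lemma AE_dA_ball:
  assumes P: "AE z in dA. P z" and B: "ball k R \<subseteq> unit_disc" "R > 0"
  obtains w where "w \<in> ball k R" "P w"
proof -
  have "AE z in lebesgue. z \<in> unit_disc \<longrightarrow> P z" using P by (subst (asm) AE_restrict_space_iff) auto
  then have AE: "AE z in lborel. z \<in> unit_disc \<longrightarrow> P z" by (simp add: AE_completion_iff)
  have "\<exists>w\<in>ball k R. P w"
  proof (rule ccontr)
    assume "\<not> (\<exists>w\<in>ball k R. P w)"
    then have "AE z in lborel. z \<notin> ball k R" using AE B(1) by (auto elim!: eventually_mono)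
    then have "ball k R \<in> null_sets lborel" by (subst AE_iff_null_sets) auto
    then have "emeasure lborel (ball k R) = 0" by auto
    then show False using B(2) by (simp add: emeasure_lborel_ball_complex)
  qed
  then show ?thesis using that by blast
qed

lemma lattice_disjoint_sum:
  assumes Z: "disc_lattice \<epsilon> Z" and \<epsilon>: "\<epsilon> \<le> 1" and F: "finite F" "F \<subseteq> Z"
    and g: "g \<in> borel_measurable (restrict_space borel unit_disc)"
  shows "(\<Sum>k\<in>F. \<integral>\<^sup>+z. g z * indicator (ball k (\<epsilon> * bdist k)) z \<partial>lborel) \<le> (\<integral>\<^sup>+z. g z * indicator unit_disc z \<partial>lborel)"
proof -
  let ?B = "\<lambda>k. ball k (\<epsilon> * bdist k)"
  have "(\<Sum>k\<in>F. \<integral>\<^sup>+z. g z * indicator (?B k) z \<partial>lborel) = (\<Sum>k\<in>F. \<integral>\<^sup>+z. g z * indicator unit_disc z * indicator (?B k) z \<partial>lborel)"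
  proof (intro sum.cong refl nn_integral_cong)
    fix k z assume "k \<in> F"
    then have "z \<in> ?B k \<Longrightarrow> z \<in> unit_disc"
      using ball_bdist_subset[OF _ \<epsilon>] F Z by (auto simp: disc_lattice_def)
    then show "g z * indicator (?B k) z = g z * indicator unit_disc z * indicator (?B k) z"
      by (auto simp: indicator_def)
  qed
  also have "\<dots> \<le> (\<integral>\<^sup>+z. g z * indicator unit_disc z \<partial>lborel)"
    using g by (intro lattice_nn_integral_sum_le[OF Z F]) (subst (asm) borel_measurable_restrict_space_iff_ennreal, auto)
  finally show ?thesis .
qed

lemma ennreal_divide_mono:
  assumes "x \<le> y" "a \<le> b" "0 < a"
  shows "x / ennreal b \<le> y / ennreal a"
  using assms unfolding divide_ennreal_def by (intro mult_mono) (auto simp: inverse_ennreal ennreal_leI)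

text \<open>Young's inequality for x / A and y / B. Summed over k, with A and B the sizes of the two
  sums, it does the work of Hoelder's inequality.\<close>

lemma powr_split_product:
  fixes x y A B t :: real
  assumes "x \<ge> 0" "y \<ge> 0" "A > 0" "B > 0" "0 < t" "t < 1"
  shows "x powr t * y powr (1 - t) \<le> A powr t * B powr (1 - t) * (x / A + y / B)"
proof (cases "x = 0 \<or> y = 0")
  case False
  then have xy: "x > 0" "y > 0" using assms by auto
  have "(x / A) powr t * (y / B) powr (1 - t) \<le> t * (x / A) + (1 - t) * (y / B)"
    using assms xy by (intro Youngs_inequality_0) auto
  also have "\<dots> \<le> 1 * (x / A) + 1 * (y / B)" using assms xy by (intro add_mono mult_right_mono) auto
  finally have *: "(x / A) powr t * (y / B) powr (1 - t) \<le> x / A + y / B" by simp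
  have "x powr t * y powr (1 - t) = A powr t * B powr (1 - t) * ((x / A) powr t * (y / B) powr (1 - t))"
    using assms by (simp add: powr_divide)
  also have "\<dots> \<le> A powr t * B powr (1 - t) * (x / A + y / B)" by (intro mult_left_mono *) auto
  finally show ?thesis .
qed (use assms in auto)

context D_weight
begin

lemma lattice_ball_comparable:
  assumes "\<epsilon> \<le> 1 / 20"
  shows "\<exists>C\<ge>1. \<forall>k\<in>unit_disc. \<forall>w\<in>ball k (5 * \<epsilon> * bdist k).
    w \<in> unit_disc \<and> bdist w \<le> 2 * bdist k \<and> bdist k \<le> 2 * bdist w \<and> W (bdist w) \<le> C * W (bdist k)"
proof -
  obtain C where C: "C \<ge> 1" and Wc: "\<And>s t. 0 < s \<Longrightarrow> 0 < t \<Longrightarrow> s \<le> 1 \<Longrightarrow> t \<le> 1 \<Longrightarrow> t \<le> 2 * s \<Longrightarrow> W t \<le> C * W s"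
    using W_le_mult[of 2] by auto
  have "w \<in> unit_disc \<and> bdist w \<le> 2 * bdist k \<and> bdist k \<le> 2 * bdist w \<and> W (bdist w) \<le> C * W (bdist k)"
    if k: "k \<in> unit_disc" and w: "w \<in> ball k (5 * \<epsilon> * bdist k)" for k w
  proof -
    have h: "bdist k > 0" by (rule bdist_pos[OF k])
    have "5 * \<epsilon> * bdist k \<le> 1 / 4 * bdist k" using assms h by (intro mult_right_mono) auto
    then have "cmod (w - k) < 1 / 4 * bdist k" using w by (simp add: dist_norm norm_minus_commute)
    then have 1: "bdist w \<le> 2 * bdist k" "bdist k \<le> 2 * bdist w" using bdist_diff_le[of w k] h by linarith+
    have wD: "w \<in> unit_disc" using ball_bdist_subset[OF k _ w] assms by simp
    show ?thesis using 1 wD bdist_pos[OF wD] h bdist_le_1 Wc[of "bdist k" "bdist w"] by simp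
  qed
  then show ?thesis using C by blast
qed

text \<open>The quotients I k / bdist k are bounded by a multiple of X, so their power q / p >= 1 is
  at most of order X^((q - p) / p) times the first power, which sums. The bound is linear in
  \<open>kratio_mass\<close> at the same point a, so that vanishing is inherited.\<close>

lemma sufficiency_le:
  assumes p: "p > 0" and pq: "p \<le> q" and r: "0 < r" "r < 1 / 4"
  shows "\<exists>C>0. \<forall>\<mu> N f X a. borel_measure_on_disc \<mu> \<and> 0 \<le> N \<and> (AE z in dA. G_fun p q \<omega> \<mu> r z \<le> ennreal N) \<and>
    carleson_bound p f X \<and> a \<in> unit_disc \<longrightarrow>
    carleson_mass \<mu> q f a \<le>
      ennreal (C * N powr q * X powr ((q - p) / p)) * kratio_mass p f a"
proof -
  have q: "q > 0" using p pq by simp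
  \<comment> \<open>Makes the covering radius 5 * \<epsilon> equal to r / 4, for which a lattice
    ball lies in the pseudo-hyperbolic discs of radius r about its points.\<close>
  define \<epsilon> where "\<epsilon> = r / 20"
  have \<epsilon>: "0 < \<epsilon>" "\<epsilon> \<le> 1 / 20" "5 * \<epsilon> = r / 4" using r by (auto simp: \<epsilon>_def)
  obtain Z where Z: "disc_lattice \<epsilon> Z" using disc_lattice_exists[OF \<epsilon>(1)] by blast
  have ZD: "k \<in> unit_disc" if "k \<in> Z" for k using Z that by (auto simp: disc_lattice_def)
  obtain C1 where C1: "C1 > 0" and LI: "\<forall>f X. carleson_bound p f X \<longrightarrow> (\<exists>I.
    (\<forall>k\<in>Z. 0 \<le> I k \<and> I k \<le> C1 * X * bdist k \<and>
       (\<forall>w\<in>ball k (5 * \<epsilon> * bdist k). cmod (f w) powr p * (bdist k * W (bdist k)) \<le> C1 * I k)) \<and>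
    (\<forall>a\<in>unit_disc. (\<integral>\<^sup>+k. ennreal (I k * kratio a k powr 2) \<partial>count_space Z) \<le>
       ennreal C1 * kratio_mass p f a))"
    using lattice_integrals[OF p Z \<epsilon>(1,2)] by blast
  obtain C2 where C2: "C2 \<ge> 1" and cmp: "\<forall>k\<in>unit_disc. \<forall>w\<in>ball k (5 * \<epsilon> * bdist k).
    w \<in> unit_disc \<and> bdist w \<le> 2 * bdist k \<and> bdist k \<le> 2 * bdist w \<and> W (bdist w) \<le> C2 * W (bdist k)"
    using lattice_ball_comparable[OF \<epsilon>(2)] by blast
  define C3 where "C3 = 225 * C1 powr (q / p) * (C2 powr (q / p) * 2) * C1 powr ((q - p) / p)"
  define C where "C = C3 * C1"
  have C3: "C3 > 0" using C1 C2 by (simp add: C3_def)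
  have C: "C > 0" using C1 C3 by (simp add: C_def)
  show ?thesis
  proof (intro exI[of _ C] conjI C allI impI)
    fix \<mu> N f X a
    assume "borel_measure_on_disc \<mu> \<and> 0 \<le> N \<and> (AE z in dA. G_fun p q \<omega> \<mu> r z \<le> ennreal N) \<and>
      carleson_bound p f X \<and> a \<in> unit_disc"
    then have \<mu>: "borel_measure_on_disc \<mu>" and N: "0 \<le> N" and G: "AE z in dA. G_fun p q \<omega> \<mu> r z \<le> ennreal N"
      and car: "carleson_bound p f X" and a: "a \<in> unit_disc" by auto
    have X: "X \<ge> 0" using car by (simp add: carleson_bound_def)
    obtain I where I: "\<And>k. k \<in> Z \<Longrightarrow> 0 \<le> I k" "\<And>k. k \<in> Z \<Longrightarrow> I k \<le> C1 * X * bdist k"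
      "\<And>k w. k \<in> Z \<Longrightarrow> w \<in> ball k (5 * \<epsilon> * bdist k) \<Longrightarrow> cmod (f w) powr p * (bdist k * W (bdist k)) \<le> C1 * I k"
      and Isum: "(\<integral>\<^sup>+k. ennreal (I k * kratio a k powr 2) \<partial>count_space Z) \<le>
       ennreal C1 * kratio_mass p f a"
      using LI[rule_format, OF car] a by blast
    let ?J = "kratio_mass p f a"
    define m where "m k = (C1 * I k / (bdist k * W (bdist k))) powr (q / p)" for k
    have hW: "bdist k > 0" "W (bdist k) > 0" if "k \<in> Z" for k
      using bdist_pos[OF ZD[OF that]] W_pos[OF _ bdist_le_1] by auto
    have "carleson_mass \<mu> q f a \<le>
      (\<integral>\<^sup>+k. ennreal (225 * (m k * kratio a k powr 2)) * emeasure \<mu> (ball k (5 * \<epsilon> * bdist k)) \<partial>count_space Z)"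
    proof (rule lattice_embedding[OF \<mu> Z \<epsilon>(1,2) _ _ a])
      fix k w assume k: "k \<in> Z" and w: "w \<in> ball k (5 * \<epsilon> * bdist k)"
      have "cmod (f w) powr p \<le> C1 * I k / (bdist k * W (bdist k))"
        using I(3)[OF k w] hW[OF k] by (simp add: field_simps)
      then have "(cmod (f w) powr p) powr (q / p) \<le> m k"
        unfolding m_def using p q by (intro powr_mono2) auto
      then show "cmod (f w) powr q \<le> m k" using p by (simp add: powr_powr)
    qed (simp add: m_def)
    also have "\<dots> \<le> (\<integral>\<^sup>+k. ennreal (C3 * N powr q * X powr ((q - p) / p)) * ennreal (I k * kratio a k powr 2) \<partial>count_space Z)"
    proof (rule nn_integral_mono)
      fix k assume "k \<in> space (count_space Z)"
      then have k: "k \<in> Z" by simp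
      note h = hW[OF k]
      have Ball: "ball k (5 * \<epsilon> * bdist k) \<subseteq> unit_disc" using cmp ZD[OF k] by blast
      \<comment> \<open>The bound on \<open>G_fun\<close> holds almost everywhere, hence at some
        point of the ball; k itself may be exceptional.\<close>
      obtain w where w: "w \<in> ball k (5 * \<epsilon> * bdist k)" and Gw: "G_fun p q \<omega> \<mu> r w \<le> ennreal N"
        using AE_dA_ball[OF G Ball] \<epsilon>(1) h(1) by auto
      have wc: "w \<in> unit_disc" "bdist w \<le> 2 * bdist k" "W (bdist w) \<le> C2 * W (bdist k)"
        using cmp ZD[OF k] w by auto
      have "emeasure \<mu> (ball k (5 * \<epsilon> * bdist k)) \<le> emeasure \<mu> (pseudo_hyp_disc w r)"
        using ball_subset_pseudo_hyp_disc[OF ZD[OF k] r(1), of w] r w \<epsilon>(3) pseudo_hyp_disc_measurable \<mu>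
        by (intro emeasure_mono) (auto simp: borel_measure_on_disc_def)
      also have "\<dots> \<le> ennreal (N powr q * (W (bdist w) powr (q / p) * bdist w))"
        using Gw G_fun_le_iff[OF wc(1) q N] by simp
      also have "\<dots> \<le> ennreal (N powr q * ((C2 * W (bdist k)) powr (q / p) * (2 * bdist k)))"
        using wc p q bdist_pos[OF wc(1)] by (intro ennreal_leI mult_left_mono mult_mono powr_mono2) auto
      finally have em: "emeasure \<mu> (ball k (5 * \<epsilon> * bdist k)) \<le> ennreal (N powr q * ((C2 * W (bdist k)) powr (q / p) * (2 * bdist k)))" .
      have "ennreal (225 * (m k * kratio a k powr 2)) * emeasure \<mu> (ball k (5 * \<epsilon> * bdist k)) \<le>
        ennreal (225 * (m k * kratio a k powr 2)) * ennreal (N powr q * ((C2 * W (bdist k)) powr (q / p) * (2 * bdist k)))"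
        by (intro mult_left_mono em) simp
      also have "\<dots> = ennreal (225 * (m k * kratio a k powr 2) * (N powr q * ((C2 * W (bdist k)) powr (q / p) * (2 * bdist k))))"
        using h by (intro ennreal_mult[symmetric]) (auto simp: m_def)
      also have "\<dots> \<le> ennreal (C3 * N powr q * X powr ((q - p) / p) * (I k * kratio a k powr 2))"
      proof (rule ennreal_leI)
        have step: "(I k / bdist k) powr (q / p) * bdist k \<le> (C1 * X) powr ((q - p) / p) * I k"
        proof (cases "I k = 0")
          case False
          then have Ip: "I k > 0" using I(1)[OF k] by simp
          have "q / p = (q - p) / p + 1" using p by (simp add: field_simps)
          then have "(I k / bdist k) powr (q / p) = (I k / bdist k) powr ((q - p) / p) * (I k / bdist k)"
            using Ip h by (simp add: powr_add)
          then have "(I k / bdist k) powr (q / p) * bdist k = (I k / bdist k) powr ((q - p) / p) * I k"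
            using h by simp
          also have "\<dots> \<le> (C1 * X) powr ((q - p) / p) * I k"
            using I(2)[OF k] Ip h p pq by (intro mult_right_mono powr_mono2) (auto simp: field_simps)
          finally show ?thesis .
        qed simp
        have "m k * ((C2 * W (bdist k)) powr (q / p) * (2 * bdist k)) =
          C1 powr (q / p) * (C2 powr (q / p) * 2) * ((I k / bdist k) powr (q / p) * bdist k)"
        proof -
          have "(C1 * I k / (bdist k * W (bdist k))) powr (q / p) = C1 powr (q / p) * (I k / bdist k) powr (q / p) / W (bdist k) powr (q / p)"
            using C1 I(1)[OF k] h by (simp add: powr_mult powr_divide)
          moreover have "(C2 * W (bdist k)) powr (q / p) = C2 powr (q / p) * W (bdist k) powr (q / p)"
            by (simp add: powr_mult)
          ultimately show ?thesis using h by (simp add: m_def)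
        qed
        also have "\<dots> \<le> C1 powr (q / p) * (C2 powr (q / p) * 2) * ((C1 * X) powr ((q - p) / p) * I k)"
          using C1 C2 by (intro mult_left_mono step) auto
        also have "(C1 * X) powr ((q - p) / p) = C1 powr ((q - p) / p) * X powr ((q - p) / p)" by (simp only: powr_mult)
        finally have "225 * kratio a k powr 2 * N powr q * (m k * ((C2 * W (bdist k)) powr (q / p) * (2 * bdist k))) \<le>
          225 * kratio a k powr 2 * N powr q * (C1 powr (q / p) * (C2 powr (q / p) * 2) * (C1 powr ((q - p) / p) * X powr ((q - p) / p) * I k))"
          by (intro mult_left_mono) auto
        then show "225 * (m k * kratio a k powr 2) * (N powr q * ((C2 * W (bdist k)) powr (q / p) * (2 * bdist k))) \<le>
          C3 * N powr q * X powr ((q - p) / p) * (I k * kratio a k powr 2)"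
          by (simp only: C3_def mult_ac)
      qed
      also have "\<dots> = ennreal (C3 * N powr q * X powr ((q - p) / p)) * ennreal (I k * kratio a k powr 2)"
        using C3 I(1)[OF k] by (intro ennreal_mult) auto
      finally show "ennreal (225 * (m k * kratio a k powr 2)) * emeasure \<mu> (ball k (5 * \<epsilon> * bdist k)) \<le>
        ennreal (C3 * N powr q * X powr ((q - p) / p)) * ennreal (I k * kratio a k powr 2)" .
    qed
    also have "\<dots> = ennreal (C3 * N powr q * X powr ((q - p) / p)) * (\<integral>\<^sup>+k. ennreal (I k * kratio a k powr 2) \<partial>count_space Z)"
      by (rule nn_integral_cmult) simp
    also have "\<dots> \<le> ennreal (C3 * N powr q * X powr ((q - p) / p)) * (ennreal C1 * ?J)"
      by (intro mult_left_mono Isum) simp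
    also have "\<dots> = ennreal (C * N powr q * X powr ((q - p) / p)) * ?J"
    proof -
      have "ennreal (C * N powr q * X powr ((q - p) / p)) = ennreal (C3 * N powr q * X powr ((q - p) / p)) * ennreal C1"
        using C3 C1 by (subst ennreal_mult[symmetric]) (auto simp: C_def mult_ac)
      then show ?thesis by (simp only: mult.assoc)
    qed
    finally show "carleson_mass \<mu> q f a \<le>
      ennreal (C * N powr q * X powr ((q - p) / p)) * ?J" .
  qed
qed

text \<open>With t = q / p, the contribution of k splits, up to constants, as x^t * Y^(1 - t), where
  the x sum to a multiple of A * bdist a and the Y to a multiple of B * bdist a. A and B are
  separate so that A can be small for a near the boundary while B stays fixed.\<close>

lemma sufficiency_gt:
  assumes q: "q > 0" and pq: "q < p" and r: "0 < r" "r < 1 / 4"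
  shows "\<exists>C>0. \<forall>\<mu> f X A B a. borel_measure_on_disc \<mu> \<and> carleson_bound p f X \<and> 0 < A \<and> 0 < B \<and> a \<in> unit_disc \<and>
    kratio_mass p f a \<le> ennreal (A * bdist a) \<and>
    (\<integral>\<^sup>+z. epowr (G_fun p q \<omega> \<mu> r z) (p * q / (p - q)) * ennreal (1 / bdist z * kratio a z powr 2) * indicator unit_disc z \<partial>lborel) \<le> ennreal (B * bdist a)
    \<longrightarrow> carleson_mass \<mu> q f a \<le>
      ennreal (C * (A powr (q / p) * B powr (1 - q / p)) * bdist a)"
proof -
  have p: "p > 0" using q pq by simp
  define s where "s = p * q / (p - q)"
  have s: "s > 0" using p q pq by (simp add: s_def)
  define t where "t = q / p"
  have t: "0 < t" "t < 1" using p q pq by (auto simp: t_def)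
  \<comment> \<open>This identity determines s: the power 1 - t of G^s contains \<mu> to the first
    power.\<close>
  have st: "s / q * (1 - t) = 1" using p q pq by (simp add: s_def t_def field_simps)
  define \<epsilon> where "\<epsilon> = r / 20"
  have \<epsilon>: "0 < \<epsilon>" "\<epsilon> \<le> 1 / 20" "5 * \<epsilon> = r / 4" using r by (auto simp: \<epsilon>_def)
  obtain Z where Z: "disc_lattice \<epsilon> Z" using disc_lattice_exists[OF \<epsilon>(1)] by blast
  have ZD: "k \<in> unit_disc" if "k \<in> Z" for k using Z that by (auto simp: disc_lattice_def)
  have Zc: "countable Z" using Z by (simp add: disc_lattice_def)
  obtain C1 where C1: "C1 > 0" and LI: "\<forall>f X. carleson_bound p f X \<longrightarrow> (\<exists>I.
    (\<forall>k\<in>Z. 0 \<le> I k \<and> I k \<le> C1 * X * bdist k \<and>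
       (\<forall>w\<in>ball k (5 * \<epsilon> * bdist k). cmod (f w) powr p * (bdist k * W (bdist k)) \<le> C1 * I k)) \<and>
    (\<forall>a\<in>unit_disc. (\<integral>\<^sup>+k. ennreal (I k * kratio a k powr 2) \<partial>count_space Z) \<le>
       ennreal C1 * kratio_mass p f a))"
    using lattice_integrals[OF p Z \<epsilon>(1,2)] by blast
  obtain C2 where C2: "C2 \<ge> 1" and cmp: "\<forall>k\<in>unit_disc. \<forall>w\<in>ball k (5 * \<epsilon> * bdist k).
    w \<in> unit_disc \<and> bdist w \<le> 2 * bdist k \<and> bdist k \<le> 2 * bdist w \<and> W (bdist w) \<le> C2 * W (bdist k)"
    using lattice_ball_comparable[OF \<epsilon>(2)] by blast
  define D where "D = C2 powr (1 / p) * 2 powr (1 / q)"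
  have D: "D > 0" using C2 by (simp add: D_def)
  define C3 where "C3 = D powr s * (72 / (pi * \<epsilon>\<^sup>2))"
  have C3: "C3 > 0" using D \<epsilon> by (simp add: C3_def)
  define C4 where "C4 = 225 * C1 powr t"
  have C4: "C4 > 0" using C1 by (simp add: C4_def)
  define C where "C = C4 * (C1 + C3)"
  have C: "C > 0" using C1 C3 C4 by (simp add: C_def)
  show ?thesis
    unfolding s_def[symmetric] t_def[symmetric]
  proof (intro exI[of _ C] conjI C allI impI, elim conjE)
    fix \<mu> f X A B a
    assume \<mu>: "borel_measure_on_disc \<mu>" and car: "carleson_bound p f X" and A: "0 < A" and B: "0 < B" and a: "a \<in> unit_disc"
      and fA: "kratio_mass p f a \<le> ennreal (A * bdist a)"
      and GB: "(\<integral>\<^sup>+z. epowr (G_fun p q \<omega> \<mu> r z) s * ennreal (1 / bdist z * kratio a z powr 2) * indicator unit_disc z \<partial>lborel) \<le> ennreal (B * bdist a)"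
    have ha: "bdist a > 0" by (rule bdist_pos[OF a])
    obtain I where I: "\<And>k. k \<in> Z \<Longrightarrow> 0 \<le> I k"
      "\<And>k w. k \<in> Z \<Longrightarrow> w \<in> ball k (5 * \<epsilon> * bdist k) \<Longrightarrow> cmod (f w) powr p * (bdist k * W (bdist k)) \<le> C1 * I k"
      and Isum: "(\<integral>\<^sup>+k. ennreal (I k * kratio a k powr 2) \<partial>count_space Z) \<le>
       ennreal C1 * kratio_mass p f a"
      using LI[rule_format, OF car] a by blast
    have hW: "bdist k > 0" "W (bdist k) > 0" if "k \<in> Z" for k
      using bdist_pos[OF ZD[OF that]] W_pos[OF _ bdist_le_1] by auto
    define e where "e k = emeasure \<mu> (ball k (5 * \<epsilon> * bdist k))" for k
    define d where "d k = W (bdist k) powr (1 / p) * bdist k powr (1 / q)" for k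
    have d: "d k > 0" if "k \<in> Z" for k using hW[OF that] by (simp add: d_def)
    define \<Gamma> where "\<Gamma> k = epowr (epowr (e k) (1 / q) / ennreal (D * d k)) s" for k
    let ?g = "\<lambda>z. epowr (G_fun p q \<omega> \<mu> r z) s * ennreal (1 / bdist z * kratio a z powr 2)"
    have gm: "?g \<in> borel_measurable (restrict_space borel unit_disc)"
    proof -
      have [measurable]: "G_fun p q \<omega> \<mu> r \<in> borel_measurable (restrict_space borel unit_disc)" by (rule G_fun_measurable[OF \<mu>])
      have [measurable]: "bdist \<in> borel_measurable (restrict_space borel unit_disc)" "kratio a \<in> borel_measurable (restrict_space borel unit_disc)"
        by (intro measurable_restrict_space1; measurable)+
      show ?thesis by measurable
    qed
    \<comment> \<open>72 = 2 * 36: \<open>bdist\<close> may double on the ball, and the squared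
      kernel loses 6^2.\<close>
    let ?c = "pi * \<epsilon>\<^sup>2 / 72"
    have c: "?c > 0" using \<epsilon> by simp
    \<comment> \<open>The ball of radius 5 * \<epsilon> * bdist k lies in the disc of radius r about
      each point of the smaller ball, so its measure bounds \<open>G_fun\<close> from below on a set
      of area of order (bdist k)^2.\<close>
    have lower: "\<Gamma> k * ennreal (?c * (bdist k * kratio a k powr 2)) \<le> (\<integral>\<^sup>+z. ?g z * indicator (ball k (\<epsilon> * bdist k)) z \<partial>lborel)"
      if k: "k \<in> Z" for k
    proof -
      note h = hW[OF k]
      have "\<Gamma> k * ennreal (?c * (bdist k * kratio a k powr 2)) =
        (\<Gamma> k * ennreal (1 / (2 * bdist k) * (kratio a k / 6) powr 2)) * ennreal (pi * (\<epsilon> * bdist k)\<^sup>2)"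
      proof -
        have "?c * (bdist k * kratio a k powr 2) = 1 / (2 * bdist k) * (kratio a k / 6) powr 2 * (pi * (\<epsilon> * bdist k)\<^sup>2)"
          using h kratio_pos[OF a ZD[OF k]] by (simp add: power2_eq_square power_divide)
        then have "ennreal (?c * (bdist k * kratio a k powr 2)) = ennreal (1 / (2 * bdist k) * (kratio a k / 6) powr 2) * ennreal (pi * (\<epsilon> * bdist k)\<^sup>2)"
          using h by (subst ennreal_mult[symmetric]) auto
        then show ?thesis by (simp only: mult.assoc)
      qed
      also have "\<dots> = (\<integral>\<^sup>+z. (\<Gamma> k * ennreal (1 / (2 * bdist k) * (kratio a k / 6) powr 2)) * indicator (ball k (\<epsilon> * bdist k)) z \<partial>lborel)"
        using h \<epsilon> by (subst nn_integral_cmult_indicator) (auto simp: emeasure_lborel_ball_complex)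
      also have "\<dots> \<le> (\<integral>\<^sup>+z. ?g z * indicator (ball k (\<epsilon> * bdist k)) z \<partial>lborel)"
      proof (rule nn_integral_mono)
        fix w :: complex
        show "(\<Gamma> k * ennreal (1 / (2 * bdist k) * (kratio a k / 6) powr 2)) * indicator (ball k (\<epsilon> * bdist k)) w \<le> ?g w * indicator (ball k (\<epsilon> * bdist k)) w"
        proof (cases "w \<in> ball k (\<epsilon> * bdist k)")
          case True
          have "\<epsilon> * bdist k \<le> 5 * \<epsilon> * bdist k" using \<epsilon> h by (intro mult_right_mono) auto
          then have w: "w \<in> ball k (5 * \<epsilon> * bdist k)" using True by simp
          have wc: "w \<in> unit_disc" "bdist w \<le> 2 * bdist k" "W (bdist w) \<le> C2 * W (bdist k)"
            using cmp ZD[OF k] w by auto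
          have hw: "bdist w > 0" "W (bdist w) > 0" using bdist_pos[OF wc(1)] W_pos[OF _ bdist_le_1] by auto
          have "e k \<le> emeasure \<mu> (pseudo_hyp_disc w r)"
            unfolding e_def using ball_subset_pseudo_hyp_disc[OF ZD[OF k] r(1), of w] r w \<epsilon>(3) pseudo_hyp_disc_measurable \<mu>
            by (intro emeasure_mono) (auto simp: borel_measure_on_disc_def)
          then have "epowr (e k) (1 / q) \<le> epowr (emeasure \<mu> (pseudo_hyp_disc w r)) (1 / q)"
            using q by (intro epowr_mono) auto
          moreover have "W (bdist w) powr (1 / p) * bdist w powr (1 / q) \<le> D * d k"
          proof -
            have "W (bdist w) powr (1 / p) * bdist w powr (1 / q) \<le> (C2 * W (bdist k)) powr (1 / p) * (2 * bdist k) powr (1 / q)"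
              using wc hw p q by (intro mult_mono powr_mono2) auto
            also have "\<dots> = D * d k" by (simp add: D_def d_def powr_mult)
            finally show "W (bdist w) powr (1 / p) * bdist w powr (1 / q) \<le> D * d k" .
          qed
          ultimately have "epowr (e k) (1 / q) / ennreal (D * d k) \<le> G_fun p q \<omega> \<mu> r w"
            unfolding G_fun_eq[OF wc(1)] using hw by (intro ennreal_divide_mono) auto
          then have 1: "\<Gamma> k \<le> epowr (G_fun p q \<omega> \<mu> r w) s" unfolding \<Gamma>_def using s by (intro epowr_mono) auto
          have "kdist k w \<le> 2 * bdist k + cmod (k - w)" by (rule kdist_le_dist[OF ZD[OF k]])
          also have "cmod (k - w) \<le> \<epsilon> * bdist k" using True by (simp add: dist_norm)
          also have "\<epsilon> * bdist k \<le> 1 * bdist k" using \<epsilon> h by (intro mult_right_mono) auto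
          finally have "1 / 3 \<le> kratio k w" using kdist_pos[OF ZD[OF k] wc(1)] by (simp add: kratio_def field_simps)
          then have "kratio a k * (1 / 3) \<le> kratio a k * kratio k w"
            using kratio_pos[OF a ZD[OF k]] by (intro mult_left_mono) auto
          also have "\<dots> \<le> 2 * kratio a w" by (rule kratio_mult_le[OF a ZD[OF k] wc(1)])
          finally have "kratio a k / 6 \<le> kratio a w" by simp
          then have "(kratio a k / 6) powr 2 \<le> kratio a w powr 2"
            using kratio_pos[OF a ZD[OF k]] by (intro powr_mono2) auto
          moreover have "1 / (2 * bdist k) \<le> 1 / bdist w" using wc hw h by (intro divide_left_mono) auto
          ultimately have 2: "ennreal (1 / (2 * bdist k) * (kratio a k / 6) powr 2) \<le> ennreal (1 / bdist w * kratio a w powr 2)"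
            using h hw by (intro ennreal_leI mult_mono) auto
          show ?thesis using True mult_mono[OF 1 2] by simp
        qed simp
      qed
      finally show ?thesis .
    qed
    have \<Gamma>sum: "(\<integral>\<^sup>+k. \<Gamma> k * ennreal (?c * (bdist k * kratio a k powr 2)) \<partial>count_space Z) \<le> ennreal (B * bdist a)"
    proof (rule nn_integral_count_space_le[OF Zc])
      fix F assume F: "finite F" "F \<subseteq> Z"
      have "(\<Sum>k\<in>F. \<Gamma> k * ennreal (?c * (bdist k * kratio a k powr 2))) \<le> (\<Sum>k\<in>F. \<integral>\<^sup>+z. ?g z * indicator (ball k (\<epsilon> * bdist k)) z \<partial>lborel)"
        using F by (intro sum_mono lower) auto
      also have "\<dots> \<le> (\<integral>\<^sup>+z. ?g z * indicator unit_disc z \<partial>lborel)"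
        using \<epsilon> by (intro lattice_disjoint_sum[OF Z _ F gm]) auto
      also have "\<dots> \<le> ennreal (B * bdist a)" by (rule GB)
      finally show "(\<Sum>k\<in>F. \<Gamma> k * ennreal (?c * (bdist k * kratio a k powr 2))) \<le> ennreal (B * bdist a)" .
    qed
    \<comment> \<open>An infinite measure would make the finite sum \<open>\<Gamma>sum\<close>
      infinite; from here on real numbers \<open>M k\<close> can replace the measures.\<close>
    have efin: "e k \<noteq> top" if k: "k \<in> Z" for k
    proof
      assume "e k = top"
      then have "\<Gamma> k = top" using d[OF k] D by (simp add: \<Gamma>_def epowr_def ennreal_top_divide)
      then have inf: "\<Gamma> k * ennreal (?c * (bdist k * kratio a k powr 2)) = top"
        using hW[OF k] c kratio_pos[OF a ZD[OF k]] by (simp add: ennreal_top_mult ennreal_eq_0_iff not_le)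
      have "\<Gamma> k * ennreal (?c * (bdist k * kratio a k powr 2)) \<le> (\<integral>\<^sup>+k. \<Gamma> k * ennreal (?c * (bdist k * kratio a k powr 2)) \<partial>count_space Z)"
        by (rule nn_integral_ge_point[OF k])
      also note \<Gamma>sum
      finally have "top \<le> ennreal (B * bdist a)" unfolding inf .
      then show False by (simp add: top_unique)
    qed
    define M where "M k = enn2real (e k)" for k
    have eM: "e k = ennreal (M k)" if "k \<in> Z" for k using efin[OF that] by (simp add: M_def less_top)
    have M0: "0 \<le> M k" for k by (simp add: M_def)
    define Y where "Y k = (M k powr (1 / q) / d k) powr s * (bdist k * kratio a k powr 2)" for k
    have Y0: "0 \<le> Y k" if "k \<in> Z" for k using hW[OF that] by (simp add: Y_def)
    have Ysum: "(\<integral>\<^sup>+k. ennreal (Y k) \<partial>count_space Z) \<le> ennreal (C3 * (B * bdist a))"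
    proof -
      have "(\<integral>\<^sup>+k. ennreal (Y k) \<partial>count_space Z) = (\<integral>\<^sup>+k. ennreal C3 * (\<Gamma> k * ennreal (?c * (bdist k * kratio a k powr 2))) \<partial>count_space Z)"
      proof (rule nn_integral_cong)
        fix k assume "k \<in> space (count_space Z)"
        then have k: "k \<in> Z" by simp
        have \<Gamma>k: "\<Gamma> k = ennreal ((M k powr (1 / q) / (D * d k)) powr s)"
          unfolding \<Gamma>_def eM[OF k] using D d[OF k] M0 by (simp add: epowr_ennreal divide_ennreal)
        have e3: "ennreal (x * (y * z)) = ennreal x * (ennreal y * ennreal z)" if "0 \<le> x" "0 \<le> y" "0 \<le> z" for x y z
          using that by (simp add: ennreal_mult)
        have "ennreal C3 * (\<Gamma> k * ennreal (?c * (bdist k * kratio a k powr 2))) =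
          ennreal (C3 * ((M k powr (1 / q) / (D * d k)) powr s * (?c * (bdist k * kratio a k powr 2))))"
          unfolding \<Gamma>k using C3 c hW[OF k] by (intro e3[symmetric]) auto
        also have "C3 * ((M k powr (1 / q) / (D * d k)) powr s * (?c * (bdist k * kratio a k powr 2))) = Y k"
        proof -
          have "(M k powr (1 / q) / (D * d k)) powr s = (M k powr (1 / q) / d k) powr s / D powr s"
            by (simp add: powr_divide powr_mult)
          then show ?thesis using D \<epsilon> by (simp add: C3_def Y_def)
        qed
        finally show "ennreal (Y k) = ennreal C3 * (\<Gamma> k * ennreal (?c * (bdist k * kratio a k powr 2)))" by simp
      qed
      also have "\<dots> = ennreal C3 * (\<integral>\<^sup>+k. \<Gamma> k * ennreal (?c * (bdist k * kratio a k powr 2)) \<partial>count_space Z)"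
        by (rule nn_integral_cmult) simp
      also have "\<dots> \<le> ennreal C3 * ennreal (B * bdist a)" by (intro mult_left_mono \<Gamma>sum) simp
      also have "\<dots> = ennreal (C3 * (B * bdist a))" using C3 B ha by (intro ennreal_mult[symmetric]) auto
      finally show ?thesis .
    qed
    define x where "x k = I k * kratio a k powr 2" for k
    have x0: "0 \<le> x k" if "k \<in> Z" for k using I(1)[OF that] by (simp add: x_def)
    have xsum: "(\<integral>\<^sup>+k. ennreal (x k) \<partial>count_space Z) \<le> ennreal (C1 * (A * bdist a))"
    proof -
      have "(\<integral>\<^sup>+k. ennreal (x k) \<partial>count_space Z) \<le> ennreal C1 * ennreal (A * bdist a)"
        unfolding x_def by (rule order_trans[OF Isum]) (intro mult_left_mono fA, simp)
      also have "\<dots> = ennreal (C1 * (A * bdist a))" using C1 A ha by (intro ennreal_mult[symmetric]) auto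
      finally show ?thesis .
    qed
    define m where "m k = (C1 * I k / (bdist k * W (bdist k))) powr t" for k
    let ?P = "A powr t * B powr (1 - t)"
    have "carleson_mass \<mu> q f a \<le>
      (\<integral>\<^sup>+k. ennreal (225 * (m k * kratio a k powr 2)) * emeasure \<mu> (ball k (5 * \<epsilon> * bdist k)) \<partial>count_space Z)"
    proof (rule lattice_embedding[OF \<mu> Z \<epsilon>(1,2) _ _ a])
      fix k w assume k: "k \<in> Z" and w: "w \<in> ball k (5 * \<epsilon> * bdist k)"
      have "cmod (f w) powr p \<le> C1 * I k / (bdist k * W (bdist k))"
        using I(2)[OF k w] hW[OF k] by (simp add: field_simps)
      then have "(cmod (f w) powr p) powr t \<le> m k"
        unfolding m_def using t by (intro powr_mono2) auto
      then show "cmod (f w) powr q \<le> m k" using p by (simp add: powr_powr t_def)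
    qed (simp add: m_def)
    also have "\<dots> \<le> (\<integral>\<^sup>+k. ennreal (C4 * ?P / A) * ennreal (x k) + ennreal (C4 * ?P / B) * ennreal (Y k) \<partial>count_space Z)"
    proof (rule nn_integral_mono)
      fix k assume "k \<in> space (count_space Z)"
      then have k: "k \<in> Z" by simp
      note h = hW[OF k]
      have kr: "kratio a k > 0" by (rule kratio_pos[OF a ZD[OF k]])
      have "m k * kratio a k powr 2 * M k = C1 powr t * (x k powr t * Y k powr (1 - t))"
      proof -
        have m1: "m k = C1 powr t * I k powr t / (bdist k powr t * W (bdist k) powr t)"
          unfolding m_def by (simp add: powr_mult powr_divide)
        have x1: "x k powr t = I k powr t * (kratio a k powr 2) powr t" by (simp only: x_def powr_mult)
        have "((M k powr (1 / q) / d k) powr s) powr (1 - t) = M k / (W (bdist k) powr t * bdist k)"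
        proof -
          have "s * (1 - t) = q" using st q by (simp add: field_simps)
          then have "((M k powr (1 / q) / d k) powr s) powr (1 - t) = (M k powr (1 / q) / d k) powr q"
            by (simp add: powr_powr)
          also have "\<dots> = M k / (W (bdist k) powr t * bdist k)"
            using h q M0 by (simp add: d_def powr_divide powr_mult powr_powr t_def)
          finally show ?thesis .
        qed
        then have y1: "Y k powr (1 - t) = M k / (W (bdist k) powr t * bdist k) * (bdist k powr (1 - t) * (kratio a k powr 2) powr (1 - t))"
          by (simp only: Y_def powr_mult)
        have k1: "(kratio a k powr 2) powr t * (kratio a k powr 2) powr (1 - t) = kratio a k powr 2"
          using kr unfolding powr_add[symmetric] by simp
        have b1: "bdist k powr (1 - t) = bdist k / bdist k powr t" using h by (simp add: powr_diff)
        have "C1 powr t * (x k powr t * Y k powr (1 - t)) =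
          C1 powr t * I k powr t * ((kratio a k powr 2) powr t * (kratio a k powr 2) powr (1 - t)) * (M k / (W (bdist k) powr t * bdist k) * bdist k powr (1 - t))"
          unfolding x1 y1 by (simp only: mult_ac)
        also have "\<dots> = m k * kratio a k powr 2 * M k"
          unfolding k1 b1 m1 using h by (simp add: field_simps)
        finally show ?thesis by simp
      qed
      also have "\<dots> \<le> C1 powr t * (?P * (x k / A + Y k / B))"
        using x0[OF k] Y0[OF k] A B t by (intro mult_left_mono powr_split_product) auto
      finally have "225 * (m k * kratio a k powr 2 * M k) \<le> 225 * (C1 powr t * (?P * (x k / A + Y k / B)))" by simp
      then have le: "225 * (m k * kratio a k powr 2) * M k \<le> C4 * ?P / A * x k + C4 * ?P / B * Y k"
        by (simp add: C4_def algebra_simps)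
      have "ennreal (225 * (m k * kratio a k powr 2)) * emeasure \<mu> (ball k (5 * \<epsilon> * bdist k)) = ennreal (225 * (m k * kratio a k powr 2) * M k)"
        unfolding e_def[symmetric] eM[OF k] using M0 by (intro ennreal_mult[symmetric]) (auto simp: m_def)
      also have "\<dots> \<le> ennreal (C4 * ?P / A * x k + C4 * ?P / B * Y k)" by (intro ennreal_leI le)
      also have "\<dots> = ennreal (C4 * ?P / A * x k) + ennreal (C4 * ?P / B * Y k)"
        using C4 A B x0[OF k] Y0[OF k] by (intro ennreal_plus) auto
      also have "ennreal (C4 * ?P / A * x k) = ennreal (C4 * ?P / A) * ennreal (x k)"
        using C4 A x0[OF k] by (intro ennreal_mult) auto
      also have "ennreal (C4 * ?P / B * Y k) = ennreal (C4 * ?P / B) * ennreal (Y k)"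
        using C4 B Y0[OF k] by (intro ennreal_mult) auto
      finally show "ennreal (225 * (m k * kratio a k powr 2)) * emeasure \<mu> (ball k (5 * \<epsilon> * bdist k)) \<le>
        ennreal (C4 * ?P / A) * ennreal (x k) + ennreal (C4 * ?P / B) * ennreal (Y k)" .
    qed
    also have "\<dots> = ennreal (C4 * ?P / A) * (\<integral>\<^sup>+k. ennreal (x k) \<partial>count_space Z) + ennreal (C4 * ?P / B) * (\<integral>\<^sup>+k. ennreal (Y k) \<partial>count_space Z)"
      by (subst nn_integral_add) (simp_all add: nn_integral_cmult)
    also have "\<dots> \<le> ennreal (C4 * ?P / A) * ennreal (C1 * (A * bdist a)) + ennreal (C4 * ?P / B) * ennreal (C3 * (B * bdist a))"
      by (intro add_mono mult_left_mono xsum Ysum) auto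
    also have "\<dots> = ennreal (C4 * ?P / A * (C1 * (A * bdist a))) + ennreal (C4 * ?P / B * (C3 * (B * bdist a)))"
      using C1 C3 C4 A B ha by (intro arg_cong2[where f = "(+)"] ennreal_mult[symmetric]) auto
    also have "\<dots> = ennreal (C4 * ?P / A * (C1 * (A * bdist a)) + C4 * ?P / B * (C3 * (B * bdist a)))"
      using C1 C3 C4 A B ha by (intro ennreal_plus[symmetric]) auto
    also have "C4 * ?P / A * (C1 * (A * bdist a)) + C4 * ?P / B * (C3 * (B * bdist a)) = C * ?P * bdist a"
      using A B by (simp add: C_def field_simps)
    finally show "carleson_mass \<mu> q f a \<le> ennreal (C * ?P * bdist a)" .
  qed
qed

end

section \<open>Necessity\<close>

text \<open>Flip the sign of x j alone: 2 |x j| <= |y + x j| + |y - x j|, so one pattern of each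
  pair is at least |x j| in modulus. This lower bound takes the place of Khinchin's
  inequality.\<close>

lemma sum_signs_ge:
  fixes x :: "'a \<Rightarrow> complex"
  assumes F: "finite F" "j \<in> F" and q: "q > 0"
  shows "2 ^ card F * cmod (x j) powr q \<le>
    2 * (\<Sum>A\<in>Pow F. cmod (\<Sum>k\<in>F. (if k \<in> A then x k else - x k)) powr q)"
proof -
  let ?f = "\<lambda>A. cmod (\<Sum>k\<in>F. (if k \<in> A then x k else - x k)) powr q"
  define F' where "F' = F - {j}"
  have F': "finite F'" "j \<notin> F'" "F = insert j F'" using F by (auto simp: F'_def)
  have inj: "inj_on (insert j) (Pow F')" by (rule inj_onI) (metis F'(2) PowD insert_ident subsetD)
  have disj: "Pow F' \<inter> insert j ` Pow F' = {}" using F'(2) by blast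
  have pair: "cmod (x j) powr q \<le> ?f A + ?f (insert j A)" if A: "A \<in> Pow F'" for A
  proof -
    define y where "y = (\<Sum>k\<in>F'. (if k \<in> A then x k else - x k))"
    have y': "(\<Sum>k\<in>F'. (if k \<in> insert j A then x k else - x k)) = y"
      unfolding y_def using F'(2) by (intro sum.cong) auto
    have jA: "j \<notin> A" using A F'(2) by blast
    have 1: "(\<Sum>k\<in>F. (if k \<in> A then x k else - x k)) = y - x j"
      unfolding F'(3) using F' jA by (simp add: y_def)
    have 2: "(\<Sum>k\<in>F. (if k \<in> insert j A then x k else - x k)) = y + x j"
      unfolding F'(3) sum.insert[OF F'(1,2)] y' by simp
    have "2 * cmod (x j) \<le> cmod (y + x j) + cmod (y - x j)"
    proof -
      have "(y + x j) - (y - x j) = 2 * x j" by simp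
      then show ?thesis using norm_triangle_ineq4[of "y + x j" "y - x j"] by (simp only: norm_mult) simp
    qed
    then have "cmod (x j) \<le> cmod (y - x j) \<or> cmod (x j) \<le> cmod (y + x j)" by linarith
    then show ?thesis unfolding 1 2
    proof
      assume "cmod (x j) \<le> cmod (y - x j)"
      then have "cmod (x j) powr q \<le> cmod (y - x j) powr q" using q by (intro powr_mono2) auto
      then show "cmod (x j) powr q \<le> cmod (y - x j) powr q + cmod (y + x j) powr q"
        by (rule add_increasing2[OF powr_ge_zero])
    next
      assume "cmod (x j) \<le> cmod (y + x j)"
      then have "cmod (x j) powr q \<le> cmod (y + x j) powr q" using q by (intro powr_mono2) auto
      then show "cmod (x j) powr q \<le> cmod (y - x j) powr q + cmod (y + x j) powr q"
        by (rule add_increasing[OF powr_ge_zero])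
    qed
  qed
  have "(\<Sum>A\<in>Pow F. ?f A) = (\<Sum>A\<in>Pow F'. ?f A) + (\<Sum>A\<in>insert j ` Pow F'. ?f A)"
    unfolding F'(3) Pow_insert using F' disj by (intro sum.union_disjoint) auto
  also have "(\<Sum>A\<in>insert j ` Pow F'. ?f A) = (\<Sum>A\<in>Pow F'. ?f (insert j A))"
    using inj by (simp only: sum.reindex o_def)
  also have "(\<Sum>A\<in>Pow F'. ?f A) + (\<Sum>A\<in>Pow F'. ?f (insert j A)) = (\<Sum>A\<in>Pow F'. ?f A + ?f (insert j A))"
    by (simp only: sum.distrib)
  finally have eq: "(\<Sum>A\<in>Pow F. ?f A) = (\<Sum>A\<in>Pow F'. ?f A + ?f (insert j A))" .
  have "2 ^ card F' * cmod (x j) powr q = (\<Sum>A\<in>Pow F'. cmod (x j) powr q)"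
    using F' by (simp add: card_Pow)
  also have "\<dots> \<le> (\<Sum>A\<in>Pow F'. ?f A + ?f (insert j A))" by (intro sum_mono pair)
  finally have "2 ^ card F' * cmod (x j) powr q \<le> (\<Sum>A\<in>Pow F. ?f A)" unfolding eq .
  moreover have "card F = Suc (card F')" unfolding F'(3) using F' by simp
  ultimately show ?thesis by simp
qed

lemma kdist_near:
  assumes k: "k \<in> unit_disc" and u: "u \<in> ball k (3 / 4 * bdist k)"
  shows "u \<in> unit_disc" "kdist k u \<le> 3 * bdist k" "1 / 3 \<le> kratio k u" "bdist k \<le> 4 * bdist u"
proof -
  have h: "bdist k > 0" by (rule bdist_pos[OF k])
  show uD: "u \<in> unit_disc" using ball_bdist_subset[OF k _ u] by simp
  have d: "cmod (k - u) < 3 / 4 * bdist k" using u by (simp add: dist_norm)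
  show 1: "kdist k u \<le> 3 * bdist k" using kdist_le_dist[OF k, of u] d h by linarith
  then show "1 / 3 \<le> kratio k u" using kdist_pos[OF k uD] by (simp add: kratio_def field_simps)
  show "bdist k \<le> 4 * bdist u" using bdist_diff_le[of k u] d by linarith
qed

text \<open>Each k whose ball contains u contributes at least (bdist u)^(-1) / 108 to the lattice
  sum of kernels, which is at most of order (bdist u)^(-1); 108 = 3^3 * 4.\<close>

lemma lattice_overlap:
  assumes Z: "disc_lattice \<epsilon> Z" and \<epsilon>: "0 < \<epsilon>" "\<epsilon> \<le> 1"
  shows "\<exists>C>0. \<forall>F u. finite F \<and> F \<subseteq> Z \<longrightarrow> real (card {k\<in>F. u \<in> ball k (3 / 4 * bdist k)}) \<le> C"
proof -
  have ZD: "k \<in> unit_disc" if "k \<in> Z" for k using Z that by (auto simp: disc_lattice_def)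
  obtain C where C: "C > 0" and S: "\<And>F u. finite F \<Longrightarrow> F \<subseteq> Z \<Longrightarrow> u \<in> unit_disc \<Longrightarrow>
      (\<Sum>k\<in>F. kratio k u powr (2 + 1) * bdist k powr (- 1)) \<le> C * bdist u powr (- 1)"
    by (rule lattice_kratio_sum[OF Z \<epsilon> zero_less_one]) (rule that)
  have "real (card {k\<in>F. u \<in> ball k (3 / 4 * bdist k)}) \<le> 108 * C" if F: "finite F" "F \<subseteq> Z" for F u
  proof (cases "{k\<in>F. u \<in> ball k (3 / 4 * bdist k)} = {}")
    case False
    define J where "J = {k\<in>F. u \<in> ball k (3 / 4 * bdist k)}"
    have J: "finite J" "J \<subseteq> Z" using F by (auto simp: J_def)
    have near: "k \<in> unit_disc" "u \<in> ball k (3 / 4 * bdist k)" if "k \<in> J" for k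
      using that J ZD by (auto simp: J_def)
    obtain k0 where "k0 \<in> J" using False by (auto simp: J_def)
    then have u: "u \<in> unit_disc" using kdist_near(1)[OF near] by blast
    have hu: "bdist u > 0" by (rule bdist_pos[OF u])
    have "real (card J) * (1 / 108 * bdist u powr (- 1)) = (\<Sum>k\<in>J. 1 / 108 * bdist u powr (- 1))" by simp
    also have "\<dots> \<le> (\<Sum>k\<in>J. kratio k u powr (2 + 1) * bdist k powr (- 1))"
    proof (rule sum_mono)
      fix k assume k: "k \<in> J"
      note n = kdist_near[OF near[OF k]]
      have h: "bdist k > 0" by (rule bdist_pos[OF near(1)[OF k]])
      have "(1 / 3) powr (2 + 1) \<le> kratio k u powr (2 + 1)" using n(3) by (intro powr_mono2) auto
      then have a: "1 / 27 \<le> kratio k u powr (2 + 1)" by (simp add: powr_divide)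
      have b: "1 / 4 * bdist u powr (- 1) \<le> bdist k powr (- 1)"
        using n(4) h hu by (simp add: powr_minus_divide field_simps)
      show "1 / 108 * bdist u powr (- 1) \<le> kratio k u powr (2 + 1) * bdist k powr (- 1)"
        using mult_mono[OF a b] by simp
    qed
    also have "\<dots> \<le> C * bdist u powr (- 1)" by (rule S[OF J u])
    finally have "real (card J) * (1 / 108) * bdist u powr (- 1) \<le> C * bdist u powr (- 1)" by (simp only: mult.assoc)
    then have "real (card J) * (1 / 108) \<le> C" using hu by (subst (asm) mult_le_cancel_right) auto
    then show ?thesis by (simp add: J_def)
  next
    case True
    show ?thesis using C unfolding True by simp
  qed
  then show ?thesis using C by (intro exI[of _ "108 * C"]) auto
qed

context D_weight
begin

text \<open>The consequence that both embeddings share, as these functions belong to the little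
  space as well. N plays the role of the norm of the embedding and L bounds the norm of the test
  function.\<close>

definition embeds_tests :: "real \<Rightarrow> real \<Rightarrow> complex measure \<Rightarrow> real \<Rightarrow> bool"
  where "embeds_tests p q \<mu> N \<longleftrightarrow> 0 \<le> N \<and> (\<forall>n F c L. finite F \<and> F \<subseteq> unit_disc \<and> L > 0 \<and>
      carleson_bound p (test p n F c) (L powr p) \<longrightarrow>
    (\<forall>b\<in>unit_disc. carleson_mass \<mu> q (test p n F c) b \<le>
      ennreal ((N * L) powr q * bdist b)))"

text \<open>Coefficients of Carleson constant X give a test function of tent norm at most (C *
  X)^(1/p), to which the bound N is applied.\<close>

lemma necessity_tests:
  assumes p: "p > 0" and q: "q > 0" and Z: "disc_lattice \<epsilon> Z" and \<epsilon>: "0 < \<epsilon>" "\<epsilon> \<le> 1"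
  shows "\<exists>n. \<exists>C>0. \<forall>\<mu> N F c X b. embeds_tests p q \<mu> N \<and> finite F \<and> F \<subseteq> Z \<and> X > 0 \<and>
    (\<forall>b'\<in>unit_disc. (\<Sum>k\<in>{k\<in>F. k \<in> carleson_square b'}. \<bar>c k\<bar> powr p * bdist k) \<le> X * bdist b') \<and> b \<in> unit_disc \<longrightarrow>
    carleson_mass \<mu> q (test p n F c) b \<le>
      ennreal (C * N powr q * X powr (q / p) * bdist b)"
proof -
  have ZD: "Z \<subseteq> unit_disc" using Z by (simp add: disc_lattice_def)
  show ?thesis
  proof (rule test_carleson[OF p Z \<epsilon>])
    fix n C assume C: "C > 0" and T: "\<And>n' F c X b. n' \<ge> n \<Longrightarrow> finite F \<Longrightarrow> F \<subseteq> Z \<Longrightarrow> X \<ge> 0 \<Longrightarrow>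
     (\<And>b'. b' \<in> unit_disc \<Longrightarrow> (\<Sum>k\<in>{k\<in>F. k \<in> carleson_square b'}. \<bar>c k\<bar> powr p * bdist k) \<le> X * bdist b') \<Longrightarrow>
     b \<in> unit_disc \<Longrightarrow>
     (\<integral>\<^sup>+u. ennreal (cmod (test p n' F c u) powr p) * indicator {..5 / 2 * bdist b} (kdist b u) \<partial>wA) \<le> ennreal (C * X * bdist b)"
    show ?thesis
  proof (intro exI[of _ n] exI[of _ "C powr (q / p)"] conjI allI impI)
    show "C powr (q / p) > 0" using C by simp
    fix \<mu> N F c X b
    assume *: "embeds_tests p q \<mu> N \<and> finite F \<and> F \<subseteq> Z \<and> X > 0 \<and>
      (\<forall>b'\<in>unit_disc. (\<Sum>k\<in>{k\<in>F. k \<in> carleson_square b'}. \<bar>c k\<bar> powr p * bdist k) \<le> X * bdist b') \<and> b \<in> unit_disc"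
    then have emb: "embeds_tests p q \<mu> N" and F: "finite F" "F \<subseteq> Z" and X: "X > 0" and b: "b \<in> unit_disc"
      and cX: "\<And>b'. b' \<in> unit_disc \<Longrightarrow> (\<Sum>k\<in>{k\<in>F. k \<in> carleson_square b'}. \<bar>c k\<bar> powr p * bdist k) \<le> X * bdist b'"
      by auto
    have FD: "F \<subseteq> unit_disc" using F ZD by blast
    define L where "L = (C * X) powr (1 / p)"
    have L: "L > 0" "L powr p = C * X" using C X p by (auto simp: L_def powr_powr)
    have "carleson_bound p (test p n F c) (L powr p)"
      unfolding carleson_bound_def L(2)
    proof (intro conjI ballI)
      fix a :: complex assume a: "a \<in> unit_disc"
      have "carleson_mass wA p (test p n F c) a \<le>
        (\<integral>\<^sup>+u. ennreal (cmod (test p n F c u) powr p) * indicator {..5 / 2 * bdist a} (kdist a u) \<partial>wA)"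
        using carleson_square_subset(2)[OF a] by (intro nn_integral_mono mult_left_mono) (auto simp: indicator_def)
      also have "\<dots> \<le> ennreal (C * X * bdist a)"
        using X by (intro T F cX a) auto
      finally show "carleson_mass wA p (test p n F c) a \<le> ennreal (C * X * bdist a)" .
    qed (use C X holomorphic_test[OF FD] in auto)
    then have "carleson_mass \<mu> q (test p n F c) b \<le> ennreal ((N * L) powr q * bdist b)"
      using emb F(1) FD L(1) b unfolding embeds_tests_def by blast
    also have "(N * L) powr q = C powr (q / p) * N powr q * X powr (q / p)"
      by (simp add: L_def powr_mult powr_powr mult_ac)
    finally show "carleson_mass \<mu> q (test p n F c) b \<le>
      ennreal (C powr (q / p) * N powr q * X powr (q / p) * bdist b)" .
  qed
  qed
qed

text \<open>Test with one summand of coefficient 1: on the ball of k its kernel is bounded below,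
  and the ball lies in a Carleson square of comparable height.\<close>

lemma necessity_single:
  assumes p: "p > 0" and q: "q > 0" and Z: "disc_lattice \<epsilon> Z" and \<epsilon>: "0 < \<epsilon>" "\<epsilon> \<le> 1"
  shows "\<exists>C>0. \<forall>\<mu> N k. borel_measure_on_disc \<mu> \<and> embeds_tests p q \<mu> N \<and> k \<in> Z \<longrightarrow>
    emeasure \<mu> (ball k (3 / 4 * bdist k)) \<le> ennreal (C * N powr q * (W (bdist k) powr (q / p) * bdist k))"
proof -
  have ZD: "k \<in> unit_disc" if "k \<in> Z" for k using Z that by (auto simp: disc_lattice_def)
  obtain n C where C: "C > 0" and T: "\<forall>\<mu> N F c X b. embeds_tests p q \<mu> N \<and> finite F \<and> F \<subseteq> Z \<and> X > 0 \<and>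
    (\<forall>b'\<in>unit_disc. (\<Sum>k\<in>{k\<in>F. k \<in> carleson_square b'}. \<bar>c k\<bar> powr p * bdist k) \<le> X * bdist b') \<and> b \<in> unit_disc \<longrightarrow>
    carleson_mass \<mu> q (test p n F c) b \<le>
      ennreal (C * N powr q * X powr (q / p) * bdist b)"
    using necessity_tests[OF p q Z \<epsilon>] by blast
  define c where "c = ((1 / 3) ^ n) powr q"
  have c: "c > 0" by (simp add: c_def)
  define C' where "C' = C * (5 / 2) powr (q / p) * 42 / c"
  show ?thesis
  proof (intro exI[of _ C'] conjI allI impI)
    show "C' > 0" using C c by (simp add: C'_def)
    fix \<mu> N k
    assume "borel_measure_on_disc \<mu> \<and> embeds_tests p q \<mu> N \<and> k \<in> Z"
    then have \<mu>: "borel_measure_on_disc \<mu>" and emb: "embeds_tests p q \<mu> N" and k: "k \<in> Z" by auto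
    note kD = ZD[OF k]
    have h: "bdist k > 0" by (rule bdist_pos[OF kD])
    have Wk: "W (bdist k) > 0" by (rule W_pos[OF h bdist_le_1])
    let ?E = "ball k (3 / 4 * bdist k)"
    have "?E \<subseteq> unit_disc" using kdist_near(1)[OF kD] by blast
    then have "?E \<in> sets (restrict_space borel unit_disc)" by (subst sets_restrict_space_iff) auto
    then have E: "?E \<in> sets \<mu>" using \<mu> by (simp add: borel_measure_on_disc_def)
    have h3: "3 * bdist k > 0" using h by simp
    obtain b where b: "b \<in> unit_disc" "bdist b = min 1 (14 * (3 * bdist k))"
      "\<And>u. u \<in> unit_disc \<Longrightarrow> kdist k u \<le> 3 * bdist k \<Longrightarrow> u \<in> carleson_square b"
      by (rule kdist_ball_subset_carleson_square[OF kD h3]) (rule that)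
    have w: "c * W (bdist k) powr (- q / p) \<le> cmod (test p n {k} (\<lambda>_. 1) u) powr q" if u: "u \<in> ?E" for u
    proof -
      note n = kdist_near[OF kD u]
      have "cmod (test p n {k} (\<lambda>_. 1) u) = W (bdist k) powr (- 1 / p) * kratio k u ^ n"
        by (simp add: test_def norm_mult norm_ker[OF kD])
      then have "cmod (test p n {k} (\<lambda>_. 1) u) powr q = W (bdist k) powr (- q / p) * (kratio k u ^ n) powr q"
        by (simp add: powr_mult powr_powr)
      moreover have "c \<le> (kratio k u ^ n) powr q"
        unfolding c_def using n(3) q by (intro powr_mono2 power_mono) auto
      ultimately show ?thesis
        using mult_right_mono[of c "(kratio k u ^ n) powr q" "W (bdist k) powr (- q / p)"] by (simp add: mult.commute)
    qed
    have "ennreal (c * W (bdist k) powr (- q / p)) * emeasure \<mu> ?E = (\<integral>\<^sup>+u. ennreal (c * W (bdist k) powr (- q / p)) * indicator ?E u \<partial>\<mu>)"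
      using E by (rule nn_integral_cmult_indicator[symmetric])
    also have "\<dots> \<le> carleson_mass \<mu> q (test p n {k} (\<lambda>_. 1)) b"
    proof (rule nn_integral_mono)
      fix u
      show "ennreal (c * W (bdist k) powr (- q / p)) * indicator ?E u \<le> ennreal (cmod (test p n {k} (\<lambda>_. 1) u) powr q) * indicator (carleson_square b) u"
      proof (cases "u \<in> ?E")
        case True
        have "u \<in> carleson_square b" using kdist_near[OF kD True] by (intro b(3)) auto
        then show ?thesis using w[OF True] True by (simp add: ennreal_leI)
      qed (auto simp: indicator_def)
    qed
    \<comment> \<open>A single point has Carleson constant at most 5 / 2, since bdist k <= 5 / 2 *
      bdist b' whenever k lies in S(b').\<close>
    also have "\<dots> \<le> ennreal (C * N powr q * (5 / 2) powr (q / p) * bdist b)"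
    proof (rule T[rule_format], intro conjI ballI emb b(1))
      fix b' :: complex assume b': "b' \<in> unit_disc"
      show "(\<Sum>k\<in>{k' \<in> {k}. k' \<in> carleson_square b'}. \<bar>1::real\<bar> powr p * bdist k) \<le> 5 / 2 * bdist b'"
      proof (cases "k \<in> carleson_square b'")
        case True
        then have "{k' \<in> {k}. k' \<in> carleson_square b'} = {k}" by auto
        then show ?thesis
          using carleson_square_subset(2)[OF b' True] bdist_le_kdist'[OF b' kD] by simp
      next
        case False
        then have "{k' \<in> {k}. k' \<in> carleson_square b'} = {}" by auto
        then show ?thesis using bdist_pos[OF b'] by (simp only: sum.empty)
      qed
    qed (use k in auto)
    \<comment> \<open>42 = 14 * 3: the ball has \<open>kdist\<close> radius 3 * bdist k.\<close>
    also have "\<dots> \<le> ennreal (C * N powr q * (5 / 2) powr (q / p) * (42 * bdist k))"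
      using b(2) C by (intro ennreal_leI mult_left_mono) auto
    finally have le: "ennreal (c * W (bdist k) powr (- q / p)) * emeasure \<mu> ?E \<le> ennreal (C * N powr q * (5 / 2) powr (q / p) * (42 * bdist k))" .
    define a where "a = c * W (bdist k) powr (- q / p)"
    have a: "a > 0" using c Wk by (simp add: a_def)
    have "emeasure \<mu> ?E = ennreal (1 / a) * (ennreal a * emeasure \<mu> ?E)"
      using a by (simp add: mult.assoc[symmetric] ennreal_mult[symmetric] del: ennreal_mult)
    also have "\<dots> \<le> ennreal (1 / a) * ennreal (C * N powr q * (5 / 2) powr (q / p) * (42 * bdist k))"
      using le by (intro mult_left_mono) (auto simp: a_def)
    also have "\<dots> = ennreal (1 / a * (C * N powr q * (5 / 2) powr (q / p) * (42 * bdist k)))"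
      using a C h by (intro ennreal_mult[symmetric]) auto
    also have "1 / a * (C * N powr q * (5 / 2) powr (q / p) * (42 * bdist k)) = C' * N powr q * (W (bdist k) powr (q / p) * bdist k)"
    proof -
      have "1 / a = W (bdist k) powr (q / p) / c" using Wk by (simp add: a_def powr_minus field_simps)
      then show ?thesis by (simp add: C'_def)
    qed
    finally show "emeasure \<mu> ?E \<le> ennreal (C' * N powr q * (W (bdist k) powr (q / p) * bdist k))" .
  qed
qed

text \<open>\<open>pseudo_hyp_disc z r\<close> lies in the ball of k: z is within 1/20 * bdist k of
  k, the disc within 2/3 * bdist z of z, and 1/20 + 2/3 * 21/20 = 3/4.\<close>

lemma G_fun_le_lattice:
  assumes p: "p > 0" and q: "q > 0" and r: "0 < r" "r \<le> 1 / 4" and \<epsilon>: "\<epsilon> \<le> 1 / 100"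
  shows "\<exists>C>0. \<forall>\<mu> k z g. borel_measure_on_disc \<mu> \<and> k \<in> unit_disc \<and> z \<in> ball k (5 * \<epsilon> * bdist k) \<and> 0 \<le> g \<and>
    emeasure \<mu> (ball k (3 / 4 * bdist k)) \<le> ennreal (g * (W (bdist k) powr (q / p) * bdist k)) \<longrightarrow>
    G_fun p q \<omega> \<mu> r z \<le> ennreal (C * g powr (1 / q))"
proof -
  obtain C where C: "C \<ge> 1" and Wc: "\<And>s t. 0 < s \<Longrightarrow> 0 < t \<Longrightarrow> s \<le> 1 \<Longrightarrow> t \<le> 1 \<Longrightarrow> t \<le> 2 * s \<Longrightarrow> W t \<le> C * W s"
    using W_le_mult[of 2] by auto
  define D where "D = (C powr (q / p) * 2) powr (1 / q)"
  have D: "D > 0" using C by (simp add: D_def)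
  show ?thesis
  proof (intro exI[of _ D] conjI D allI impI)
    fix \<mu> k z g
    assume *: "borel_measure_on_disc \<mu> \<and> k \<in> unit_disc \<and> z \<in> ball k (5 * \<epsilon> * bdist k) \<and> 0 \<le> g \<and>
      emeasure \<mu> (ball k (3 / 4 * bdist k)) \<le> ennreal (g * (W (bdist k) powr (q / p) * bdist k))"
    then have \<mu>: "borel_measure_on_disc \<mu>" and k: "k \<in> unit_disc" and z': "z \<in> ball k (5 * \<epsilon> * bdist k)" and g: "0 \<le> g"
      and em: "emeasure \<mu> (ball k (3 / 4 * bdist k)) \<le> ennreal (g * (W (bdist k) powr (q / p) * bdist k))" by auto
    have h: "bdist k > 0" by (rule bdist_pos[OF k])
    have "5 * \<epsilon> * bdist k \<le> 1 / 20 * bdist k" using \<epsilon> h by (intro mult_right_mono) auto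
    then have d: "cmod (k - z) < 1 / 20 * bdist k" using z' by (simp add: dist_norm)
    then have "z \<in> ball k (1 / 20 * bdist k)" by (simp add: dist_norm)
    then have z: "z \<in> unit_disc" using ball_bdist_subset[OF k, of "1 / 20" z] by simp
    have hz: "bdist z \<le> 21 / 20 * bdist k" "bdist k \<le> 2 * bdist z" using bdist_diff_le[of k z] d h by linarith+
    have hz0: "bdist z > 0" by (rule bdist_pos[OF z])
    have sub: "pseudo_hyp_disc z r \<subseteq> ball k (3 / 4 * bdist k)"
    proof
      fix u assume "u \<in> pseudo_hyp_disc z r"
      then have "cmod (z - u) < 2 / 3 * bdist z"
        using pseudo_hyp_disc_subset_ball[OF z r(2)] by (auto simp: dist_norm)
      then have "cmod (k - u) < 3 / 4 * bdist k"
        using norm_triangle_ineq[of "k - z" "z - u"] d hz by simp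
      then show "u \<in> ball k (3 / 4 * bdist k)" by (simp add: dist_norm)
    qed
    have "ball k (3 / 4 * bdist k) \<subseteq> unit_disc" using kdist_near(1)[OF k] by blast
    then have "ball k (3 / 4 * bdist k) \<in> sets (restrict_space borel unit_disc)" by (subst sets_restrict_space_iff) auto
    then have "emeasure \<mu> (pseudo_hyp_disc z r) \<le> emeasure \<mu> (ball k (3 / 4 * bdist k))"
      using sub \<mu> by (intro emeasure_mono) (auto simp: borel_measure_on_disc_def)
    also note em
    also have "ennreal (g * (W (bdist k) powr (q / p) * bdist k)) \<le> ennreal (g * ((C * W (bdist z)) powr (q / p) * (2 * bdist z)))"
      using g hz h hz0 p q C Wc[of "bdist z" "bdist k"] bdist_le_1 W_pos[OF h bdist_le_1]
      by (intro ennreal_leI mult_left_mono mult_mono powr_mono2) auto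
    also have "g * ((C * W (bdist z)) powr (q / p) * (2 * bdist z)) = (D * g powr (1 / q)) powr q * (W (bdist z) powr (q / p) * bdist z)"
      using q C g by (simp add: D_def powr_mult powr_powr)
    finally show "G_fun p q \<omega> \<mu> r z \<le> ennreal (D * g powr (1 / q))"
      using D g q by (subst G_fun_le_iff[OF z]) auto
  qed
qed

lemma necessity_le:
  assumes p: "p > 0" and q: "q > 0" and r: "0 < r" "r < 1 / 4"
  shows "\<exists>C>0. \<forall>\<mu> N z. borel_measure_on_disc \<mu> \<and> embeds_tests p q \<mu> N \<and> z \<in> unit_disc \<longrightarrow>
    G_fun p q \<omega> \<mu> r z \<le> ennreal (C * N)"
proof -
  obtain Z where Z: "disc_lattice (1 / 100) Z" using disc_lattice_exists[of "1 / 100"] by auto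
  have ZD: "k \<in> unit_disc" if "k \<in> Z" for k using Z that by (auto simp: disc_lattice_def)
  obtain C1 where C1: "C1 > 0" and T: "\<forall>\<mu> N k. borel_measure_on_disc \<mu> \<and> embeds_tests p q \<mu> N \<and> k \<in> Z \<longrightarrow>
    emeasure \<mu> (ball k (3 / 4 * bdist k)) \<le> ennreal (C1 * N powr q * (W (bdist k) powr (q / p) * bdist k))"
    using necessity_single[OF p q Z] by auto
  have r': "r \<le> 1 / 4" using r by simp
  obtain C2 where C2: "C2 > 0" and GL: "\<forall>\<mu> k z g. borel_measure_on_disc \<mu> \<and> k \<in> unit_disc \<and> z \<in> ball k (5 * (1 / 100) * bdist k) \<and> 0 \<le> g \<and>
    emeasure \<mu> (ball k (3 / 4 * bdist k)) \<le> ennreal (g * (W (bdist k) powr (q / p) * bdist k)) \<longrightarrow>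
    G_fun p q \<omega> \<mu> r z \<le> ennreal (C2 * g powr (1 / q))"
    using G_fun_le_lattice[OF p q r(1) r' order_refl] by blast
  show ?thesis
  proof (intro exI[of _ "C2 * C1 powr (1 / q)"] conjI allI impI)
    show "C2 * C1 powr (1 / q) > 0" using C1 C2 by simp
    fix \<mu> N z assume *: "borel_measure_on_disc \<mu> \<and> embeds_tests p q \<mu> N \<and> z \<in> unit_disc"
    then have N: "N \<ge> 0" by (simp add: embeds_tests_def)
    have "z \<in> (\<Union>k\<in>Z. ball k (5 * (1 / 100) * bdist k))" using Z * unfolding disc_lattice_def by blast
    then obtain k where k: "k \<in> Z" "z \<in> ball k (5 * (1 / 100) * bdist k)" by blast
    have "G_fun p q \<omega> \<mu> r z \<le> ennreal (C2 * (C1 * N powr q) powr (1 / q))"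
    proof (rule GL[rule_format], intro conjI)
      show "emeasure \<mu> (ball k (3 / 4 * bdist k)) \<le> ennreal (C1 * N powr q * (W (bdist k) powr (q / p) * bdist k))"
        using T * k(1) by blast
    qed (use * k ZD C1 in auto)
    also have "C2 * (C1 * N powr q) powr (1 / q) = C2 * C1 powr (1 / q) * N"
      using q N by (simp add: powr_mult powr_powr)
    finally show "G_fun p q \<omega> \<mu> r z \<le> ennreal (C2 * C1 powr (1 / q) * N)" .
  qed
qed

end

text \<open>F is finite, so the best constant S is finite beforehand. The hypothesis
  \<open>self\<close>, applied with X = S, gives S <= K * S^t, and t < 1 allows this to be solved
  for S.\<close>

lemma finite_Carleson_sup:
  fixes a :: "complex \<Rightarrow> real"
  assumes F: "finite F" "F \<subseteq> unit_disc" and a: "\<And>k. k \<in> F \<Longrightarrow> 0 \<le> a k"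
    and self: "\<And>X b. X > 0 \<Longrightarrow> (\<And>b'. b' \<in> unit_disc \<Longrightarrow> (\<Sum>k\<in>{k\<in>F. k \<in> carleson_square b'}. a k * bdist k) \<le> X * bdist b') \<Longrightarrow>
      b \<in> unit_disc \<Longrightarrow> (\<Sum>k\<in>{k\<in>F. k \<in> carleson_square b}. a k * bdist k) \<le> K * X powr t * bdist b"
    and t: "t < 1" and K: "K \<ge> 0" and b: "b \<in> unit_disc"
  shows "(\<Sum>k\<in>{k\<in>F. k \<in> carleson_square b}. a k * bdist k) \<le> K powr (1 / (1 - t)) * bdist b"
proof -
  define R where "R b = (\<Sum>k\<in>{k\<in>F. k \<in> carleson_square b}. a k * bdist k) / bdist b" for b
  have sum_eq: "(\<Sum>k\<in>{k\<in>F. k \<in> carleson_square b}. a k * bdist k) = R b * bdist b" if "b \<in> unit_disc" for b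
    using bdist_pos[OF that] by (simp add: R_def)
  define S where "S = (SUP b\<in>unit_disc. R b)"
  have "R b \<le> 5 / 2 * (\<Sum>k\<in>F. a k)" if b: "b \<in> unit_disc" for b
  proof -
    have "(\<Sum>k\<in>{k\<in>F. k \<in> carleson_square b}. a k * bdist k) \<le> (\<Sum>k\<in>{k\<in>F. k \<in> carleson_square b}. a k * (5 / 2 * bdist b))"
    proof (rule sum_mono)
      fix k assume k: "k \<in> {k\<in>F. k \<in> carleson_square b}"
      then have kD: "k \<in> unit_disc" using F by blast
      have "bdist k \<le> 5 / 2 * bdist b"
        using carleson_square_subset(2)[OF b, of k] bdist_le_kdist'[OF b kD] k by simp
      then show "a k * bdist k \<le> a k * (5 / 2 * bdist b)" using a k by (intro mult_left_mono) auto
    qed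
    also have "\<dots> \<le> (\<Sum>k\<in>F. a k * (5 / 2 * bdist b))"
      using F a bdist_pos[OF b] by (intro sum_mono2) auto
    also have "\<dots> = 5 / 2 * (\<Sum>k\<in>F. a k) * bdist b" by (simp add: sum_distrib_right sum_distrib_left mult_ac)
    finally show ?thesis using bdist_pos[OF b] by (simp add: R_def divide_le_eq)
  qed
  then have bdd: "bdd_above (R ` unit_disc)" by (intro bdd_aboveI2)
  have RS: "R b \<le> S" if "b \<in> unit_disc" for b unfolding S_def by (rule cSUP_upper[OF that bdd])
  have "S \<le> K powr (1 / (1 - t))"
  proof (cases "S > 0")
    case True
    have "R b \<le> K * S powr t" if b: "b \<in> unit_disc" for b
    proof -
      have "R b * bdist b \<le> K * S powr t * bdist b"
        unfolding sum_eq[OF b, symmetric]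
      proof (rule self[OF True _ b])
        fix b' :: complex assume b': "b' \<in> unit_disc"
        show "(\<Sum>k\<in>{k\<in>F. k \<in> carleson_square b'}. a k * bdist k) \<le> S * bdist b'"
          unfolding sum_eq[OF b'] using RS[OF b'] bdist_pos[OF b'] by (intro mult_right_mono) auto
      qed
      then show ?thesis using bdist_pos[OF b] by (subst (asm) mult_le_cancel_right) auto
    qed
    then have "S \<le> K * S powr t" unfolding S_def by (intro cSUP_least) auto
    then have "S powr (1 - t) \<le> K" using True by (simp add: powr_diff divide_le_eq)
    then have "(S powr (1 - t)) powr (1 / (1 - t)) \<le> K powr (1 / (1 - t))" using t by (intro powr_mono2) auto
    then show ?thesis using True t by (simp add: powr_powr)
  next
    case False
    then show ?thesis using powr_ge_zero[of K "1 / (1 - t)"] by linarith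
  qed
  then show ?thesis unfolding sum_eq[OF b]
    using RS[OF b] bdist_pos[OF b] by (intro mult_right_mono) auto
qed

context D_weight
begin

text \<open>\<open>g k\<close> is comparable to the q-th power of G at k. The sum over a square is
  an integral of weights w k over the balls; these are dominated, up to bounded overlap, by the
  average over all signs of the test functions, whose integrals over one larger square are
  known.\<close>

lemma necessity_coefficients:
  assumes q: "q > 0" and pq: "q < p" and Z: "disc_lattice \<epsilon> Z" and \<epsilon>: "0 < \<epsilon>" "\<epsilon> \<le> 1"
  shows "\<exists>C>0. \<forall>\<mu> N F g b. borel_measure_on_disc \<mu> \<and> embeds_tests p q \<mu> N \<and> finite F \<and> F \<subseteq> Z \<and>
    (\<forall>k\<in>F. 0 \<le> g k \<and> emeasure \<mu> (ball k (3 / 4 * bdist k)) = ennreal (g k * (W (bdist k) powr (q / p) * bdist k))) \<and>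
    b \<in> unit_disc \<longrightarrow>
    (\<Sum>k\<in>{k\<in>F. k \<in> carleson_square b}. g k powr (p / (p - q)) * bdist k) \<le> C * N powr (p * q / (p - q)) * bdist b"
proof -
  have p: "p > 0" using q pq by simp
  have ZD: "k \<in> unit_disc" if "k \<in> Z" for k using Z that by (auto simp: disc_lattice_def)
  obtain n C1 where C1: "C1 > 0" and T: "\<forall>\<mu> N F c X b. embeds_tests p q \<mu> N \<and> finite F \<and> F \<subseteq> Z \<and> X > 0 \<and>
    (\<forall>b'\<in>unit_disc. (\<Sum>k\<in>{k\<in>F. k \<in> carleson_square b'}. \<bar>c k\<bar> powr p * bdist k) \<le> X * bdist b') \<and> b \<in> unit_disc \<longrightarrow>
    carleson_mass \<mu> q (test p n F c) b \<le>
      ennreal (C1 * N powr q * X powr (q / p) * bdist b)"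
    using necessity_tests[OF p q Z \<epsilon>] by blast
  obtain C2 where C2: "C2 > 0" and ov: "\<forall>F u. finite F \<and> F \<subseteq> Z \<longrightarrow> real (card {k\<in>F. u \<in> ball k (3 / 4 * bdist k)}) \<le> C2"
    using lattice_overlap[OF Z \<epsilon>] by blast
  define c0 where "c0 = ((1 / 3) ^ n) powr q"
  have c0: "c0 > 0" by (simp add: c0_def)
  define t where "t = q / p"
  have t: "t < 1" using q pq by (simp add: t_def)
  define K0 where "K0 = 2 * C2 / c0 * C1 * 140"
  have K0: "K0 > 0" using C1 C2 c0 by (simp add: K0_def)
  show ?thesis
  proof (intro exI[of _ "K0 powr (1 / (1 - t))"] conjI allI impI)
    show "K0 powr (1 / (1 - t)) > 0" using K0 by simp
    fix \<mu> N F g b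
    assume *: "borel_measure_on_disc \<mu> \<and> embeds_tests p q \<mu> N \<and> finite F \<and> F \<subseteq> Z \<and>
      (\<forall>k\<in>F. 0 \<le> g k \<and> emeasure \<mu> (ball k (3 / 4 * bdist k)) = ennreal (g k * (W (bdist k) powr (q / p) * bdist k))) \<and>
      b \<in> unit_disc"
    then have \<mu>: "borel_measure_on_disc \<mu>" and emb: "embeds_tests p q \<mu> N" and F: "finite F" "F \<subseteq> Z"
      and g: "\<And>k. k \<in> F \<Longrightarrow> 0 \<le> g k"
      and em: "\<And>k. k \<in> F \<Longrightarrow> emeasure \<mu> (ball k (3 / 4 * bdist k)) = ennreal (g k * (W (bdist k) powr (q / p) * bdist k))"
      and b: "b \<in> unit_disc" by auto
    have FD: "k \<in> unit_disc" if "k \<in> F" for k using F ZD that by blast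
    have N: "N \<ge> 0" using emb by (simp add: embeds_tests_def)
    \<comment> \<open>The exponent for which |c k|^p and (c k)^q * g k agree, so that the estimate
      bounds a sum by a power of its own Carleson constant.\<close>
    define c where "c k = g k powr (1 / (p - q))" for k
    define cs where "cs A k = (if k \<in> A then c k else - c k)" for A k
    have csp: "\<bar>cs A k\<bar> powr p = g k powr (p / (p - q))" for A k
      by (simp add: cs_def c_def powr_powr)
    define y where "y k u = of_real (c k * W (bdist k) powr (- 1 / p)) * ker n k u" for k u
    have test_eq: "test p n F (cs A) u = (\<Sum>k\<in>F. if k \<in> A then y k u else - y k u)" for A u
      unfolding test_def y_def cs_def by (intro sum.cong) auto
    define w where "w k = c k powr q * W (bdist k) powr (- q / p)" for k
    have wg: "w k * (g k * (W (bdist k) powr (q / p) * bdist k)) = g k powr (p / (p - q)) * bdist k" if "k \<in> F" for k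
    proof -
      have W: "W (bdist k) > 0" by (rule W_pos[OF bdist_pos[OF FD[OF that]] bdist_le_1])
      have "c k powr q * g k = g k powr (p / (p - q))"
      proof (cases "g k = 0")
        case False
        then have "g k > 0" using g[OF that] by simp
        then have "c k powr q * g k = g k powr (q / (p - q) + 1)" by (simp add: c_def powr_powr powr_add)
        also have "q / (p - q) + 1 = p / (p - q)" using pq by (simp add: field_simps)
        finally show ?thesis .
      qed (use pq p in simp)
      moreover have "W (bdist k) powr (- q / p) * W (bdist k) powr (q / p) = 1"
        using W unfolding powr_add[symmetric] by simp
      ultimately show ?thesis by (simp add: w_def mult_ac)
    qed
    have yw: "c0 * w k \<le> cmod (y k u) powr q" if k: "k \<in> F" and u: "u \<in> ball k (3 / 4 * bdist k)" for k u
    proof -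
      note kD = FD[OF k] note nr = kdist_near[OF kD u]
      have "cmod (y k u) = c k * W (bdist k) powr (- 1 / p) * kratio k u ^ n"
        by (simp add: y_def norm_mult norm_ker[OF kD] c_def)
      then have "cmod (y k u) powr q = w k * (kratio k u ^ n) powr q"
        by (simp add: powr_mult powr_powr w_def)
      moreover have "c0 \<le> (kratio k u ^ n) powr q"
        unfolding c0_def using nr(3) q by (intro powr_mono2 power_mono) auto
      ultimately show ?thesis
        using mult_right_mono[of c0 "(kratio k u ^ n) powr q" "w k"] by (simp add: mult.commute w_def)
    qed
    define Tu where "Tu u = (\<Sum>A\<in>Pow F. cmod (test p n F (cs A) u) powr q)" for u
    have Tu0: "0 \<le> Tu u" for u unfolding Tu_def by (intro sum_nonneg) auto
    \<comment> \<open>The number 2^(card F) of sign choices is divided out here and returns when the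
      bounds for all choices are added.\<close>
    define D where "D = 2 * C2 / c0 / 2 ^ card F"
    have D: "D > 0" using C2 c0 by (simp add: D_def)
    \<comment> \<open>Each w k is dominated by the same sign average, and at most C2 of the balls
      contain u.\<close>
    have pointwise: "(\<Sum>k\<in>{k\<in>F. u \<in> ball k (3 / 4 * bdist k)}. w k) \<le> D * Tu u" for u
    proof -
      let ?J = "{k\<in>F. u \<in> ball k (3 / 4 * bdist k)}"
      have "(\<Sum>k\<in>?J. w k) \<le> (\<Sum>k\<in>?J. 2 / c0 / 2 ^ card F * Tu u)"
      proof (rule sum_mono)
        fix k assume k: "k \<in> ?J"
        have "2 ^ card F * (c0 * w k) \<le> 2 ^ card F * cmod (y k u) powr q"
          using yw[of k u] k by (intro mult_left_mono) auto
        also have "\<dots> \<le> 2 * Tu u" unfolding Tu_def test_eq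
          using F(1) k q by (intro sum_signs_ge) auto
        finally show "w k \<le> 2 / c0 / 2 ^ card F * Tu u" using c0 by (simp add: field_simps)
      qed
      also have "\<dots> = real (card ?J) * (2 / c0 / 2 ^ card F * Tu u)" by simp
      also have "\<dots> \<le> C2 * (2 / c0 / 2 ^ card F * Tu u)"
        using ov F c0 Tu0 by (intro mult_right_mono) auto
      also have "\<dots> = D * Tu u" by (simp add: D_def)
      finally show ?thesis .
    qed
    have main: "(\<Sum>k\<in>{k\<in>F. k \<in> carleson_square b}. g k powr (p / (p - q)) * bdist k) \<le> (K0 * N powr q) * X powr t * bdist b"
      if X: "X > 0" and cX: "\<And>b'. b' \<in> unit_disc \<Longrightarrow> (\<Sum>k\<in>{k\<in>F. k \<in> carleson_square b'}. g k powr (p / (p - q)) * bdist k) \<le> X * bdist b'"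
        and b: "b \<in> unit_disc" for X b
    proof -
      have hb: "bdist b > 0" by (rule bdist_pos[OF b])
      \<comment> \<open>10 = 5 / 2 + 3 * 5 / 2: a point k of S(b) is within 5 / 2 * bdist b of b,
        and its ball adds 3 * bdist k.\<close>
      have h10: "10 * bdist b > 0" using hb by simp
      obtain b1 where b1: "b1 \<in> unit_disc" "bdist b1 = min 1 (14 * (10 * bdist b))"
        "\<And>u. u \<in> unit_disc \<Longrightarrow> kdist b u \<le> 10 * bdist b \<Longrightarrow> u \<in> carleson_square b1"
        by (rule kdist_ball_subset_carleson_square[OF b h10]) (rule that)
      let ?Fb = "{k\<in>F. k \<in> carleson_square b}"
      have Fb: "finite ?Fb" using F by simp
      let ?E = "\<lambda>k. ball k (3 / 4 * bdist k)"
      have E: "?E k \<in> sets \<mu>" if "k \<in> F" for k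
      proof -
        have "?E k \<subseteq> unit_disc" using kdist_near(1)[OF FD[OF that]] by blast
        then have "?E k \<in> sets (restrict_space borel unit_disc)" by (subst sets_restrict_space_iff) auto
        then show ?thesis using \<mu> by (simp add: borel_measure_on_disc_def)
      qed
      have Eb: "u \<in> carleson_square b1" if k: "k \<in> ?Fb" and u: "u \<in> ?E k" for k u
      proof -
        have kD: "k \<in> unit_disc" using FD k by blast
        note nr = kdist_near[OF kD u]
        have kb: "kdist b k \<le> 5 / 2 * bdist b" using carleson_square_subset(2)[OF b] k by blast
        show ?thesis
          using kdist_triangle[OF b kD nr(1)] nr(2) kb bdist_le_kdist'[OF b kD] by (intro b1(3) nr(1)) linarith
      qed
      have w0: "0 \<le> w k" for k by (simp add: w_def)
      let ?I = "\<lambda>A. carleson_mass \<mu> q (test p n F (cs A)) b1"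
      have mtest: "(\<lambda>u. cmod (test p n F (cs A) u) powr q) \<in> borel_measurable \<mu>" for A
      proof -
        have "(\<lambda>u. cmod (test p n F (cs A) u) powr q) \<in> borel_measurable (restrict_space borel unit_disc)"
          using q FD by (intro borel_measurable_restrict_norm_powr holomorphic_test) auto
        then show ?thesis using \<mu> by (simp add: borel_measure_on_disc_def cong: measurable_cong_sets)
      qed
      have mS: "carleson_square b1 \<in> sets \<mu>"
        using carleson_square_measurable[of b1] \<mu> b1 by (simp add: borel_measure_on_disc_def)
      note [measurable] = mtest mS
      have "ennreal (\<Sum>k\<in>?Fb. g k powr (p / (p - q)) * bdist k) = (\<Sum>k\<in>?Fb. ennreal (g k powr (p / (p - q)) * bdist k))"
        by (intro sum_ennreal[symmetric] mult_nonneg_nonneg less_imp_le[OF bdist_pos[OF FD]]) auto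
      also have "\<dots> = (\<Sum>k\<in>?Fb. ennreal (w k) * emeasure \<mu> (?E k))"
      proof (rule sum.cong[OF refl])
        fix k assume "k \<in> ?Fb"
        then have k: "k \<in> F" by simp
        have "ennreal (w k) * emeasure \<mu> (?E k) = ennreal (w k * (g k * (W (bdist k) powr (q / p) * bdist k)))"
          unfolding em[OF k] using w0 g[OF k] bdist_pos[OF FD[OF k]] by (intro ennreal_mult[symmetric]) auto
        then show "ennreal (g k powr (p / (p - q)) * bdist k) = ennreal (w k) * emeasure \<mu> (?E k)"
          unfolding wg[OF k] by simp
      qed
      also have "\<dots> = (\<Sum>k\<in>?Fb. \<integral>\<^sup>+u. ennreal (w k) * indicator (?E k) u \<partial>\<mu>)"
        using E by (intro sum.cong refl nn_integral_cmult_indicator[symmetric]) auto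
      also have "\<dots> = (\<integral>\<^sup>+u. (\<Sum>k\<in>?Fb. ennreal (w k) * indicator (?E k) u) \<partial>\<mu>)"
        using E by (intro nn_integral_sum[symmetric]) auto
      also have "\<dots> \<le> (\<integral>\<^sup>+u. (\<Sum>A\<in>Pow F. ennreal D * (ennreal (cmod (test p n F (cs A) u) powr q) * indicator (carleson_square b1) u)) \<partial>\<mu>)"
      proof (rule nn_integral_mono)
        fix u
        show "(\<Sum>k\<in>?Fb. ennreal (w k) * indicator (?E k) u) \<le>
          (\<Sum>A\<in>Pow F. ennreal D * (ennreal (cmod (test p n F (cs A) u) powr q) * indicator (carleson_square b1) u))"
        proof (cases "u \<in> carleson_square b1")
          case True
          have "(\<Sum>k\<in>?Fb. ennreal (w k) * indicator (?E k) u) \<le> (\<Sum>k\<in>F. ennreal (w k) * indicator (?E k) u)"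
            using F by (intro sum_mono2) auto
          also have "\<dots> = (\<Sum>k\<in>{k\<in>F. u \<in> ?E k}. ennreal (w k))"
            using F by (intro sum.mono_neutral_cong_right) (auto simp: indicator_def)
          also have "\<dots> = ennreal (\<Sum>k\<in>{k\<in>F. u \<in> ?E k}. w k)" using w0 by (intro sum_ennreal) auto
          also have "\<dots> \<le> ennreal (D * Tu u)" by (intro ennreal_leI pointwise)
          also have "\<dots> = ennreal D * (\<Sum>A\<in>Pow F. ennreal (cmod (test p n F (cs A) u) powr q))"
            unfolding Tu_def using D by (simp add: ennreal_mult sum_nonneg sum_ennreal)
          also have "\<dots> = (\<Sum>A\<in>Pow F. ennreal D * (ennreal (cmod (test p n F (cs A) u) powr q) * indicator (carleson_square b1) u))"
            using True by (simp add: sum_distrib_left del: sum_ennreal)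
          finally show ?thesis .
        next
          case False
          then have "(\<Sum>k\<in>?Fb. ennreal (w k) * indicator (?E k) u) = (\<Sum>k\<in>?Fb. 0)"
            using Eb by (intro sum.cong refl) (auto simp: indicator_def)
          then show ?thesis by simp
        qed
      qed
      also have "\<dots> = (\<Sum>A\<in>Pow F. ennreal D * ?I A)"
        by (subst nn_integral_sum) (simp_all add: nn_integral_cmult)
      \<comment> \<open>All sign choices have the same moduli of coefficients, hence the same
        Carleson constant X.\<close>
      also have "\<dots> \<le> (\<Sum>A\<in>Pow F. ennreal D * ennreal (C1 * N powr q * X powr (q / p) * bdist b1))"
        using cX X F emb b1(1)
        by (intro sum_mono mult_left_mono T[rule_format] conjI ballI) (auto simp: csp)
      also have "\<dots> = of_nat (card (Pow F)) * (ennreal D * ennreal (C1 * N powr q * X powr (q / p) * bdist b1))"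
        by (rule sum_constant)
      also have "of_nat (card (Pow F)) = ennreal (2 ^ card F)"
        using F by (simp add: card_Pow ennreal_of_nat_eq_real_of_nat)
      also have "ennreal D * ennreal (C1 * N powr q * X powr (q / p) * bdist b1) = ennreal (D * (C1 * N powr q * X powr (q / p) * bdist b1))"
        using D C1 bdist_pos[OF b1(1)] by (intro ennreal_mult[symmetric]) auto
      also have "ennreal (2 ^ card F) * \<dots> = ennreal (2 ^ card F * (D * (C1 * N powr q * X powr (q / p) * bdist b1)))"
        using D C1 bdist_pos[OF b1(1)] by (intro ennreal_mult[symmetric]) auto
      finally have "(\<Sum>k\<in>?Fb. g k powr (p / (p - q)) * bdist k) \<le> 2 ^ card F * (D * (C1 * N powr q * X powr (q / p) * bdist b1))"
        using D C1 bdist_pos[OF b1(1)] by (subst (asm) ennreal_le_iff) auto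
      also have "\<dots> = 2 * C2 / c0 * C1 * N powr q * X powr t * bdist b1"
        by (simp add: D_def t_def)
      also have "\<dots> \<le> 2 * C2 / c0 * C1 * N powr q * X powr t * (140 * bdist b)"
        using b1(2) C1 C2 c0 by (intro mult_left_mono) auto
      also have "\<dots> = (K0 * N powr q) * X powr t * bdist b" by (simp add: K0_def)
      finally show ?thesis .
    qed
    have "(\<Sum>k\<in>{k\<in>F. k \<in> carleson_square b}. g k powr (p / (p - q)) * bdist k) \<le> (K0 * N powr q) powr (1 / (1 - t)) * bdist b"
    proof (rule finite_Carleson_sup[OF F(1) _ _ main t _ b])
      show "F \<subseteq> unit_disc" using FD by blast
      show "0 \<le> K0 * N powr q" using K0 by simp
    qed auto
    also have "(K0 * N powr q) powr (1 / (1 - t)) = K0 powr (1 / (1 - t)) * N powr (p * q / (p - q))"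
    proof -
      have "q * (1 / (1 - t)) = p * q / (p - q)" using p pq by (simp add: t_def field_simps)
      then show ?thesis by (simp add: powr_mult powr_powr)
    qed
    finally show "(\<Sum>k\<in>{k\<in>F. k \<in> carleson_square b}. g k powr (p / (p - q)) * bdist k) \<le> K0 powr (1 / (1 - t)) * N powr (p * q / (p - q)) * bdist b" .
  qed
qed

text \<open>On a lattice ball \<open>G_fun\<close> is at most C2 * (g k)^(1/q). As s / q = p / (p -
  q), the integral reduces to the sum in \<open>necessity_coefficients\<close>; the finiteness of
  the measures, needed to define real \<open>g k\<close>, comes from
  \<open>necessity_single\<close>.\<close>

lemma necessity_gt:
  assumes q: "q > 0" and pq: "q < p" and r: "0 < r" "r < 1 / 4"
  shows "\<exists>C>0. \<forall>\<mu> N b. borel_measure_on_disc \<mu> \<and> embeds_tests p q \<mu> N \<and> b \<in> unit_disc \<longrightarrow>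
    (\<integral>\<^sup>+z. epowr (G_fun p q \<omega> \<mu> r z) (p * q / (p - q)) * ennreal (1 / bdist z) * indicator (carleson_square b) z \<partial>lborel) \<le>
      ennreal (C * N powr (p * q / (p - q)) * bdist b)"
proof -
  have p: "p > 0" using q pq by simp
  define \<epsilon> :: real where "\<epsilon> = 1 / 100"
  have \<epsilon>: "0 < \<epsilon>" "\<epsilon> \<le> 1" "\<epsilon> \<le> 1 / 100" "5 * \<epsilon> = 1 / 20" by (auto simp: \<epsilon>_def)
  obtain Z where Z: "disc_lattice \<epsilon> Z" using disc_lattice_exists[OF \<epsilon>(1)] by blast
  have ZD: "k \<in> unit_disc" if "k \<in> Z" for k using Z that by (auto simp: disc_lattice_def)
  have Zc: "countable Z" using Z by (simp add: disc_lattice_def)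
  define s where "s = p * q / (p - q)"
  have s: "s > 0" "s / q = p / (p - q)" using p q pq by (auto simp: s_def)
  obtain C1 where C1: "C1 > 0" and single: "\<forall>\<mu> N k. borel_measure_on_disc \<mu> \<and> embeds_tests p q \<mu> N \<and> k \<in> Z \<longrightarrow>
    emeasure \<mu> (ball k (3 / 4 * bdist k)) \<le> ennreal (C1 * N powr q * (W (bdist k) powr (q / p) * bdist k))"
    using necessity_single[OF p q Z \<epsilon>(1,2)] by blast
  have r': "r \<le> 1 / 4" using r by simp
  obtain C2 where C2: "C2 > 0" and GL: "\<forall>\<mu> k z g. borel_measure_on_disc \<mu> \<and> k \<in> unit_disc \<and> z \<in> ball k (5 * \<epsilon> * bdist k) \<and> 0 \<le> g \<and>
    emeasure \<mu> (ball k (3 / 4 * bdist k)) \<le> ennreal (g * (W (bdist k) powr (q / p) * bdist k)) \<longrightarrow>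
    G_fun p q \<omega> \<mu> r z \<le> ennreal (C2 * g powr (1 / q))"
    using G_fun_le_lattice[OF p q r(1) r' \<epsilon>(3)] by blast
  obtain C3 where C3: "C3 > 0" and coef: "\<forall>\<mu> N F g b. borel_measure_on_disc \<mu> \<and> embeds_tests p q \<mu> N \<and> finite F \<and> F \<subseteq> Z \<and>
    (\<forall>k\<in>F. 0 \<le> g k \<and> emeasure \<mu> (ball k (3 / 4 * bdist k)) = ennreal (g k * (W (bdist k) powr (q / p) * bdist k))) \<and>
    b \<in> unit_disc \<longrightarrow>
    (\<Sum>k\<in>{k\<in>F. k \<in> carleson_square b}. g k powr (p / (p - q)) * bdist k) \<le> C3 * N powr (p * q / (p - q)) * bdist b"
    using necessity_coefficients[OF q pq Z \<epsilon>(1,2)] by blast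
  define c where "c = C2 powr s * 2 * pi * (5 * \<epsilon>)\<^sup>2"
  have c: "c > 0" using C2 \<epsilon> by (simp add: c_def)
  show ?thesis
  proof (intro exI[of _ "c * C3 * 140"] conjI allI impI)
    show "c * C3 * 140 > 0" using c C3 by simp
    fix \<mu> N b
    assume "borel_measure_on_disc \<mu> \<and> embeds_tests p q \<mu> N \<and> b \<in> unit_disc"
    then have \<mu>: "borel_measure_on_disc \<mu>" and emb: "embeds_tests p q \<mu> N" and b: "b \<in> unit_disc" by auto
    let ?E = "\<lambda>k. emeasure \<mu> (ball k (3 / 4 * bdist k))"
    let ?d = "\<lambda>k. W (bdist k) powr (q / p) * bdist k"
    have hW: "bdist k > 0" "W (bdist k) > 0" if "k \<in> Z" for k
      using bdist_pos[OF ZD[OF that]] W_pos[OF _ bdist_le_1] by auto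
    define g where "g k = enn2real (?E k) / ?d k" for k
    have g0: "0 \<le> g k" if "k \<in> Z" for k using hW[OF that] by (simp add: g_def)
    have em: "?E k = ennreal (g k * ?d k)" if k: "k \<in> Z" for k
    proof -
      have "?E k \<le> ennreal (C1 * N powr q * ?d k)" using single \<mu> emb k by blast
      then have "?E k < top" using ennreal_less_top by (rule order_le_less_trans)
      then show ?thesis using hW[OF k] by (simp add: g_def)
    qed
    have hb: "bdist b > 0" by (rule bdist_pos[OF b])
    have h10: "10 * bdist b > 0" using hb by simp
    obtain b1 where b1: "b1 \<in> unit_disc" "bdist b1 = min 1 (14 * (10 * bdist b))"
      "\<And>u. u \<in> unit_disc \<Longrightarrow> kdist b u \<le> 10 * bdist b \<Longrightarrow> u \<in> carleson_square b1"
      by (rule kdist_ball_subset_carleson_square[OF b h10]) (rule that)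
    let ?B = "\<lambda>k. ball k (5 * \<epsilon> * bdist k)"
    \<comment> \<open>Balls that meet S(b) have their centres in the larger square of b1; 2 / bdist
      k bounds 1 / bdist z on the ball.\<close>
    define v where "v k = (if k \<in> carleson_square b1 then (C2 * g k powr (1 / q)) powr s * (2 / bdist k) else 0)" for k
    have v0: "0 \<le> v k" if "k \<in> Z" for k using hW[OF that] by (simp add: v_def)
    have "(\<integral>\<^sup>+z. epowr (G_fun p q \<omega> \<mu> r z) s * ennreal (1 / bdist z) * indicator (carleson_square b) z \<partial>lborel) \<le>
      (\<integral>\<^sup>+z. \<integral>\<^sup>+k. ennreal (v k) * indicator (?B k) z \<partial>count_space Z \<partial>lborel)"
    proof (rule nn_integral_mono)
      fix z :: complex
      show "epowr (G_fun p q \<omega> \<mu> r z) s * ennreal (1 / bdist z) * indicator (carleson_square b) z \<le>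
        (\<integral>\<^sup>+k. ennreal (v k) * indicator (?B k) z \<partial>count_space Z)"
      proof (cases "z \<in> carleson_square b")
        case True
        have z: "z \<in> unit_disc" by (rule carleson_square_subset(1)[OF b True])
        have "z \<in> (\<Union>k\<in>Z. ?B k)" using Z z unfolding disc_lattice_def by blast
        then obtain k where k: "k \<in> Z" "z \<in> ?B k" by blast
        note kD = ZD[OF k(1)] note h = hW[OF k(1)]
        have d: "cmod (k - z) < 1 / 20 * bdist k" using k(2) \<epsilon>(4) by (simp add: dist_norm)
        have hz: "bdist k \<le> 2 * bdist z" "bdist z \<le> 2 * bdist k" "cmod (k - z) \<le> bdist z"
          using bdist_diff_le[of k z] d h by linarith+
        have hz0: "bdist z > 0" by (rule bdist_pos[OF z])
        have bz: "kdist b z \<le> 5 / 2 * bdist b" by (rule carleson_square_subset(2)[OF b True])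
        have zb: "bdist z \<le> 5 / 2 * bdist b" using bdist_le_kdist'[OF b z] bz by linarith
        have "kdist z k \<le> 2 * bdist z + cmod (z - k)" by (rule kdist_le_dist[OF z])
        then have "kdist z k \<le> 3 * bdist z" using hz(3) by (simp add: norm_minus_commute)
        then have "kdist b k \<le> 10 * bdist b" using kdist_triangle[OF b z kD] bz zb by linarith
        then have kS: "k \<in> carleson_square b1" by (intro b1(3) kD)
        have "G_fun p q \<omega> \<mu> r z \<le> ennreal (C2 * g k powr (1 / q))"
          by (rule GL[rule_format], intro conjI) (rule \<mu>, rule kD, rule k(2), rule g0[OF k(1)], simp only: em[OF k(1)] order_refl)
        then have "epowr (G_fun p q \<omega> \<mu> r z) s \<le> epowr (ennreal (C2 * g k powr (1 / q))) s"
          using s by (intro epowr_mono) auto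
        also have "\<dots> = ennreal ((C2 * g k powr (1 / q)) powr s)" using C2 by (intro epowr_ennreal) auto
        finally have G: "epowr (G_fun p q \<omega> \<mu> r z) s \<le> ennreal ((C2 * g k powr (1 / q)) powr s)" .
        have "1 / bdist z \<le> 2 / bdist k" using hz h hz0 by (simp add: field_simps)
        then have "ennreal (1 / bdist z) \<le> ennreal (2 / bdist k)" by (rule ennreal_leI)
        with G have "epowr (G_fun p q \<omega> \<mu> r z) s * ennreal (1 / bdist z) \<le>
          ennreal ((C2 * g k powr (1 / q)) powr s) * ennreal (2 / bdist k)" by (rule mult_mono) auto
        also have "\<dots> = ennreal (v k)" unfolding v_def if_P[OF kS] using h by (intro ennreal_mult[symmetric]) auto
        finally have "epowr (G_fun p q \<omega> \<mu> r z) s * ennreal (1 / bdist z) * indicator (carleson_square b) z \<le> ennreal (v k) * indicator (?B k) z"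
          using True k(2) by simp
        also have "\<dots> \<le> (\<integral>\<^sup>+k. ennreal (v k) * indicator (?B k) z \<partial>count_space Z)"
          by (rule nn_integral_ge_point[OF k(1)])
        finally show ?thesis .
      qed simp
    qed
    also have "\<dots> = (\<integral>\<^sup>+k. \<integral>\<^sup>+z. ennreal (v k) * indicator (?B k) z \<partial>lborel \<partial>count_space Z)"
      by (rule nn_integral_count_space_nn_integral[OF Zc]) (simp add: borel_measurable_times_ennreal borel_measurable_indicator)
    also have "\<dots> = (\<integral>\<^sup>+k. ennreal (v k) * emeasure lborel (?B k) \<partial>count_space Z)"
      by (intro nn_integral_cong nn_integral_cmult_indicator) simp
    also have "\<dots> \<le> ennreal (c * (C3 * N powr s * bdist b1))"
    proof (rule nn_integral_count_space_le[OF Zc])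
      fix F assume F: "finite F" "F \<subseteq> Z"
      have "(\<Sum>k\<in>F. ennreal (v k) * emeasure lborel (?B k)) =
        (\<Sum>k\<in>F. ennreal (c * (if k \<in> carleson_square b1 then g k powr (p / (p - q)) * bdist k else 0)))"
      proof (rule sum.cong[OF refl])
        fix k assume "k \<in> F"
        then have k: "k \<in> Z" using F by blast
        note h = hW[OF k]
        have "ennreal (v k) * emeasure lborel (?B k) = ennreal (v k * (pi * (5 * \<epsilon> * bdist k)\<^sup>2))"
        proof -
          have "emeasure lborel (?B k) = ennreal (pi * (5 * \<epsilon> * bdist k)\<^sup>2)"
            using h \<epsilon>(1) by (intro emeasure_lborel_ball_complex) auto
          then show ?thesis using v0[OF k] by (simp only:) (intro ennreal_mult[symmetric], auto)
        qed
        also have "v k * (pi * (5 * \<epsilon> * bdist k)\<^sup>2) = c * (if k \<in> carleson_square b1 then g k powr (p / (p - q)) * bdist k else 0)"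
        proof -
          have "(C2 * g k powr (1 / q)) powr s = C2 powr s * g k powr (p / (p - q))"
            by (simp add: powr_mult powr_powr s(2)[symmetric])
          then show ?thesis using h by (simp add: v_def c_def power2_eq_square)
        qed
        finally show "ennreal (v k) * emeasure lborel (?B k) = ennreal (c * (if k \<in> carleson_square b1 then g k powr (p / (p - q)) * bdist k else 0))" .
      qed
      also have "\<dots> = ennreal (\<Sum>k\<in>F. c * (if k \<in> carleson_square b1 then g k powr (p / (p - q)) * bdist k else 0))"
              proof (intro sum_ennreal)
        fix k assume "k \<in> F"
        then have "0 < bdist k" using F hW(1) by blast
        then show "0 \<le> c * (if k \<in> carleson_square b1 then g k powr (p / (p - q)) * bdist k else 0)" using c by simp
      qed
      also have "(\<Sum>k\<in>F. c * (if k \<in> carleson_square b1 then g k powr (p / (p - q)) * bdist k else 0)) =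
        c * (\<Sum>k\<in>{k\<in>F. k \<in> carleson_square b1}. g k powr (p / (p - q)) * bdist k)"
        using F by (simp only: sum_distrib_left[symmetric] sum.inter_filter)
      also have "ennreal \<dots> \<le> ennreal (c * (C3 * N powr s * bdist b1))"
        unfolding s_def using c
      proof (intro ennreal_leI mult_left_mono)
        show "(\<Sum>k\<in>{k\<in>F. k \<in> carleson_square b1}. g k powr (p / (p - q)) * bdist k) \<le> C3 * N powr (p * q / (p - q)) * bdist b1"
        proof (rule coef[rule_format], intro conjI ballI)
          fix k assume "k \<in> F"
          then have "k \<in> Z" using F by blast
          then show "0 \<le> g k" "?E k = ennreal (g k * ?d k)" by (fact g0, fact em)
        qed (fact \<mu> emb F b1(1))+
      qed simp
      finally show "(\<Sum>k\<in>F. ennreal (v k) * emeasure lborel (?B k)) \<le> ennreal (c * (C3 * N powr s * bdist b1))" .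
    qed
    also have "\<dots> \<le> ennreal (c * (C3 * N powr s * (140 * bdist b)))"
      using b1(2) c C3 by (intro ennreal_leI mult_left_mono) auto
    also have "c * (C3 * N powr s * (140 * bdist b)) = c * C3 * 140 * N powr s * bdist b" by simp
    finally show "(\<integral>\<^sup>+z. epowr (G_fun p q \<omega> \<mu> r z) (p * q / (p - q)) * ennreal (1 / bdist z) * indicator (carleson_square b) z \<partial>lborel) \<le>
      ennreal (c * C3 * 140 * N powr (p * q / (p - q)) * bdist b)" unfolding s_def .
  qed
qed

end

section \<open>Tent spaces\<close>

lemma borel_measurable_restrict_holomorphic:
  "f holomorphic_on unit_disc \<Longrightarrow> f \<in> borel_measurable (restrict_space borel unit_disc)"
  by (intro borel_measurable_continuous_on_restrict holomorphic_on_imp_continuous_on)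

lemma borel_measurable_weight_measure:
  assumes "\<phi> \<in> borel_measurable (restrict_space borel unit_disc)"
  shows "\<phi> \<in> borel_measurable (completion (weight_measure w))"
proof (rule measurable_completion)
  show "\<phi> \<in> borel_measurable (weight_measure w)"
    using borel_measurable_dA[OF assms] by (simp add: weight_measure_def)
qed

lemma tent_average_le_iff:
  assumes a: "a \<in> unit_disc" and X: "X \<ge> 0"
  shows "tent_average q M g a \<le> ennreal X \<longleftrightarrow>
    (\<integral>\<^sup>+z. epowr (g z) q * indicator (carleson_square a) z \<partial>M) \<le> ennreal (X * bdist a)"
proof -
  have h: "bdist a > 0" by (rule bdist_pos[OF a])
  have "tent_average q M g a = (\<integral>\<^sup>+z. epowr (g z) q * indicator (carleson_square a) z \<partial>M) / ennreal (bdist a)"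
    using h by (simp add: tent_average_def divide_ennreal_def inverse_ennreal bdist_def[symmetric] mult.commute inverse_eq_divide)
  then show ?thesis using ennreal_divide_le_iff[OF h X] by simp
qed

lemma tent_norm_le_iff:
  assumes q: "q > 0" and L: "L \<ge> 0"
  shows "tent_norm q M g \<le> ennreal L \<longleftrightarrow>
    (\<forall>a\<in>unit_disc. (\<integral>\<^sup>+z. epowr (g z) q * indicator (carleson_square a) z \<partial>M) \<le> ennreal (L powr q * bdist a))"
  unfolding tent_norm_def SUP_le_iff epowr_le_iff[OF q L]
  using tent_average_le_iff[of _ "L powr q"] by (intro ball_cong) auto

lemma tent_average_tendsto_0_iff:
  "(tent_average q M g \<longlongrightarrow> 0) (filtercomap cmod (at_left 1)) \<longleftrightarrow>
    (\<forall>e>0. \<exists>d>0. \<forall>b\<in>unit_disc. bdist b < d \<longrightarrow>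
      (\<integral>\<^sup>+z. epowr (g z) q * indicator (carleson_square b) z \<partial>M) \<le> ennreal (e * bdist b))" (is "?L \<longleftrightarrow> ?R")
proof -
  \<comment> \<open>The filter forces cmod b < 1 eventually, so b lies in the disc
    automatically.\<close>
  have ev: "eventually P (filtercomap cmod (at_left 1)) \<longleftrightarrow> (\<exists>d>0. \<forall>b\<in>unit_disc. bdist b < d \<longrightarrow> P b)" for P
  proof
    assume "eventually P (filtercomap cmod (at_left 1))"
    then obtain Q where Q: "eventually Q (at_left (1::real))" "\<And>b. Q (cmod b) \<Longrightarrow> P b"
      unfolding eventually_filtercomap by blast
    obtain c where c: "c < 1" "\<And>y. c < y \<Longrightarrow> y < 1 \<Longrightarrow> Q y"
      using Q(1) eventually_at_left[of 0 "1::real" Q] by auto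
    have "P b" if "b \<in> unit_disc" "bdist b < 1 - c" for b
      using that by (intro Q(2) c(2)) (auto simp: bdist_def)
    then show "\<exists>d>0. \<forall>b\<in>unit_disc. bdist b < d \<longrightarrow> P b" using c(1) by (intro exI[of _ "1 - c"]) auto
  next
    assume "\<exists>d>0. \<forall>b\<in>unit_disc. bdist b < d \<longrightarrow> P b"
    then obtain d where d: "d > 0" "\<And>b. b \<in> unit_disc \<Longrightarrow> bdist b < d \<Longrightarrow> P b" by blast
    have "eventually (\<lambda>y. 1 - d < y \<and> y < 1) (at_left (1::real))"
      using d(1) by (subst eventually_at_left[of 0]) (auto intro!: exI[of _ "1 - d"])
    then show "eventually P (filtercomap cmod (at_left 1))"
      unfolding eventually_filtercomap using d(2)
      by (intro exI[of _ "\<lambda>y. 1 - d < y \<and> y < 1"] conjI) (auto simp: bdist_def)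
  qed
  show ?thesis
  proof
    assume L: ?L
    show ?R
    proof (intro allI impI)
      fix e :: real assume e: "e > 0"
      have "eventually (\<lambda>b. tent_average q M g b < ennreal e) (filtercomap cmod (at_left 1))"
        using L e by (intro order_tendstoD(2)[where y = 0]) auto
      then obtain d where d: "d > 0" "\<forall>b\<in>unit_disc. bdist b < d \<longrightarrow> tent_average q M g b < ennreal e" unfolding ev by blast
      show "\<exists>d>0. \<forall>b\<in>unit_disc. bdist b < d \<longrightarrow>
        (\<integral>\<^sup>+z. epowr (g z) q * indicator (carleson_square b) z \<partial>M) \<le> ennreal (e * bdist b)"
      proof (intro exI[of _ d] conjI d(1) ballI impI)
        fix b :: complex assume b: "b \<in> unit_disc" "bdist b < d"
        then have "tent_average q M g b \<le> ennreal e" using d(2) by (auto intro: less_imp_le)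
        then show "(\<integral>\<^sup>+z. epowr (g z) q * indicator (carleson_square b) z \<partial>M) \<le> ennreal (e * bdist b)"
          using tent_average_le_iff[OF b(1), of e] e by simp
      qed
    qed
  next
    assume R: ?R
    show ?L
    proof (rule order_tendstoI)
      fix x :: ennreal assume "0 < x"
      then obtain y where y: "0 < y" "y < x" using dense by blast
      then obtain e where e: "y = ennreal e" "0 < e"
        by (cases y) auto
      obtain d where d: "d > 0" "\<forall>b\<in>unit_disc. bdist b < d \<longrightarrow>
        (\<integral>\<^sup>+z. epowr (g z) q * indicator (carleson_square b) z \<partial>M) \<le> ennreal (e * bdist b)" using R e(2) by blast
      have "tent_average q M g b < x" if "b \<in> unit_disc" "bdist b < d" for b
      proof -
        have "tent_average q M g b \<le> ennreal e" using d(2) that e(2) by (subst tent_average_le_iff) auto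
        then show ?thesis using y(2) e(1) by simp
      qed
      then show "eventually (\<lambda>b. tent_average q M g b < x) (filtercomap cmod (at_left 1))"
        unfolding ev using d(1) by blast
    qed simp
  qed
qed

definition little_carleson :: "complex measure \<Rightarrow> real \<Rightarrow> (complex \<Rightarrow> complex) \<Rightarrow> bool"
  where "little_carleson M q f \<longleftrightarrow> (\<forall>e>0. \<exists>d>0. \<forall>b\<in>unit_disc. bdist b < d \<longrightarrow>
    carleson_mass M q f b \<le> ennreal (e * bdist b))"

lemma epowr_modulus: "epowr (modulus f z) q = ennreal (cmod (f z) powr q)"
  by (simp add: modulus_def epowr_ennreal)

lemma in_T_inf_iff:
  assumes "borel_measure_on_disc \<mu>" "f holomorphic_on unit_disc"
  shows "f \<in> T_inf q \<mu> \<longleftrightarrow> tent_norm q \<mu> (modulus f) < \<infinity>"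
proof -
  have "f \<in> borel_measurable \<mu>"
    using borel_measurable_restrict_holomorphic[OF assms(2)] assms(1)
    by (simp add: borel_measure_on_disc_def cong: measurable_cong_sets)
  then have "f \<in> borel_measurable (completion \<mu>)" by (rule measurable_completion)
  then show ?thesis by (simp add: T_inf_def)
qed

lemma in_AT_inf_iff: "f \<in> AT_inf p w \<longleftrightarrow> f holomorphic_on unit_disc \<and> tent_norm p (weight_measure w) (modulus f) < \<infinity>"
  using borel_measurable_weight_measure[OF borel_measurable_restrict_holomorphic]
  by (auto simp: AT_inf_def T_inf_def)

lemma in_T_zero_iff: "f \<in> T_zero q M \<longleftrightarrow> f \<in> T_inf q M \<and> little_carleson M q f"
  by (simp add: T_zero_def tent_average_tendsto_0_iff little_carleson_def epowr_modulus)

text \<open>If x is real, it is approached by the positive numbers a + e / C; if x is infinite, so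
  is C * x. This allows the estimates to be stated for strictly positive real bounds, also where the
  norm itself is 0.\<close>

lemma ennreal_le_mult_limit:
  assumes C: "C > 0" and le: "\<And>N. N > 0 \<Longrightarrow> x \<le> ennreal N \<Longrightarrow> y \<le> ennreal (C * N)"
  shows "y \<le> ennreal C * x"
proof (cases x)
  case (real a)
  have "y \<le> ennreal (C * a) + ennreal e" if e: "e > 0" for e
  proof -
    have pos: "a + e / C > 0" using real(1) e C by (intro add_nonneg_pos) auto
    have "y \<le> ennreal (C * (a + e / C))"
      using pos real e C by (intro le) (auto intro!: ennreal_leI)
    also have "C * (a + e / C) = C * a + e" using C by (simp add: field_simps)
    also have "ennreal (C * a + e) = ennreal (C * a) + ennreal e" using C real(1) e by (intro ennreal_plus) auto
    finally show ?thesis .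
  qed
  then have "y \<le> ennreal (C * a)" by (rule ennreal_le_epsilon)
  then show ?thesis using real C by (simp add: ennreal_mult)
next
  case top
  then show ?thesis using C by (simp add: ennreal_mult_top)
qed

section \<open>From Carleson bounds to embeddings of the tent spaces\<close>

context D_weight
begin

lemma wA_tent:
  assumes "f holomorphic_on unit_disc" "p > 0"
  shows "carleson_mass (weight_measure \<omega>) p f b =
    carleson_mass wA p f b"
proof (rule nn_integral_weight_measure)
  note [measurable] = borel_measurable_restrict_norm_powr[OF assms] carleson_square_measurable[of b]
  show "(\<lambda>u. ennreal (cmod (f u) powr p) * indicator (carleson_square b) u) \<in> borel_measurable (restrict_space borel unit_disc)"
    by measurable
qed

lemma carleson_bound_iff_tent_norm:
  assumes p: "p > 0" and L: "L \<ge> 0" and f: "f holomorphic_on unit_disc"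
  shows "carleson_bound p f (L powr p) \<longleftrightarrow> tent_norm p (weight_measure \<omega>) (modulus f) \<le> ennreal L"
  using f by (simp add: tent_norm_le_iff[OF p L] epowr_modulus wA_tent[OF f p] carleson_bound_def)

lemma in_AT_zero_iff: "p > 0 \<Longrightarrow> f \<in> AT_zero p \<omega> \<longleftrightarrow> f \<in> AT_inf p \<omega> \<and> little_carleson wA p f"
  by (auto simp: AT_zero_def AT_inf_def in_T_zero_iff little_carleson_def wA_tent)

text \<open>Norm bound and preservation of vanishing in one predicate, so that one sufficiency
  argument serves both spaces.\<close>

definition embeds :: "real \<Rightarrow> real \<Rightarrow> complex measure \<Rightarrow> real \<Rightarrow> bool"
  where "embeds p q \<mu> A \<longleftrightarrow>
    (\<forall>f L. L > 0 \<and> carleson_bound p f (L powr p) \<longrightarrow>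
      (\<forall>b\<in>unit_disc. carleson_mass \<mu> q f b \<le> ennreal ((A * L) powr q * bdist b)) \<and>
      (little_carleson wA p f \<longrightarrow> little_carleson \<mu> q f))"

lemma embedsD:
  assumes "embeds p q \<mu> A" "L > 0" "carleson_bound p f (L powr p)"
  shows "\<forall>b\<in>unit_disc. carleson_mass \<mu> q f b \<le> ennreal ((A * L) powr q * bdist b)"
    and "little_carleson wA p f \<Longrightarrow> little_carleson \<mu> q f"
proof -
  note * = assms(1)[unfolded embeds_def, THEN spec, THEN spec, THEN mp, OF conjI[OF assms(2,3)]]
  show "\<forall>b\<in>unit_disc. carleson_mass \<mu> q f b \<le> ennreal ((A * L) powr q * bdist b)"
    by (rule conjunct1[OF *])
  show "little_carleson wA p f \<Longrightarrow> little_carleson \<mu> q f" by (rule mp[OF conjunct2[OF *]])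
qed

lemma embeds_tent_norm:
  assumes p: "p > 0" and q: "q > 0" and A: "A > 0" and emb: "embeds p q \<mu> A"
    and f: "f \<in> AT_inf p \<omega>"
  shows "tent_norm q \<mu> (modulus f) \<le> ennreal A * tent_norm p (weight_measure \<omega>) (modulus f)"
    and "little_carleson wA p f \<Longrightarrow> little_carleson \<mu> q f"
proof -
  have h: "f holomorphic_on unit_disc" and fin: "tent_norm p (weight_measure \<omega>) (modulus f) < \<infinity>" using f by (auto simp: in_AT_inf_iff)
  show "tent_norm q \<mu> (modulus f) \<le> ennreal A * tent_norm p (weight_measure \<omega>) (modulus f)"
  proof (rule ennreal_le_mult_limit[OF A])
    fix L :: real assume L: "L > 0" "tent_norm p (weight_measure \<omega>) (modulus f) \<le> ennreal L"
    then have "carleson_bound p f (L powr p)" using carleson_bound_iff_tent_norm[OF p _ h, of L] by simp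
    then have "\<forall>b\<in>unit_disc. carleson_mass \<mu> q f b \<le> ennreal ((A * L) powr q * bdist b)"
      by (rule embedsD(1)[OF emb L(1)])
    then show "tent_norm q \<mu> (modulus f) \<le> ennreal (A * L)"
      using A L q by (subst tent_norm_le_iff) (auto simp: epowr_modulus)
  qed
  obtain a where a: "a \<ge> 0" "tent_norm p (weight_measure \<omega>) (modulus f) = ennreal a"
    using fin by (cases "tent_norm p (weight_measure \<omega>) (modulus f)") auto
  \<comment> \<open>The norm a may be 0 while \<open>embeds\<close> asks for L > 0; for vanishing
    the size of L does not matter.\<close>
  have ca: "carleson_bound p f ((a + 1) powr p)"
    using a carleson_bound_iff_tent_norm[OF p _ h, of "a + 1"] by (simp add: ennreal_leI)
  have a1: "a + 1 > 0" using a by simp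
  show "little_carleson wA p f \<Longrightarrow> little_carleson \<mu> q f" by (rule embedsD(2)[OF emb a1 ca])
qed

lemma embeds_imp_bounded:
  assumes p: "p > 0" and q: "q > 0" and A: "A > 0" and emb: "embeds p q \<mu> A" and \<mu>: "borel_measure_on_disc \<mu>"
  shows "Id_bounded_inf p q \<omega> \<mu>" "Id_bounded_zero p q \<omega> \<mu>" "Id_norm p q \<omega> \<mu> \<le> ennreal A"
proof -
  note t = embeds_tent_norm[OF p q A emb]
  have hol: "f holomorphic_on unit_disc" if "f \<in> AT_inf p \<omega>" for f using that by (simp add: in_AT_inf_iff)
  have sub: "f \<in> T_inf q \<mu>" if f: "f \<in> AT_inf p \<omega>" for f
  proof -
    have "ennreal A * tent_norm p (weight_measure \<omega>) (modulus f) < \<infinity>"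
      using f by (auto simp: in_AT_inf_iff ennreal_mult_less_top)
    with t(1)[OF f] show ?thesis unfolding in_T_inf_iff[OF \<mu> hol[OF f]] by (rule order_le_less_trans)
  qed
  show "Id_bounded_inf p q \<omega> \<mu>"
    unfolding Id_bounded_inf_def bounded_embedding_def using sub t(1) A by (auto intro!: exI[of _ A])
  show "Id_bounded_zero p q \<omega> \<mu>"
    unfolding Id_bounded_zero_def bounded_embedding_def
    using sub t A by (auto intro!: exI[of _ A] simp: in_AT_zero_iff[OF p] in_T_zero_iff)
  show "Id_norm p q \<omega> \<mu> \<le> ennreal A"
    unfolding Id_norm_def embedding_norm_def
  proof (rule SUP_least)
    fix f assume "f \<in> {f \<in> AT_inf p \<omega>. tent_norm p (weight_measure \<omega>) (modulus f) \<le> 1}"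
    then have f: "f \<in> AT_inf p \<omega>" "tent_norm p (weight_measure \<omega>) (modulus f) \<le> 1" by auto
    have "tent_norm q \<mu> (modulus f) \<le> ennreal A * tent_norm p (weight_measure \<omega>) (modulus f)" by (rule t(1)[OF f(1)])
    also have "\<dots> \<le> ennreal A * 1" using f(2) by (intro mult_left_mono) auto
    finally show "tent_norm q \<mu> (modulus f) \<le> ennreal A" by simp
  qed
qed

text \<open>A finite sum of kernels is bounded on the disc, and \<open>bounded_vanishing\<close>
  applies to bounded functions.\<close>

lemma test_in_AT_zero:
  assumes p: "p > 0" and F: "finite F" "F \<subseteq> unit_disc" and car: "carleson_bound p (test p n F c) (L powr p)" "L > 0"
  shows "test p n F c \<in> AT_zero p \<omega>" "tent_norm p (weight_measure \<omega>) (modulus (test p n F c)) \<le> ennreal L"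
proof -
  have hol: "test p n F c holomorphic_on unit_disc" by (rule holomorphic_test[OF F(2)])
  show le: "tent_norm p (weight_measure \<omega>) (modulus (test p n F c)) \<le> ennreal L"
    using car carleson_bound_iff_tent_norm[OF p _ hol, of L] by simp
  then have inf: "test p n F c \<in> AT_inf p \<omega>"
    using hol by (auto simp: in_AT_inf_iff intro: order_le_less_trans)
  have bd: "cmod (test p n F c u) \<le> (\<Sum>k\<in>F. \<bar>c k\<bar> * W (bdist k) powr (- 1 / p))" if "u \<in> unit_disc" for u
    by (rule test_bounded[OF F that])
  have "little_carleson wA p (test p n F c)"
    unfolding little_carleson_def
  proof (intro allI impI)
    fix e :: real assume e: "e > 0"
    obtain d where d: "d > 0" "\<forall>b\<in>unit_disc. bdist b < d \<longrightarrow>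
      (\<integral>\<^sup>+u. ennreal (cmod (test p n F c u) powr p) * indicator {..5 / 2 * bdist b} (kdist b u) \<partial>wA) \<le> ennreal (e * bdist b)"
      using bounded_vanishing[where f = "test p n F c", OF p bd e] by blast
    show "\<exists>d>0. \<forall>b\<in>unit_disc. bdist b < d \<longrightarrow>
      carleson_mass wA p (test p n F c) b \<le> ennreal (e * bdist b)"
    proof (intro exI[of _ d] conjI d(1) ballI impI)
      fix b :: complex assume b: "b \<in> unit_disc" "bdist b < d"
      have "carleson_mass wA p (test p n F c) b \<le>
        (\<integral>\<^sup>+u. ennreal (cmod (test p n F c u) powr p) * indicator {..5 / 2 * bdist b} (kdist b u) \<partial>wA)"
        using carleson_square_subset(2)[OF b(1)] by (intro nn_integral_mono mult_left_mono) (auto simp: indicator_def)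
      also have "\<dots> \<le> ennreal (e * bdist b)" using d(2) b by blast
      finally show "carleson_mass wA p (test p n F c) b \<le> ennreal (e * bdist b)" .
    qed
  qed
  then show "test p n F c \<in> AT_zero p \<omega>" using inf by (simp add: in_AT_zero_iff[OF p])
qed

lemma embeds_testsI:
  assumes p: "p > 0" and q: "q > 0" and N: "N \<ge> 0"
    and le: "\<And>f L. f \<in> AT_zero p \<omega> \<Longrightarrow> L > 0 \<Longrightarrow> tent_norm p (weight_measure \<omega>) (modulus f) \<le> ennreal L \<Longrightarrow>
      tent_norm q \<mu> (modulus f) \<le> ennreal (N * L)"
  shows "embeds_tests p q \<mu> N"
  unfolding embeds_tests_def
proof (intro conjI allI impI N)
  fix n F c L
  assume *: "finite F \<and> F \<subseteq> unit_disc \<and> L > 0 \<and> carleson_bound p (test p n F c) (L powr p)"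
  then have "tent_norm q \<mu> (modulus (test p n F c)) \<le> ennreal (N * L)"
    using test_in_AT_zero[OF p, of F n c L] by (intro le) auto
  then show "\<forall>b\<in>unit_disc. carleson_mass \<mu> q (test p n F c) b \<le>
      ennreal ((N * L) powr q * bdist b)"
    using * N q by (subst (asm) tent_norm_le_iff) (auto simp: epowr_modulus)
qed

text \<open>X is meant for either of the two analytic spaces: boundedness on the little space alone
  already reaches all test functions.\<close>

lemma bounded_embedding_imp_embeds_tests:
  assumes p: "p > 0" and q: "q > 0" and X: "AT_zero p \<omega> \<subseteq> X"
    and bd: "bounded_embedding X (\<lambda>f. tent_norm p (weight_measure \<omega>) (modulus f)) Y (\<lambda>f. tent_norm q \<mu> (modulus f))"
  shows "\<exists>N. embeds_tests p q \<mu> N"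
proof -
  obtain C where C: "C \<ge> 0" "\<And>f. f \<in> X \<Longrightarrow> tent_norm q \<mu> (modulus f) \<le> ennreal C * tent_norm p (weight_measure \<omega>) (modulus f)"
    using bd unfolding bounded_embedding_def by blast
  have "embeds_tests p q \<mu> C"
  proof (rule embeds_testsI[OF p q C(1)])
    fix f and L :: real
    assume f: "f \<in> AT_zero p \<omega>" and L: "L > 0" "tent_norm p (weight_measure \<omega>) (modulus f) \<le> ennreal L"
    have "tent_norm q \<mu> (modulus f) \<le> ennreal C * tent_norm p (weight_measure \<omega>) (modulus f)" using C(2) f X by blast
    also have "\<dots> \<le> ennreal C * ennreal L" using L(2) by (intro mult_left_mono) auto
    also have "\<dots> = ennreal (C * L)" using C L by (intro ennreal_mult[symmetric]) auto
    finally show "tent_norm q \<mu> (modulus f) \<le> ennreal (C * L)" .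
  qed
  then show ?thesis by blast
qed

text \<open>The operator norm is a supremum over the unit ball, so f is rescaled to f / L;
  homogeneity of both tent norms is checked on the integrals.\<close>

lemma Id_norm_imp_embeds_tests:
  assumes p: "p > 0" and q: "q > 0" and N: "N \<ge> 0" and \<mu>: "borel_measure_on_disc \<mu>" and le: "Id_norm p q \<omega> \<mu> \<le> ennreal N"
  shows "embeds_tests p q \<mu> N"
proof (rule embeds_testsI[OF p q N])
  fix f and L :: real
  assume "f \<in> AT_zero p \<omega>" and L: "L > 0" and fL: "tent_norm p (weight_measure \<omega>) (modulus f) \<le> ennreal L"
  then have h: "f holomorphic_on unit_disc" by (auto simp: AT_zero_def)
  define g where "g z = f z / of_real L" for z
  have hg: "g holomorphic_on unit_disc" unfolding g_def[abs_def] using L by (intro holomorphic_intros h) auto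
  have norm: "cmod (g u) powr s = L powr (- s) * cmod (f u) powr s" for u s
    using L by (simp add: g_def norm_divide powr_divide powr_minus_divide)
  have scale: "carleson_mass M s g b =
    ennreal (L powr (- s)) * carleson_mass M s f b"
    if s: "s > 0" and M: "sets M = sets (restrict_space borel unit_disc)" for s b M
  proof -
    have [measurable]: "(\<lambda>u. cmod (f u) powr s) \<in> borel_measurable M"
      using borel_measurable_restrict_norm_powr[OF h s] M by (simp cong: measurable_cong_sets)
    have [measurable]: "carleson_square b \<in> sets M" using carleson_square_measurable M by simp
    show ?thesis unfolding norm by (subst nn_integral_cmult[symmetric]) (simp_all add: ennreal_mult mult_ac)
  qed
  have "carleson_bound p f (L powr p)" using fL L carleson_bound_iff_tent_norm[OF p _ h, of L] by simp
  have "carleson_bound p g (1 powr p)"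
    unfolding carleson_bound_def
  proof (intro conjI ballI hg)
    fix b :: complex assume b: "b \<in> unit_disc"
    have "carleson_mass wA p g b =
      ennreal (L powr (- p)) * carleson_mass wA p f b"
      by (rule scale[OF p]) (simp add: sets_wA)
    also have "\<dots> \<le> ennreal (L powr (- p)) * ennreal (L powr p * bdist b)"
      using \<open>carleson_bound p f (L powr p)\<close> b by (intro mult_left_mono) (auto simp: carleson_bound_def)
    also have "\<dots> = ennreal (L powr (- p) * (L powr p * bdist b))"
      using bdist_pos[OF b] by (intro ennreal_mult[symmetric]) auto
    also have "L powr (- p) * (L powr p * bdist b) = 1 powr p * bdist b"
      using L by (simp add: powr_minus_divide)
    finally show "carleson_mass wA p g b \<le> ennreal (1 powr p * bdist b)" .
  qed simp
  then have "tent_norm p (weight_measure \<omega>) (modulus g) \<le> 1"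
    using carleson_bound_iff_tent_norm[OF p _ hg, of 1] by simp
  then have "g \<in> {f \<in> AT_inf p \<omega>. tent_norm p (weight_measure \<omega>) (modulus f) \<le> 1}"
    using hg by (auto simp: in_AT_inf_iff intro: order_le_less_trans)
  then have "tent_norm q \<mu> (modulus g) \<le> Id_norm p q \<omega> \<mu>"
    unfolding Id_norm_def embedding_norm_def by (rule SUP_upper)
  also note le
  finally have gN: "\<forall>b\<in>unit_disc. carleson_mass \<mu> q g b \<le> ennreal (N powr q * bdist b)"
    using q N by (subst (asm) tent_norm_le_iff) (auto simp: epowr_modulus)
  show "tent_norm q \<mu> (modulus f) \<le> ennreal (N * L)"
  proof (subst tent_norm_le_iff[OF q], use N L in simp, unfold epowr_modulus, intro ballI)
    fix b :: complex assume b: "b \<in> unit_disc"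
    let ?I = "carleson_mass \<mu> q f b"
    have "?I = ennreal (L powr q) * (ennreal (L powr (- q)) * ?I)"
      using L by (simp add: mult.assoc[symmetric] ennreal_mult[symmetric] powr_add[symmetric] del: ennreal_mult)
    also have "ennreal (L powr (- q)) * ?I = carleson_mass \<mu> q g b"
      using \<mu> by (intro scale[symmetric] q) (simp add: borel_measure_on_disc_def)
    also have "ennreal (L powr q) * \<dots> \<le> ennreal (L powr q) * ennreal (N powr q * bdist b)"
      using gN b by (intro mult_left_mono) auto
    also have "\<dots> = ennreal (L powr q * (N powr q * bdist b))"
      using bdist_pos[OF b] by (intro ennreal_mult[symmetric]) auto
    also have "L powr q * (N powr q * bdist b) = (N * L) powr q * bdist b" by (simp add: powr_mult)
    finally show "?I \<le> ennreal ((N * L) powr q * bdist b)" .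
  qed
qed

lemma little_carleson_kratio:
  assumes car: "carleson_bound p f X" and p: "p > 0" and lc: "little_carleson wA p f" and e: "e > 0"
  shows "\<exists>d>0. \<forall>b\<in>unit_disc. bdist b < d \<longrightarrow>
    kratio_mass p f b \<le> ennreal (e * bdist b)"
proof (rule carleson_kratio_integral_vanishing[OF _ _ _ _ _ _ _ e])
  have "(\<lambda>u. cmod (f u) powr p) \<in> borel_measurable wA"
    using car p by (intro measurable_wA borel_measurable_restrict_norm_powr) (auto simp: carleson_bound_def)
  then show "(\<lambda>u. ennreal (cmod (f u) powr p)) \<in> borel_measurable wA" by measurable
  show "0 \<le> X" using car by (simp add: carleson_bound_def)
  show "carleson_mass wA p f b \<le> ennreal (X * bdist b)"
    if "b \<in> unit_disc" for b using car that by (simp add: carleson_bound_def)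
  show "\<exists>d>0. \<forall>b\<in>unit_disc. bdist b < d \<longrightarrow>
    carleson_mass wA p f b \<le> ennreal (e' * bdist b)" if "e' > 0" for e'
    using lc that by (simp add: little_carleson_def)
qed auto

lemma embeds_le:
  assumes p: "p > 0" and pq: "p \<le> q" and r: "0 < r" "r < 1 / 4"
  shows "\<exists>C>0. \<forall>\<mu> N. borel_measure_on_disc \<mu> \<and> N > 0 \<and> esssup dA (G_fun p q \<omega> \<mu> r) \<le> ennreal N \<longrightarrow> embeds p q \<mu> (C * N)"
proof -
  have q: "q > 0" using p pq by simp
  obtain C where C: "C > 0" and suff: "\<forall>\<mu> N f X a. borel_measure_on_disc \<mu> \<and> 0 \<le> N \<and> (AE z in dA. G_fun p q \<omega> \<mu> r z \<le> ennreal N) \<and>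
    carleson_bound p f X \<and> a \<in> unit_disc \<longrightarrow>
    carleson_mass \<mu> q f a \<le>
      ennreal (C * N powr q * X powr ((q - p) / p)) * kratio_mass p f a"
    using sufficiency_le[OF p pq r] by blast
  define cc where "cc = carleson_const 2"
  have cc: "cc > 0" by (simp add: cc_def carleson_const_pos)
  define D where "D = (C * cc) powr (1 / q)"
  have D: "D > 0" "D powr q = C * cc" using C cc q by (auto simp: D_def powr_powr)
  show ?thesis
  proof (intro exI[of _ D] conjI D(1) allI impI)
    fix \<mu> N assume *: "borel_measure_on_disc \<mu> \<and> N > 0 \<and> esssup dA (G_fun p q \<omega> \<mu> r) \<le> ennreal N"
    then have \<mu>: "borel_measure_on_disc \<mu>" and N: "N > 0" by auto
    have G: "AE z in dA. G_fun p q \<omega> \<mu> r z \<le> ennreal N"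
      using esssup_AE[of "G_fun p q \<omega> \<mu> r" dA] * by (elim eventually_mono) (auto intro: order_trans)
    show "embeds p q \<mu> (D * N)"
      unfolding embeds_def
    proof (intro allI impI)
      fix f L assume fL: "L > 0 \<and> carleson_bound p f (L powr p)"
      define K where "K = C * N powr q * (L powr p) powr ((q - p) / p)"
      have K: "K > 0" using C N fL by (simp add: K_def)
      have le: "carleson_mass \<mu> q f b \<le>
        ennreal K * kratio_mass p f b" if "b \<in> unit_disc" for b
        unfolding K_def using fL N by (intro suff[rule_format] conjI \<mu> G that) auto
      have bound: "carleson_mass \<mu> q f b \<le> ennreal ((D * N * L) powr q * bdist b)"
        if b: "b \<in> unit_disc" for b
      proof -
        note le[OF b]
        also have "ennreal K * kratio_mass p f b \<le>
          ennreal K * ennreal (cc * L powr p * bdist b)"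
          unfolding cc_def using fL by (intro mult_left_mono carleson_bound_kratio p b) auto
        also have "\<dots> = ennreal (K * (cc * L powr p * bdist b))"
          using K cc bdist_pos[OF b] by (intro ennreal_mult[symmetric]) auto
        \<comment> \<open>The powers of L add up to (q - p) + p = q.\<close>
        also have "K * (cc * L powr p * bdist b) = (D * N * L) powr q * bdist b"
        proof -
          have "(L powr p) powr ((q - p) / p) * L powr p = L powr q"
            using p fL by (simp add: powr_powr powr_add[symmetric])
          then have "K * (cc * L powr p) = (C * cc) * N powr q * L powr q" by (simp add: K_def mult_ac)
          also have "\<dots> = (D * N * L) powr q" by (simp add: powr_mult D(2))
          finally show ?thesis by (simp add: mult.assoc[symmetric])
        qed
        finally show ?thesis .
      qed
      moreover have "little_carleson \<mu> q f" if lc: "little_carleson wA p f"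
        unfolding little_carleson_def
      proof (intro allI impI)
        fix e :: real assume e: "e > 0"
        then have eK: "e / K > 0" using K by simp
        obtain d where d: "d > 0" "\<forall>b\<in>unit_disc. bdist b < d \<longrightarrow>
          kratio_mass p f b \<le> ennreal (e / K * bdist b)"
          using little_carleson_kratio[OF conjunct2[OF fL] p lc eK] by blast
        show "\<exists>d>0. \<forall>b\<in>unit_disc. bdist b < d \<longrightarrow>
          carleson_mass \<mu> q f b \<le> ennreal (e * bdist b)"
        proof (intro exI[of _ d] conjI d(1) ballI impI)
          fix b :: complex assume b: "b \<in> unit_disc" "bdist b < d"
          note le[OF b(1)]
          also have "ennreal K * kratio_mass p f b \<le>
            ennreal K * ennreal (e / K * bdist b)"
            using d(2) b by (intro mult_left_mono) auto
          also have "\<dots> = ennreal (K * (e / K * bdist b))"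
            using K e bdist_pos[OF b(1)] by (intro ennreal_mult[symmetric]) auto
          also have "K * (e / K * bdist b) = e * bdist b" using K by simp
          finally show "carleson_mass \<mu> q f b \<le> ennreal (e * bdist b)" .
        qed
      qed
      ultimately show "(\<forall>b\<in>unit_disc. carleson_mass \<mu> q f b \<le> ennreal ((D * N * L) powr q * bdist b)) \<and>
        (little_carleson wA p f \<longrightarrow> little_carleson \<mu> q f)" by blast
    qed
  qed
qed

lemma tent_integral_power_measure:
  assumes \<mu>: "borel_measure_on_disc \<mu>" and b: "b \<in> unit_disc"
  shows "(\<integral>\<^sup>+z. epowr (G_fun p q \<omega> \<mu> r z) s * indicator (carleson_square b) z \<partial>power_measure (- 1)) =
    (\<integral>\<^sup>+z. epowr (G_fun p q \<omega> \<mu> r z) s * ennreal (1 / bdist z) * indicator (carleson_square b) z \<partial>lborel)"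
proof -
  note [measurable] = G_fun_measurable[OF \<mu>, of p q r] carleson_square_measurable[of b]
  have w: "(\<lambda>z::complex. ennreal ((1 - cmod z) powr - 1)) \<in> borel_measurable dA"
    by (intro borel_measurable_dA measurable_restrict_space1) measurable
  have "(\<integral>\<^sup>+z. epowr (G_fun p q \<omega> \<mu> r z) s * indicator (carleson_square b) z \<partial>power_measure (- 1)) =
    (\<integral>\<^sup>+z. ennreal ((1 - cmod z) powr - 1) * (epowr (G_fun p q \<omega> \<mu> r z) s * indicator (carleson_square b) z) * indicator unit_disc z \<partial>lborel)"
    unfolding power_measure_def by (rule nn_integral_weight_measure_lborel[OF w]) measurable
  also have "\<dots> = (\<integral>\<^sup>+z. epowr (G_fun p q \<omega> \<mu> r z) s * ennreal (1 / bdist z) * indicator (carleson_square b) z \<partial>lborel)"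
  proof (rule nn_integral_cong)
    fix z
    show "ennreal ((1 - cmod z) powr - 1) * (epowr (G_fun p q \<omega> \<mu> r z) s * indicator (carleson_square b) z) * indicator unit_disc z =
      epowr (G_fun p q \<omega> \<mu> r z) s * ennreal (1 / bdist z) * indicator (carleson_square b) z"
    proof (cases "z \<in> carleson_square b")
      case True
      have z: "z \<in> unit_disc" by (rule carleson_square_subset(1)[OF b True])
      then have "(1 - cmod z) powr - 1 = 1 / bdist z"
        using bdist_pos[OF z] by (simp add: bdist_def powr_minus_divide)
      then show ?thesis using True z by (simp add: mult.commute)
    qed simp
  qed
  finally show ?thesis .
qed

lemma embeds_gt:
  assumes q: "q > 0" and pq: "q < p" and r: "0 < r" "r < 1 / 4"
  shows "\<exists>C>0. \<forall>\<mu> N. borel_measure_on_disc \<mu> \<and> N > 0 \<and>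
    tent_norm (p * q / (p - q)) (power_measure (- 1)) (G_fun p q \<omega> \<mu> r) \<le> ennreal N \<longrightarrow> embeds p q \<mu> (C * N)"
proof -
  have p: "p > 0" using q pq by simp
  define s where "s = p * q / (p - q)"
  have s: "s > 0" "s * (1 - q / p) = q" using p q pq by (auto simp: s_def field_simps)
  obtain C where C: "C > 0" and suff: "\<forall>\<mu> f X A B a. borel_measure_on_disc \<mu> \<and> carleson_bound p f X \<and> 0 < A \<and> 0 < B \<and> a \<in> unit_disc \<and>
    kratio_mass p f a \<le> ennreal (A * bdist a) \<and>
    (\<integral>\<^sup>+z. epowr (G_fun p q \<omega> \<mu> r z) s * ennreal (1 / bdist z * kratio a z powr 2) * indicator unit_disc z \<partial>lborel) \<le> ennreal (B * bdist a)
    \<longrightarrow> carleson_mass \<mu> q f a \<le>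
      ennreal (C * (A powr (q / p) * B powr (1 - q / p)) * bdist a)"
    using sufficiency_gt[OF q pq r] unfolding s_def by blast
  define cc where "cc = carleson_const 2"
  have cc: "cc > 0" by (simp add: cc_def carleson_const_pos)
  define D where "D = (C * cc) powr (1 / q)"
  have D: "D > 0" "D powr q = C * cc" using C cc q by (auto simp: D_def powr_powr)
  show ?thesis
  proof (intro exI[of _ D] conjI D(1) allI impI)
    fix \<mu> N assume *: "borel_measure_on_disc \<mu> \<and> N > 0 \<and>
      tent_norm (p * q / (p - q)) (power_measure (- 1)) (G_fun p q \<omega> \<mu> r) \<le> ennreal N"
    then have \<mu>: "borel_measure_on_disc \<mu>" and N: "N > 0" by auto
    note [measurable] = G_fun_measurable[OF \<mu>, of p q r]
    \<comment> \<open>The Carleson lemma turns the tent norm bound into one for the integral of G^s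
      against the squared kernel; B is the resulting constant.\<close>
    define B where "B = cc * N powr s"
    have B: "B > 0" using cc N by (simp add: B_def)
    have GB: "(\<integral>\<^sup>+z. epowr (G_fun p q \<omega> \<mu> r z) s * ennreal (1 / bdist z * kratio a z powr 2) * indicator unit_disc z \<partial>lborel) \<le> ennreal (B * bdist a)"
      if a: "a \<in> unit_disc" for a
    proof -
      let ?M = "restrict_space lborel unit_disc :: complex measure"
      let ?\<phi> = "\<lambda>z. epowr (G_fun p q \<omega> \<mu> r z) s * ennreal (1 / bdist z)"
      have sp: "space ?M = unit_disc" by (simp add: space_restrict_space)
      have sM: "sets ?M = sets (restrict_space borel unit_disc)"
        by (intro sets_restrict_space_cong) simp
      have res: "(\<integral>\<^sup>+z. h z \<partial>?M) = (\<integral>\<^sup>+z. h z * indicator unit_disc z \<partial>lborel)" for h :: "complex \<Rightarrow> ennreal"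
        by (rule nn_integral_restrict_space) simp
      have "bdist \<in> borel_measurable (restrict_space borel unit_disc)"
        by (intro measurable_restrict_space1) measurable
      then have [measurable]: "?\<phi> \<in> borel_measurable (restrict_space borel unit_disc)" by measurable
      have "(\<integral>\<^sup>+z. ?\<phi> z * ennreal (kratio a z powr 2) \<partial>?M) \<le> ennreal (carleson_const 2 * N powr s * bdist a)"
      proof (rule carleson_kratio_integral)
        show "?\<phi> \<in> borel_measurable ?M" by (simp cong: measurable_cong_sets[OF sM refl])
        show "kdist a \<in> borel_measurable ?M" by (intro measurable_restrict_space1) measurable
        fix b :: complex assume b: "b \<in> unit_disc"
        have "(\<integral>\<^sup>+z. ?\<phi> z * indicator (carleson_square b) z \<partial>?M) \<le> (\<integral>\<^sup>+z. ?\<phi> z * indicator (carleson_square b) z \<partial>lborel)"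
          unfolding res by (intro nn_integral_mono) (auto simp: indicator_def)
        also have "\<dots> = (\<integral>\<^sup>+z. epowr (G_fun p q \<omega> \<mu> r z) s * indicator (carleson_square b) z \<partial>power_measure (- 1))"
          by (rule tent_integral_power_measure[OF \<mu> b, symmetric])
        also have "\<dots> \<le> ennreal (N powr s * bdist b)"
          using * N s(1) b unfolding s_def[symmetric] by (auto simp: tent_norm_le_iff)
        finally show "(\<integral>\<^sup>+z. ?\<phi> z * indicator (carleson_square b) z \<partial>?M) \<le> ennreal (N powr s * bdist b)" .
      qed (use a sp in auto)
      moreover have "(\<integral>\<^sup>+z. ?\<phi> z * ennreal (kratio a z powr 2) \<partial>?M) =
        (\<integral>\<^sup>+z. epowr (G_fun p q \<omega> \<mu> r z) s * ennreal (1 / bdist z * kratio a z powr 2) * indicator unit_disc z \<partial>lborel)"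
        unfolding res
      proof (rule nn_integral_cong)
        fix z
        show "?\<phi> z * ennreal (kratio a z powr 2) * indicator unit_disc z =
          epowr (G_fun p q \<omega> \<mu> r z) s * ennreal (1 / bdist z * kratio a z powr 2) * indicator unit_disc z"
        proof (cases "z \<in> unit_disc")
          case True
          then have "ennreal (1 / bdist z * kratio a z powr 2) = ennreal (1 / bdist z) * ennreal (kratio a z powr 2)"
            using bdist_pos[OF True] by (intro ennreal_mult) auto
          then show ?thesis by (simp only: mult.assoc)
        qed simp
      qed
      ultimately show ?thesis by (simp add: B_def cc_def)
    qed
    show "embeds p q \<mu> (D * N)"
      unfolding embeds_def
    proof (intro allI impI)
      fix f L assume fL: "L > 0 \<and> carleson_bound p f (L powr p)"
      have le: "carleson_mass \<mu> q f b \<le>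
          ennreal (C * (A powr (q / p) * B powr (1 - q / p)) * bdist b)"
        if "A > 0" "b \<in> unit_disc" "kratio_mass p f b \<le> ennreal (A * bdist b)" for A b
        using fL by (intro suff[rule_format, of _ _ "L powr p"] conjI \<mu> that B GB) auto
      have "carleson_mass \<mu> q f b \<le> ennreal ((D * N * L) powr q * bdist b)"
        if b: "b \<in> unit_disc" for b
      proof -
        have "carleson_mass \<mu> q f b \<le>
          ennreal (C * ((cc * L powr p) powr (q / p) * B powr (1 - q / p)) * bdist b)"
          using cc fL unfolding cc_def by (intro le b carleson_bound_kratio p) auto
        also have "(cc * L powr p) powr (q / p) * B powr (1 - q / p) = cc * L powr q * N powr q"
        proof -
          have "(cc * L powr p) powr (q / p) * B powr (1 - q / p) =
            (cc powr (q / p) * cc powr (1 - q / p)) * (L powr p) powr (q / p) * (N powr s) powr (1 - q / p)"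
            unfolding B_def by (simp only: powr_mult mult_ac)
          also have "\<dots> = cc * L powr q * N powr q"
            using cc p unfolding powr_add[symmetric] by (simp add: powr_powr s(2))
          finally show ?thesis .
        qed
        also have "C * (cc * L powr q * N powr q) * bdist b = (D * N * L) powr q * bdist b"
          by (simp add: powr_mult D(2))
        finally show ?thesis .
      qed
      moreover have "little_carleson \<mu> q f" if lc: "little_carleson wA p f"
        unfolding little_carleson_def
      proof (intro allI impI)
        fix e :: real assume e: "e > 0"
        define K where "K = C * B powr (1 - q / p)"
        have K: "K > 0" using C B by (simp add: K_def)
        \<comment> \<open>Solves C * A^(q/p) * B^(1 - q/p) = e with B fixed, so that smallness of f
          alone makes the mass in \<mu> small.\<close>
        define A where "A = (e / K) powr (p / q)"
        have A: "A > 0" using e K by (simp add: A_def)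
        have CA: "C * (A powr (q / p) * B powr (1 - q / p)) = e"
        proof -
          have "A powr (q / p) = e / K" using e K p q by (simp add: A_def powr_powr)
          then have "C * (A powr (q / p) * B powr (1 - q / p)) = e / K * K" by (simp add: K_def)
          then show ?thesis using K by simp
        qed
        obtain d where d: "d > 0" "\<forall>b\<in>unit_disc. bdist b < d \<longrightarrow>
          kratio_mass p f b \<le> ennreal (A * bdist b)"
          using little_carleson_kratio[OF conjunct2[OF fL] p lc A] by blast
        have "carleson_mass \<mu> q f b \<le> ennreal (e * bdist b)"
          if "b \<in> unit_disc" "bdist b < d" for b
          using le[OF A that(1)] d(2) that unfolding CA by blast
        then show "\<exists>d>0. \<forall>b\<in>unit_disc. bdist b < d \<longrightarrow>
          carleson_mass \<mu> q f b \<le> ennreal (e * bdist b)"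
          using d(1) by blast
      qed
      ultimately show "(\<forall>b\<in>unit_disc. carleson_mass \<mu> q f b \<le> ennreal ((D * N * L) powr q * bdist b)) \<and>
        (little_carleson wA p f \<longrightarrow> little_carleson \<mu> q f)" by blast
    qed
  qed
qed

lemma esssup_G_le:
  assumes p: "p > 0" and q: "q > 0" and r: "0 < r" "r < 1 / 4"
  shows "\<exists>C>0. \<forall>\<mu> N. borel_measure_on_disc \<mu> \<and> embeds_tests p q \<mu> N \<longrightarrow> esssup dA (G_fun p q \<omega> \<mu> r) \<le> ennreal (C * N)"
proof -
  obtain C where C: "C > 0" and nec: "\<forall>\<mu> N z. borel_measure_on_disc \<mu> \<and> embeds_tests p q \<mu> N \<and> z \<in> unit_disc \<longrightarrow>
    G_fun p q \<omega> \<mu> r z \<le> ennreal (C * N)"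
    using necessity_le[OF p q r] by blast
  have "esssup dA (G_fun p q \<omega> \<mu> r) \<le> ennreal (C * N)" if "borel_measure_on_disc \<mu>" "embeds_tests p q \<mu> N" for \<mu> N
    using nec that by (intro esssup_I borel_measurable_dA G_fun_measurable AE_I2) auto
  then show ?thesis using C by blast
qed

lemma tent_norm_G_le:
  assumes q: "q > 0" and pq: "q < p" and r: "0 < r" "r < 1 / 4"
  shows "\<exists>C>0. \<forall>\<mu> N. borel_measure_on_disc \<mu> \<and> embeds_tests p q \<mu> N \<longrightarrow>
    tent_norm (p * q / (p - q)) (power_measure (- 1)) (G_fun p q \<omega> \<mu> r) \<le> ennreal (C * N)"
proof -
  define s where "s = p * q / (p - q)"
  have s: "s > 0" using q pq by (simp add: s_def)
  obtain C where C: "C > 0" and nec: "\<forall>\<mu> N b. borel_measure_on_disc \<mu> \<and> embeds_tests p q \<mu> N \<and> b \<in> unit_disc \<longrightarrow>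
    (\<integral>\<^sup>+z. epowr (G_fun p q \<omega> \<mu> r z) s * ennreal (1 / bdist z) * indicator (carleson_square b) z \<partial>lborel) \<le>
      ennreal (C * N powr s * bdist b)"
    using necessity_gt[OF q pq r] unfolding s_def by blast
  have "tent_norm s (power_measure (- 1)) (G_fun p q \<omega> \<mu> r) \<le> ennreal (C powr (1 / s) * N)"
    if \<mu>: "borel_measure_on_disc \<mu>" and emb: "embeds_tests p q \<mu> N" for \<mu> N
  proof -
    have N: "N \<ge> 0" using emb by (simp add: embeds_tests_def)
    have eq: "(C powr (1 / s) * N) powr s = C * N powr s" using C s by (simp add: powr_mult powr_powr)
    show ?thesis
    proof (subst tent_norm_le_iff[OF s], use N in simp, unfold eq, intro ballI)
      fix b :: complex assume b: "b \<in> unit_disc"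
      show "(\<integral>\<^sup>+z. epowr (G_fun p q \<omega> \<mu> r z) s * indicator (carleson_square b) z \<partial>power_measure (- 1)) \<le> ennreal (C * N powr s * bdist b)"
        unfolding tent_integral_power_measure[OF \<mu> b] using nec \<mu> emb b by blast
    qed
  qed
  then show ?thesis using C unfolding s_def by (intro exI[of _ "C powr (1 / s)"]) (auto simp: s_def)
qed

text \<open>Q is the essential supremum or the tent norm of \<open>G_fun\<close>. Finiteness for one
  r gives \<open>embeds\<close>, hence both embeddings; either embedding gives the test bounds,
  hence finiteness for every r, which also identifies "some r" with "every r". In both hypotheses
  the constant precedes \<mu>, so the comparison of norms is uniform in \<mu>.\<close>

lemma embedding_characterization:
  fixes Q :: "complex measure \<Rightarrow> real \<Rightarrow> ennreal"
  assumes p: "p > 0" and q: "q > 0" and R: "R \<noteq> {}"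
    and suff: "\<And>r. r \<in> R \<Longrightarrow> \<exists>C>0. \<forall>\<mu> N. borel_measure_on_disc \<mu> \<and> N > 0 \<and> Q \<mu> r \<le> ennreal N \<longrightarrow> embeds p q \<mu> (C * N)"
    and nec: "\<And>r. r \<in> R \<Longrightarrow> \<exists>C>0. \<forall>\<mu> N. borel_measure_on_disc \<mu> \<and> embeds_tests p q \<mu> N \<longrightarrow> Q \<mu> r \<le> ennreal (C * N)"
  shows "(\<forall>\<mu>. borel_measure_on_disc \<mu> \<longrightarrow>
      (Id_bounded_inf p q \<omega> \<mu> \<longleftrightarrow> Id_bounded_zero p q \<omega> \<mu>) \<and>
      (Id_bounded_inf p q \<omega> \<mu> \<longleftrightarrow> (\<exists>r\<in>R. Q \<mu> r < \<infinity>)) \<and>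
      (Id_bounded_inf p q \<omega> \<mu> \<longleftrightarrow> (\<forall>r\<in>R. Q \<mu> r < \<infinity>))) \<and>
    (\<forall>r\<in>R. \<exists>C>0. \<forall>\<mu>. borel_measure_on_disc \<mu> \<and> Id_bounded_inf p q \<omega> \<mu> \<longrightarrow> comparable C (Id_norm p q \<omega> \<mu>) (Q \<mu> r))"
proof (intro conjI allI impI ballI)
  fix \<mu> assume \<mu>: "borel_measure_on_disc \<mu>"
  have to_Q: "Q \<mu> r < \<infinity>" if emb: "embeds_tests p q \<mu> N" and r: "r \<in> R" for N r
  proof -
    obtain C where "Q \<mu> r \<le> ennreal (C * N)" using nec[OF r] \<mu> emb by blast
    then show ?thesis by (rule order_le_less_trans) simp
  qed
  have from_Q: "Id_bounded_inf p q \<omega> \<mu> \<and> Id_bounded_zero p q \<omega> \<mu>" if r: "r \<in> R" and fin: "Q \<mu> r < \<infinity>" for r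
  proof -
    obtain C where C: "C > 0" and e: "\<forall>\<mu> N. borel_measure_on_disc \<mu> \<and> N > 0 \<and> Q \<mu> r \<le> ennreal N \<longrightarrow> embeds p q \<mu> (C * N)"
      using suff[OF r] by blast
    obtain a where a: "a \<ge> 0" "Q \<mu> r = ennreal a" using fin by (cases "Q \<mu> r") auto
    have "embeds p q \<mu> (C * (a + 1))" using e \<mu> a by (simp add: ennreal_leI)
    moreover have "C * (a + 1) > 0" using C a by simp
    ultimately show ?thesis using embeds_imp_bounded[OF p q _ _ \<mu>] by blast
  qed
  have sub: "AT_zero p \<omega> \<subseteq> AT_inf p \<omega>" by (auto simp: AT_zero_def AT_inf_def T_zero_def)
  have inf_tests: "\<exists>N. embeds_tests p q \<mu> N" if "Id_bounded_inf p q \<omega> \<mu>"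
    using bounded_embedding_imp_embeds_tests[OF p q sub] that unfolding Id_bounded_inf_def by blast
  have zero_tests: "\<exists>N. embeds_tests p q \<mu> N" if "Id_bounded_zero p q \<omega> \<mu>"
    using bounded_embedding_imp_embeds_tests[OF p q order_refl] that unfolding Id_bounded_zero_def by blast
  show "Id_bounded_inf p q \<omega> \<mu> \<longleftrightarrow> Id_bounded_zero p q \<omega> \<mu>"
    "Id_bounded_inf p q \<omega> \<mu> \<longleftrightarrow> (\<exists>r\<in>R. Q \<mu> r < \<infinity>)"
    "Id_bounded_inf p q \<omega> \<mu> \<longleftrightarrow> (\<forall>r\<in>R. Q \<mu> r < \<infinity>)"
    using R to_Q from_Q inf_tests zero_tests by blast+
next
  fix r assume r: "r \<in> R"
  obtain C1 where C1: "C1 > 0" and e: "\<forall>\<mu> N. borel_measure_on_disc \<mu> \<and> N > 0 \<and> Q \<mu> r \<le> ennreal N \<longrightarrow> embeds p q \<mu> (C1 * N)"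
    using suff[OF r] by blast
  obtain C2 where C2: "C2 > 0" and t: "\<forall>\<mu> N. borel_measure_on_disc \<mu> \<and> embeds_tests p q \<mu> N \<longrightarrow> Q \<mu> r \<le> ennreal (C2 * N)"
    using nec[OF r] by blast
  define C where "C = max C1 C2"
  have C: "C > 0" "C1 \<le> C" "C2 \<le> C" using C1 by (auto simp: C_def)
  have "comparable C (Id_norm p q \<omega> \<mu>) (Q \<mu> r)" if \<mu>: "borel_measure_on_disc \<mu>" for \<mu>
  proof -
    have "Id_norm p q \<omega> \<mu> \<le> ennreal C1 * Q \<mu> r"
    proof (rule ennreal_le_mult_limit[OF C1])
      fix N :: real assume "N > 0" "Q \<mu> r \<le> ennreal N"
      then show "Id_norm p q \<omega> \<mu> \<le> ennreal (C1 * N)"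
        using e \<mu> C1 by (intro embeds_imp_bounded(3)[OF p q _ _ \<mu>]) auto
    qed
    also have "\<dots> \<le> ennreal C * Q \<mu> r" using C by (intro mult_right_mono ennreal_leI) auto
    finally have "ennreal (1 / C) * Id_norm p q \<omega> \<mu> \<le> ennreal (1 / C) * (ennreal C * Q \<mu> r)" by (intro mult_left_mono) auto
    also have "\<dots> = ennreal (1 / C * C) * Q \<mu> r"
      using C(1) by (subst ennreal_mult) (auto simp: mult.assoc)
    also have "\<dots> = Q \<mu> r" using C(1) by simp
    finally have 1: "ennreal (1 / C) * Id_norm p q \<omega> \<mu> \<le> Q \<mu> r" .
    have "Q \<mu> r \<le> ennreal C2 * Id_norm p q \<omega> \<mu>"
    proof (rule ennreal_le_mult_limit[OF C2])
      fix N :: real assume "N > 0" "Id_norm p q \<omega> \<mu> \<le> ennreal N"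
      then show "Q \<mu> r \<le> ennreal (C2 * N)"
        using t \<mu> Id_norm_imp_embeds_tests[OF p q _ \<mu>, of N] by auto
    qed
    also have "\<dots> \<le> ennreal C * Id_norm p q \<omega> \<mu>" using C by (intro mult_right_mono ennreal_leI) auto
    finally show ?thesis using 1 by (simp add: comparable_def)
  qed
  then show "\<exists>C>0. \<forall>\<mu>. borel_measure_on_disc \<mu> \<and> Id_bounded_inf p q \<omega> \<mu> \<longrightarrow> comparable C (Id_norm p q \<omega> \<mu>) (Q \<mu> r)"
    using C(1) by blast
qed

end

theorem theorem1p1:
  fixes p q :: real and \<omega> :: "complex \<Rightarrow> real"
  assumes "0 < p" and "0 < q" and "\<omega> \<in> D_class"
  shows
    "(p \<le> q \<longrightarrow>
       (\<forall>\<mu>. borel_measure_on_disc \<mu> \<longrightarrow>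
          (Id_bounded_inf p q \<omega> \<mu> \<longleftrightarrow> Id_bounded_zero p q \<omega> \<mu>) \<and>
          (Id_bounded_inf p q \<omega> \<mu> \<longleftrightarrow> (\<exists>r\<in>{0<..<1/4}. G_fun p q \<omega> \<mu> r \<in> L_inf_ext)) \<and>
          (Id_bounded_inf p q \<omega> \<mu> \<longleftrightarrow> (\<forall>r\<in>{0<..<1/4}. G_fun p q \<omega> \<mu> r \<in> L_inf_ext))) \<and>
       (\<forall>r\<in>{0<..<1/4}. \<exists>C>0. \<forall>\<mu>. borel_measure_on_disc \<mu> \<and> Id_bounded_inf p q \<omega> \<mu> \<longrightarrow>
          comparable C (Id_norm p q \<omega> \<mu>) (esssup dA (G_fun p q \<omega> \<mu> r)))) \<and>
     (p > q \<longrightarrow>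
       (\<forall>\<mu>. borel_measure_on_disc \<mu> \<longrightarrow>
          (Id_bounded_inf p q \<omega> \<mu> \<longleftrightarrow> Id_bounded_zero p q \<omega> \<mu>) \<and>
          (Id_bounded_inf p q \<omega> \<mu> \<longleftrightarrow>
             (\<exists>r\<in>{0<..<1/4}. G_fun p q \<omega> \<mu> r \<in> T_inf_ext (p * q / (p - q)) (power_measure (-1)))) \<and>
          (Id_bounded_inf p q \<omega> \<mu> \<longleftrightarrow>
             (\<forall>r\<in>{0<..<1/4}. G_fun p q \<omega> \<mu> r \<in> T_inf_ext (p * q / (p - q)) (power_measure (-1))))) \<and>
       (\<forall>r\<in>{0<..<1/4}. \<exists>C>0. \<forall>\<mu>. borel_measure_on_disc \<mu> \<and> Id_bounded_inf p q \<omega> \<mu> \<longrightarrow>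
          comparable C (Id_norm p q \<omega> \<mu>)
            (tent_norm (p * q / (p - q)) (power_measure (-1)) (G_fun p q \<omega> \<mu> r))))"
proof -
  interpret D_weight \<omega> by unfold_locales (rule assms(3))
  let ?R = "{0<..<1/4::real}"
  have R: "?R \<noteq> {}" by (auto intro!: exI[of _ "1/8"])
  have L: "G_fun p q \<omega> \<mu> r \<in> L_inf_ext \<longleftrightarrow> esssup dA (G_fun p q \<omega> \<mu> r) < \<infinity>" for \<mu> r
    by (simp add: L_inf_ext_def)
  \<comment> \<open>Membership includes measurability for the completed measure, which holds because
    \<open>G_fun\<close> is Borel.\<close>
  have T: "G_fun p q \<omega> \<mu> r \<in> T_inf_ext (p * q / (p - q)) (power_measure (-1)) \<longleftrightarrow>
    tent_norm (p * q / (p - q)) (power_measure (-1)) (G_fun p q \<omega> \<mu> r) < \<infinity>" if "borel_measure_on_disc \<mu>" for \<mu> r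
    using borel_measurable_weight_measure[OF G_fun_measurable[OF that, of p q r]]
    by (simp add: T_inf_ext_def power_measure_def)
  show ?thesis
  proof (rule conjI; rule impI)
    assume pq: "p \<le> q"
    note c = embedding_characterization[OF assms(1,2) R, where Q = "\<lambda>\<mu> r. esssup dA (G_fun p q \<omega> \<mu> r)"]
    show "(\<forall>\<mu>. borel_measure_on_disc \<mu> \<longrightarrow>
          (Id_bounded_inf p q \<omega> \<mu> \<longleftrightarrow> Id_bounded_zero p q \<omega> \<mu>) \<and>
          (Id_bounded_inf p q \<omega> \<mu> \<longleftrightarrow> (\<exists>r\<in>{0<..<1/4}. G_fun p q \<omega> \<mu> r \<in> L_inf_ext)) \<and>
          (Id_bounded_inf p q \<omega> \<mu> \<longleftrightarrow> (\<forall>r\<in>{0<..<1/4}. G_fun p q \<omega> \<mu> r \<in> L_inf_ext))) \<and>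
       (\<forall>r\<in>{0<..<1/4}. \<exists>C>0. \<forall>\<mu>. borel_measure_on_disc \<mu> \<and> Id_bounded_inf p q \<omega> \<mu> \<longrightarrow>
          comparable C (Id_norm p q \<omega> \<mu>) (esssup dA (G_fun p q \<omega> \<mu> r)))"
      unfolding L by (rule c) (use assms pq embeds_le esssup_G_le in auto)
  next
    assume pq: "p > q"
    have S: "\<exists>C>0. \<forall>\<mu> N. borel_measure_on_disc \<mu> \<and> N > 0 \<and>
        tent_norm (p * q / (p - q)) (power_measure (-1)) (G_fun p q \<omega> \<mu> r) \<le> ennreal N \<longrightarrow> embeds p q \<mu> (C * N)"
      and N: "\<exists>C>0. \<forall>\<mu> N. borel_measure_on_disc \<mu> \<and> embeds_tests p q \<mu> N \<longrightarrow>
        tent_norm (p * q / (p - q)) (power_measure (-1)) (G_fun p q \<omega> \<mu> r) \<le> ennreal (C * N)"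
      if "r \<in> ?R" for r
      using embeds_gt[OF assms(2) pq] tent_norm_G_le[OF assms(2) pq] that by auto
    show "(\<forall>\<mu>. borel_measure_on_disc \<mu> \<longrightarrow>
          (Id_bounded_inf p q \<omega> \<mu> \<longleftrightarrow> Id_bounded_zero p q \<omega> \<mu>) \<and>
          (Id_bounded_inf p q \<omega> \<mu> \<longleftrightarrow>
             (\<exists>r\<in>{0<..<1/4}. G_fun p q \<omega> \<mu> r \<in> T_inf_ext (p * q / (p - q)) (power_measure (-1)))) \<and>
          (Id_bounded_inf p q \<omega> \<mu> \<longleftrightarrow>
             (\<forall>r\<in>{0<..<1/4}. G_fun p q \<omega> \<mu> r \<in> T_inf_ext (p * q / (p - q)) (power_measure (-1))))) \<and>
       (\<forall>r\<in>{0<..<1/4}. \<exists>C>0. \<forall>\<mu>. borel_measure_on_disc \<mu> \<and> Id_bounded_inf p q \<omega> \<mu> \<longrightarrow>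
          comparable C (Id_norm p q \<omega> \<mu>)
            (tent_norm (p * q / (p - q)) (power_measure (-1)) (G_fun p q \<omega> \<mu> r)))"
      by (simp only: T cong: imp_cong) (rule embedding_characterization[OF assms(1,2) R S N])
  qed
qed

end
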